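(* Let $n>0$ and let $K$ be the simplicial model of $S^{2n+1}$ with exactly two nondegenerate simplices, in degrees $0$ and $2n+1$. Let $\Upsilon: C^*K\,\widetilde\otimes\,\mathcal BC^*K\to CU^*\mathcal LS^{2n+1}$ be the thin free loop model quasi-isomorphism, let $\lambda^2:\mathcal LS^{2n+1}\to\mathcal LS^{2n+1}$ be the second power map $\lambda^2(\ell)(z)=\ell(z^2)$, and let $\chi$ be the (deconcatenation) coproduct on $\mathcal BC^*K$. Then the cochain maps $$\Upsilon\circ\big(Id\otimes(\psi_K^\sharp\chi)\big)\quad\text{and}\quad CU^*\lambda^2\circ\Upsilon:\ C^*K\,\widetilde\otimes\,\mathcal BC^*K\longrightarrow CU^*\mathcal LS^{2n+1}$$ are cochain homotopic.
   Context: All coefficients are $\mathbb Z$. Koszul sign rule, except that cubical cochains are dualized without signs as stated below. **Bar and cobar constructions.** For cochain (upper) gradings $s$ lowers degree by 1 and $s^{-1}$ raises degree by 1. For a graded module $V$, $\perp V$ is the cofree coassociative coalgebra (tensor coalgebra, elements $v_1|\cdots|v_m$, deconcatenation coproduct). For a cochain algebra $A$, $\mathcal BA=(\perp sA^{+},d_{\mathcal B})$ where $d_{\mathcal B}$ is the coderivation whose linear part sends $sa\mapsto -s(da)$, $sa_1|sa_2\mapsto(-1)^{|a_1|+1}s(a_1a_2)$, and longer words to $0$. For a (co)chain coalgebra $C$, $\Omega C=T(s^{-1}C_+)$ with $d_\Omega=-s^{-1}ds+(s^{-1}\otimes s^{-1})\overline\Delta s$ on generators. **The product $\star=\psi_K^\sharp$.**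 $C_*K$, $C^*K$ are the normalized chains and cochains of a finite-type, 1-reduced simplicial set $K$. Let $\psi_K:\Omega C_*K\to\Omega C_*K\otimes\Omega C_*K$ be the Alexander–Whitney cobar diagonal, the composite of $\Omega$ of the map $C_*K\to C_*(K\times K)$ induced by the diagonal, the natural chain algebra map $\Omega C_*(K\times K)\to\Omega(C_*K\otimes C_*K)$ of Gugenheim–Munkholm whose linear part is the Alexander–Whitney map, and Milgram's algebra map $\rho:\Omega(C_*K\otimes C_*K)\to\Omega C_*K\otimes\Omega C_*K$ ($\rho(s^{-1}(x\otimes1))=s^{-1}x\otimes 1$, $\rho(s^{-1}(1\otimes y))=1\otimes s^{-1}y$, $\rho(s^{-1}(x\otimes y))=0$ for $x,y$ of positive degree). Its dual $\psi_K^\sharp$ is an associative product on $\mathcal BC^*K=(\Omega C_*K)^\sharp$, written $a\star b$, and a coalgebra map; put $\varphi=\Omega\psi_K^\sharp:\Omega(\mathcal BC^*K\otimes\mathcal BC^*K)\to\Omega\mathcal BC^*K$. For the $K$ of the claim, $C^*K=\Lambda z$ with $|z|=2n+1$ and $\mathcal BC^*K=\Gamma(sz)$ is the divided power algebra, with $sz(m)=sz|\cdots|sz$ ($m$ factors), $sz(a)\star sz(b)=\binom{a+b}{a}sz(a+b)$, $\chi(sz(m))=\sum_{i=0}^m sz(i)\otimes sz(m-i)$. Let $\varepsilon_K:\Omega\mathcal BC^*K\to C^*K$ be the counit of the cobar–bar adjunction: the algebra map with $s^{-1}(sx)\mapsto x$ and $s^{-1}(w)\mapsto0$ for words $w$ of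 length $>1$. **The path model.** $\Omega(\mathcal BC^*K\otimes\mathcal BC^*K)\odot\mathcal BC^*K$ is the free right $\Omega(\mathcal BC^*K\otimes\mathcal BC^*K)$-module on $\mathcal BC^*K$, $(w\otimes c)\cdot w'=(-1)^{|w'||c|}ww'\otimes c$, with commuting left action and differential $D$ (derivation for the action) given recursively, with $\theta_j=j+\sum_{i\le j}|x_i|$ (signs $(-1)^{b\cdot\theta}$ use $|b|$), by $$(s^{-1}(a\otimes b)\otimes1)(1\otimes sx_1|\cdots|sx_m)=s^{-1}(a\otimes b)\otimes sx_1|\cdots|sx_m+(-1)^{b\theta_m}\big(s^{-1}(a\otimes((sx_1|\cdots|sx_m)\star b))-s^{-1}((a\star(sx_1|\cdots|sx_m))\otimes b)\big)$$ $$+\sum_{j=1}^{m-1}\big[-(-1)^{b\theta_j}s^{-1}((a\star(sx_1|\cdots|sx_j))\otimes b)\cdot(1\otimes sx_{j+1}|\cdots|sx_m)+(-1)^{(b+\theta_j)(\theta_m-\theta_j)}s^{-1}(a\otimes((sx_{j+1}|\cdots|sx_m)\star b))\otimes sx_1|\cdots|sx_j\big],$$ $$D(1\otimes sx_1|\cdots|sx_m)=1\otimes d_{\mathcal B}(sx_1|\cdots|sx_m)+s^{-1}(sx_1|\cdots|sx_m\otimes1)-s^{-1}(1\otimes sx_1|\cdots|sx_m)$$ $$+\sum_{j=1}^{m-1}\big[s^{-1}(sx_1|\cdots|sx_j\otimes1)\cdot(1\otimes sx_{j+1}|\cdots|sx_m)-(-1)^{\theta_j(\theta_m-\theta_j)}s^{-1}(1\otimes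 sx_{j+1}|\cdots|sx_m)\otimes sx_1|\cdots|sx_j\big].$$ On $\Omega\mathcal BC^*K\odot\mathcal BC^*K$ (free right $\Omega\mathcal BC^*K$-module on $\mathcal BC^*K$) the differential is $\overline D(1\otimes c)=(\varphi\otimes Id)D(1\otimes c)$, extended as a right-module derivation. **Cubical chains and cochains.** $CU_*Y$ is the chain complex of singular cubes modulo degenerate ones (independent of some coordinate), with $dT=\sum_{i}(-1)^i(T|_{t_i=1}-T|_{t_i=0})$ and coproduct $\Delta T=\sum_L\rho_L\,T|_{t_j=0,\,j\notin L}\otimes T|_{t_j=1,\,j\in L}$, $L$ ranging over subsets of coordinates, $\rho_L$ the sign of the shuffle $(L,L^c)$. $CU^*Y$ is the dual cochain algebra, with $d^\sharp f=f\circ d$ and product $(fg)(T)=(f\otimes g)(\Delta T)$ (no extra signs). **The map $\Upsilon$.** Let $X$ be a 1-connected space with $|K|\simeq X$ (here $X=S^{2n+1}$), and $\mathcal LX$ its free loop space. Fix a commutative square $CU^*\Delta\circ\tilde\alpha=\tilde\gamma\circ\varphi$ with $\tilde\alpha:\Omega(\mathcal BC^*K\otimes\mathcal BC^*K)\to CU^*(X\times X)$ and $\tilde\gamma:\Omega\mathcal BC^*K\to CU^*X$ quasi-isomorphisms inducing algebra maps in cohomology, $\ker\varepsilon_K\subseteq\ker\tilde\gamma$, and $\tilde\alpha\iota_k=CU^*pr_k\circ\tilde\gamma$ for the tensor-factor inclusions $\iota_k$ and projections $pr_k$, $k=1,2$. Let $i:X\to X^I$ send a point to the constant path, $p:X^I\to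 X\times X$, $p(\ell)=(\ell(0),\ell(1))$, $j:\mathcal LX\to X^I$ the inclusion, $e:\mathcal LX\to X$ evaluation at the basepoint. For $f\in\ker CU^*i$ let $(Jf)(T)=-f(H(T))$, where $H(T)(t_0,\dots,t_m)(u)=T(t_1,\dots,t_m)(t_0u)$. Define $\tilde\beta$ on $\Omega(\mathcal BC^*K\otimes\mathcal BC^*K)\odot\mathcal BC^*K$ with values in $CU^*X^I$ recursively by $\tilde\beta(1\otimes 1)=1$, $\tilde\beta(1\otimes c)=J\tilde\beta D(1\otimes c)$ for $|c|>0$, $\tilde\beta(w\otimes c)=(-1)^{|w||c|}\tilde\beta(1\otimes c)\cdot CU^*p\,\tilde\alpha(w)$. Define $\tilde\delta:\Omega\mathcal BC^*K\odot\mathcal BC^*K\to CU^*\mathcal LX$ by $\tilde\delta(1\otimes1)=1$, $\tilde\delta(1\otimes c)=CU^*j\,J\tilde\beta D(1\otimes c)$ for $|c|>0$, $\tilde\delta(w\otimes c)=(-1)^{|w||c|}\tilde\delta(1\otimes c)\cdot CU^*e\,\tilde\gamma(w)$. Let $C^*K\,\widetilde\otimes\,\mathcal BC^*K$ be the free right $C^*K$-module $C^*K\otimes\mathcal BC^*K$ with differential $\check D(1\otimes c)=(\varepsilon_K\otimes Id)\overline D(1\otimes c)$ extended as a right-module derivation (for the $K$ of the claim, $\check D=0$). Let $\hat\sigma:C^*K\,\widetilde\otimes\,\mathcal BC^*K\to\Omega\mathcal BC^*K\odot\mathcal BC^*K$ be a cochain section of $\varepsilon_K\otimes Id$ with $\hat\sigma(x\otimes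 c)=s^{-1}(sx)\otimes c$ (and $\hat\sigma(1\otimes c)=1\otimes c$) for words $c$ of length $\le2$. Then $\Upsilon=\tilde\delta\circ\hat\sigma$; it is a standing fact that $\tilde\beta,\tilde\delta,\hat\sigma$, hence $\Upsilon$, are quasi-isomorphisms of cochain complexes. Since $\ker\varepsilon_K\subseteq\ker\tilde\gamma$, $\Upsilon(x\otimes c)=\tilde\delta(s^{-1}(sx)\otimes c)$. The pair $(C^*K\,\widetilde\otimes\,\mathcal BC^*K,\Upsilon)$ is called a thin free loop model for $X$. *)

theory Defs
  imports "HOL-Homology.Homology" "HOL-Library.Function_Algebras"
begin

section \<open>Graded complexes over the integers\<close>

text \<open>Free modules are the type \<open>'b \<Rightarrow>\<^sub>0 int\<close>, with the library operations \<open>frag_of\<close> (basis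
  element), \<open>frag_cmul\<close> (scalar multiple) and \<open>frag_extend\<close> (linear extension).\<close>

definition frag_extend2 ::
    "('a \<Rightarrow> 'b \<Rightarrow> 'c \<Rightarrow>\<^sub>0 int) \<Rightarrow> ('a \<Rightarrow>\<^sub>0 int) \<Rightarrow> ('b \<Rightarrow>\<^sub>0 int) \<Rightarrow> 'c \<Rightarrow>\<^sub>0 int" where
  "frag_extend2 f p q = frag_extend (\<lambda>a. frag_extend (f a) q) p"

definition tensor :: "('a \<Rightarrow>\<^sub>0 int) \<Rightarrow> ('b \<Rightarrow>\<^sub>0 int) \<Rightarrow> ('a \<times> 'b) \<Rightarrow>\<^sub>0 int" where
  "tensor = frag_extend2 (\<lambda>a b. frag_of (a, b))"

record 'a cochain_complex =
  grade :: "nat \<Rightarrow> 'a set"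
  codiff :: "'a \<Rightarrow> 'a"

definition free_grade :: "'b set \<Rightarrow> ('b \<Rightarrow> nat) \<Rightarrow> nat \<Rightarrow> ('b \<Rightarrow>\<^sub>0 int) set" where
  "free_grade B dg k = {p. Poly_Mapping.keys p \<subseteq> {b \<in> B. dg b = k}}"

definition graded_hom ::
    "('a::ab_group_add) cochain_complex \<Rightarrow> ('b::ab_group_add) cochain_complex \<Rightarrow> ('a \<Rightarrow> 'b) \<Rightarrow> bool" where
  "graded_hom C C' f \<longleftrightarrow>
     (\<forall>k. \<forall>x\<in>grade C k. f x \<in> grade C' k \<and> (\<forall>y\<in>grade C k. f (x + y) = f x + f y))"

definition cochain_map ::
    "('a::ab_group_add) cochain_complex \<Rightarrow> ('b::ab_group_add) cochain_complex \<Rightarrow> ('a \<Rightarrow> 'b) \<Rightarrow> bool" where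
  "cochain_map C C' f \<longleftrightarrow>
     graded_hom C C' f \<and> (\<forall>k. \<forall>x\<in>grade C k. f (codiff C x) = codiff C' (f x))"

definition cocycles :: "('a::ab_group_add) cochain_complex \<Rightarrow> nat \<Rightarrow> 'a set" where
  "cocycles C k = {x \<in> grade C k. codiff C x = 0}"

definition coboundaries :: "('a::ab_group_add) cochain_complex \<Rightarrow> nat \<Rightarrow> 'a set" where
  "coboundaries C k = (case k of 0 \<Rightarrow> {0} | Suc j \<Rightarrow> codiff C ` grade C j)"

definition quasi_iso ::
    "('a::ab_group_add) cochain_complex \<Rightarrow> ('b::ab_group_add) cochain_complex \<Rightarrow> ('a \<Rightarrow> 'b) \<Rightarrow> bool" where
  "quasi_iso C C' f \<longleftrightarrow> cochain_map C C' f \<and>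
     (\<forall>k. (\<forall>x\<in>cocycles C k. f x \<in> coboundaries C' k \<longrightarrow> x \<in> coboundaries C k) \<and>
          (\<forall>y\<in>cocycles C' k. \<exists>x\<in>cocycles C k. y - f x \<in> coboundaries C' k))"

definition cochain_homotopic ::
    "('a::ab_group_add) cochain_complex \<Rightarrow> ('b::ab_group_add) cochain_complex
      \<Rightarrow> ('a \<Rightarrow> 'b) \<Rightarrow> ('a \<Rightarrow> 'b) \<Rightarrow> bool" where
  "cochain_homotopic C C' f g \<longleftrightarrow> cochain_map C C' f \<and> cochain_map C C' g \<and>
     (\<exists>h. (\<forall>x\<in>grade C 0. h x = 0) \<and>
          (\<forall>k. \<forall>x\<in>grade C (Suc k). h x \<in> grade C' k) \<and>
          (\<forall>k. \<forall>x\<in>grade C k. \<forall>y\<in>grade C k. h (x + y) = h x + h y) \<and>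
          (\<forall>k. \<forall>x\<in>grade C k. f x - g x = codiff C' (h x) + h (codiff C x)))"

text \<open>A map of graded modules between cochain algebras (each given by its complex, product and unit)
  that induces an algebra map in cohomology.\<close>

definition cohomology_algebra_map ::
    "('a::ab_group_add) cochain_complex \<Rightarrow> ('a \<Rightarrow> 'a \<Rightarrow> 'a) \<Rightarrow> 'a
      \<Rightarrow> ('b::ab_group_add) cochain_complex \<Rightarrow> ('b \<Rightarrow> 'b \<Rightarrow> 'b) \<Rightarrow> 'b \<Rightarrow> ('a \<Rightarrow> 'b) \<Rightarrow> bool" where
  "cohomology_algebra_map C mul e C' mul' e' f \<longleftrightarrow>
     f e - e' \<in> coboundaries C' 0 \<and>
     (\<forall>k l. \<forall>x\<in>cocycles C k. \<forall>y\<in>cocycles C l.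
        f (mul x y) - mul' (f x) (f y) \<in> coboundaries C' (k + l))"


section \<open>Coalgebras and the cobar construction\<close>

text \<open>A connected differential graded coalgebra with a homogeneous basis containing the image of
  the coaugmentation, \<open>cunit\<close>. The remaining basis elements span \<open>C\<^sub>+\<close>. The same record serves
  for lower and for upper gradings.\<close>

record 'b coalg =
  cbasis :: "'b set"
  cdeg :: "'b \<Rightarrow> nat"
  cunit :: 'b
  cdiff :: "'b \<Rightarrow> 'b \<Rightarrow>\<^sub>0 int"
  ccop :: "'b \<Rightarrow> ('b \<times> 'b) \<Rightarrow>\<^sub>0 int"

definition coalg_tensor :: "'a coalg \<Rightarrow> 'b coalg \<Rightarrow> ('a \<times> 'b) coalg" where
  "coalg_tensor C D =
    \<lparr> cbasis = cbasis C \<times> cbasis D,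
      cdeg = (\<lambda>(a, b). cdeg C a + cdeg D b),
      cunit = (cunit C, cunit D),
      cdiff = (\<lambda>(a, b). tensor (cdiff C a) (frag_of b)
                 + frag_cmul ((-1) ^ cdeg C a) (tensor (frag_of a) (cdiff D b))),
      ccop = (\<lambda>(a, b). frag_extend2
                (\<lambda>(a1, a2) (b1, b2). frag_cmul ((-1) ^ (cdeg C a2 * cdeg D b1)) (frag_of ((a1, b1), (a2, b2))))
                (ccop C a) (ccop D b)) \<rparr>"

text \<open>The word \<open>[b\<^sub>1, \<dots>, b\<^sub>m]\<close> stands for \<open>s\<^sup>-\<^sup>1b\<^sub>1 \<dots> s\<^sup>-\<^sup>1b\<^sub>m\<close>.\<close>

definition cobar_words :: "'b coalg \<Rightarrow> 'b list set" where
  "cobar_words C = lists (cbasis C - {cunit C})"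

text \<open>The degree for lower gradings (\<open>s\<^sup>-\<^sup>1\<close> lowers) and for upper gradings (\<open>s\<^sup>-\<^sup>1\<close> raises);
  their parities agree, so signs do not depend on which one is used.\<close>

definition cobar_low_deg :: "'b coalg \<Rightarrow> 'b list \<Rightarrow> nat" where
  "cobar_low_deg C w = (\<Sum>b\<leftarrow>w. cdeg C b - 1)"

definition cobar_deg :: "'b coalg \<Rightarrow> 'b list \<Rightarrow> nat" where
  "cobar_deg C w = (\<Sum>b\<leftarrow>w. cdeg C b + 1)"

definition conc :: "('b list \<Rightarrow>\<^sub>0 int) \<Rightarrow> ('b list \<Rightarrow>\<^sub>0 int) \<Rightarrow> 'b list \<Rightarrow>\<^sub>0 int" where
  "conc = frag_extend2 (\<lambda>u v. frag_of (u @ v))"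

definition sinv :: "'b coalg \<Rightarrow> ('b \<Rightarrow>\<^sub>0 int) \<Rightarrow> 'b list \<Rightarrow>\<^sub>0 int" where
  "sinv C = frag_extend (\<lambda>b. if b = cunit C then 0 else frag_of [b])"

text \<open>\<open>(s\<^sup>-\<^sup>1 \<otimes> s\<^sup>-\<^sup>1)(x \<otimes> y) = (-1)\<^bsup>|x|\<^esup> s\<^sup>-\<^sup>1x \<otimes> s\<^sup>-\<^sup>1y\<close>; as \<open>sinv\<close> kills the unit, the full
  coproduct may be used in place of the reduced one.\<close>

definition cobar_diff_gen :: "'b coalg \<Rightarrow> 'b \<Rightarrow> 'b list \<Rightarrow>\<^sub>0 int" where
  "cobar_diff_gen C b =
     - sinv C (cdiff C b)
     + frag_extend (\<lambda>(x, y). frag_cmul ((-1) ^ cdeg C x) (conc (sinv C (frag_of x)) (sinv C (frag_of y))))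
         (ccop C b)"

primrec cobar_diff_word :: "'b coalg \<Rightarrow> 'b list \<Rightarrow> 'b list \<Rightarrow>\<^sub>0 int" where
  "cobar_diff_word C [] = 0"
| "cobar_diff_word C (b # w) =
     conc (cobar_diff_gen C b) (frag_of w)
     + frag_cmul ((-1) ^ (cdeg C b + 1)) (conc (frag_of [b]) (cobar_diff_word C w))"

definition cobar_diff :: "'b coalg \<Rightarrow> ('b list \<Rightarrow>\<^sub>0 int) \<Rightarrow> 'b list \<Rightarrow>\<^sub>0 int" where
  "cobar_diff C = frag_extend (cobar_diff_word C)"

definition cobar_complex :: "'b coalg \<Rightarrow> ('b list \<Rightarrow>\<^sub>0 int) cochain_complex" where
  "cobar_complex C = \<lparr> grade = free_grade (cobar_words C) (cobar_deg C), codiff = cobar_diff C \<rparr>"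

text \<open>The value on a word of the algebra map with values \<open>f b\<close> on the generators \<open>s\<^sup>-\<^sup>1b\<close>.\<close>

definition alg_ext :: "('m \<Rightarrow> 'm \<Rightarrow> 'm) \<Rightarrow> 'm \<Rightarrow> ('b \<Rightarrow> 'm) \<Rightarrow> 'b list \<Rightarrow> 'm" where
  "alg_ext mul e f w = foldr (\<lambda>b. mul (f b)) w e"


section \<open>Simplicial sets and normalized chains\<close>

text \<open>Every simplex carries its dimension.\<close>

record 's sset =
  simplices :: "'s set"
  sdim :: "'s \<Rightarrow> nat"
  face :: "nat \<Rightarrow> 's \<Rightarrow> 's"
  degen :: "nat \<Rightarrow> 's \<Rightarrow> 's"

definition simplicial_set :: "'s sset \<Rightarrow> bool" where
  "simplicial_set K \<longleftrightarrow> (\<forall>x\<in>simplices K.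
     (\<forall>i\<le>sdim K x. 0 < sdim K x \<longrightarrow>
        face K i x \<in> simplices K \<and> sdim K (face K i x) = sdim K x - 1) \<and>
     (\<forall>i\<le>sdim K x. degen K i x \<in> simplices K \<and> sdim K (degen K i x) = sdim K x + 1) \<and>
     (\<forall>i j. i < j \<and> j \<le> sdim K x \<and> 2 \<le> sdim K x \<longrightarrow>
        face K i (face K j x) = face K (j - 1) (face K i x)) \<and>
     (\<forall>i j. i \<le> j \<and> j \<le> sdim K x \<longrightarrow>
        degen K i (degen K j x) = degen K (j + 1) (degen K i x)) \<and>
     (\<forall>i j. i < j \<and> j \<le> sdim K x \<longrightarrow>
        face K i (degen K j x) = degen K (j - 1) (face K i x)) \<and>
     (\<forall>j\<le>sdim K x. face K j (degen K j x) = x \<and> face K (j + 1) (degen K j x) = x) \<and>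
     (\<forall>i j. j + 1 < i \<and> i \<le> sdim K x + 1 \<and> j \<le> sdim K x \<longrightarrow>
        face K i (degen K j x) = degen K j (face K (i - 1) x)))"

definition nondegenerate :: "'s sset \<Rightarrow> 's set" where
  "nondegenerate K = {x \<in> simplices K. \<not> (\<exists>y\<in>simplices K. \<exists>i\<le>sdim K y. x = degen K i y)}"

definition sset_prod :: "'s sset \<Rightarrow> 't sset \<Rightarrow> ('s \<times> 't) sset" where
  "sset_prod K L =
    \<lparr> simplices = {(x, y). x \<in> simplices K \<and> y \<in> simplices L \<and> sdim K x = sdim L y},
      sdim = (\<lambda>(x, y). sdim K x),
      face = (\<lambda>i (x, y). (face K i x, face L i y)),
      degen = (\<lambda>i (x, y). (degen K i x, degen L i y)) \<rparr>"

definition front_face :: "'s sset \<Rightarrow> nat \<Rightarrow> 's \<Rightarrow> 's" where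
  "front_face K i x = ((\<lambda>y. face K (sdim K y) y) ^^ (sdim K x - i)) x"

definition back_face :: "'s sset \<Rightarrow> nat \<Rightarrow> 's \<Rightarrow> 's" where
  "back_face K i x = (face K 0 ^^ i) x"

definition nchain :: "'s sset \<Rightarrow> 's \<Rightarrow> 's \<Rightarrow>\<^sub>0 int" where
  "nchain K x = (if x \<in> nondegenerate K then frag_of x else 0)"

text \<open>The Alexander-Whitney map \<open>C\<^sub>*(K \<times> K) \<rightarrow> C\<^sub>*K \<otimes> C\<^sub>*K\<close>.\<close>

definition AW :: "'s sset \<Rightarrow> 's \<times> 's \<Rightarrow> ('s \<times> 's) \<Rightarrow>\<^sub>0 int" where
  "AW K = (\<lambda>(x, y). \<Sum>i\<le>sdim K x. tensor (nchain K (front_face K i x)) (nchain K (back_face K i y)))"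

text \<open>Normalized chains of a simplicial set with a single vertex.\<close>

definition base_vertex :: "'s sset \<Rightarrow> 's" where
  "base_vertex K = (THE v. v \<in> simplices K \<and> sdim K v = 0)"

definition chains :: "'s sset \<Rightarrow> 's coalg" where
  "chains K =
    \<lparr> cbasis = nondegenerate K,
      cdeg = sdim K,
      cunit = base_vertex K,
      cdiff = (\<lambda>x. if sdim K x = 0 then 0
                   else \<Sum>i\<le>sdim K x. frag_cmul ((-1) ^ i) (nchain K (face K i x))),
      ccop = (\<lambda>x. AW K (x, x)) \<rparr>"


section \<open>The Alexander-Whitney cobar diagonal\<close>

text \<open>\<open>G\<close> gives the values on generators of a chain algebra map
  \<open>\<Omega>C\<^sub>*(K \<times> K) \<rightarrow> \<Omega>(C\<^sub>*K \<otimes> C\<^sub>*K)\<close> whose linear part is the Alexander-Whitney map.\<close>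

definition AW_algebra_map :: "'s sset \<Rightarrow> ('s \<times> 's \<Rightarrow> ('s \<times> 's) list \<Rightarrow>\<^sub>0 int) \<Rightarrow> bool" where
  "AW_algebra_map K G \<longleftrightarrow>
    (let KK = chains (sset_prod K K); CC = coalg_tensor (chains K) (chains K) in
     \<forall>g\<in>cbasis KK - {cunit KK}.
       G g \<in> free_grade (cobar_words CC) (cobar_low_deg CC) (cdeg KK g - 1) \<and>
       (\<forall>c\<in>cbasis CC - {cunit CC}. Poly_Mapping.lookup (G g) [c] = Poly_Mapping.lookup (AW K g) c) \<and>
       cobar_diff CC (G g) = frag_extend (alg_ext conc (frag_of []) G) (cobar_diff_gen KK g))"

definition conc_tensor :: "'b coalg \<Rightarrow> (('b list \<times> 'b list) \<Rightarrow>\<^sub>0 int) \<Rightarrow> (('b list \<times> 'b list) \<Rightarrow>\<^sub>0 int)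
    \<Rightarrow> ('b list \<times> 'b list) \<Rightarrow>\<^sub>0 int" where
  "conc_tensor C = frag_extend2 (\<lambda>(u, v) (u', v').
     frag_cmul ((-1) ^ (cobar_low_deg C v * cobar_low_deg C u')) (frag_of (u @ u', v @ v')))"

definition milgram_gen :: "'s coalg \<Rightarrow> 's \<times> 's \<Rightarrow> ('s list \<times> 's list) \<Rightarrow>\<^sub>0 int" where
  "milgram_gen C = (\<lambda>(x, y).
     if y = cunit C then frag_of ([x], []) else if x = cunit C then frag_of ([], [y]) else 0)"

definition milgram :: "'s coalg \<Rightarrow> (('s \<times> 's) list \<Rightarrow>\<^sub>0 int) \<Rightarrow> ('s list \<times> 's list) \<Rightarrow>\<^sub>0 int" where
  "milgram C = frag_extend (alg_ext (conc_tensor C) (frag_of ([], [])) (milgram_gen C))"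

definition cobar_diagonal ::
    "'s sset \<Rightarrow> ('s \<times> 's \<Rightarrow> ('s \<times> 's) list \<Rightarrow>\<^sub>0 int) \<Rightarrow> 's list \<Rightarrow> ('s list \<times> 's list) \<Rightarrow>\<^sub>0 int" where
  "cobar_diagonal K G w =
     milgram (chains K) (alg_ext conc (frag_of []) G (map (\<lambda>x. (x, x)) w))"


section \<open>Normalized cochains and the bar construction\<close>

text \<open>\<open>C\<^sup>*K\<close> has the basis dual to the nondegenerate simplices, each dual basis element being written
  as the simplex itself. Dualization follows the Koszul rule: \<open>df = -(-1)\<^bsup>|f|\<^esup> f \<circ> \<partial>\<close> and
  \<open>(fg)(c) = (f \<otimes> g)(\<Delta>c)\<close> with \<open>(f \<otimes> g)(c' \<otimes> c'') = (-1)\<^bsup>|g||c'|\<^esup> f(c') g(c'')\<close>.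
  The argument of \<open>Abs_poly_mapping\<close> has finite support when \<open>K\<close> is of finite type.\<close>

definition cup :: "'s sset \<Rightarrow> 's \<Rightarrow> 's \<Rightarrow> 's \<Rightarrow>\<^sub>0 int" where
  "cup K x y = Abs_poly_mapping (\<lambda>z. if z \<in> nondegenerate K
     then (-1) ^ (sdim K x * sdim K y) * Poly_Mapping.lookup (ccop (chains K) z) (x, y) else 0)"

definition simp_codiff :: "'s sset \<Rightarrow> 's \<Rightarrow> 's \<Rightarrow>\<^sub>0 int" where
  "simp_codiff K x = Abs_poly_mapping (\<lambda>z. if z \<in> nondegenerate K
     then - ((-1) ^ sdim K x) * Poly_Mapping.lookup (cdiff (chains K) z) x else 0)"

text \<open>The word \<open>[x\<^sub>1, \<dots>, x\<^sub>m]\<close> stands for \<open>sx\<^sub>1|\<dots>|sx\<^sub>m\<close>.\<close>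

definition bar_words :: "'s sset \<Rightarrow> 's list set" where
  "bar_words K = lists (nondegenerate K - {base_vertex K})"

definition bar_deg :: "'s sset \<Rightarrow> 's list \<Rightarrow> nat" where
  "bar_deg K c = (\<Sum>x\<leftarrow>c. sdim K x - 1)"

definition bar_cons :: "('s \<Rightarrow>\<^sub>0 int) \<Rightarrow> ('s list \<Rightarrow>\<^sub>0 int) \<Rightarrow> 's list \<Rightarrow>\<^sub>0 int" where
  "bar_cons = frag_extend2 (\<lambda>x c. frag_of (x # c))"

fun bar_diff :: "'s sset \<Rightarrow> 's list \<Rightarrow> 's list \<Rightarrow>\<^sub>0 int" where
  "bar_diff K [] = 0"
| "bar_diff K (x # c) =
     - bar_cons (simp_codiff K x) (frag_of c)
     + (case c of [] \<Rightarrow> 0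
        | y # c' \<Rightarrow> frag_cmul ((-1) ^ (sdim K x + 1)) (bar_cons (cup K x y) (frag_of c')))
     + frag_cmul ((-1) ^ (sdim K x - 1)) (bar_cons (frag_of x) (bar_diff K c))"

text \<open>The coproduct is deconcatenation.\<close>

definition Bar :: "'s sset \<Rightarrow> 's list coalg" where
  "Bar K =
    \<lparr> cbasis = bar_words K,
      cdeg = bar_deg K,
      cunit = [],
      cdiff = bar_diff K,
      ccop = (\<lambda>c. \<Sum>j\<le>length c. frag_of (take j c, drop j c)) \<rparr>"

abbreviation BarBar :: "'s sset \<Rightarrow> ('s list \<times> 's list) coalg" where
  "BarBar K \<equiv> coalg_tensor (Bar K) (Bar K)"

text \<open>Under \<open>\<B>C\<^sup>*K = (\<Omega>C\<^sub>*K)\<^sup>\<sharp>\<close> the bar word \<open>sx\<^sub>1|\<dots>|sx\<^sub>m\<close> takes the value \<open>bar_pairing\<close> on the cobar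
  word \<open>s\<^sup>-\<^sup>1x\<^sub>1 \<dots> s\<^sup>-\<^sup>1x\<^sub>m\<close>, and 0 on the other words. It is the Koszul sign of the evaluation, with
  \<open>\<langle>sf, s\<^sup>-\<^sup>1c\<rangle> = (-1)\<^bsup>|sf|\<^esup> \<langle>f, c\<rangle>\<close>; this normalization turns the dual of the cobar differential
  into the bar differential as signed above.\<close>

primrec bar_pairing :: "'s sset \<Rightarrow> 's list \<Rightarrow> int" where
  "bar_pairing K [] = 1"
| "bar_pairing K (x # c) = (-1) ^ ((sdim K x - 1) + (sdim K x - 1) * bar_deg K c) * bar_pairing K c"

text \<open>The product \<open>\<psi>\<^sub>K\<^sup>\<sharp>\<close>, given by \<open>(a \<star> b)(w) = (a \<otimes> b)(\<psi>\<^sub>K w)\<close> with the Koszul sign.\<close>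

definition star ::
    "'s sset \<Rightarrow> ('s \<times> 's \<Rightarrow> ('s \<times> 's) list \<Rightarrow>\<^sub>0 int) \<Rightarrow> 's list \<Rightarrow> 's list \<Rightarrow> 's list \<Rightarrow>\<^sub>0 int" where
  "star K G a b = Abs_poly_mapping (\<lambda>w. if w \<in> bar_words K
     then (-1) ^ (bar_deg K a * bar_deg K b) * bar_pairing K a * bar_pairing K b * bar_pairing K w
          * Poly_Mapping.lookup (cobar_diagonal K G w) (a, b)
     else 0)"

definition phi_word ::
    "'s sset \<Rightarrow> ('s \<times> 's \<Rightarrow> ('s \<times> 's) list \<Rightarrow>\<^sub>0 int) \<Rightarrow> ('s list \<times> 's list) list \<Rightarrow> 's list list \<Rightarrow>\<^sub>0 int" where
  "phi_word K G = alg_ext conc (frag_of []) (\<lambda>(a, b). sinv (Bar K) (star K G a b))"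

definition phi ::
    "'s sset \<Rightarrow> ('s \<times> 's \<Rightarrow> ('s \<times> 's) list \<Rightarrow>\<^sub>0 int) \<Rightarrow> (('s list \<times> 's list) list \<Rightarrow>\<^sub>0 int) \<Rightarrow> 's list list \<Rightarrow>\<^sub>0 int" where
  "phi K G = frag_extend (phi_word K G)"

definition eps_word :: "'s sset \<Rightarrow> 's list list \<Rightarrow> 's \<Rightarrow>\<^sub>0 int" where
  "eps_word K = alg_ext (frag_extend2 (cup K)) (frag_of (base_vertex K))
     (\<lambda>c. case c of [x] \<Rightarrow> frag_of x | _ \<Rightarrow> 0)"

definition eps :: "'s sset \<Rightarrow> ('s list list \<Rightarrow>\<^sub>0 int) \<Rightarrow> 's \<Rightarrow>\<^sub>0 int" where
  "eps K = frag_extend (eps_word K)"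


section \<open>The path and free loop models\<close>

text \<open>Elements \<open>w \<otimes> c\<close> of a free right \<open>\<Omega>C\<close>-module on \<open>\<B>C\<^sup>*K\<close>.\<close>

definition right_act :: "'s sset \<Rightarrow> 'b coalg \<Rightarrow> (('b list \<times> 's list) \<Rightarrow>\<^sub>0 int) \<Rightarrow> ('b list \<Rightarrow>\<^sub>0 int)
    \<Rightarrow> ('b list \<times> 's list) \<Rightarrow>\<^sub>0 int" where
  "right_act K C = frag_extend2
     (\<lambda>(w, c) w'. frag_cmul ((-1) ^ (cobar_deg C w' * bar_deg K c)) (frag_of (w @ w', c)))"

text \<open>The right-module derivation with values \<open>D1 c\<close> on \<open>1 \<otimes> c\<close>, using
  \<open>w \<otimes> c = (-1)\<^bsup>|w||c|\<^esup> (1 \<otimes> c) \<cdot> w\<close>.\<close>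

definition twisted_diff_basis :: "'s sset \<Rightarrow> 'b coalg \<Rightarrow> ('s list \<Rightarrow> ('b list \<times> 's list) \<Rightarrow>\<^sub>0 int)
    \<Rightarrow> 'b list \<times> 's list \<Rightarrow> ('b list \<times> 's list) \<Rightarrow>\<^sub>0 int" where
  "twisted_diff_basis K C D1 = (\<lambda>(w, c). frag_cmul ((-1) ^ (cobar_deg C w * bar_deg K c))
     (right_act K C (D1 c) (frag_of w)
      + frag_cmul ((-1) ^ bar_deg K c) (right_act K C (frag_of ([], c)) (cobar_diff_word C w))))"

definition twisted_complex :: "'s sset \<Rightarrow> 'b coalg \<Rightarrow> ('s list \<Rightarrow> ('b list \<times> 's list) \<Rightarrow>\<^sub>0 int)
    \<Rightarrow> (('b list \<times> 's list) \<Rightarrow>\<^sub>0 int) cochain_complex" where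
  "twisted_complex K C D1 =
    \<lparr> grade = free_grade (cobar_words C \<times> bar_words K) (\<lambda>(w, c). cobar_deg C w + bar_deg K c),
      codiff = frag_extend (twisted_diff_basis K C D1) \<rparr>"

text \<open>\<open>theta K (take j c)\<close> is \<open>\<theta>\<^sub>j\<close>, and \<open>theta K (drop j c)\<close> is \<open>\<theta>\<^sub>m - \<theta>\<^sub>j\<close>.\<close>

definition theta :: "'s sset \<Rightarrow> 's list \<Rightarrow> nat" where
  "theta K c = length c + (\<Sum>x\<leftarrow>c. sdim K x)"

text \<open>\<open>left_gen K G a b c\<close> is \<open>(s\<^sup>-\<^sup>1(a \<otimes> b) \<otimes> 1)(1 \<otimes> c)\<close>.\<close>

function left_gen :: "'s sset \<Rightarrow> ('s \<times> 's \<Rightarrow> ('s \<times> 's) list \<Rightarrow>\<^sub>0 int) \<Rightarrow> 's list \<Rightarrow> 's list \<Rightarrow> 's list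
    \<Rightarrow> (('s list \<times> 's list) list \<times> 's list) \<Rightarrow>\<^sub>0 int" where
  "left_gen K G a b c =
    (let S = (\<lambda>p q. sinv (BarBar K) (tensor p q))
     in if c = [] then tensor (S (frag_of a) (frag_of b)) (frag_of [])
        else tensor (S (frag_of a) (frag_of b)) (frag_of c)
          + frag_cmul ((-1) ^ (bar_deg K b * theta K c))
              (tensor (S (frag_of a) (star K G c b) - S (star K G a c) (frag_of b)) (frag_of []))
          + (\<Sum>j\<in>{1..<length c}.
               - frag_cmul ((-1) ^ (bar_deg K b * theta K (take j c)))
                   (frag_extend (\<lambda>a'. left_gen K G a' b (drop j c)) (star K G a (take j c)))
               + frag_cmul ((-1) ^ ((bar_deg K b + theta K (take j c)) * theta K (drop j c)))
                   (tensor (S (frag_of a) (star K G (drop j c) b)) (frag_of (take j c)))))"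
  by pat_completeness auto
termination
  by (relation "measure (\<lambda>(K, G, a, b, c). length c)") auto

declare left_gen.simps [simp del]

definition path_D1 :: "'s sset \<Rightarrow> ('s \<times> 's \<Rightarrow> ('s \<times> 's) list \<Rightarrow>\<^sub>0 int) \<Rightarrow> 's list
    \<Rightarrow> (('s list \<times> 's list) list \<times> 's list) \<Rightarrow>\<^sub>0 int" where
  "path_D1 K G c =
    (let S = (\<lambda>a b. sinv (BarBar K) (frag_of (a, b)))
     in tensor (frag_of []) (bar_diff K c) + tensor (S c []) (frag_of []) - tensor (S [] c) (frag_of [])
        + (\<Sum>j\<in>{1..<length c}.
             left_gen K G (take j c) [] (drop j c)
             - frag_cmul ((-1) ^ (theta K (take j c) * theta K (drop j c)))
                 (tensor (S [] (drop j c)) (frag_of (take j c)))))"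

definition path_model :: "'s sset \<Rightarrow> ('s \<times> 's \<Rightarrow> ('s \<times> 's) list \<Rightarrow>\<^sub>0 int)
    \<Rightarrow> ((('s list \<times> 's list) list \<times> 's list) \<Rightarrow>\<^sub>0 int) cochain_complex" where
  "path_model K G = twisted_complex K (BarBar K) (path_D1 K G)"

definition loop_D1 :: "'s sset \<Rightarrow> ('s \<times> 's \<Rightarrow> ('s \<times> 's) list \<Rightarrow>\<^sub>0 int) \<Rightarrow> 's list
    \<Rightarrow> ('s list list \<times> 's list) \<Rightarrow>\<^sub>0 int" where
  "loop_D1 K G c = frag_extend (\<lambda>(w, c'). tensor (phi_word K G w) (frag_of c')) (path_D1 K G c)"

definition loop_model :: "'s sset \<Rightarrow> ('s \<times> 's \<Rightarrow> ('s \<times> 's) list \<Rightarrow>\<^sub>0 int)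
    \<Rightarrow> (('s list list \<times> 's list) \<Rightarrow>\<^sub>0 int) cochain_complex" where
  "loop_model K G = twisted_complex K (Bar K) (loop_D1 K G)"

definition eps_Id :: "'s sset \<Rightarrow> (('s list list \<times> 's list) \<Rightarrow>\<^sub>0 int) \<Rightarrow> ('s \<times> 's list) \<Rightarrow>\<^sub>0 int" where
  "eps_Id K = frag_extend (\<lambda>(w, c). tensor (eps_word K w) (frag_of c))"

definition thin_right_act :: "'s sset \<Rightarrow> (('s \<times> 's list) \<Rightarrow>\<^sub>0 int) \<Rightarrow> ('s \<Rightarrow>\<^sub>0 int) \<Rightarrow> ('s \<times> 's list) \<Rightarrow>\<^sub>0 int" where
  "thin_right_act K = frag_extend2
     (\<lambda>(y, c) x. frag_cmul ((-1) ^ (sdim K x * bar_deg K c)) (tensor (cup K y x) (frag_of c)))"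

definition thin_diff_basis :: "'s sset \<Rightarrow> ('s \<times> 's \<Rightarrow> ('s \<times> 's) list \<Rightarrow>\<^sub>0 int) \<Rightarrow> 's \<times> 's list
    \<Rightarrow> ('s \<times> 's list) \<Rightarrow>\<^sub>0 int" where
  "thin_diff_basis K G = (\<lambda>(x, c). frag_cmul ((-1) ^ (sdim K x * bar_deg K c))
     (thin_right_act K (eps_Id K (loop_D1 K G c)) (frag_of x)
      + frag_cmul ((-1) ^ bar_deg K c)
          (thin_right_act K (frag_of (base_vertex K, c)) (simp_codiff K x))))"

definition thin_model :: "'s sset \<Rightarrow> ('s \<times> 's \<Rightarrow> ('s \<times> 's) list \<Rightarrow>\<^sub>0 int)
    \<Rightarrow> (('s \<times> 's list) \<Rightarrow>\<^sub>0 int) cochain_complex" where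
  "thin_model K G =
    \<lparr> grade = free_grade (nondegenerate K \<times> bar_words K) (\<lambda>(x, c). sdim K x + bar_deg K c),
      codiff = frag_extend (thin_diff_basis K G) \<rparr>"

text \<open>\<open>Id \<otimes> \<psi>\<^sub>K\<^sup>\<sharp>\<chi>\<close>\<close>

definition Id_star_cop :: "'s sset \<Rightarrow> ('s \<times> 's \<Rightarrow> ('s \<times> 's) list \<Rightarrow>\<^sub>0 int)
    \<Rightarrow> (('s \<times> 's list) \<Rightarrow>\<^sub>0 int) \<Rightarrow> ('s \<times> 's list) \<Rightarrow>\<^sub>0 int" where
  "Id_star_cop K G = frag_extend (\<lambda>(x, c).
     tensor (frag_of x) (frag_extend (\<lambda>(a, b). star K G a b) (ccop (Bar K) c)))"


section \<open>Cubical cochains\<close>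

definition cube :: "nat \<Rightarrow> (nat \<Rightarrow> real) set" where
  "cube m = {t. (\<forall>i<m. 0 \<le> t i \<and> t i \<le> 1) \<and> (\<forall>i\<ge>m. t i = 0)}"

text \<open>A cube is paired with its dimension.\<close>

type_synonym 'y scube = "nat \<times> ((nat \<Rightarrow> real) \<Rightarrow> 'y)"

definition singular_cubes :: "'y topology \<Rightarrow> 'y scube set" where
  "singular_cubes Y = {(m, T).
     continuous_map (subtopology (powertop_real UNIV) (cube m)) Y T \<and> T \<in> extensional (cube m)}"

definition degenerate_cube :: "'y scube \<Rightarrow> bool" where
  "degenerate_cube = (\<lambda>(m, T). \<exists>i<m. \<forall>t\<in>cube m. \<forall>s\<in>{0..1}. T (t(i := s)) = T t)"

definition nd_cubes :: "'y topology \<Rightarrow> 'y scube set" where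
  "nd_cubes Y = {c \<in> singular_cubes Y. \<not> degenerate_cube c}"

text \<open>Restriction of \<open>(m, T)\<close> to the face on which the coordinates outside \<open>L\<close> are equal to \<open>e\<close>; the
  coordinates in \<open>L\<close> keep their order.\<close>

definition subcube :: "nat set \<Rightarrow> real \<Rightarrow> 'y scube \<Rightarrow> 'y scube" where
  "subcube L e = (\<lambda>(m, T). (card L,
     restrict (\<lambda>t. T (\<lambda>j. if j \<in> L then t (card {i \<in> L. i < j}) else if j < m then e else 0))
       (cube (card L))))"

text \<open>The sign of the shuffle \<open>(L, L\<^sup>c)\<close> of the coordinates of an \<open>m\<close>-cube.\<close>

definition shuffle_sign :: "nat \<Rightarrow> nat set \<Rightarrow> int" where
  "shuffle_sign m L = (-1) ^ card {(i, j). i \<in> L \<and> j < m \<and> j \<notin> L \<and> j < i}"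

text \<open>A cochain is a function on the nondegenerate singular cubes (the basis of \<open>CU\<^sub>*Y\<close>), extended
  by 0. The coordinate \<open>t\<^sub>i\<close>, \<open>1 \<le> i \<le> m\<close>, of a cube is here the coordinate with index \<open>i - 1\<close>.\<close>

definition CU_codiff :: "'y topology \<Rightarrow> ('y scube \<Rightarrow> int) \<Rightarrow> 'y scube \<Rightarrow> int" where
  "CU_codiff Y f c = (if c \<in> nd_cubes Y
     then \<Sum>i<fst c. (-1) ^ (i + 1) *
            (f (subcube ({..<fst c} - {i}) 1 c) - f (subcube ({..<fst c} - {i}) 0 c))
     else 0)"

definition CU :: "'y topology \<Rightarrow> ('y scube \<Rightarrow> int) cochain_complex" where
  "CU Y = \<lparr> grade = (\<lambda>k. {f. \<forall>c. f c \<noteq> 0 \<longrightarrow> c \<in> nd_cubes Y \<and> fst c = k}), codiff = CU_codiff Y \<rparr>"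

definition CU_mult :: "'y topology \<Rightarrow> ('y scube \<Rightarrow> int) \<Rightarrow> ('y scube \<Rightarrow> int) \<Rightarrow> 'y scube \<Rightarrow> int" where
  "CU_mult Y f g c = (if c \<in> nd_cubes Y
     then \<Sum>L\<in>Pow {..<fst c}.
            shuffle_sign (fst c) L * f (subcube L 0 c) * g (subcube ({..<fst c} - L) 1 c)
     else 0)"

definition CU_one :: "'y topology \<Rightarrow> 'y scube \<Rightarrow> int" where
  "CU_one Y c = (if c \<in> nd_cubes Y \<and> fst c = 0 then 1 else 0)"

text \<open>The cochain map induced by a continuous map \<open>g\<close> with domain \<open>Y\<close>.\<close>

definition CU_map :: "'y topology \<Rightarrow> ('y \<Rightarrow> 'z) \<Rightarrow> ('z scube \<Rightarrow> int) \<Rightarrow> 'y scube \<Rightarrow> int" where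
  "CU_map Y g f = (\<lambda>(m, T). if (m, T) \<in> nd_cubes Y then f (m, restrict (g \<circ> T) (cube m)) else 0)"


section \<open>Path and loop spaces\<close>

text \<open>\<open>X\<^sup>I\<close> with the compact-open topology.\<close>

definition paths :: "'a topology \<Rightarrow> (real \<Rightarrow> 'a) set" where
  "paths X = {l. continuous_map (top_of_set {0..1}) X l \<and> l \<in> extensional {0..1}}"

definition path_space :: "'a topology \<Rightarrow> (real \<Rightarrow> 'a) topology" where
  "path_space X = topology_generated_by
     {{l \<in> paths X. l ` C \<subseteq> U} | C U. compact C \<and> C \<subseteq> {0..1} \<and> openin X U}"

text \<open>The circle is \<open>I\<close> with its end points identified, \<open>t\<close> corresponding to \<open>z = exp (2\<pi>it)\<close>; the
  inclusion into \<open>X\<^sup>I\<close> is the identity on the underlying functions.\<close>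

definition free_loop_space :: "'a topology \<Rightarrow> (real \<Rightarrow> 'a) topology" where
  "free_loop_space X = subtopology (path_space X) {l. l 0 = l 1}"

definition power_map2 :: "(real \<Rightarrow> 'a) \<Rightarrow> real \<Rightarrow> 'a" where
  "power_map2 l = restrict (\<lambda>t. if t \<le> 1/2 then l (2 * t) else l (2 * t - 1)) {0..1}"

text \<open>\<open>H(T)(t\<^sub>0, \<dots>, t\<^sub>m)(u) = T(t\<^sub>1, \<dots>, t\<^sub>m)(t\<^sub>0u)\<close>, and \<open>J\<close>.\<close>

definition H_cube :: "(real \<Rightarrow> 'a) scube \<Rightarrow> (real \<Rightarrow> 'a) scube" where
  "H_cube = (\<lambda>(m, T). (m + 1,
     restrict (\<lambda>t. restrict (\<lambda>u. T (\<lambda>j. t (j + 1)) (t 0 * u)) {0..1}) (cube (m + 1))))"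

definition J :: "'a topology \<Rightarrow> ((real \<Rightarrow> 'a) scube \<Rightarrow> int) \<Rightarrow> (real \<Rightarrow> 'a) scube \<Rightarrow> int" where
  "J X f c = (if c \<in> nd_cubes (path_space X) then - f (H_cube c) else 0)"


section \<open>The thin free loop model\<close>

definition model_square :: "'s sset \<Rightarrow> ('s \<times> 's \<Rightarrow> ('s \<times> 's) list \<Rightarrow>\<^sub>0 int) \<Rightarrow> 'a topology
    \<Rightarrow> ((('s list \<times> 's list) list \<Rightarrow>\<^sub>0 int) \<Rightarrow> ('a \<times> 'a) scube \<Rightarrow> int)
    \<Rightarrow> (('s list list \<Rightarrow>\<^sub>0 int) \<Rightarrow> 'a scube \<Rightarrow> int) \<Rightarrow> bool" where
  "model_square K G X \<alpha> \<gamma> \<longleftrightarrow>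
    (let XX = prod_topology X X; A = cobar_complex (BarBar K); B = cobar_complex (Bar K) in
     quasi_iso A (CU XX) \<alpha> \<and>
     quasi_iso B (CU X) \<gamma> \<and>
     cohomology_algebra_map A conc (frag_of []) (CU XX) (CU_mult XX) (CU_one XX) \<alpha> \<and>
     cohomology_algebra_map B conc (frag_of []) (CU X) (CU_mult X) (CU_one X) \<gamma> \<and>
     (\<forall>k. \<forall>p\<in>grade A k. CU_map X (\<lambda>x. (x, x)) (\<alpha> p) = \<gamma> (phi K G p)) \<and>
     (\<forall>k. \<forall>p\<in>grade B k. eps K p = 0 \<longrightarrow> \<gamma> p = 0) \<and>
     (\<forall>k. \<forall>p\<in>grade B k.
        \<alpha> (frag_extend (\<lambda>w. frag_of (map (\<lambda>c. (c, [])) w)) p) = CU_map XX fst (\<gamma> p) \<and>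
        \<alpha> (frag_extend (\<lambda>w. frag_of (map (\<lambda>c. ([], c)) w)) p) = CU_map XX snd (\<gamma> p)))"

text \<open>The recursive equations that determine \<open>\<beta>\<close>.\<close>

definition path_map_equations :: "'s sset \<Rightarrow> ('s \<times> 's \<Rightarrow> ('s \<times> 's) list \<Rightarrow>\<^sub>0 int) \<Rightarrow> 'a topology
    \<Rightarrow> ((('s list \<times> 's list) list \<Rightarrow>\<^sub>0 int) \<Rightarrow> ('a \<times> 'a) scube \<Rightarrow> int)
    \<Rightarrow> (((('s list \<times> 's list) list \<times> 's list) \<Rightarrow>\<^sub>0 int) \<Rightarrow> (real \<Rightarrow> 'a) scube \<Rightarrow> int) \<Rightarrow> bool" where
  "path_map_equations K G X \<alpha> \<beta> \<longleftrightarrow>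
     graded_hom (path_model K G) (CU (path_space X)) \<beta> \<and>
     \<beta> (frag_of ([], [])) = CU_one (path_space X) \<and>
     (\<forall>c\<in>bar_words K - {[]}. \<beta> (frag_of ([], c)) = J X (\<beta> (path_D1 K G c))) \<and>
     (\<forall>w\<in>cobar_words (BarBar K). \<forall>c\<in>bar_words K.
        \<beta> (frag_of (w, c)) = (\<lambda>T. (-1) ^ (cobar_deg (BarBar K) w * bar_deg K c) *
          CU_mult (path_space X) (\<beta> (frag_of ([], c)))
            (CU_map (path_space X) (\<lambda>l. (l 0, l 1)) (\<alpha> (frag_of w))) T))"

definition delta1 :: "'s sset \<Rightarrow> ('s \<times> 's \<Rightarrow> ('s \<times> 's) list \<Rightarrow>\<^sub>0 int) \<Rightarrow> 'a topology
    \<Rightarrow> (((('s list \<times> 's list) list \<times> 's list) \<Rightarrow>\<^sub>0 int) \<Rightarrow> (real \<Rightarrow> 'a) scube \<Rightarrow> int)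
    \<Rightarrow> 's list \<Rightarrow> (real \<Rightarrow> 'a) scube \<Rightarrow> int" where
  "delta1 K G X \<beta> c =
     (if c = [] then CU_one (free_loop_space X)
      else CU_map (free_loop_space X) (\<lambda>l. l) (J X (\<beta> (path_D1 K G c))))"

definition delta_basis :: "'s sset \<Rightarrow> ('s \<times> 's \<Rightarrow> ('s \<times> 's) list \<Rightarrow>\<^sub>0 int) \<Rightarrow> 'a topology
    \<Rightarrow> (((('s list \<times> 's list) list \<times> 's list) \<Rightarrow>\<^sub>0 int) \<Rightarrow> (real \<Rightarrow> 'a) scube \<Rightarrow> int)
    \<Rightarrow> (('s list list \<Rightarrow>\<^sub>0 int) \<Rightarrow> 'a scube \<Rightarrow> int)
    \<Rightarrow> 's list list \<times> 's list \<Rightarrow> (real \<Rightarrow> 'a) scube \<Rightarrow> int" where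
  "delta_basis K G X \<beta> \<gamma> = (\<lambda>(w, c) T. (-1) ^ (cobar_deg (Bar K) w * bar_deg K c) *
     CU_mult (free_loop_space X) (delta1 K G X \<beta> c)
       (CU_map (free_loop_space X) (\<lambda>l. l 0) (\<gamma> (frag_of w))) T)"

definition delta :: "'s sset \<Rightarrow> ('s \<times> 's \<Rightarrow> ('s \<times> 's) list \<Rightarrow>\<^sub>0 int) \<Rightarrow> 'a topology
    \<Rightarrow> (((('s list \<times> 's list) list \<times> 's list) \<Rightarrow>\<^sub>0 int) \<Rightarrow> (real \<Rightarrow> 'a) scube \<Rightarrow> int)
    \<Rightarrow> (('s list list \<Rightarrow>\<^sub>0 int) \<Rightarrow> 'a scube \<Rightarrow> int)
    \<Rightarrow> (('s list list \<times> 's list) \<Rightarrow>\<^sub>0 int) \<Rightarrow> (real \<Rightarrow> 'a) scube \<Rightarrow> int" where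
  "delta K G X \<beta> \<gamma> p =
     (\<lambda>T. \<Sum>b\<in>Poly_Mapping.keys p. Poly_Mapping.lookup p b * delta_basis K G X \<beta> \<gamma> b T)"

definition thin_section :: "'s sset \<Rightarrow> ('s \<times> 's \<Rightarrow> ('s \<times> 's) list \<Rightarrow>\<^sub>0 int)
    \<Rightarrow> ((('s \<times> 's list) \<Rightarrow>\<^sub>0 int) \<Rightarrow> ('s list list \<times> 's list) \<Rightarrow>\<^sub>0 int) \<Rightarrow> bool" where
  "thin_section K G \<sigma> \<longleftrightarrow>
     cochain_map (thin_model K G) (loop_model K G) \<sigma> \<and>
     (\<forall>k. \<forall>p\<in>grade (thin_model K G) k. eps_Id K (\<sigma> p) = p) \<and>
     (\<forall>x\<in>nondegenerate K. \<forall>c\<in>bar_words K. length c \<le> 2 \<longrightarrow>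
        \<sigma> (frag_of (x, c)) = frag_of (if x = base_vertex K then [] else [[x]], c))"

definition Upsilon :: "'s sset \<Rightarrow> ('s \<times> 's \<Rightarrow> ('s \<times> 's) list \<Rightarrow>\<^sub>0 int) \<Rightarrow> 'a topology
    \<Rightarrow> (((('s list \<times> 's list) list \<times> 's list) \<Rightarrow>\<^sub>0 int) \<Rightarrow> (real \<Rightarrow> 'a) scube \<Rightarrow> int)
    \<Rightarrow> (('s list list \<Rightarrow>\<^sub>0 int) \<Rightarrow> 'a scube \<Rightarrow> int)
    \<Rightarrow> ((('s \<times> 's list) \<Rightarrow>\<^sub>0 int) \<Rightarrow> ('s list list \<times> 's list) \<Rightarrow>\<^sub>0 int)
    \<Rightarrow> (('s \<times> 's list) \<Rightarrow>\<^sub>0 int) \<Rightarrow> (real \<Rightarrow> 'a) scube \<Rightarrow> int" where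
  "Upsilon K G X \<beta> \<gamma> \<sigma> = delta K G X \<beta> \<gamma> \<circ> \<sigma>"

end

theory Submission
  imports Defs "HOL-Analysis.Abstract_Topological_Spaces" "HOL-Analysis.Function_Metric"
begin

text \<open>
  Since \<open>K\<close> has two nondegenerate simplices, the thin model has zero differential, \<open>Id \<otimes> \<psi>\<^sub>K\<^sup>\<sharp>\<chi>\<close> is
  multiplication by \<open>2\<^sup>m\<close> on \<open>x \<otimes> sz(m)\<close>, and a homotopy exists as soon as the two maps agree up to
  a coboundary on each basis element. The kernel condition on \<open>\<gamma>\<close> gives
  \<open>\<Upsilon>(z \<otimes> sz(m)) = x\<^sub>m \<cdot> e\<^sup>*\<omega>\<close> with \<open>x\<^sub>m = \<Upsilon>(1 \<otimes> sz(m))\<close> and \<open>\<omega> = \<gamma>(s\<^sup>-\<^sup>1(sz))\<close>. As \<open>e \<circ> \<lambda>\<^sup>2 = e\<close>, it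
  remains to see that \<open>\<lambda>\<^sup>2\<close> multiplies the class of \<open>x\<^sub>m\<close> by \<open>2\<^sup>m\<close>.

  This class generates the cohomology of \<open>\<L>S\<^sup>2\<^sup>n\<^sup>+\<^sup>1\<close> in degree \<open>2nm\<close>. Let \<open>y\<close> be the transgression of \<open>\<omega>\<close>,
  evaluated on a cube of loops by evaluating \<open>\<omega>\<close> on the adjoint cube. Cutting the circle into halves
  gives \<open>\<lambda>\<^sup>2y \<sim> 2y\<close>, hence \<open>\<lambda>\<^sup>2y\<^sup>m \<sim> 2\<^sup>my\<^sup>m\<close>. With \<open>y\<^sup>m \<sim> c x\<^sub>m\<close> and \<open>\<lambda>\<^sup>2x\<^sub>m \<sim> d x\<^sub>m\<close> one gets
  \<open>(2\<^sup>m - d) y\<^sup>m \<sim> 0\<close>, so \<open>d = 2\<^sup>m\<close> because \<open>y\<^sup>m\<close> has infinite order: the slant operation given by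
  concatenation with a spherical cycle of loops is a derivation up to homotopy and maps \<open>y\<close> to a
  nonzero constant \<open>u\<close>, so that its \<open>m\<close>-th iterate maps \<open>y\<^sup>m\<close> to \<open>m! u\<^sup>m\<close>.
\<close>

section \<open>Singular cubes and their reparametrizations\<close>

text \<open>The maps \<open>\<beta>\<close> and \<open>\<sigma>\<close> enter only through their
  formal properties: \<open>\<sigma>\<close> splits \<open>eps_Id\<close> and the composite
  \<open>\<Upsilon>\<close> is a quasi-isomorphism. A parity count of degrees then makes x_m a
  generator, so the eigenvalue is some integer, and any class of infinite order in that degree
  reveals it. The obstacle is to show that y^m is such a class. All that is known of
  \<open>\<omega>\<close> is that it is no coboundary, while the slant argument needs its value on
  an explicit cycle. Passing from one to the other amounts to computing the top cubical cohomology
  of a sphere; this is the purpose of subdivision, Mayer-Vietoris and the suspension cubes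
  \<open>iota\<close>. Induced maps, transgression, slants and all homotopies are instances of one
  operator \<open>CX\<close>, the pullback of cochains along the product of a parameter cube with a
  given cube. Its two rules, \<open>CX_codiff\<close> for the differential and
  \<open>CX_mult\<close> for products, carry the topological part. The evenness of q = 2n matters
  twice: the slant satisfies its rules without signs, and the two generators of the cobar diagonal
  commute, which produces binomial coefficients.\<close>

definition pull :: "nat \<Rightarrow> ((nat \<Rightarrow> real) \<Rightarrow> nat \<Rightarrow> real) \<Rightarrow> 'y scube \<Rightarrow> 'y scube" where
  "pull k \<phi> c = (k, restrict (snd c \<circ> \<phi>) (cube k))"

definition cube_map :: "nat \<Rightarrow> nat \<Rightarrow> ((nat \<Rightarrow> real) \<Rightarrow> nat \<Rightarrow> real) \<Rightarrow> bool" where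
  "cube_map k m \<phi> \<longleftrightarrow> continuous_on (cube k) \<phi> \<and> \<phi> \<in> cube k \<rightarrow> cube m"

text \<open>Cochains are functions on all pairs, extended by zero; this is the normalization
  condition, detached from the degree so that it also serves products, restrictions and
  sums.\<close>

definition nd_supp :: "'y topology \<Rightarrow> ('y scube \<Rightarrow> int) \<Rightarrow> bool" where
  "nd_supp Y f \<longleftrightarrow> (\<forall>c. f c \<noteq> 0 \<longrightarrow> c \<in> nd_cubes Y)"

text \<open>The i-th coface inclusion of cubes; the later coordinates move up by one.\<close>

definition ins :: "nat \<Rightarrow> real \<Rightarrow> (nat \<Rightarrow> real) \<Rightarrow> nat \<Rightarrow> real" where
  "ins i e t = (\<lambda>j. if j < i then t j else if j = i then e else t (j - 1))"

lemma cubeI: "(\<And>i. i < m \<Longrightarrow> 0 \<le> t i \<and> t i \<le> 1) \<Longrightarrow> (\<And>i. i \<ge> m \<Longrightarrow> t i = 0) \<Longrightarrow> t \<in> cube m"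
  by (simp add: cube_def)

lemma cubeD: "t \<in> cube m \<Longrightarrow> 0 \<le> t i" "t \<in> cube m \<Longrightarrow> t i \<le> 1" "t \<in> cube m \<Longrightarrow> m \<le> i \<Longrightarrow> t i = 0"
  by (auto simp: cube_def) (metis linorder_not_less order_refl zero_le_one)+

lemma cube_upd: "t \<in> cube m \<Longrightarrow> i < m \<Longrightarrow> s \<in> {0..1} \<Longrightarrow> t(i := s) \<in> cube m"
  by (auto simp: cube_def)

lemma cube_0: "cube 0 = {\<lambda>_. 0}"
  by (auto simp: cube_def)

lemma zero_in_cube [simp]: "(\<lambda>_. 0) \<in> cube m"
  by (auto simp: cube_def)

lemma cubetop_eq: "subtopology (powertop_real UNIV) S = top_of_set S"
  by (simp add: euclidean_product_topology)

lemma singular_cubes_iff: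
  "c \<in> singular_cubes Y \<longleftrightarrow>
     continuous_map (top_of_set (cube (fst c))) Y (snd c) \<and> snd c \<in> extensional (cube (fst c))"
  by (auto simp: singular_cubes_def cubetop_eq split: prod.splits)

lemma cube_mapI:
  assumes "\<And>t. t \<in> cube k \<Longrightarrow> \<phi> t \<in> cube m" "\<And>j. continuous_on (cube k) (\<lambda>t. \<phi> t j)"
  shows "cube_map k m \<phi>"
  using assms by (auto simp: cube_map_def intro: continuous_on_coordinatewise_then_product)

lemma cube_mapD: "cube_map k m \<phi> \<Longrightarrow> t \<in> cube k \<Longrightarrow> \<phi> t \<in> cube m"
  by (auto simp: cube_map_def)

lemma continuous_on_coord [continuous_intros]: "continuous_on S (\<lambda>t::nat \<Rightarrow> real. t j)"
  by (rule continuous_on_subset[OF continuous_on_product_coordinates]) auto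

lemma pull_singular:
  assumes "c \<in> singular_cubes Y" "cube_map k (fst c) \<phi>"
  shows "pull k \<phi> c \<in> singular_cubes Y"
proof -
  have 1: "continuous_map (top_of_set (cube k)) (top_of_set (cube (fst c))) \<phi>"
    using assms by (auto simp: cube_map_def)
  have "continuous_map (top_of_set (cube k)) Y (snd c \<circ> \<phi>)"
    using continuous_map_compose[OF 1] assms(1) by (auto simp: singular_cubes_iff)
  then have "continuous_map (top_of_set (cube k)) Y (restrict (snd c \<circ> \<phi>) (cube k))"
    by (rule continuous_map_eq) auto
  then show ?thesis by (auto simp: singular_cubes_iff pull_def)
qed

lemma fst_pull [simp]: "fst (pull k \<phi> c) = k"
  by (simp add: pull_def)

lemma snd_pull: "t \<in> cube k \<Longrightarrow> snd (pull k \<phi> c) t = snd c (\<phi> t)"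
  by (simp add: pull_def)

lemma pull_pull: "(\<And>t. t \<in> cube k \<Longrightarrow> \<psi> t \<in> cube l) \<Longrightarrow> pull k \<psi> (pull l \<phi> c) = pull k (\<lambda>t. \<phi> (\<psi> t)) c"
  by (auto simp: pull_def restrict_def)

lemma pull_cong: "(\<And>t. t \<in> cube k \<Longrightarrow> \<phi> t = \<psi> t) \<Longrightarrow> pull k \<phi> c = pull k \<psi> c"
  by (auto simp: pull_def restrict_def)

lemma pull_id: "c \<in> singular_cubes Y \<Longrightarrow> (\<And>t. t \<in> cube (fst c) \<Longrightarrow> \<phi> t = t) \<Longrightarrow> pull (fst c) \<phi> c = c"
  by (auto simp: pull_def singular_cubes_iff restrict_def extensional_def prod_eq_iff)

lemma degenerate_iff:
  "degenerate_cube c \<longleftrightarrow> (\<exists>i<fst c. \<forall>t\<in>cube (fst c). \<forall>s\<in>{0..1}. snd c (t(i := s)) = snd c t)"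
  by (auto simp: degenerate_cube_def split: prod.splits)

lemma degenerate_pull:
  assumes "i < k" "\<And>t s. t \<in> cube k \<Longrightarrow> s \<in> {0..1} \<Longrightarrow> snd c (\<phi> (t(i := s))) = snd c (\<phi> t)"
  shows "degenerate_cube (pull k \<phi> c)"
  unfolding degenerate_iff using assms
  by (auto simp: snd_pull cube_upd intro!: exI[of _ i])

section \<open>Normalized cubical cochains and their differential\<close>

lemma nd_suppD: "nd_supp Y f \<Longrightarrow> degenerate_cube c \<Longrightarrow> f c = 0" "nd_supp Y f \<Longrightarrow> c \<notin> singular_cubes Y \<Longrightarrow> f c = 0"
  unfolding nd_supp_def nd_cubes_def by blast+

lemma CU_grade: "f \<in> grade (CU Y) k \<longleftrightarrow> nd_supp Y f \<and> (\<forall>c. f c \<noteq> 0 \<longrightarrow> fst c = k)"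
  by (auto simp: CU_def nd_supp_def)

lemma CU_gradeD: "f \<in> grade (CU Y) k \<Longrightarrow> fst c \<noteq> k \<Longrightarrow> f c = 0"
  unfolding CU_grade by blast

lemma CU_grade_supp: "f \<in> grade (CU Y) k \<Longrightarrow> nd_supp Y f"
  by (simp add: CU_grade)

lemma nd_suppI: "(\<And>c. c \<notin> nd_cubes Y \<Longrightarrow> f c = 0) \<Longrightarrow> nd_supp Y f"
  unfolding nd_supp_def by blast

lemma CU_gradeI: "nd_supp Y f \<Longrightarrow> (\<And>c. c \<in> nd_cubes Y \<Longrightarrow> fst c \<noteq> k \<Longrightarrow> f c = 0) \<Longrightarrow> f \<in> grade (CU Y) k"
  unfolding CU_grade nd_supp_def by blast

lemma CU_codiff [simp]: "codiff (CU Y) = CU_codiff Y"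
  by (simp add: CU_def)

lemma ins_cube: "t \<in> cube k \<Longrightarrow> i \<le> k \<Longrightarrow> e \<in> {0..1} \<Longrightarrow> ins i e t \<in> cube (Suc k)"
  by (rule cubeI) (auto simp: ins_def cubeD)

lemma cube_map_ins: "i \<le> k \<Longrightarrow> e \<in> {0..1} \<Longrightarrow> cube_map k (Suc k) (ins i e)"
proof (rule cube_mapI)
  fix j show "continuous_on (cube k) (\<lambda>t. ins i e t j)"
    by (cases "j < i"; cases "j = i") (simp_all add: ins_def continuous_intros)
qed (rule ins_cube)

text \<open>The inclusion of the face spanned by \<open>L\<close>: a coordinate in \<open>L\<close>
  reads the entry whose index is its rank in \<open>L\<close>, and the other coordinates of the
  m-cube are frozen at \<open>e\<close>.\<close>

definition fins :: "nat set \<Rightarrow> nat \<Rightarrow> real \<Rightarrow> (nat \<Rightarrow> real) \<Rightarrow> nat \<Rightarrow> real" where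
  "fins L m e t = (\<lambda>j. if j \<in> L then t (card {i \<in> L. i < j}) else if j < m then e else 0)"

lemma subcube_eq_pull: "subcube L e c = pull (card L) (fins L (fst c) e) c"
  by (cases c) (auto simp: subcube_def pull_def fins_def comp_def)

lemma card_less_rank: "finite L \<Longrightarrow> j \<in> L \<Longrightarrow> card {i \<in> L. i < j} < card (L::nat set)"
  by (rule psubset_card_mono) auto

lemma cube_map_fins:
  assumes "L \<subseteq> {..<m}" "e \<in> {0..1}"
  shows "cube_map (card L) m (fins L m e)"
proof (rule cube_mapI)
  fix t assume t: "t \<in> cube (card L)"
  have [simp]: "finite L" using assms finite_subset by blast
  show "fins L m e t \<in> cube m"
    using assms t by (intro cubeI) (auto simp: fins_def cubeD)
next
  fix j show "continuous_on (cube (card L)) (\<lambda>t. fins L m e t j)"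
    by (cases "j \<in> L"; cases "j < m") (simp_all add: fins_def continuous_intros)
qed

lemma fins_ins:
  assumes "i < m" "t \<in> cube (m - 1)"
  shows "fins ({..<m} - {i}) m e t = ins i e t"
proof
  fix j
  have 1: "card {k \<in> {..<m} - {i}. k < j} = j" if "j < i"
  proof -
    have "{k \<in> {..<m} - {i}. k < j} = {..<j}" using that assms by auto
    then show ?thesis by simp
  qed
  have 2: "card {k \<in> {..<m} - {i}. k < j} = j - 1" if "i < j" "j < m"
  proof -
    have "{k \<in> {..<m} - {i}. k < j} = {..<j} - {i}" using that assms by auto
    then show ?thesis using that by simp
  qed
  show "fins ({..<m} - {i}) m e t j = ins i e t j"
    using assms 1 2 cubeD(3)[OF assms(2)] by (auto simp: fins_def ins_def)
qed

lemma subcube_face: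
  assumes "i < fst c"
  shows "subcube ({..<fst c} - {i}) e c = pull (fst c - 1) (ins i e) c"
proof -
  have 1: "card ({..<fst c} - {i}) = fst c - 1" using assms by simp
  show ?thesis unfolding subcube_eq_pull 1
    by (rule pull_cong) (use assms fins_ins in auto)
qed

text \<open>The formula for the differential also holds on degenerate cubes.\<close>

lemma CU_codiff_singular:
  assumes "nd_supp Y f" "c \<in> singular_cubes Y"
  shows "CU_codiff Y f c =
    (\<Sum>i<fst c. (-1) ^ (i + 1) * (f (pull (fst c - 1) (ins i 1) c) - f (pull (fst c - 1) (ins i 0) c)))"
proof (cases "c \<in> nd_cubes Y")
  case True
  then show ?thesis
    by (auto simp: CU_codiff_def subcube_face intro!: sum.cong)
next
  case False
  then have "degenerate_cube c" using assms by (auto simp: nd_cubes_def)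
  then obtain i where i: "i < fst c"
      and d: "\<And>t s. t \<in> cube (fst c) \<Longrightarrow> s \<in> {0..1} \<Longrightarrow> snd c (t(i := s)) = snd c t"
    unfolding degenerate_iff by blast
  define m where "m = fst c - 1"
  have m: "fst c = Suc m" using i m_def by simp
  have "(-1) ^ (j + 1) * (f (pull m (ins j 1) c) - f (pull m (ins j 0) c)) = 0" if j: "j < Suc m" for j
  proof (cases "j = i")
    case True
    have "pull m (ins j 1) c = pull m (ins j 0) c"
    proof -
      have "snd c (ins i 1 t) = snd c (ins i 0 t)" if t: "t \<in> cube m" for t
      proof -
        have "ins i 1 t = (ins i 0 t)(i := 1)" by (auto simp: ins_def)
        then show ?thesis using d[of "ins i 0 t" 1] ins_cube[OF t, of i 0] i m by simp
      qed
      then show ?thesis using True by (auto simp: pull_def restrict_def)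
    qed
    then show ?thesis by simp
  next
    case False
    define i' where "i' = (if i < j then i else i - 1)"
    have i': "i' < m" using i j False m by (auto simp: i'_def)
    have *: "degenerate_cube (pull m (ins j e) c)" if e: "e \<in> {0..1}" for e
    proof (rule degenerate_pull[OF i'])
      fix t s assume t: "t \<in> cube m" "s \<in> {0..1::real}"
      have "ins j e (t(i' := s)) = (ins j e t)(i := s)"
        using False by (auto simp: ins_def i'_def fun_eq_iff)
      then show "snd c (ins j e (t(i' := s))) = snd c (ins j e t)"
        using d[of "ins j e t" s] t ins_cube[OF t(1), of j e] e j m by simp
    qed
    show ?thesis using nd_suppD(1)[OF assms(1) *[of 1]] nd_suppD(1)[OF assms(1) *[of 0]] by simp
  qed
  then have "(\<Sum>j<fst c. (-1) ^ (j + 1) * (f (pull (fst c - 1) (ins j 1) c) - f (pull (fst c - 1) (ins j 0) c))) = 0"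
    using m by (intro sum.neutral) auto
  then show ?thesis using False by (simp add: CU_codiff_def)
qed

lemma CU_codiff_supp [simp]: "nd_supp Y (CU_codiff Y f)"
  by (auto simp: nd_supp_def CU_codiff_def)

lemma nd_supp_eqI:
  assumes "nd_supp Y f" "nd_supp Y g" "\<And>c. c \<in> nd_cubes Y \<Longrightarrow> f c = g c"
  shows "f = g"
proof
  fix c show "f c = g c"
    using assms unfolding nd_supp_def by metis
qed

lemma face_singular:
  assumes "c \<in> singular_cubes Y" "fst c = Suc m" "i \<le> m" "e \<in> {0..1}"
  shows "pull m (ins i e) c \<in> singular_cubes Y"
  using assms by (intro pull_singular) (auto intro: cube_map_ins)

lemma CU_codiff_grade:
  assumes "f \<in> grade (CU Y) k"
  shows "CU_codiff Y f \<in> grade (CU Y) (Suc k)"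
proof -
  have s: "nd_supp Y f" using assms by (simp add: CU_grade)
  have "fst c = Suc k" if "CU_codiff Y f c \<noteq> 0" for c
  proof (rule ccontr)
    assume n: "fst c \<noteq> Suc k"
    have c: "c \<in> singular_cubes Y" using that by (auto simp: CU_codiff_def nd_cubes_def split: if_splits)
    have "f (pull (fst c - 1) (ins i e) c) = 0" if "i < fst c" for i e
    proof (rule ccontr)
      assume "f (pull (fst c - 1) (ins i e) c) \<noteq> 0"
      then have "fst (pull (fst c - 1) (ins i e) c) = k" using assms unfolding CU_grade by blast
      then show False using n that by simp
    qed
    then have "CU_codiff Y f c = 0" unfolding CU_codiff_singular[OF s c] by (intro sum.neutral) auto
    then show False using that by simp
  qed
  then show ?thesis by (simp add: CU_grade)
qed

lemma CU_codiff_add: "CU_codiff Y (f + g) = CU_codiff Y f + CU_codiff Y g"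
  by (auto simp: CU_codiff_def fun_eq_iff simp flip: sum.distrib intro!: sum.cong simp: algebra_simps)

lemma CU_codiff_smult: "CU_codiff Y (\<lambda>T. r * f T) = (\<lambda>T. r * CU_codiff Y f T)"
  by (auto simp: CU_codiff_def fun_eq_iff sum_distrib_left intro!: sum.cong simp: algebra_simps)

lemma CU_codiff_0 [simp]: "CU_codiff Y 0 = 0"
  by (auto simp: CU_codiff_def fun_eq_iff)

lemma CU_codiff_minus: "CU_codiff Y (- f) = - CU_codiff Y f"
  using CU_codiff_smult[of Y "-1" f] by (simp add: fun_Compl_def)

lemma CU_codiff_diff: "CU_codiff Y (f - g) = CU_codiff Y f - CU_codiff Y g"
  using CU_codiff_add[of Y f "- g"] CU_codiff_minus[of Y g] by simp

lemma nd_supp_add: "nd_supp Y f \<Longrightarrow> nd_supp Y g \<Longrightarrow> nd_supp Y (f + g)"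
  unfolding nd_supp_def by (metis add_0 plus_fun_apply)

lemma nd_supp_smult: "nd_supp Y f \<Longrightarrow> nd_supp Y (\<lambda>T. r * f T)"
  by (simp add: nd_supp_def)

lemma nd_supp_minus: "nd_supp Y f \<Longrightarrow> nd_supp Y (- f)"
  by (simp add: nd_supp_def)

lemma nd_supp_diff: "nd_supp Y f \<Longrightarrow> nd_supp Y g \<Longrightarrow> nd_supp Y (f - g)"
  using nd_supp_add[of Y f "- g"] by (simp add: nd_supp_minus)

lemma nd_supp_0 [simp]: "nd_supp Y 0"
  by (simp add: nd_supp_def)

lemma CU_grade_add: "f \<in> grade (CU Y) k \<Longrightarrow> g \<in> grade (CU Y) k \<Longrightarrow> f + g \<in> grade (CU Y) k"
  unfolding CU_grade by (metis add_0 nd_supp_add plus_fun_apply)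

lemma CU_grade_smult: "f \<in> grade (CU Y) k \<Longrightarrow> (\<lambda>T. r * f T) \<in> grade (CU Y) k"
  by (simp add: CU_grade nd_supp_smult)

lemma CU_grade_minus: "f \<in> grade (CU Y) k \<Longrightarrow> - f \<in> grade (CU Y) k"
  by (simp add: CU_grade nd_supp_minus)

lemma CU_grade_diff: "f \<in> grade (CU Y) k \<Longrightarrow> g \<in> grade (CU Y) k \<Longrightarrow> f - g \<in> grade (CU Y) k"
  using CU_grade_add[of f Y k "- g"] by (simp add: CU_grade_minus)

lemma CU_grade_0 [simp]: "0 \<in> grade (CU Y) k"
  by (simp add: CU_grade)

lemma ins_ins:
  "j \<le> i \<Longrightarrow> ins j e (ins i e' t) = ins (Suc i) e' (ins j e t)"
  by (auto simp: ins_def fun_eq_iff)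

lemma CU_codiff_codiff:
  assumes "nd_supp Y f"
  shows "CU_codiff Y (CU_codiff Y f) = 0"
proof (rule nd_supp_eqI[of Y])
  fix c assume "c \<in> nd_cubes Y"
  then have c: "c \<in> singular_cubes Y" by (simp add: nd_cubes_def)
  show "CU_codiff Y (CU_codiff Y f) c = 0 c"
  proof (cases "fst c")
    case 0
    then show ?thesis using c by (simp add: CU_codiff_singular)
  next
    case (Suc m)
    show ?thesis
    proof (cases m)
      case 0
      then show ?thesis using Suc c
        by (simp add: CU_codiff_singular[OF _ c] CU_codiff_singular[OF assms] face_singular)
    next
      case m: (Suc k)
      define F where "F i e j e' = f (pull k (ins j e') (pull m (ins i e) c))" for i e j e'
      define G where "G i j = (-1) ^ (i + j) * (F i 1 j 1 - F i 1 j 0 - F i 0 j 1 + F i 0 j 0)" for i j :: nat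
      have F: "F i e j e' = F (Suc j) e' i e" if "i \<le> j" "j \<le> k" "e \<in> {0..1}" "e' \<in> {0..1}" for i j e e'
      proof -
        have "pull k (ins j e') (pull m (ins i e) c) = pull k (\<lambda>t. ins i e (ins j e' t)) c"
          using that m by (intro pull_pull) (auto intro: ins_cube)
        also have "\<dots> = pull k (\<lambda>t. ins (Suc j) e' (ins i e t)) c"
          using that by (simp add: ins_ins)
        also have "\<dots> = pull k (ins i e) (pull m (ins (Suc j) e') c)"
          using that m by (intro pull_pull[symmetric]) (auto intro: ins_cube)
        finally show ?thesis by (simp add: F_def)
      qed
      have G: "G (Suc j) i = - G i j" if "i \<le> j" "j \<le> k" for i j
        using that by (simp add: G_def F[of i j] algebra_simps)
      have D: "CU_codiff Y f (pull m (ins i e) c) = (\<Sum>j<m. (-1) ^ (j + 1) * (F i e j 1 - F i e j 0))"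
        if "i < Suc m" "e \<in> {0..1}" for i e
        using that Suc m by (simp add: CU_codiff_singular[OF assms] face_singular[OF c] F_def)
      have "CU_codiff Y (CU_codiff Y f) c = (\<Sum>i<Suc m. (-1) ^ (i + 1) *
          (CU_codiff Y f (pull m (ins i 1) c) - CU_codiff Y f (pull m (ins i 0) c)))"
        using Suc by (simp only: CU_codiff_singular[OF CU_codiff_supp c]) simp
      also have "\<dots> = (\<Sum>i<Suc m. \<Sum>j<m. G i j)"
      proof (rule sum.cong)
        fix i assume i: "i \<in> {..<Suc m}"
        have "CU_codiff Y f (pull m (ins i 1) c) - CU_codiff Y f (pull m (ins i 0) c)
            = (\<Sum>j<m. (-1) ^ (j + 1) * (F i 1 j 1 - F i 1 j 0) - (-1) ^ (j + 1) * (F i 0 j 1 - F i 0 j 0))"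
          using D[of i 1] D[of i 0] i by (simp only: sum_subtractf) simp
        then show "(-1) ^ (i + 1) * (CU_codiff Y f (pull m (ins i 1) c) - CU_codiff Y f (pull m (ins i 0) c))
            = (\<Sum>j<m. G i j)"
          by (simp only: sum_distrib_left, intro sum.cong) (simp_all add: G_def power_add algebra_simps)
      qed simp
      also have "\<dots> = (\<Sum>(i, j)\<in>{..<Suc m} \<times> {..<m}. G i j)"
        by (simp add: sum.cartesian_product)
      also have "{..<Suc m} \<times> {..<m} = {(i, j). i \<le> j \<and> j < m} \<union> {(i, j). j < i \<and> i \<le> m}"
        by auto
      also have "(\<Sum>(i, j)\<in>\<dots>. G i j) = (\<Sum>(i, j)\<in>{(i, j). i \<le> j \<and> j < m}. G i j)
          + (\<Sum>(i, j)\<in>{(i, j). j < i \<and> i \<le> m}. G i j)"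
      proof (rule sum.union_disjoint)
        show "finite {(i, j). i \<le> j \<and> j < m}" by (rule finite_subset[of _ "{..m} \<times> {..m}"]) auto
        show "finite {(i, j). j < i \<and> i \<le> m}" by (rule finite_subset[of _ "{..m} \<times> {..m}"]) auto
      qed auto
      also have "(\<Sum>(i, j)\<in>{(i, j). j < i \<and> i \<le> m}. G i j)
          = (\<Sum>(i, j)\<in>{(i, j). i \<le> j \<and> j < m}. G (Suc j) i)"
        by (rule sum.reindex_bij_witness[of _ "\<lambda>(i, j). (Suc j, i)" "\<lambda>(i, j). (j, i - 1)"]) auto
      also have "\<dots> = (\<Sum>(i, j)\<in>{(i, j). i \<le> j \<and> j < m}. - G i j)"
        using m by (intro sum.cong) (auto simp: G)
      also have "\<dots> = - (\<Sum>(i, j)\<in>{(i, j). i \<le> j \<and> j < m}. G i j)"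
        by (simp add: sum_negf[symmetric] case_prod_unfold)
      finally show ?thesis by simp
    qed
  qed
qed auto

section \<open>Cochain operators induced by parametrized families of maps\<close>

abbreviation cfst :: "nat \<Rightarrow> (nat \<Rightarrow> real) \<Rightarrow> nat \<Rightarrow> real" where
  "cfst p t \<equiv> (\<lambda>j. if j < p then t j else 0)"

abbreviation csnd :: "nat \<Rightarrow> (nat \<Rightarrow> real) \<Rightarrow> nat \<Rightarrow> real" where
  "csnd p t \<equiv> (\<lambda>j. t (j + p))"

text \<open>The product of the identity p-cube with \<open>c\<close>, mapped by the family
  \<open>a\<close>; the parameters are the first \<open>p\<close> coordinates. Dually
  \<open>CX\<close> lowers degrees by \<open>p\<close>. For p = 0 it is the cochain map induced by a
  continuous map, for p = 1 a transgression or a homotopy, for larger \<open>p\<close> a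
  slant.\<close>

definition cross :: "nat \<Rightarrow> ((nat \<Rightarrow> real) \<Rightarrow> 'y \<Rightarrow> 'z) \<Rightarrow> 'y scube \<Rightarrow> 'z scube" where
  "cross p a c = (p + fst c, restrict (\<lambda>t. a (cfst p t) (snd c (csnd p t))) (cube (p + fst c)))"

definition CX :: "'y topology \<Rightarrow> nat \<Rightarrow> ((nat \<Rightarrow> real) \<Rightarrow> 'y \<Rightarrow> 'z) \<Rightarrow> ('z scube \<Rightarrow> int) \<Rightarrow> 'y scube \<Rightarrow> int" where
  "CX Y p a f c = (if c \<in> nd_cubes Y then f (cross p a c) else 0)"

definition cross_map :: "'y topology \<Rightarrow> 'z topology \<Rightarrow> nat \<Rightarrow> ((nat \<Rightarrow> real) \<Rightarrow> 'y \<Rightarrow> 'z) \<Rightarrow> bool" where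
  "cross_map Y Z p a \<longleftrightarrow> continuous_map (prod_topology (top_of_set (cube p)) Y) Z (\<lambda>(s, y). a s y)"

lemma cfst_cube: "t \<in> cube (p + m) \<Longrightarrow> cfst p t \<in> cube p"
  by (rule cubeI) (auto simp: cubeD)

lemma csnd_cube: "t \<in> cube (p + m) \<Longrightarrow> csnd p t \<in> cube m"
  by (rule cubeI) (auto simp: cubeD)

lemma fst_cross [simp]: "fst (cross p a c) = p + fst c"
  by (simp add: cross_def)

lemma snd_cross:
  "t \<in> cube (p + fst c) \<Longrightarrow> snd (cross p a c) t = a (cfst p t) (snd c (csnd p t))"
  by (simp add: cross_def)

lemma singular_cubes_topspace:
  "c \<in> singular_cubes Y \<Longrightarrow> t \<in> cube (fst c) \<Longrightarrow> snd c t \<in> topspace Y"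
  by (auto simp: singular_cubes_iff continuous_map_def)

lemma cross_singular:
  assumes "cross_map Y Z p a" "c \<in> singular_cubes Y"
  shows "cross p a c \<in> singular_cubes Z"
proof -
  let ?D = "top_of_set (cube (p + fst c))"
  have 1: "continuous_map ?D (top_of_set (cube p)) (\<lambda>t. cfst p t)"
  proof -
    have "continuous_on (cube (p + fst c)) (cfst p)"
    proof (rule continuous_on_coordinatewise_then_product)
      fix j show "continuous_on (cube (p + fst c)) (\<lambda>t. if j < p then t j else 0)"
        by (cases "j < p") (simp_all add: continuous_intros)
    qed
    then show ?thesis by (auto simp: cfst_cube)
  qed
  have 2: "continuous_map ?D (top_of_set (cube (fst c))) (\<lambda>t. csnd p t)"
  proof -
    have "continuous_on (cube (p + fst c)) (csnd p)"
      by (rule continuous_on_coordinatewise_then_product) (simp add: continuous_intros)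
    then show ?thesis by (auto simp: csnd_cube)
  qed
  have "continuous_map ?D Y (snd c \<circ> csnd p)"
    using assms(2) by (intro continuous_map_compose[OF 2]) (simp add: singular_cubes_iff)
  then have "continuous_map ?D (prod_topology (top_of_set (cube p)) Y) (\<lambda>t. (cfst p t, snd c (csnd p t)))"
    using 1 by (auto simp: continuous_map_pairwise comp_def)
  then have "continuous_map ?D Z ((\<lambda>(s, y). a s y) \<circ> (\<lambda>t. (cfst p t, snd c (csnd p t))))"
    using assms(1) unfolding cross_map_def by (rule continuous_map_compose)
  then have "continuous_map ?D Z (restrict (\<lambda>t. a (cfst p t) (snd c (csnd p t))) (cube (p + fst c)))"
    by (rule continuous_map_eq) auto
  then show ?thesis by (auto simp: singular_cubes_iff cross_def)
qed

lemma csnd_upd: "(\<lambda>j. (t(i + p := s)) (j + p)) = (csnd p t)(i := s)"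
  by (auto simp: fun_eq_iff)

lemma cross_degenerate:
  assumes "degenerate_cube c"
  shows "degenerate_cube (cross p a c)"
proof -
  obtain i where i: "i < fst c"
      and d: "\<And>t s. t \<in> cube (fst c) \<Longrightarrow> s \<in> {0..1} \<Longrightarrow> snd c (t(i := s)) = snd c t"
    using assms unfolding degenerate_iff by blast
  have "snd (cross p a c) (t(i + p := s)) = snd (cross p a c) t"
    if "t \<in> cube (p + fst c)" "s \<in> {0..1}" for t s
  proof -
    have "t(i + p := s) \<in> cube (p + fst c)" using i that by (intro cube_upd) auto
    moreover have "cfst p (t(i + p := s)) = cfst p t" by auto
    ultimately show ?thesis
      using that d[OF csnd_cube[OF that(1)] that(2)] by (simp add: snd_cross csnd_upd del: fun_upd_apply)
  qed
  then show ?thesis unfolding degenerate_iff using i by (intro exI[of _ "i + p"]) auto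
qed

lemma cross_degenerate':
  assumes "c \<in> singular_cubes Y" "i < p"
    "\<And>s y u. s \<in> cube p \<Longrightarrow> y \<in> topspace Y \<Longrightarrow> u \<in> {0..1} \<Longrightarrow> a (s(i := u)) y = a s y"
  shows "degenerate_cube (cross p a c)"
proof -
  have "snd (cross p a c) (t(i := u)) = snd (cross p a c) t"
    if t: "t \<in> cube (p + fst c)" "u \<in> {0..1}" for t u
  proof -
    have 1: "t(i := u) \<in> cube (p + fst c)" using that assms by (intro cube_upd) auto
    have 2: "cfst p (t(i := u)) = (cfst p t)(i := u)" using assms(2) by auto
    have 3: "csnd p (t(i := u)) = csnd p t" using assms(2) by auto
    show ?thesis
      unfolding snd_cross[OF 1] snd_cross[OF t(1)] 2 3
      by (rule assms(3)) (use t in \<open>auto intro: cfst_cube csnd_cube singular_cubes_topspace[OF assms(1)]\<close>)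
  qed
  then show ?thesis unfolding degenerate_iff using assms(2) by (intro exI[of _ i]) auto
qed

lemma cross_cong:
  assumes "c \<in> singular_cubes Y" "\<And>s y. s \<in> cube p \<Longrightarrow> y \<in> topspace Y \<Longrightarrow> a s y = b s y"
  shows "cross p a c = cross p b c"
  unfolding cross_def using assms
  by (auto simp: restrict_def fun_eq_iff cfst_cube csnd_cube singular_cubes_topspace)

lemma cross_cross:
  "cross p a (cross q b c) = cross (p + q) (\<lambda>s y. a (cfst p s) (b (csnd p s) y)) c"
proof -
  have "a (cfst p t) (snd (cross q b c) (csnd p t))
      = a (cfst p (cfst (p + q) t)) (b (csnd p (cfst (p + q) t)) (snd c (csnd (p + q) t)))"
    if t: "t \<in> cube (p + (q + fst c))" for t
  proof -
    have 1: "csnd p t \<in> cube (q + fst c)" using t by (rule csnd_cube)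
    have 2: "cfst p (cfst (p + q) t) = cfst p t" by auto
    have 3: "csnd p (cfst (p + q) t) = cfst q (csnd p t)" by auto
    show ?thesis unfolding 2 3 snd_cross[OF 1] by (simp add: add.assoc add.commute[of q p])
  qed
  then show ?thesis
    by (auto simp: cross_def[of p] cross_def[of "p + q"] add.assoc restrict_def fun_eq_iff)
qed

lemma CX_supp [simp]: "nd_supp Y (CX Y p a f)"
  by (auto simp: nd_supp_def CX_def)

lemma CX_singular: "nd_supp Z f \<Longrightarrow> c \<in> singular_cubes Y \<Longrightarrow> CX Y p a f c = f (cross p a c)"
  by (auto simp: CX_def nd_suppD cross_degenerate nd_cubes_def)

lemma CX_grade: "f \<in> grade (CU Z) (p + k) \<Longrightarrow> CX Y p a f \<in> grade (CU Y) k"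
  by (rule CU_gradeI) (simp_all add: CX_def CU_gradeD)

lemma CX_add: "CX Y p a (f + g) = CX Y p a f + CX Y p a g"
  by (auto simp: CX_def fun_eq_iff)

lemma CX_diff: "CX Y p a (f - g) = CX Y p a f - CX Y p a g"
  by (auto simp: CX_def fun_eq_iff)

lemma CX_smult: "CX Y p a (\<lambda>T. r * f T) = (\<lambda>T. r * CX Y p a f T)"
  by (auto simp: CX_def fun_eq_iff)

lemma CX_0 [simp]: "CX Y p a 0 = 0"
  by (auto simp: CX_def fun_eq_iff)

lemma CX_cong:
  assumes "\<And>s y. s \<in> cube p \<Longrightarrow> y \<in> topspace Y \<Longrightarrow> a s y = b s y"
  shows "CX Y p a f = CX Y p b f"
proof
  fix c show "CX Y p a f c = CX Y p b f c"
    using cross_cong[of c Y p a b] assms by (auto simp: CX_def nd_cubes_def)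
qed

lemma CX_degenerate:
  assumes "nd_supp Z f" "i < p"
    "\<And>s y u. s \<in> cube p \<Longrightarrow> y \<in> topspace Y \<Longrightarrow> u \<in> {0..1} \<Longrightarrow> a (s(i := u)) y = a s y"
  shows "CX Y p a f = 0"
  using cross_degenerate'[of _ Y i p a] assms by (auto simp: CX_def fun_eq_iff nd_cubes_def nd_suppD)

lemma cross_const_degenerate:
  assumes "0 < fst c"
  shows "degenerate_cube (cross p (\<lambda>s y. a s) c)"
proof -
  have "snd (cross p (\<lambda>s y. a s) c) (t(p := u)) = snd (cross p (\<lambda>s y. a s) c) t"
    if t: "t \<in> cube (p + fst c)" "u \<in> {0..1}" for t u
  proof -
    have 1: "t(p := u) \<in> cube (p + fst c)" using that assms by (intro cube_upd) auto
    have 2: "cfst p (t(p := u)) = cfst p t" by auto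
    show ?thesis unfolding snd_cross[OF 1] snd_cross[OF t(1)] 2 ..
  qed
  then show ?thesis unfolding degenerate_iff using assms by (intro exI[of _ p]) auto
qed

text \<open>The product cube forgets the coordinates of \<open>c\<close>, so it is degenerate unless
  \<open>c\<close> is a point, and then its dimension \<open>p\<close> is too small.\<close>

lemma CX_const:
  assumes "f \<in> grade (CU Z) k" "p < k"
  shows "CX Y p (\<lambda>s y. a s) f = 0"
proof
  fix c
  show "CX Y p (\<lambda>s y. a s) f c = 0 c"
  proof (cases "fst c = 0")
    case True
    then show ?thesis using assms by (simp add: CX_def CU_gradeD)
  next
    case False
    then show ?thesis using cross_const_degenerate[of c p a] assms
      by (simp add: CX_def nd_suppD(1)[OF CU_grade_supp[OF assms(1)]])
  qed
qed

lemma CX_CX: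
  assumes "nd_supp V f" "cross_map Y Z q b"
  shows "CX Y q b (CX Z p a f) = CX Y (p + q) (\<lambda>s y. a (cfst p s) (b (csnd p s) y)) f"
proof
  fix c
  show "CX Y q b (CX Z p a f) c = CX Y (p + q) (\<lambda>s y. a (cfst p s) (b (csnd p s) y)) f c"
    using cross_singular[OF assms(2), of c] CX_singular[OF assms(1), of "cross q b c" Z p a]
    by (auto simp: CX_def[of Y] nd_cubes_def cross_cross)
qed

lemma cross_face_fst:
  assumes "i \<le> q" "e \<in> {0..1}"
  shows "pull (q + fst c) (ins i e) (cross (Suc q) a c) = cross q (\<lambda>s. a (ins i e s)) c"
proof -
  have "snd (cross (Suc q) a c) (ins i e t) = a (ins i e (cfst q t)) (snd c (csnd q t))"
    if t: "t \<in> cube (q + fst c)" for t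
  proof -
    have 1: "ins i e t \<in> cube (Suc q + fst c)" using ins_cube[OF t] assms by simp
    have 2: "cfst (Suc q) (ins i e t) = ins i e (cfst q t)" using assms by (auto simp: ins_def fun_eq_iff)
    have 3: "csnd (Suc q) (ins i e t) = csnd q t" using assms by (auto simp: ins_def fun_eq_iff)
    show ?thesis unfolding snd_cross[OF 1] 2 3 ..
  qed
  then show ?thesis by (auto simp: cross_def[of q] pull_def restrict_def fun_eq_iff)
qed

lemma cross_face_snd:
  assumes "fst c = Suc m" "i \<le> m" "e \<in> {0..1}"
  shows "pull (p + m) (ins (p + i) e) (cross p a c) = cross p a (pull m (ins i e) c)"
proof -
  have "snd (cross p a c) (ins (p + i) e t) = a (cfst p t) (snd (pull m (ins i e) c) (csnd p t))"
    if t: "t \<in> cube (p + m)" for t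
  proof -
    have 1: "ins (p + i) e t \<in> cube (p + fst c)" using ins_cube[OF t, of "p + i" e] assms by simp
    have 2: "cfst p (ins (p + i) e t) = cfst p t" by (auto simp: ins_def fun_eq_iff)
    have 3: "csnd p (ins (p + i) e t) = ins i e (csnd p t)" by (auto simp: ins_def fun_eq_iff)
    show ?thesis unfolding snd_cross[OF 1] 2 3 snd_pull[OF csnd_cube[OF t]] ..
  qed
  then show ?thesis by (auto simp: cross_def[of p a "pull m (ins i e) c"] pull_def[of "p + m"] restrict_def fun_eq_iff)
qed

text \<open>The faces of the product cube are those of the parameter cube and those of
  \<open>c\<close>, the latter with the sign of moving past \<open>p\<close> coordinates. Every
  homotopy formula below comes from here: for a cocycle \<open>f\<close> the left side
  vanishes.\<close>

lemma CX_codiff: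
  assumes f: "nd_supp Z f" and a: "cross_map Y Z p a"
  shows "CX Y p a (CU_codiff Z f) = (\<lambda>c. (-1) ^ p * CU_codiff Y (CX Y p a f) c
    + (\<Sum>i<p. (-1) ^ (i + 1) * (CX Y (p - 1) (\<lambda>s. a (ins i 1 s)) f c - CX Y (p - 1) (\<lambda>s. a (ins i 0 s)) f c)))"
    (is "_ = ?R")
proof (rule nd_supp_eqI[of Y])
  have "nd_supp Y (\<lambda>c. \<Sum>i<p. (-1) ^ (i + 1) * (CX Y (p - 1) (\<lambda>s. a (ins i 1 s)) f c - CX Y (p - 1) (\<lambda>s. a (ins i 0 s)) f c))"
    by (rule nd_suppI) (simp add: CX_def)
  then show "nd_supp Y ?R"
    using nd_supp_add[OF nd_supp_smult[OF CU_codiff_supp]] by (simp add: plus_fun_def)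
next
  fix c assume "c \<in> nd_cubes Y"
  then have c: "c \<in> singular_cubes Y" by (simp add: nd_cubes_def)
  define m where "m = fst c"
  define s where "s i = (-1) ^ (i + 1) * (f (pull (p + m - 1) (ins i 1) (cross p a c)) - f (pull (p + m - 1) (ins i 0) (cross p a c)))" for i :: nat
  have "CX Y p a (CU_codiff Z f) c = (\<Sum>i<p + m. s i)"
    using cross_singular[OF a c] c
    by (simp add: CX_singular[OF CU_codiff_supp] CU_codiff_singular[OF f] s_def m_def)
  also have "\<dots> = (\<Sum>i<p. s i) + (\<Sum>i<m. s (p + i))"
    by (induction m) simp_all
  also have "(\<Sum>i<m. s (p + i)) = (-1) ^ p * CU_codiff Y (CX Y p a f) c"
  proof (cases m)
    case 0
    then show ?thesis by (simp add: CU_codiff_singular[OF _ c] m_def)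
  next
    case (Suc k)
    have "s (p + i) = (-1) ^ p * ((-1) ^ (i + 1) * (CX Y p a f (pull k (ins i 1) c) - CX Y p a f (pull k (ins i 0) c)))"
      if "i < m" for i
      using that Suc c m_def face_singular[OF c, of k i]
      by (simp add: s_def cross_face_snd CX_singular[OF f] power_add)
    then show ?thesis using Suc m_def
      by (simp add: CU_codiff_singular[OF _ c] sum_distrib_left del: sum.lessThan_Suc)
  qed
  also have "(\<Sum>i<p. s i) = (\<Sum>i<p. (-1) ^ (i + 1) * (CX Y (p - 1) (\<lambda>s. a (ins i 1 s)) f c - CX Y (p - 1) (\<lambda>s. a (ins i 0 s)) f c))"
  proof (rule sum.cong)
    fix i assume i: "i \<in> {..<p}"
    then obtain q where q: "p = Suc q" by (cases p) auto
    show "s i = (-1) ^ (i + 1) * (CX Y (p - 1) (\<lambda>s. a (ins i 1 s)) f c - CX Y (p - 1) (\<lambda>s. a (ins i 0 s)) f c)"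
      using i by (simp add: s_def q m_def cross_face_fst CX_singular[OF f c])
  qed simp
  finally show "CX Y p a (CU_codiff Z f) c = ?R c" by simp
qed simp

lemma CU_map_eq_CX: "CU_map Y g f = CX Y 0 (\<lambda>s. g) f"
  by (auto simp: CU_map_def CX_def cross_def fun_eq_iff comp_def split: prod.splits)

lemma cross_map_0: "cross_map Y Z 0 (\<lambda>s. g) \<longleftrightarrow> continuous_map Y Z g"
proof
  assume "cross_map Y Z 0 (\<lambda>s. g)"
  then have 1: "continuous_map (prod_topology (top_of_set (cube 0)) Y) Z (\<lambda>(s, y). g y)"
    by (simp add: cross_map_def)
  have "continuous_map Y (prod_topology (top_of_set (cube 0)) Y) (\<lambda>y. (\<lambda>_. 0, y))"
    by (auto simp: continuous_map_pairwise comp_def)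
  from continuous_map_compose[OF this 1] show "continuous_map Y Z g" by (simp add: comp_def)
next
  assume "continuous_map Y Z g"
  from continuous_map_compose[OF continuous_map_snd this, of "top_of_set (cube 0)"]
  show "cross_map Y Z 0 (\<lambda>s. g)" by (simp add: cross_map_def comp_def case_prod_beta')
qed

lemma CU_map_codiff:
  assumes "nd_supp Z f" "continuous_map Y Z g"
  shows "CU_map Y g (CU_codiff Z f) = CU_codiff Y (CU_map Y g f)"
  using CX_codiff[OF assms(1), of Y 0 "\<lambda>s. g"] assms(2) by (simp add: CU_map_eq_CX cross_map_0)

section \<open>The cup product\<close>

text \<open>The exponent of the shuffle sign, for two arbitrary sets of coordinates, so that
  coordinates may be inserted, deleted and shifted.\<close>

definition inversions :: "nat set \<Rightarrow> nat set \<Rightarrow> nat" where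
  "inversions A B = card {(x, y). x \<in> A \<and> y \<in> B \<and> y < x}"

lemma shuffle_sign_eq: "L \<subseteq> {..<m} \<Longrightarrow> shuffle_sign m L = (-1) ^ inversions L ({..<m} - L)"
  unfolding shuffle_sign_def inversions_def
  by (rule arg_cong[of _ _ "\<lambda>S. (-1) ^ card S"]) auto

lemma finite_inversions: "finite A \<Longrightarrow> finite B \<Longrightarrow> finite {(x, y). x \<in> A \<and> y \<in> B \<and> y < (x::nat)}"
  by (rule finite_subset[of _ "A \<times> B"]) auto

lemma inversions_empty [simp]: "inversions A {} = 0" "inversions {} B = 0"
  by (simp_all add: inversions_def)

lemma inversions_insert_left:
  assumes "finite A" "finite B" "i \<notin> A"
  shows "inversions (insert i A) B = inversions A B + card {b \<in> B. b < i}"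
proof -
  have "{(x, y). x \<in> insert i A \<and> y \<in> B \<and> y < x} = {(x, y). x \<in> A \<and> y \<in> B \<and> y < x} \<union> Pair i ` {b \<in> B. b < i}"
    by auto
  moreover have "card ({(x, y). x \<in> A \<and> y \<in> B \<and> y < x} \<union> Pair i ` {b \<in> B. b < i})
     = card {(x, y). x \<in> A \<and> y \<in> B \<and> y < x} + card (Pair i ` {b \<in> B. b < i})"
    using assms by (intro card_Un_disjoint finite_inversions) auto
  ultimately show ?thesis unfolding inversions_def by (simp add: card_image inj_on_def)
qed

lemma inversions_insert_right:
  assumes "finite A" "finite B" "i \<notin> B"
  shows "inversions A (insert i B) = inversions A B + card {a \<in> A. i < a}"
proof -
  have "{(x, y). x \<in> A \<and> y \<in> insert i B \<and> y < x} = {(x, y). x \<in> A \<and> y \<in> B \<and> y < x} \<union> (\<lambda>a. (a, i)) ` {a \<in> A. i < a}"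
    by auto
  moreover have "card ({(x, y). x \<in> A \<and> y \<in> B \<and> y < x} \<union> (\<lambda>a. (a, i)) ` {a \<in> A. i < a})
     = card {(x, y). x \<in> A \<and> y \<in> B \<and> y < x} + card ((\<lambda>a. (a, i)) ` {a \<in> A. i < a})"
    using assms by (intro card_Un_disjoint finite_inversions) auto
  ultimately show ?thesis unfolding inversions_def by (simp add: card_image inj_on_def)
qed

lemma card_above_below:
  assumes "finite L" "(i::nat) \<notin> L"
  shows "card {a \<in> L. i < a} + card {a \<in> L. a < i} = card L"
proof -
  have "L = {a \<in> L. i < a} \<union> {a \<in> L. a < i}" using assms by (auto, metis linorder_neqE_nat)
  moreover have "card ({a \<in> L. i < a} \<union> {a \<in> L. a < i}) = card {a \<in> L. i < a} + card {a \<in> L. a < i}"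
  proof (rule card_Un_disjoint)
    show "{a \<in> L. i < a} \<inter> {a \<in> L. a < i} = {}" unfolding disjoint_iff by simp
  qed (simp_all add: assms(1))
  ultimately show ?thesis by simp
qed

lemma rank_less:
  assumes "finite L" "i \<in> L" "(i::nat) < j"
  shows "card {k \<in> L. k < i} < card {k \<in> L. k < j}"
  using assms by (intro psubset_card_mono) auto

lemma rank_inj:
  assumes "finite L" "i \<in> L" "j \<in> L" "card {k \<in> L. k < i} = card {k \<in> L. k < (j::nat)}"
  shows "i = j"
  using rank_less[OF assms(1,2), of j] rank_less[OF assms(1,3), of i] assms(4)
  by (metis linorder_neqE_nat nat_neq_iff)

lemma rank_bij:
  assumes "finite L"
  shows "bij_betw (\<lambda>i. card {k \<in> L. k < i}) L {..<card (L::nat set)}"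
proof -
  have inj: "inj_on (\<lambda>i. card {k \<in> L. k < i}) L" using rank_inj[OF assms] by (auto simp: inj_on_def)
  have "(\<lambda>i. card {k \<in> L. k < i}) ` L \<subseteq> {..<card L}" using card_less_rank[OF assms] by auto
  then have "(\<lambda>i. card {k \<in> L. k < i}) ` L = {..<card L}"
    using inj by (intro card_subset_eq) (auto simp: card_image)
  then show ?thesis using inj by (simp add: bij_betw_def)
qed

section \<open>Front and back faces, and the product of cochains\<close>

lemma subcube_singular:
  assumes "c \<in> singular_cubes Y" "L \<subseteq> {..<fst c}" "e \<in> {0..1}"
  shows "subcube L e c \<in> singular_cubes Y"
  unfolding subcube_eq_pull using assms by (intro pull_singular cube_map_fins) auto

lemma fst_subcube [simp]: "fst (subcube L e c) = card L"
  by (simp add: subcube_eq_pull)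

lemma subcube_degenerate:
  assumes L: "L \<subseteq> {..<fst c}" "i \<in> L" "e \<in> {0..1}"
    and d: "\<And>t s. t \<in> cube (fst c) \<Longrightarrow> s \<in> {0..1} \<Longrightarrow> snd c (t(i := s)) = snd c t"
  shows "degenerate_cube (subcube L e c)"
proof -
  have fin: "finite L" using L finite_subset by blast
  let ?r = "card {k \<in> L. k < i}"
  have r: "?r < card L" using card_less_rank[OF fin L(2)] .
  show ?thesis unfolding subcube_eq_pull
  proof (rule degenerate_pull[OF r])
    fix t s assume t: "t \<in> cube (card L)" "s \<in> {0..1::real}"
    have "fins L (fst c) e (t(?r := s)) = (fins L (fst c) e t)(i := s)"
      using rank_inj[OF fin _ L(2)] L(2) by (auto simp: fins_def fun_eq_iff)
    then show "snd c (fins L (fst c) e (t(?r := s))) = snd c (fins L (fst c) e t)"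
      using d[OF cube_mapD[OF cube_map_fins[OF L(1,3)] t(1)] t(2)] by simp
  qed
qed

lemma CU_mult_singular:
  assumes f: "nd_supp Y f" and g: "nd_supp Y g" and c: "c \<in> singular_cubes Y"
  shows "CU_mult Y f g c = (\<Sum>L\<in>Pow {..<fst c}.
     (-1) ^ inversions L ({..<fst c} - L) * f (subcube L 0 c) * g (subcube ({..<fst c} - L) 1 c))"
proof (cases "c \<in> nd_cubes Y")
  case True
  then show ?thesis by (auto simp: CU_mult_def shuffle_sign_eq intro!: sum.cong)
next
  case False
  then have "degenerate_cube c" using c by (auto simp: nd_cubes_def)
  then obtain i where i: "i < fst c"
      and d: "\<And>t s. t \<in> cube (fst c) \<Longrightarrow> s \<in> {0..1} \<Longrightarrow> snd c (t(i := s)) = snd c t"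
    unfolding degenerate_iff by blast
  have "f (subcube L 0 c) * g (subcube ({..<fst c} - L) 1 c) = 0" if "L \<subseteq> {..<fst c}" for L
  proof (cases "i \<in> L")
    case True
    then show ?thesis using subcube_degenerate[of L c i 0] that d nd_suppD[OF f] by simp
  next
    case False
    then show ?thesis using subcube_degenerate[of "{..<fst c} - L" c i 1] i d nd_suppD[OF g] by auto
  qed
  then have "(\<Sum>L\<in>Pow {..<fst c}. (-1) ^ inversions L ({..<fst c} - L) *
      (f (subcube L 0 c) * g (subcube ({..<fst c} - L) 1 c))) = 0"
    by (intro sum.neutral) simp
  then show ?thesis using False by (simp add: CU_mult_def mult.assoc)
qed

lemma CU_mult_supp [simp]: "nd_supp Y (CU_mult Y f g)"
  by (rule nd_suppI) (simp add: CU_mult_def)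

lemma CU_mult_grade:
  assumes "f \<in> grade (CU Y) p" "g \<in> grade (CU Y) q"
  shows "CU_mult Y f g \<in> grade (CU Y) (p + q)"
proof (rule CU_gradeI)
  fix c assume c: "c \<in> nd_cubes Y" "fst c \<noteq> p + q"
  have "f (subcube L 0 c) * g (subcube ({..<fst c} - L) 1 c) = 0" if L: "L \<subseteq> {..<fst c}" for L
  proof -
    have "card L + card ({..<fst c} - L) = fst c"
      using L by (metis card_Un_disjnt card_lessThan finite_Diff finite_lessThan finite_subset Diff_partition disjnt_def Diff_disjoint)
    then have "card L \<noteq> p \<or> card ({..<fst c} - L) \<noteq> q" using c by auto
    then show ?thesis using CU_gradeD[OF assms(1), of "subcube L 0 c"] CU_gradeD[OF assms(2), of "subcube ({..<fst c} - L) 1 c"] by auto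
  qed
  then show "CU_mult Y f g c = 0" by (auto simp: CU_mult_def mult.assoc intro!: sum.neutral)
qed simp

lemma CU_mult_add_left: "CU_mult Y (f + f') g = CU_mult Y f g + CU_mult Y f' g"
  by (auto simp: CU_mult_def fun_eq_iff distrib_left distrib_right sum.distrib)

lemma CU_mult_add_right: "CU_mult Y f (g + g') = CU_mult Y f g + CU_mult Y f g'"
  by (auto simp: CU_mult_def fun_eq_iff distrib_left sum.distrib)

lemma CU_mult_diff_left: "CU_mult Y (f - f') g = CU_mult Y f g - CU_mult Y f' g"
  by (auto simp: CU_mult_def fun_eq_iff algebra_simps sum_subtractf)

lemma CU_mult_diff_right: "CU_mult Y f (g - g') = CU_mult Y f g - CU_mult Y f g'"
  by (auto simp: CU_mult_def fun_eq_iff algebra_simps sum_subtractf)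

lemma CU_mult_smult_left: "CU_mult Y (\<lambda>T. r * f T) g = (\<lambda>T. r * CU_mult Y f g T)"
  by (auto simp: CU_mult_def fun_eq_iff sum_distrib_left mult_ac intro!: sum.cong)

lemma CU_mult_smult_right: "CU_mult Y f (\<lambda>T. r * g T) = (\<lambda>T. r * CU_mult Y f g T)"
  by (auto simp: CU_mult_def fun_eq_iff sum_distrib_left mult_ac intro!: sum.cong)

lemma CU_mult_0 [simp]: "CU_mult Y 0 g = 0" "CU_mult Y f 0 = 0"
  by (auto simp: CU_mult_def fun_eq_iff)

text \<open>A face with one distinguished coordinate \<open>i\<close> frozen at \<open>e\<close> and
  the others at \<open>e'\<close>. A face of a subcube and a subcube of a face both have this shape,
  which makes the terms of the Leibniz rule comparable.\<close>

definition fins2 :: "nat set \<Rightarrow> nat \<Rightarrow> real \<Rightarrow> nat \<Rightarrow> real \<Rightarrow> (nat \<Rightarrow> real) \<Rightarrow> nat \<Rightarrow> real" where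
  "fins2 A i e m e' t = (\<lambda>j. if j \<in> A then t (card {k \<in> A. k < j}) else if j = i then e else if j < m then e' else 0)"

definition subcube2 :: "nat set \<Rightarrow> nat \<Rightarrow> real \<Rightarrow> real \<Rightarrow> 'y scube \<Rightarrow> 'y scube" where
  "subcube2 A i e e' c = pull (card A) (fins2 A i e (fst c) e') c"

lemma subcube2_same: "i < fst c \<Longrightarrow> subcube2 A i e e c = subcube A e c"
  unfolding subcube2_def subcube_eq_pull by (rule pull_cong) (auto simp: fins2_def fins_def)

lemma fins_insert_ins:
  assumes "finite A" "i \<notin> A"
  shows "fins (insert i A) m e' (ins (card {k \<in> A. k < i}) e t) = fins2 A i e m e' t"
proof
  fix j
  have 1: "card {k \<in> insert i A. k < i} = card {k \<in> A. k < i}"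
    by (rule arg_cong[of _ _ card]) auto
  have 2: "card {k \<in> insert i A. k < j} = card {k \<in> A. k < j}" if "j < i"
    by (rule arg_cong[of _ _ card]) (use that in auto)
  have 3: "card {k \<in> insert i A. k < j} = Suc (card {k \<in> A. k < j})" if "i < j"
  proof -
    have "{k \<in> insert i A. k < j} = insert i {k \<in> A. k < j}" using that by auto
    then show ?thesis using assms by simp
  qed
  have 4: "card {k \<in> A. k < i} \<le> card {k \<in> A. k < j}" if "i < j"
    using that assms by (intro card_mono) auto
  show "fins (insert i A) m e' (ins (card {k \<in> A. k < i}) e t) j = fins2 A i e m e' t j"
    using 1 2 3 4 rank_less[OF assms(1), of j i] assms
    by (cases i j rule: linorder_cases) (auto simp: fins_def fins2_def ins_def)
qed

lemma codiff_subcube: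
  assumes f: "nd_supp Y f" and c: "c \<in> singular_cubes Y" and L: "L \<subseteq> {..<fst c}" and e: "e \<in> {0..1}"
  shows "CU_codiff Y f (subcube L e c) = (\<Sum>i\<in>L. (-1) ^ (card {k \<in> L - {i}. k < i} + 1) *
     (f (subcube2 (L - {i}) i 1 e c) - f (subcube2 (L - {i}) i 0 e c)))"
proof -
  have fin: "finite L" using L finite_subset by blast
  define h where "h k = (-1) ^ (k + 1) * (f (pull (card L - 1) (ins k 1) (subcube L e c)) - f (pull (card L - 1) (ins k 0) (subcube L e c)))" for k :: nat
  have "CU_codiff Y f (subcube L e c) = (\<Sum>k<card L. h k)"
    using subcube_singular[OF c L e] by (simp add: CU_codiff_singular[OF f] h_def)
  also have "\<dots> = (\<Sum>i\<in>L. h (card {k \<in> L. k < i}))"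
    using sum.reindex_bij_betw[OF rank_bij[OF fin], of h] by simp
  also have "\<dots> = (\<Sum>i\<in>L. (-1) ^ (card {k \<in> L - {i}. k < i} + 1) *
     (f (subcube2 (L - {i}) i 1 e c) - f (subcube2 (L - {i}) i 0 e c)))"
  proof (rule sum.cong)
    fix i assume i: "i \<in> L"
    define A where "A = L - {i}"
    have A: "L = insert i A" "i \<notin> A" "finite A" using i fin by (auto simp: A_def)
    have r: "card {k \<in> L. k < i} = card {k \<in> A. k < i}"
      by (rule arg_cong[of _ _ card]) (auto simp: A_def)
    have "pull (card L - 1) (ins (card {k \<in> A. k < i}) e1) (subcube L e c) = subcube2 A i e1 e c" if "e1 \<in> {0..1}" for e1
    proof -
      have "pull (card L - 1) (ins (card {k \<in> A. k < i}) e1) (pull (card L) (fins L (fst c) e) c)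
          = pull (card L - 1) (\<lambda>t. fins L (fst c) e (ins (card {k \<in> A. k < i}) e1 t)) c"
        using A that by (intro pull_pull) (auto intro!: ins_cube card_mono)
      then show ?thesis
        using A by (simp add: subcube_eq_pull subcube2_def fins_insert_ins)
    qed
    then show "h (card {k \<in> L. k < i}) = (-1) ^ (card {k \<in> L - {i}. k < i} + 1) *
       (f (subcube2 (L - {i}) i 1 e c) - f (subcube2 (L - {i}) i 0 e c))"
      by (simp add: h_def r A_def)
  qed simp
  finally show ?thesis .
qed

lemma sum_Pow_remove:
  assumes "finite S"
  shows "(\<Sum>L\<in>Pow S. \<Sum>i\<in>L. h (L - {i}) i) = (\<Sum>i\<in>S. \<Sum>A\<in>Pow (S - {i}). h A i)"
proof -
  have "(\<Sum>L\<in>Pow S. \<Sum>i\<in>L. h (L - {i}) i) = (\<Sum>(L, i)\<in>Sigma (Pow S) (\<lambda>L. L). h (L - {i}) i)"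
    using assms by (intro sum.Sigma) (auto intro: finite_subset)
  also have "\<dots> = (\<Sum>(i, A)\<in>Sigma S (\<lambda>i. Pow (S - {i})). h A i)"
    by (rule sum.reindex_bij_witness[of _ "\<lambda>(i, A). (insert i A, i)" "\<lambda>(L, i). (i, L - {i})"]) auto
  also have "\<dots> = (\<Sum>i\<in>S. \<Sum>A\<in>Pow (S - {i}). h A i)"
    using assms by (intro sum.Sigma[symmetric]) auto
  finally show ?thesis .
qed

lemma sum_Pow_compl: "(\<Sum>L\<in>Pow S. h (S - L)) = (\<Sum>L\<in>Pow S. h L)"
  by (rule sum.reindex_bij_witness[of _ "\<lambda>L. S - L" "\<lambda>L. S - L"]) auto

text \<open>The coface map on indices: it enumerates the indices other than \<open>i\<close> in
  order.\<close>

definition skip :: "nat \<Rightarrow> nat \<Rightarrow> nat" where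
  "skip i j = (if j < i then j else Suc j)"

lemma skip_less_iff [simp]: "skip i x < skip i y \<longleftrightarrow> x < y"
  by (auto simp: skip_def)

lemma inj_skip: "inj (skip i)"
  by (auto simp: skip_def inj_def split: if_splits)

lemma skip_image:
  assumes "i \<le> m"
  shows "skip i ` {..<m} = {..<Suc m} - {i}"
proof (intro equalityI subsetI)
  fix x assume "x \<in> {..<Suc m} - {i}"
  then show "x \<in> skip i ` {..<m}"
    by (intro image_eqI[of _ _ "if x < i then x else x - 1"]) (use assms in \<open>auto simp: skip_def\<close>)
qed (use assms in \<open>auto simp: skip_def\<close>)

lemma inversions_skip: "inversions (skip i ` A) (skip i ` B) = inversions A B"
proof -
  have "{(x, y). x \<in> skip i ` A \<and> y \<in> skip i ` B \<and> y < x} = map_prod (skip i) (skip i) ` {(x, y). x \<in> A \<and> y \<in> B \<and> y < x}"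
  proof (intro equalityI subsetI)
    fix z assume "z \<in> {(x, y). x \<in> skip i ` A \<and> y \<in> skip i ` B \<and> y < x}"
    then obtain a b where "z = (skip i a, skip i b)" "a \<in> A" "b \<in> B" "b < a" by auto
    then show "z \<in> map_prod (skip i) (skip i) ` {(x, y). x \<in> A \<and> y \<in> B \<and> y < x}"
      by (intro image_eqI[of _ _ "(a, b)"]) auto
  qed auto
  then have eq: "{(x, y). x \<in> skip i ` A \<and> y \<in> skip i ` B \<and> y < x} = map_prod (skip i) (skip i) ` {(x, y). x \<in> A \<and> y \<in> B \<and> y < x}" .
  show ?thesis unfolding inversions_def eq
    by (intro card_image inj_on_subset[OF prod.inj_map[OF inj_skip inj_skip]]) simp
qed

lemma subcube_of_face:
  assumes "fst c = Suc m" "i \<le> m" "L \<subseteq> {..<m}" "e' \<in> {0..1}"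
  shows "subcube L e' (pull m (ins i e) c) = subcube2 (skip i ` L) i e e' c"
proof -
  have fin: "finite L" using assms finite_subset by blast
  have inj: "inj_on (skip i) S" for S using inj_skip by (auto intro: inj_on_subset)
  have "ins i e (fins L m e' t) = fins2 (skip i ` L) i e (Suc m) e' t" for t
  proof
    fix j
    have 0: "i \<notin> skip i ` L" by (auto simp: skip_def)
    have r: "card {k \<in> skip i ` L. k < skip i l} = card {k \<in> L. k < l}" for l
    proof -
      have "{k \<in> skip i ` L. k < skip i l} = skip i ` {k \<in> L. k < l}" by auto
      then show ?thesis by (simp add: card_image inj)
    qed
    have mem: "skip i l \<in> skip i ` L \<longleftrightarrow> l \<in> L" for l using inj_skip[of i] by (simp add: inj_image_mem_iff)
    show "ins i e (fins L m e' t) j = fins2 (skip i ` L) i e (Suc m) e' t j"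
    proof (cases "j = i")
      case True
      then show ?thesis using 0 by (simp add: ins_def fins2_def)
    next
      case False
      define l where "l = (if j < i then j else j - 1)"
      have j: "j = skip i l" using False by (auto simp: l_def skip_def)
      have "ins i e (fins L m e' t) j = fins L m e' t l" using False by (auto simp: ins_def l_def)
      also have "\<dots> = fins2 (skip i ` L) i e (Suc m) e' t j"
        using False assms(2) by (simp add: fins_def fins2_def j r mem) (auto simp: skip_def)
      finally show ?thesis .
    qed
  qed
  moreover have "subcube L e' (pull m (ins i e) c) = pull (card L) (\<lambda>t. ins i e (fins L m e' t)) c"
    unfolding subcube_eq_pull fst_pull using cube_mapD[OF cube_map_fins[OF assms(3,4)]]
    by (intro pull_pull) auto
  ultimately show ?thesis using assms(1) by (simp add: subcube2_def card_image inj)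
qed

lemma zero_in_unit: "(0::real) \<in> {0..1}" and one_in_unit: "(1::real) \<in> {0..1}"
  by auto

text \<open>All three terms are sums over a direction \<open>i\<close> and a set \<open>A\<close> of
  other directions, the remaining directions going to the second factor. Term by term the rule is F1
  G1 - F0 G0 = (F1 - F0) G1 + F0 (G1 - G0), the subscript being the height of the coordinate
  \<open>i\<close>.\<close>

lemma CU_mult_codiff:
  assumes f: "f \<in> grade (CU Y) p" and g: "nd_supp Y g"
  shows "CU_codiff Y (CU_mult Y f g)
    = CU_mult Y (CU_codiff Y f) g + (\<lambda>T. (-1) ^ p * CU_mult Y f (CU_codiff Y g) T)" (is "_ = ?R")
proof (rule nd_supp_eqI[of Y])
  show "nd_supp Y ?R" by (intro nd_supp_add nd_supp_smult) simp_all
next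
  fix c assume "c \<in> nd_cubes Y"
  then have c: "c \<in> singular_cubes Y" by (simp add: nd_cubes_def)
  have fs: "nd_supp Y f" using f by (rule CU_grade_supp)
  define M where "M = fst c"
  define S where "S = {..<M}"
  define F where "F A i e = f (subcube2 A i e 0 c)" for A i e
  define G where "G A i e = g (subcube2 A i e 1 c)" for A i e
  define sg where "sg A i = ((-1)::int) ^ (inversions A (S - {i} - A) + i + 1)" for A i
  \<comment> \<open>At height 0 the coordinate \<open>i\<close> is frozen as in any front face, at
    height 1 as in any back face; so these values are ordinary factors of a product.\<close>
  have F0: "F A i 0 = f (subcube A 0 c)" if "i \<in> S" for A i
    using that by (simp add: F_def subcube2_same S_def M_def)
  have G1: "G A i 1 = g (subcube A 1 c)" if "i \<in> S" for A i
    using that by (simp add: G_def subcube2_same S_def M_def)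
  have split_i: "card {a \<in> A. a < i} + card {b \<in> S - {i} - A. b < i} = i" if "i \<in> S" "A \<subseteq> S - {i}" for A i
  proof -
    have "card {a \<in> A. a < i} + card {b \<in> S - {i} - A. b < i} = card ({a \<in> A. a < i} \<union> {b \<in> S - {i} - A. b < i})"
      using that finite_subset[of A S] by (intro card_Un_disjoint[symmetric]) (auto simp: S_def)
    also have "{a \<in> A. a < i} \<union> {b \<in> S - {i} - A. b < i} = {..<i}" using that by (auto simp: S_def)
    finally show ?thesis by simp
  qed
  have parity: "((-1)::int) ^ a = (-1) ^ b" if "even (a + b)" for a b :: nat
    using that by (simp add: minus_one_power_iff)

  have 1: "CU_codiff Y (CU_mult Y f g) c = (\<Sum>i\<in>S. \<Sum>A\<in>Pow (S - {i}).
      sg A i * (F A i 1 * G (S - {i} - A) i 1 - F A i 0 * G (S - {i} - A) i 0))"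
  proof (cases M)
    case 0
    then show ?thesis by (simp add: S_def CU_codiff_singular[OF _ c] M_def)
  next
    case (Suc m)
    have eq: "(-1) ^ (i + 1) * (CU_mult Y f g (pull m (ins i 1) c) - CU_mult Y f g (pull m (ins i 0) c))
       = (\<Sum>A\<in>Pow (S - {i}). sg A i * (F A i 1 * G (S - {i} - A) i 1 - F A i 0 * G (S - {i} - A) i 0))"
      if i: "i < Suc m" for i
    proof -
      have S: "skip i ` {..<m} = S - {i}" using skip_image[of i m] i Suc by (simp add: S_def)
      have compl: "skip i ` ({..<m} - L) = S - {i} - skip i ` L" for L
        using inj_skip[of i] by (metis S image_set_diff)
      have e: "CU_mult Y f g (pull m (ins i e) c) = (\<Sum>A\<in>Pow (S - {i}).
          (-1) ^ inversions A (S - {i} - A) * F A i e * G (S - {i} - A) i e)" if "e \<in> {0..1}" for e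
      proof -
        have pc: "pull m (ins i e) c \<in> singular_cubes Y"
          using i Suc M_def by (intro face_singular[OF c] that) auto
        have "CU_mult Y f g (pull m (ins i e) c) = (\<Sum>L\<in>Pow {..<m}.
           (-1) ^ inversions (skip i ` L) (S - {i} - skip i ` L) * F (skip i ` L) i e * G (S - {i} - skip i ` L) i e)"
          unfolding CU_mult_singular[OF fs g pc] fst_pull
          using i Suc M_def
          by (intro sum.cong) (auto simp: subcube_of_face F_def G_def inversions_skip simp flip: compl)
        also have "\<dots> = (\<Sum>A\<in>Pow (S - {i}).
           (-1) ^ inversions A (S - {i} - A) * F A i e * G (S - {i} - A) i e)"
          using inj_skip[of i] S
          by (intro sum.reindex_bij_betw[where g = "\<lambda>A. (-1) ^ inversions A (S - {i} - A) * F A i e * G (S - {i} - A) i e"] bij_betw_Pow)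
            (auto simp: bij_betw_def intro: inj_on_subset)
        finally show ?thesis .
      qed
      show ?thesis
        by (simp add: e sg_def power_add sum_distrib_left sum_subtractf[symmetric] algebra_simps
            del: sum_subtractf)
    qed
    show ?thesis unfolding CU_codiff_singular[OF CU_mult_supp c]
      using eq Suc by (intro sum.cong) (auto simp: S_def M_def)
  qed
  have 2: "CU_mult Y (CU_codiff Y f) g c = (\<Sum>i\<in>S. \<Sum>A\<in>Pow (S - {i}).
      sg A i * ((F A i 1 - F A i 0) * G (S - {i} - A) i 1))"
  proof -
    have "CU_mult Y (CU_codiff Y f) g c = (\<Sum>L\<in>Pow S. \<Sum>i\<in>L.
       sg (L - {i}) i * ((F (L - {i}) i 1 - F (L - {i}) i 0) * G (S - {i} - (L - {i})) i 1))"
      unfolding CU_mult_singular[OF CU_codiff_supp g c]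
    proof (rule sum.cong)
      fix L assume "L \<in> Pow S"
      then have L: "L \<subseteq> S" by simp
      have finL: "finite L" using L S_def finite_subset by blast
      show "(-1) ^ inversions L ({..<fst c} - L) * CU_codiff Y f (subcube L 0 c) * g (subcube ({..<fst c} - L) 1 c)
        = (\<Sum>i\<in>L. sg (L - {i}) i * ((F (L - {i}) i 1 - F (L - {i}) i 0) * G (S - {i} - (L - {i})) i 1))"
      proof -
        have "(-1) ^ inversions L (S - L) * ((-1) ^ (card {k \<in> L - {i}. k < i} + 1)) = sg (L - {i}) i" if i: "i \<in> L" for i
        proof -
          define A where "A = L - {i}"
          have A: "L = insert i A" "i \<notin> A" "finite A" "S - L = S - {i} - A" "A \<subseteq> S - {i}" "i \<in> S"
            using i finL L by (auto simp: A_def)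
          have "inversions L (S - L) = inversions A (S - {i} - A) + card {b \<in> S - {i} - A. b < i}"
            by (subst A(1), subst A(4), rule inversions_insert_left) (use A in \<open>auto simp: S_def\<close>)
          then have iv: "inversions L (S - L) = inversions A (S - {i} - A) + card {b \<in> S - {i} - A. b < i}" .
          have "(-1) ^ inversions L (S - L) * ((-1) ^ (card {k \<in> A. k < i} + 1))
             = ((-1)::int) ^ (inversions L (S - L) + (card {k \<in> A. k < i} + 1))"
            by (simp only: power_add)
          also have "\<dots> = (-1) ^ (inversions A (S - {i} - A) + i + 1)"
          proof (rule parity)
            show "even (inversions L (S - L) + (card {k \<in> A. k < i} + 1) + (inversions A (S - {i} - A) + i + 1))"
              using split_i[OF A(6,5)] unfolding iv by presburger
          qed
          finally show ?thesis by (simp add: sg_def flip: A_def)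
        qed
        note sg = this
        have S: "{..<fst c} = S" by (simp add: S_def M_def)
        have L': "L \<subseteq> {..<fst c}" using L S by simp
        show ?thesis
          unfolding codiff_subcube[OF fs c L' zero_in_unit] S sum_distrib_left sum_distrib_right
        proof (rule sum.cong)
          fix i assume i: "i \<in> L"
          then have "S - {i} - (L - {i}) = S - L" by auto
          then have G: "G (S - {i} - (L - {i})) i 1 = g (subcube (S - L) 1 c)" using G1[of i] i L by auto
          show "(-1) ^ inversions L (S - L) * ((-1) ^ (card {k \<in> L - {i}. k < i} + 1) *
               (f (subcube2 (L - {i}) i 1 0 c) - f (subcube2 (L - {i}) i 0 0 c))) * g (subcube (S - L) 1 c)
             = sg (L - {i}) i * ((F (L - {i}) i 1 - F (L - {i}) i 0) * G (S - {i} - (L - {i})) i 1)"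
            unfolding sg[OF i, symmetric] G F_def by (simp only: ac_simps)
        qed simp
      qed
    qed (simp add: S_def M_def)
    then show ?thesis
      using sum_Pow_remove[of S "\<lambda>A i. sg A i * ((F A i 1 - F A i 0) * G (S - {i} - A) i 1)"]
      by (simp add: S_def)
  qed
  have 3: "(-1) ^ p * CU_mult Y f (CU_codiff Y g) c = (\<Sum>i\<in>S. \<Sum>A\<in>Pow (S - {i}).
      sg A i * (F A i 0 * (G (S - {i} - A) i 1 - G (S - {i} - A) i 0)))"
  proof -
    define h where "h B i = sg (S - {i} - B) i * (F (S - {i} - B) i 0 * (G B i 1 - G B i 0))" for B i
    have "(-1) ^ p * CU_mult Y f (CU_codiff Y g) c = (\<Sum>L\<in>Pow S. \<Sum>i\<in>S - L. h (S - L - {i}) i)"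
      unfolding CU_mult_singular[OF fs CU_codiff_supp c] sum_distrib_left
    proof (rule sum.cong)
      fix L assume "L \<in> Pow S"
      then have L: "L \<subseteq> S" by simp
      have finL: "finite L" using L S_def finite_subset by blast
      show "(-1) ^ p * ((-1) ^ inversions L ({..<fst c} - L) * f (subcube L 0 c) * CU_codiff Y g (subcube ({..<fst c} - L) 1 c))
        = (\<Sum>i\<in>S - L. h (S - L - {i}) i)"
      \<comment> \<open>Only sets of size \<open>p\<close> contribute. For them (-1)^p splits into
        the directions of \<open>L\<close> above \<open>i\<close>, which cancel the inversions
        created by \<open>i\<close>, and those below \<open>i\<close>, which complete the sign of
        the face.\<close>
      proof (cases "card L = p")
        case False
        then have "f (subcube L 0 c) = 0" by (intro CU_gradeD[OF f]) simp
        moreover have "S - {i} - (S - L - {i}) = L" if "i \<in> S - L" for i using L that by auto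
        ultimately show ?thesis by (simp add: h_def F0)
      next
        case True
        have "(-1) ^ p * ((-1) ^ inversions L (S - L) * ((-1) ^ (card {k \<in> S - L - {i}. k < i} + 1))) = sg L i" if i: "i \<in> S - L" for i
        proof -
          define B where "B = S - L - {i}"
          have B: "S - L = insert i B" "i \<notin> B" "finite B" "B = S - {i} - L" "L \<subseteq> S - {i}" "i \<in> S"
            using i L by (auto simp: B_def S_def)
          have iv: "inversions L (S - L) = inversions L B + card {a \<in> L. i < a}"
            by (subst B(1), rule inversions_insert_right) (use B finL in auto)
          have p: "p = card {a \<in> L. i < a} + card {a \<in> L. a < i}"
            using card_above_below[OF finL, of i] True i by simp
          have "(-1) ^ p * ((-1) ^ inversions L (S - L) * ((-1) ^ (card {k \<in> B. k < i} + 1)))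
             = ((-1)::int) ^ (p + (inversions L (S - L) + (card {k \<in> B. k < i} + 1)))"
            by (simp only: power_add)
          also have "\<dots> = (-1) ^ (inversions L B + i + 1)"
          proof (rule parity)
            have "i = card {a \<in> L. a < i} + card {k \<in> B. k < i}" using split_i[OF B(6,5)] B(4) by simp
            then show "even (p + (inversions L (S - L) + (card {k \<in> B. k < i} + 1)) + (inversions L B + i + 1))"
              unfolding iv p by presburger
          qed
          finally show ?thesis by (simp add: sg_def B(4) flip: B_def)
        qed
        note sg = this
        have S: "{..<fst c} = S" by (simp add: S_def M_def)
        have L': "S - L \<subseteq> {..<fst c}" using L S by auto
        show ?thesis
          unfolding S codiff_subcube[OF g c L' one_in_unit] sum_distrib_left
        proof (rule sum.cong)
          fix i assume i: "i \<in> S - L"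
          then have "S - {i} - (S - L - {i}) = L" using L by auto
          then have h: "h (S - L - {i}) i = sg L i * (f (subcube L 0 c) * (G (S - L - {i}) i 1 - G (S - L - {i}) i 0))"
            using i by (simp add: h_def F0)
          show "(-1) ^ p * ((-1) ^ inversions L (S - L) * f (subcube L 0 c) *
               ((-1) ^ (card {k \<in> S - L - {i}. k < i} + 1) *
               (g (subcube2 (S - L - {i}) i 1 1 c) - g (subcube2 (S - L - {i}) i 0 1 c)))) = h (S - L - {i}) i"
            unfolding h sg[OF i, symmetric] G_def by (simp only: ac_simps)
        qed simp
      qed
    qed (simp add: S_def M_def)
    also have "\<dots> = (\<Sum>L\<in>Pow S. \<Sum>i\<in>L. h (L - {i}) i)"
      by (rule sum_Pow_compl[of "\<lambda>L. \<Sum>i\<in>L. h (L - {i}) i" S])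
    also have "\<dots> = (\<Sum>i\<in>S. \<Sum>B\<in>Pow (S - {i}). h B i)"
      by (rule sum_Pow_remove) (simp add: S_def)
    also have "\<dots> = (\<Sum>i\<in>S. \<Sum>A\<in>Pow (S - {i}). h (S - {i} - A) i)"
      by (intro sum.cong refl sum_Pow_compl[symmetric])
    also have "\<dots> = (\<Sum>i\<in>S. \<Sum>A\<in>Pow (S - {i}).
      sg A i * (F A i 0 * (G (S - {i} - A) i 1 - G (S - {i} - A) i 0)))"
    proof (intro sum.cong refl)
      fix i A assume "A \<in> Pow (S - {i})"
      then have "S - {i} - (S - {i} - A) = A" by auto
      then show "h (S - {i} - A) i = sg A i * (F A i 0 * (G (S - {i} - A) i 1 - G (S - {i} - A) i 0))"
        by (simp add: h_def)
    qed
    finally show ?thesis .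
  qed
  show "CU_codiff Y (CU_mult Y f g) c = ?R c"
    unfolding plus_fun_apply 1 2 3
    by (simp add: sum.distrib[symmetric] algebra_simps)
qed simp

section \<open>Cochain products on products of cubes\<close>

lemma subcube_cross:
  assumes A: "A \<subseteq> {..<p}" and B: "B \<subseteq> {..<fst c}" and e: "e \<in> {0..1}"
  shows "subcube (A \<union> (+) p ` B) e (cross p a c)
    = cross (card A) (\<lambda>s. a (fins A p e s)) (subcube B e c)"
proof -
  let ?L = "A \<union> (+) p ` B"
  have fin: "finite A" "finite B" using A B finite_subset by blast+
  have cB: "card ((+) p ` S) = card S" for S :: "nat set" by (simp add: card_image)
  have card: "card ?L = card A + card B"
    using fin A by (subst card_Un_disjoint) (auto simp: cB)
  have L: "?L \<subseteq> {..<p + fst c}" using A B by auto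
  have r1: "card {i \<in> ?L. i < j} = card {i \<in> A. i < j}" if "j < p" for j
    by (rule arg_cong[of _ _ card]) (use that in auto)
  have r2: "card {i \<in> ?L. i < p + j} = card A + card {i \<in> B. i < j}" for j
  proof -
    have "{i \<in> ?L. i < p + j} = A \<union> (+) p ` {i \<in> B. i < j}" using A by auto
    then show ?thesis using fin A by (simp, subst card_Un_disjoint) (auto simp: cB)
  qed
  have r3: "card {i \<in> A. i < j} < card A" if "j \<in> A" for j
    using card_less_rank[OF fin(1) that] .
  have "snd (cross p a c) (fins ?L (p + fst c) e t)
      = a (fins A p e (cfst (card A) t)) (snd (subcube B e c) (csnd (card A) t))"
    if t: "t \<in> cube (card A + card B)" for t
  proof -
    have 1: "fins ?L (p + fst c) e t \<in> cube (p + fst c)"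
      using cube_mapD[OF cube_map_fins[OF L e]] t card by simp
    have 2: "cfst p (fins ?L (p + fst c) e t) = fins A p e (cfst (card A) t)"
    proof
      fix j
      have "j \<notin> (+) p ` B" if "j < p" using that by auto
      then show "cfst p (fins ?L (p + fst c) e t) j = fins A p e (cfst (card A) t) j"
        using A r1[of j] r3[of j] by (auto simp: fins_def)
    qed
    have 3: "csnd p (fins ?L (p + fst c) e t) = fins B (fst c) e (csnd (card A) t)"
    proof
      fix j
      have "j + p \<in> ?L \<longleftrightarrow> j \<in> B" using A by auto
      then show "csnd p (fins ?L (p + fst c) e t) j = fins B (fst c) e (csnd (card A) t) j"
        using r2[of j] by (simp add: fins_def add.commute)
    qed
    show ?thesis
      unfolding snd_cross[OF 1] 2 3 subcube_eq_pull snd_pull[OF csnd_cube[OF t]] ..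
  qed
  then show ?thesis
    unfolding subcube_eq_pull[of ?L] card
    by (auto simp: pull_def cross_def[of "card A"] restrict_def fun_eq_iff)
qed

text \<open>Besides the inversions inside the two blocks, every element of \<open>B\<close>, shifted
  above \<open>p\<close>, is inverted with every element of the first block outside
  \<open>A\<close>.\<close>

lemma inversions_shift:
  assumes A: "A \<subseteq> {..<p}" and B: "B \<subseteq> {..<m}"
  shows "inversions (A \<union> (+) p ` B) ({..<p + m} - (A \<union> (+) p ` B))
     = inversions A ({..<p} - A) + inversions B ({..<m} - B) + card B * (p - card A)"
proof -
  let ?A = "{..<p} - A" and ?B = "{..<m} - B"
  have fin: "finite A" "finite B" using A B finite_subset by blast+
  have compl: "{..<p + m} - (A \<union> (+) p ` B) = ?A \<union> (+) p ` ?B"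
  proof (intro equalityI subsetI)
    fix x assume x: "x \<in> {..<p + m} - (A \<union> (+) p ` B)"
    show "x \<in> ?A \<union> (+) p ` ?B"
    proof (cases "x < p")
      case True then show ?thesis using x by auto
    next
      case False
      then have "x = p + (x - p)" "x - p < m" "x - p \<notin> B" using x by (auto simp: image_iff)
      then show ?thesis by blast
    qed
  qed (use A in auto)
  have "{(x, y). x \<in> A \<union> (+) p ` B \<and> y \<in> ?A \<union> (+) p ` ?B \<and> y < x}
     = {(x, y). x \<in> A \<and> y \<in> ?A \<and> y < x} \<union> (map_prod ((+) p) ((+) p) ` {(x, y). x \<in> B \<and> y \<in> ?B \<and> y < x}
       \<union> ((+) p ` B) \<times> ?A)" (is "?L = ?X \<union> (?Y \<union> ?Z)")
  proof (intro equalityI subsetI)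
    fix z assume "z \<in> ?L"
    then obtain x y where z: "z = (x, y)" "y < x" and xy: "x \<in> A \<union> (+) p ` B" "y \<in> ?A \<union> (+) p ` ?B"
      by auto
    show "z \<in> ?X \<union> (?Y \<union> ?Z)"
    proof (cases "x \<in> A")
      case True
      then have "y \<in> ?A" using xy A z(2) by auto
      then show ?thesis using True z by auto
    next
      case False
      then obtain b where b: "x = p + b" "b \<in> B" using xy by auto
      show ?thesis
      proof (cases "y \<in> ?A")
        case True then show ?thesis using b z by auto
      next
        case False
        then obtain b' where "y = p + b'" "b' \<in> ?B" using xy by auto
        then have "z = map_prod ((+) p) ((+) p) (b, b')" "b' < b" "b \<in> B" "b' \<in> ?B" using z b by auto
        then have "z \<in> ?Y" by (intro image_eqI[of _ _ "(b, b')"]) auto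
        then show ?thesis by simp
      qed
    qed
  qed auto
  then have "inversions (A \<union> (+) p ` B) (?A \<union> (+) p ` ?B) = card (?X \<union> (?Y \<union> ?Z))"
    by (simp add: inversions_def)
  also have "\<dots> = card ?X + card (?Y \<union> ?Z)"
    using fin A by (intro card_Un_disjoint finite_inversions finite_UnI finite_imageI) auto
  also have "card (?Y \<union> ?Z) = card ?Y + card ?Z"
    using fin by (intro card_Un_disjoint finite_inversions finite_imageI) auto
  also have "card ?Y = inversions B ?B"
    unfolding inversions_def by (intro card_image) (auto simp: inj_on_def)
  also have "card ?Z = card B * (p - card A)"
    using fin A by (simp add: card_cartesian_product card_image card_Diff_subset)
  finally show ?thesis unfolding compl by (simp add: inversions_def)
qed

lemma sum_Pow_shift:
  "(\<Sum>L\<in>Pow {..<p + m :: nat}. h L) = (\<Sum>A\<in>Pow {..<p}. \<Sum>B\<in>Pow {..<m}. h (A \<union> (+) p ` B))"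
proof -
  have "(\<Sum>A\<in>Pow {..<p}. \<Sum>B\<in>Pow {..<m}. h (A \<union> (+) p ` B))
      = (\<Sum>(A, B)\<in>Pow {..<p} \<times> Pow {..<m}. h (A \<union> (+) p ` B))"
    by (rule sum.cartesian_product)
  also have "\<dots> = (\<Sum>L\<in>Pow {..<p + m}. h L)"
  proof (rule sum.reindex_bij_witness[of _ "\<lambda>L. (L \<inter> {..<p}, {j. p + j \<in> L})" "\<lambda>(A, B). A \<union> (+) p ` B"])
    fix L assume "L \<in> Pow {..<p + m}"
    have "x \<in> (+) p ` {j. p + j \<in> L}" if "x \<in> L" "\<not> x < p" for x
      using that by (intro image_eqI[of _ _ "x - p"]) auto
    then show "(case (L \<inter> {..<p}, {j. p + j \<in> L}) of (A, B) \<Rightarrow> A \<union> (+) p ` B) = L" by auto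
  qed (auto simp: subset_eq)
  finally show ?thesis ..
qed

text \<open>The coproduct of a product of cubes is the product of their coproducts.\<close>

lemma CX_mult:
  assumes f: "f \<in> grade (CU Z) q" and g: "nd_supp Z g" and a: "cross_map Y Z p a"
    and c: "c \<in> singular_cubes Y"
  shows "CX Y p a (CU_mult Z f g) c = (\<Sum>A\<in>Pow {..<p}.
     (-1) ^ (inversions A ({..<p} - A) + (p - card A) * (q - card A)) *
     CU_mult Y (CX Y (card A) (\<lambda>s. a (fins A p 0 s)) f)
               (CX Y (card ({..<p} - A)) (\<lambda>s. a (fins ({..<p} - A) p 1 s)) g) c)"
proof -
  have fs: "nd_supp Z f" using f by (rule CU_grade_supp)
  define m where "m = fst c"
  have "CX Y p a (CU_mult Z f g) c = CU_mult Z f g (cross p a c)"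
    by (rule CX_singular[OF CU_mult_supp c])
  also have "\<dots> = (\<Sum>A\<in>Pow {..<p}. \<Sum>B\<in>Pow {..<m}.
     (-1) ^ inversions (A \<union> (+) p ` B) ({..<p + m} - (A \<union> (+) p ` B)) *
     f (subcube (A \<union> (+) p ` B) 0 (cross p a c)) * g (subcube ({..<p + m} - (A \<union> (+) p ` B)) 1 (cross p a c)))"
    by (simp add: CU_mult_singular[OF fs g cross_singular[OF a c]] m_def sum_Pow_shift)
  also have "\<dots> = (\<Sum>A\<in>Pow {..<p}.
     (-1) ^ (inversions A ({..<p} - A) + (p - card A) * (q - card A)) *
     CU_mult Y (CX Y (card A) (\<lambda>s. a (fins A p 0 s)) f)
               (CX Y (card ({..<p} - A)) (\<lambda>s. a (fins ({..<p} - A) p 1 s)) g) c)"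
  proof (rule sum.cong)
    fix A assume "A \<in> Pow {..<p}"
    then have A: "A \<subseteq> {..<p}" by simp
    show "(\<Sum>B\<in>Pow {..<m}.
     (-1) ^ inversions (A \<union> (+) p ` B) ({..<p + m} - (A \<union> (+) p ` B)) *
     f (subcube (A \<union> (+) p ` B) 0 (cross p a c)) * g (subcube ({..<p + m} - (A \<union> (+) p ` B)) 1 (cross p a c)))
     = (-1) ^ (inversions A ({..<p} - A) + (p - card A) * (q - card A)) *
     CU_mult Y (CX Y (card A) (\<lambda>s. a (fins A p 0 s)) f)
               (CX Y (card ({..<p} - A)) (\<lambda>s. a (fins ({..<p} - A) p 1 s)) g) c"
      unfolding CU_mult_singular[OF CX_supp CX_supp c] sum_distrib_left m_def[symmetric]
    proof (rule sum.cong)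
      fix B assume "B \<in> Pow {..<m}"
      then have B: "B \<subseteq> {..<m}" by simp
      have compl: "{..<p + m} - (A \<union> (+) p ` B) = ({..<p} - A) \<union> (+) p ` ({..<m} - B)"
      proof (intro equalityI subsetI)
        fix x assume x: "x \<in> {..<p + m} - (A \<union> (+) p ` B)"
        show "x \<in> ({..<p} - A) \<union> (+) p ` ({..<m} - B)"
        proof (cases "x < p")
          case True then show ?thesis using x by auto
        next
          case False
          then have "x = p + (x - p)" "x - p < m" "x - p \<notin> B" using x by (auto simp: image_iff)
          then show ?thesis by blast
        qed
      qed (use A in auto)
      have sA: "subcube (A \<union> (+) p ` B) 0 (cross p a c) = cross (card A) (\<lambda>s. a (fins A p 0 s)) (subcube B 0 c)"
        using A B by (intro subcube_cross) (auto simp: m_def)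
      have sB: "subcube (({..<p} - A) \<union> (+) p ` ({..<m} - B)) 1 (cross p a c)
          = cross (card ({..<p} - A)) (\<lambda>s. a (fins ({..<p} - A) p 1 s)) (subcube ({..<m} - B) 1 c)"
        by (intro subcube_cross) (auto simp: m_def)
      have fA: "CX Y (card A) (\<lambda>s. a (fins A p 0 s)) f (subcube B 0 c) = f (cross (card A) (\<lambda>s. a (fins A p 0 s)) (subcube B 0 c))"
        using B by (intro CX_singular[OF fs] subcube_singular[OF c]) (auto simp: m_def)
      have gB: "CX Y (card ({..<p} - A)) (\<lambda>s. a (fins ({..<p} - A) p 1 s)) g (subcube ({..<m} - B) 1 c)
          = g (cross (card ({..<p} - A)) (\<lambda>s. a (fins ({..<p} - A) p 1 s)) (subcube ({..<m} - B) 1 c))"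
        by (intro CX_singular[OF g] subcube_singular[OF c]) (auto simp: m_def)
      show "(-1) ^ inversions (A \<union> (+) p ` B) ({..<p + m} - (A \<union> (+) p ` B)) *
         f (subcube (A \<union> (+) p ` B) 0 (cross p a c)) * g (subcube ({..<p + m} - (A \<union> (+) p ` B)) 1 (cross p a c))
         = (-1) ^ (inversions A ({..<p} - A) + (p - card A) * (q - card A)) *
          ((-1) ^ inversions B ({..<m} - B) *
           CX Y (card A) (\<lambda>s. a (fins A p 0 s)) f (subcube B 0 c) *
           CX Y (card ({..<p} - A)) (\<lambda>s. a (fins ({..<p} - A) p 1 s)) g (subcube ({..<m} - B) 1 c))"
        unfolding compl inversions_shift[OF A B, unfolded compl] sA sB fA gB
      \<comment> \<open>The factor \<open>f\<close> vanishes unless its front face has dimension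
        \<open>q\<close>. This replaces the size of \<open>B\<close> in the sign by
        \<open>q - card A\<close>, so that the sign can leave the sum over \<open>B\<close>.\<close>
      proof (cases "card A + card B = q")
        case True
        then have "card B = q - card A" by simp
        then show "(-1) ^ (inversions A ({..<p} - A) + inversions B ({..<m} - B) + card B * (p - card A)) *
           f (cross (card A) (\<lambda>s. a (fins A p 0 s)) (subcube B 0 c)) * g (cross (card ({..<p} - A)) (\<lambda>s. a (fins ({..<p} - A) p 1 s)) (subcube ({..<m} - B) 1 c)) =
           (-1) ^ (inversions A ({..<p} - A) + (p - card A) * (q - card A)) *
          ((-1) ^ inversions B ({..<m} - B) * f (cross (card A) (\<lambda>s. a (fins A p 0 s)) (subcube B 0 c)) *
           g (cross (card ({..<p} - A)) (\<lambda>s. a (fins ({..<p} - A) p 1 s)) (subcube ({..<m} - B) 1 c)))"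
          by (simp only: power_add ac_simps)
      next
        case False
        then have "f (cross (card A) (\<lambda>s. a (fins A p 0 s)) (subcube B 0 c)) = 0"
          by (intro CU_gradeD[OF f]) simp
        then show "(-1) ^ (inversions A ({..<p} - A) + inversions B ({..<m} - B) + card B * (p - card A)) *
           f (cross (card A) (\<lambda>s. a (fins A p 0 s)) (subcube B 0 c)) * g (cross (card ({..<p} - A)) (\<lambda>s. a (fins ({..<p} - A) p 1 s)) (subcube ({..<m} - B) 1 c)) =
           (-1) ^ (inversions A ({..<p} - A) + (p - card A) * (q - card A)) *
          ((-1) ^ inversions B ({..<m} - B) * f (cross (card A) (\<lambda>s. a (fins A p 0 s)) (subcube B 0 c)) *
           g (cross (card ({..<p} - A)) (\<lambda>s. a (fins ({..<p} - A) p 1 s)) (subcube ({..<m} - B) 1 c)))"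
          by simp
      qed
    qed simp
  qed simp
  finally show ?thesis .
qed

lemma CU_map_mult:
  assumes "f \<in> grade (CU Z) q" "nd_supp Z g" "continuous_map Y Z h"
  shows "CU_map Y h (CU_mult Z f g) = CU_mult Y (CU_map Y h f) (CU_map Y h g)"
proof (rule nd_supp_eqI[of Y])
  fix c assume "c \<in> nd_cubes Y"
  then show "CU_map Y h (CU_mult Z f g) c = CU_mult Y (CU_map Y h f) (CU_map Y h g) c"
    using CX_mult[OF assms(1,2), of Y 0 "\<lambda>s. h" c] assms(3)
    by (simp add: CU_map_eq_CX cross_map_0 nd_cubes_def)
qed (simp_all add: CU_map_eq_CX)

lemma CU_mult_one:
  assumes "nd_supp Y f"
  shows "CU_mult Y (CU_one Y) f = f" "CU_mult Y f (CU_one Y) = f"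
proof -
  have one: "nd_supp Y (CU_one Y)" by (rule nd_suppI) (simp add: CU_one_def)
  have triv: "CU_one Y (subcube L e c) = (if L = {} then 1 else 0)"
    if "c \<in> singular_cubes Y" "L \<subseteq> {..<fst c}" "e \<in> {0..1}" for c L e
    using subcube_singular[OF that] finite_subset[OF that(2)]
    by (auto simp: CU_one_def nd_cubes_def degenerate_iff)
  have id: "subcube {..<fst c} e c = c" if "c \<in> singular_cubes Y" for c e
  proof -
    have "card {i. i < fst c \<and> i < j} = j" if "j < fst c" for j
    proof -
      have "{i. i < fst c \<and> i < j} = {..<j}" using that by auto
      then show ?thesis by simp
    qed
    then show ?thesis
      unfolding subcube_eq_pull card_lessThan
      by (intro pull_id[OF that]) (auto simp: fins_def fun_eq_iff cubeD)
  qed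
  show "CU_mult Y (CU_one Y) f = f"
  proof (rule nd_supp_eqI[OF CU_mult_supp assms])
    fix c assume "c \<in> nd_cubes Y"
    then have c: "c \<in> singular_cubes Y" by (simp add: nd_cubes_def)
    have "CU_mult Y (CU_one Y) f c = (\<Sum>L\<in>Pow {..<fst c}. if L = {} then f c else 0)"
      unfolding CU_mult_singular[OF one assms c]
      by (intro sum.cong) (auto simp: triv[OF c] id[OF c] inversions_def)
    then show "CU_mult Y (CU_one Y) f c = f c" by simp
  qed
  show "CU_mult Y f (CU_one Y) = f"
  proof (rule nd_supp_eqI[OF CU_mult_supp assms])
    fix c assume "c \<in> nd_cubes Y"
    then have c: "c \<in> singular_cubes Y" by (simp add: nd_cubes_def)
    have "CU_mult Y f (CU_one Y) c = (\<Sum>L\<in>Pow {..<fst c}. if L = {..<fst c} then f c else 0)"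
      unfolding CU_mult_singular[OF assms one c]
    proof (intro sum.cong refl)
      fix L assume "L \<in> Pow {..<fst c}"
      then show "(-1) ^ inversions L ({..<fst c} - L) * f (subcube L 0 c) * CU_one Y (subcube ({..<fst c} - L) 1 c)
         = (if L = {..<fst c} then f c else 0)"
        using triv[OF c, of "{..<fst c} - L" 1] id[OF c] by auto
    qed
    then show "CU_mult Y f (CU_one Y) c = f c" by simp
  qed
qed

section \<open>Path spaces\<close>

lemma topspace_path_space [simp]: "topspace (path_space X) = paths X"
proof -
  have "paths X \<in> {{l \<in> paths X. l ` C \<subseteq> U} | C U. compact C \<and> C \<subseteq> {0..1} \<and> openin X U}"
    by (rule CollectI, rule exI[of _ "{}"], rule exI[of _ "{}"]) auto
  then show ?thesis unfolding path_space_def topology_generated_by_topspace by blast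
qed

lemma pathsD: "l \<in> paths X \<Longrightarrow> continuous_map (top_of_set {0..1}) X l" "l \<in> paths X \<Longrightarrow> l \<in> extensional {0..1}"
  by (auto simp: paths_def)

text \<open>Joint continuity rests on the local compactness of the interval: a small closed ball
  around \<open>t\<close> that \<open>l\<close> sends into \<open>U\<close> defines a subbasic
  neighbourhood of \<open>l\<close>.\<close>

lemma continuous_map_eval:
  "continuous_map (prod_topology (top_of_set {0..1}) (path_space X)) X (\<lambda>(t, l). l t)"
  unfolding continuous_map_alt
proof (intro conjI allI impI)
  show "(\<lambda>(t, l). l t) \<in> topspace (prod_topology (top_of_set {0..1}) (path_space X)) \<rightarrow> topspace X"
    using pathsD(1) by (fastforce simp: continuous_map_def)
next
  fix U assume U: "openin X U"
  let ?W = "(\<lambda>(t, l). l t) -` U \<inter> topspace (prod_topology (top_of_set {0..1}) (path_space X))"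
  show "openin (prod_topology (top_of_set {0..1}) (path_space X)) ?W"
    unfolding openin_prod_topology_alt
  proof (intro allI impI)
    fix t l assume "(t, l) \<in> ?W"
    then have t: "t \<in> {0..1}" "l \<in> paths X" "l t \<in> U" by auto
    have "openin (top_of_set {0..1}) {t \<in> {0..1}. l t \<in> U}"
      using pathsD(1)[OF t(2)] U by (auto simp: continuous_map_def)
    then obtain V where V: "open V" "{t \<in> {0..1}. l t \<in> U} = {0..1} \<inter> V"
      by (auto simp: openin_open)
    then have "t \<in> V" using t by auto
    then obtain e where e: "e > 0" "cball t e \<subseteq> V" using V(1) open_contains_cball by blast
    define C where "C = {0..1} \<inter> cball t e"
    have C: "compact C" "C \<subseteq> {0..1}" "l ` C \<subseteq> U"
      using e V by (auto simp: C_def intro: compact_Int)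
    show "\<exists>A B. openin (top_of_set {0..1}) A \<and> openin (path_space X) B \<and> t \<in> A \<and> l \<in> B \<and> A \<times> B \<subseteq> ?W"
    proof (intro exI conjI)
      show "openin (top_of_set {0..1}) ({0..1} \<inter> ball t e)" by (auto simp: openin_open)
      show "openin (path_space X) {l \<in> paths X. l ` C \<subseteq> U}"
        unfolding path_space_def by (rule topology_generated_by_Basis) (use C U in blast)
      show "t \<in> {0..1} \<inter> ball t e" using t e by auto
      show "l \<in> {l \<in> paths X. l ` C \<subseteq> U}" using t C by auto
      show "({0..1} \<inter> ball t e) \<times> {l \<in> paths X. l ` C \<subseteq> U} \<subseteq> ?W"
        by (auto simp: C_def image_subset_iff)
    qed
  qed
qed

lemma continuous_map_eval_comp:
  assumes f: "continuous_map W (path_space X) f"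
    and \<tau>: "continuous_map W euclideanreal \<tau>" "\<And>w. w \<in> topspace W \<Longrightarrow> \<tau> w \<in> {0..1}"
  shows "continuous_map W X (\<lambda>w. f w (\<tau> w))"
proof -
  have "continuous_map W (prod_topology (top_of_set {0..1}) (path_space X)) (\<lambda>w. (\<tau> w, f w))"
    using assms by (auto simp: continuous_map_pairwise comp_def continuous_map_in_subtopology)
  from continuous_map_compose[OF this continuous_map_eval] show ?thesis by (simp add: comp_def)
qed

text \<open>For the subbasic set of a compact \<open>C\<close> and an open \<open>U\<close>, the
  tube lemma provides a neighbourhood of \<open>w\<close> whose product with \<open>C\<close> stays
  in the preimage of \<open>U\<close>.\<close>

lemma continuous_map_curry:
  assumes g: "continuous_map (prod_topology W (top_of_set {0..1})) X (\<lambda>(w, u). g w u)"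
  shows "continuous_map W (path_space X) (\<lambda>w. restrict (g w) {0..1})"
  unfolding path_space_def
proof (rule continuous_on_generated_topo)
  let ?h = "\<lambda>w. restrict (g w) {0..1}"
  have paths: "?h w \<in> paths X" if "w \<in> topspace W" for w
  proof -
    have "continuous_map (top_of_set {0..1}) (prod_topology W (top_of_set {0..1})) (\<lambda>u. (w, u))"
      using that by (auto simp: continuous_map_pairwise comp_def)
    from continuous_map_compose[OF this g] have "continuous_map (top_of_set {0..1}) X (g w)"
      by (simp add: comp_def)
    then show ?thesis by (auto simp: paths_def intro: continuous_map_eq)
  qed
  then show "?h ` topspace W \<subseteq> \<Union> {{l \<in> paths X. l ` C \<subseteq> U} | C U. compact C \<and> C \<subseteq> {0..1} \<and> openin X U}"
    using topspace_path_space[of X] unfolding path_space_def topology_generated_by_topspace by blast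
  fix S assume "S \<in> {{l \<in> paths X. l ` C \<subseteq> U} | C U. compact C \<and> C \<subseteq> {0..1} \<and> openin X U}"
  then obtain C U where S: "S = {l \<in> paths X. l ` C \<subseteq> U}" and C: "compact C" "C \<subseteq> {0..1}" and U: "openin X U"
    by blast
  define V where "V = {z \<in> topspace (prod_topology W (top_of_set {0..1})). (case z of (w, u) \<Rightarrow> g w u) \<in> U}"
  have V: "openin (prod_topology W (top_of_set {0..1})) V"
    unfolding V_def using g U by (auto simp: continuous_map_def)
  have Cc: "compactin (top_of_set {0..1}) C" using C by (simp add: compactin_subtopology)
  show "openin W (?h -` S \<inter> topspace W)"
  proof (subst openin_subopen, intro ballI)
    fix w assume w: "w \<in> ?h -` S \<inter> topspace W"
    then have "{w} \<times> C \<subseteq> V" using C by (auto simp: S V_def image_subset_iff subset_eq)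
    then obtain A B where AB: "openin W A" "w \<in> A" "C \<subseteq> B" "A \<times> B \<subseteq> V"
      using tube_lemma_right[OF V Cc, of w] w by blast
    have "A \<subseteq> ?h -` S \<inter> topspace W"
    proof
      fix x assume x: "x \<in> A"
      have "x \<in> topspace W" using AB x openin_subset by blast
      moreover have "g x u \<in> U" if "u \<in> C" for u using AB x that by (force simp: V_def)
      ultimately show "x \<in> ?h -` S \<inter> topspace W" using C paths by (auto simp: S)
    qed
    then show "\<exists>T. openin W T \<and> w \<in> T \<and> T \<subseteq> ?h -` S \<inter> topspace W" using AB by blast
  qed
qed

section \<open>Concatenation of paths and the free loop space\<close>

definition path_conc :: "(real \<Rightarrow> 'a) \<Rightarrow> (real \<Rightarrow> 'a) \<Rightarrow> real \<Rightarrow> 'a" where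
  "path_conc l l' = restrict (\<lambda>u. if u \<le> 1/2 then l (2 * u) else l' (2 * u - 1)) {0..1}"

lemma power_map2_conc: "power_map2 l = path_conc l l"
  by (simp add: power_map2_def path_conc_def)

lemma continuous_map_conc:
  assumes f: "continuous_map W (path_space X) f" and g: "continuous_map W (path_space X) g"
    and fg: "\<And>w. w \<in> topspace W \<Longrightarrow> f w 1 = g w 0"
  shows "continuous_map W (path_space X) (\<lambda>w. path_conc (f w) (g w))"
  unfolding path_conc_def
proof (rule continuous_map_curry)
  let ?D = "prod_topology W (top_of_set {0..1::real})"
  have snd: "continuous_map ?D euclideanreal snd"
    using continuous_map_snd[of W "top_of_set {0..1::real}"] by (simp add: continuous_map_in_subtopology)
  have f': "continuous_map ?D (path_space X) (f \<circ> fst)" and g': "continuous_map ?D (path_space X) (g \<circ> fst)"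
    by (auto intro: continuous_map_compose[OF continuous_map_fst] f g)
  \<comment> \<open>Clamping the parameters with \<open>min\<close> and \<open>max\<close> makes
    both branches continuous on the whole product; where they are used they agree with the
    concatenation.\<close>
  have "continuous_map ?D X (\<lambda>z. if snd z \<le> 1/2 then (f \<circ> fst) z (min 1 (2 * snd z)) else (g \<circ> fst) z (max 0 (2 * snd z - 1)))"
  proof (rule continuous_map_cases_le)
    show "continuous_map ?D euclideanreal (\<lambda>z. snd z)" using snd by simp
    show "continuous_map (subtopology ?D S) X (\<lambda>z. (f \<circ> fst) z (min 1 (2 * snd z)))" for S
      by (rule continuous_map_from_subtopology, rule continuous_map_eval_comp[OF f'])
        (auto intro!: continuous_intros snd)
    show "continuous_map (subtopology ?D S) X (\<lambda>z. (g \<circ> fst) z (max 0 (2 * snd z - 1)))" for S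
      by (rule continuous_map_from_subtopology, rule continuous_map_eval_comp[OF g'])
        (auto intro!: continuous_intros snd)
  qed (auto simp: fg)
  then show "continuous_map ?D X (\<lambda>(w, u). if u \<le> 1/2 then f w (2 * u) else g w (2 * u - 1))"
    by (rule continuous_map_eq) auto
qed

lemma path_conc_0 [simp]: "path_conc l l' 0 = l 0" and path_conc_1 [simp]: "path_conc l l' 1 = l' 1"
  by (simp_all add: path_conc_def)

lemma topspace_free_loop_space: "topspace (free_loop_space X) = {l \<in> paths X. l 0 = l 1}"
  by (auto simp: free_loop_space_def)

lemma continuous_map_loop_incl: "continuous_map (free_loop_space X) (path_space X) (\<lambda>l. l)"
  by (simp add: free_loop_space_def continuous_map_from_subtopology)

lemma continuous_map_power_map2: "continuous_map (free_loop_space X) (free_loop_space X) power_map2"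
  unfolding free_loop_space_def[of X] continuous_map_in_subtopology
proof (intro conjI)
  show "continuous_map (subtopology (path_space X) {l. l 0 = l 1}) (path_space X) power_map2"
    using continuous_map_conc[OF continuous_map_loop_incl[of X] continuous_map_loop_incl[of X]]
    by (simp add: power_map2_conc[abs_def] topspace_free_loop_space flip: free_loop_space_def)
qed (auto simp: power_map2_conc)

lemma continuous_map_path_eval:
  "u \<in> {0..1} \<Longrightarrow> continuous_map (path_space X) X (\<lambda>l. l u)"
  by (rule continuous_map_eval_comp) auto

lemma continuous_map_csnd:
  "continuous_map (prod_topology (top_of_set (cube (p + q))) Y) (prod_topology (top_of_set (cube q)) Y) (\<lambda>(s, y). (csnd p s, y))"
proof -
  have "continuous_on (cube (p + q)) (csnd p)"
    by (rule continuous_on_coordinatewise_then_product) (simp add: continuous_intros)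
  then have "continuous_map (top_of_set (cube (p + q))) (top_of_set (cube q)) (\<lambda>s. csnd p s)"
    by (auto simp: csnd_cube)
  from continuous_map_compose[OF continuous_map_fst this, of Y] show ?thesis
    by (auto simp: continuous_map_pairwise comp_def case_prod_beta' intro: continuous_map_snd)
qed

section \<open>Transgression and the division of a path into halves\<close>

lemma cross_map_eval:
  assumes b: "cross_map Y (path_space X) q b"
    and \<tau>: "\<And>j. continuous_on (cube (p + q)) \<tau>" "\<And>s. s \<in> cube (p + q) \<Longrightarrow> \<tau> s \<in> {0..1}"
  shows "cross_map Y X (p + q) (\<lambda>s y. b (csnd p s) y (\<tau> s))"
proof -
  let ?D = "prod_topology (top_of_set (cube (p + q))) Y"
  have 1: "continuous_map ?D (path_space X) (\<lambda>(s, y). b (csnd p s) y)"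
    using continuous_map_compose[OF continuous_map_csnd[of p q Y] b[unfolded cross_map_def]]
    by (simp add: comp_def case_prod_beta')
  have "continuous_map (top_of_set (cube (p + q))) euclideanreal \<tau>" using \<tau>(1) by simp
  from continuous_map_compose[OF continuous_map_fst this, of Y]
  have 2: "continuous_map ?D euclideanreal (\<lambda>z. \<tau> (fst z))" by (simp add: comp_def)
  show ?thesis
    using continuous_map_eval_comp[OF 1 2] \<tau>(2) by (auto simp: cross_map_def case_prod_beta')
qed

text \<open>The exponential adjoint of a family of paths, with the path parameter as coordinate 0.
  Pulling a cochain back along it is the transgression over the family.\<close>

definition adj :: "((nat \<Rightarrow> real) \<Rightarrow> 'y \<Rightarrow> real \<Rightarrow> 'a) \<Rightarrow> (nat \<Rightarrow> real) \<Rightarrow> 'y \<Rightarrow> 'a" where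
  "adj b s y = b (csnd 1 s) y (s 0)"

lemma cross_map_adj: "cross_map Y (path_space X) q b \<Longrightarrow> cross_map Y X (Suc q) (adj b)"
  using cross_map_eval[of Y X q b 1 "\<lambda>s. s 0"]
  by (simp add: adj_def[abs_def] continuous_intros cubeD)

text \<open>A square in the interval whose edges are y at x = 0, (1 + y) / 2 at x = 1, x / 2 at y =
  0 and the constant 1 at y = 1. It compares a path with its two halves, and in \<open>phalf\<close>
  a coordinate of a cube with its two halves.\<close>

definition div_sq :: "real \<Rightarrow> real \<Rightarrow> real" where
  "div_sq x y = y + (1 - y) * x / 2"

lemma div_sq_bounds: "0 \<le> x \<Longrightarrow> x \<le> 1 \<Longrightarrow> 0 \<le> y \<Longrightarrow> y \<le> 1 \<Longrightarrow> 0 \<le> div_sq x y \<and> div_sq x y \<le> 1"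
proof -
  assume a: "0 \<le> x" "x \<le> 1" "0 \<le> y" "y \<le> 1"
  have "0 \<le> (1 - y) * x" using a by simp
  moreover have "(1 - y) * x \<le> 1 - y" using a by (intro mult_left_le) auto
  ultimately show ?thesis using a by (simp add: div_sq_def)
qed

text \<open>The boundary of the square \<open>div_sq\<close> is the unit interval minus its two halves, up to a
  constant edge.\<close>

lemma CX_divide:
  assumes \<omega>: "nd_supp X \<omega>" "CU_codiff X \<omega> = 0" and b: "cross_map Y (path_space X) q b"
  defines "sq \<equiv> \<lambda>b s y. b (csnd 2 s) y (div_sq (s 0) (s 1))"
  shows "CX Y (Suc q) (adj b) \<omega> =
     CX Y (Suc q) (adj (\<lambda>t y u. b t y ((1 + u) / 2))) \<omega> + CX Y (Suc q) (adj (\<lambda>t y u. b t y (u / 2))) \<omega>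
     - (\<lambda>c. (-1) ^ q * CU_codiff Y (CX Y (q + 2) (sq b) \<omega>) c)
     - (\<lambda>c. \<Sum>i<q. (-1) ^ (i + 1) * (CX Y (Suc q) (sq (\<lambda>t. b (ins i 1 t))) \<omega> c - CX Y (Suc q) (sq (\<lambda>t. b (ins i 0 t))) \<omega> c))"
proof
  fix c
  have cm: "cross_map Y X (q + 2) (sq b)"
    unfolding sq_def
    using cross_map_eval[OF b, of 2 "\<lambda>s. div_sq (s 0) (s 1)"]
    by (simp add: add.commute cubeD div_sq_bounds) (simp add: div_sq_def continuous_intros add.commute)
  define t where "t i = (-1) ^ (i + 1) * (CX Y (Suc q) (\<lambda>s. sq b (ins i 1 s)) \<omega> c - CX Y (Suc q) (\<lambda>s. sq b (ins i 0 s)) \<omega> c)" for i :: nat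
  \<comment> \<open>As \<open>\<omega>\<close> is closed, Stokes for the family \<open>sq b\<close>
    relates the four edges of the square, the faces of the other \<open>q\<close> parameters and a
    coboundary.\<close>
  have "0 = (-1) ^ (q + 2) * CU_codiff Y (CX Y (q + 2) (sq b) \<omega>) c + (\<Sum>i<q + 2. t i)"
    using fun_cong[OF CX_codiff[OF \<omega>(1) cm], of c] by (simp add: \<omega>(2) t_def)
  moreover have "(\<Sum>i<q + 2. t i) = t 0 + t 1 + (\<Sum>i<q. t (i + 2))"
    by (simp add: numeral_2_eq_2 sum.lessThan_Suc_shift del: sum.lessThan_Suc)
  moreover have "t 0 = CX Y (Suc q) (adj b) \<omega> c - CX Y (Suc q) (adj (\<lambda>t y u. b t y ((1 + u) / 2))) \<omega> c"
  proof -
    have "CX Y (Suc q) (\<lambda>s. sq b (ins 0 1 s)) \<omega> = CX Y (Suc q) (adj (\<lambda>t y u. b t y ((1 + u) / 2))) \<omega>"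
      by (rule CX_cong) (simp add: sq_def adj_def ins_def div_sq_def field_simps)
    moreover have "CX Y (Suc q) (\<lambda>s. sq b (ins 0 0 s)) \<omega> = CX Y (Suc q) (adj b) \<omega>"
      by (rule CX_cong) (simp add: sq_def adj_def ins_def div_sq_def)
    ultimately show ?thesis by (simp add: t_def)
  qed
  moreover have "t 1 = - CX Y (Suc q) (adj (\<lambda>t y u. b t y (u / 2))) \<omega> c"
  proof -
    have "CX Y (Suc q) (\<lambda>s. sq b (ins 1 1 s)) \<omega> = 0"
      by (rule CX_degenerate[OF \<omega>(1), of 0]) (simp_all add: sq_def ins_def div_sq_def)
    moreover have "CX Y (Suc q) (\<lambda>s. sq b (ins 1 0 s)) \<omega> = CX Y (Suc q) (adj (\<lambda>t y u. b t y (u / 2))) \<omega>"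
      by (rule CX_cong) (simp add: sq_def adj_def ins_def div_sq_def)
    ultimately show ?thesis by (simp add: t_def)
  qed
  moreover have "t (i + 2) = (-1) ^ (i + 1) * (CX Y (Suc q) (sq (\<lambda>t. b (ins i 1 t))) \<omega> c - CX Y (Suc q) (sq (\<lambda>t. b (ins i 0 t))) \<omega> c)" for i
  proof -
    have "sq b (ins (i + 2) e s) = sq (\<lambda>t. b (ins i e t)) s" for e s
    proof -
      have "csnd 2 (ins (i + 2) e s) = ins i e (csnd 2 s)" by (auto simp: ins_def fun_eq_iff)
      then show ?thesis unfolding sq_def by (simp add: ins_def)
    qed
    then show ?thesis by (simp add: t_def)
  qed
  ultimately show "CX Y (Suc q) (adj b) \<omega> c =
     (CX Y (Suc q) (adj (\<lambda>t y u. b t y ((1 + u) / 2))) \<omega> + CX Y (Suc q) (adj (\<lambda>t y u. b t y (u / 2))) \<omega>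
     - (\<lambda>c. (-1) ^ q * CU_codiff Y (CX Y (q + 2) (sq b) \<omega>) c)
     - (\<lambda>c. \<Sum>i<q. (-1) ^ (i + 1) * (CX Y (Suc q) (sq (\<lambda>t. b (ins i 1 t))) \<omega> c - CX Y (Suc q) (sq (\<lambda>t. b (ins i 0 t))) \<omega> c))) c"
    by simp
qed

lemma CX_adj_conc_upper:
  assumes "\<And>t y. t \<in> cube q \<Longrightarrow> y \<in> topspace Y \<Longrightarrow> f t y 1 = g t y 0"
  shows "CX Y (Suc q) (adj (\<lambda>t y u. path_conc (f t y) (g t y) ((1 + u) / 2))) \<omega> = CX Y (Suc q) (adj g) \<omega>"
proof (rule CX_cong)
  fix s y assume s: "s \<in> cube (Suc q)" and y: "y \<in> topspace Y"
  have t: "csnd 1 s \<in> cube q" using csnd_cube[of s 1 q] s by simp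
  show "adj (\<lambda>t y u. path_conc (f t y) (g t y) ((1 + u) / 2)) s y = adj g s y"
  \<comment> \<open>At the midpoint the concatenation still uses its first path, so the value is an
    end point of \<open>f\<close>, which has to match the start of \<open>g\<close>.\<close>
  proof (cases "s 0 = 0")
    case True
    then show ?thesis using assms[OF t y] by (simp add: adj_def path_conc_def)
  next
    case False
    then have "0 < s 0" "s 0 \<le> 1" using cubeD[OF s] by (auto simp: order.strict_iff_order)
    then show ?thesis by (simp add: adj_def path_conc_def add_divide_distrib)
  qed
qed

lemma CX_adj_conc_lower:
  "CX Y (Suc q) (adj (\<lambda>t y u. path_conc (f t y) (g t y) (u / 2))) \<omega> = CX Y (Suc q) (adj f) \<omega>"
proof (rule CX_cong)
  fix s :: "nat \<Rightarrow> real" and y assume "s \<in> cube (Suc q)"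
  then have "0 \<le> s 0" "s 0 \<le> 1" by (auto dest: cubeD)
  then show "adj (\<lambda>t y u. path_conc (f t y) (g t y) (u / 2)) s y = adj f s y"
    by (simp add: adj_def path_conc_def)
qed

section \<open>Subdivision and small cubes\<close>

text \<open>\<open>E\<close> selects the coordinates sent to the upper half. Only the coordinates
  below \<open>k\<close> are halved, so that cubes subdivided in their first directions are
  available as intermediate stages.\<close>

definition half :: "nat \<Rightarrow> nat set \<Rightarrow> (nat \<Rightarrow> real) \<Rightarrow> nat \<Rightarrow> real" where
  "half k E t = (\<lambda>j. if j < k then (t j + of_bool (j \<in> E)) / 2 else t j)"

text \<open>A prism between the stages \<open>i\<close> and \<open>i + 1\<close> of the subdivision:
  the coordinates below \<open>i\<close> are already halved, the coordinate \<open>i\<close> runs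
  through the square \<open>div_sq\<close>, and the later ones are unchanged but read one place
  further.\<close>

definition phalf :: "nat \<Rightarrow> nat set \<Rightarrow> (nat \<Rightarrow> real) \<Rightarrow> nat \<Rightarrow> real" where
  "phalf i E t = (\<lambda>j. if j < i then (t j + of_bool (j \<in> E)) / 2
     else if j = i then div_sq (t i) (t (Suc i)) else t (Suc j))"

definition SD :: "'y topology \<Rightarrow> ('y scube \<Rightarrow> int) \<Rightarrow> 'y scube \<Rightarrow> int" where
  "SD Y f c = (if c \<in> nd_cubes Y then \<Sum>E\<in>Pow {..<fst c}. f (pull (fst c) (half (fst c) E) c) else 0)"

text \<open>The homotopy from \<open>SD\<close> to the identity subdivides the coordinates one after the other.\<close>

definition SH :: "'y topology \<Rightarrow> ('y scube \<Rightarrow> int) \<Rightarrow> 'y scube \<Rightarrow> int" where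
  "SH Y f c = (if c \<in> nd_cubes Y then
     \<Sum>i<fst c. (-1) ^ i * (\<Sum>E\<in>Pow {..<i}. f (pull (Suc (fst c)) (phalf i E) c)) else 0)"

lemma half_cube: "k \<le> m \<Longrightarrow> t \<in> cube m \<Longrightarrow> half k E t \<in> cube m"
proof (rule cubeI)
  fix i assume "k \<le> m" "t \<in> cube m" "i < m"
  then show "0 \<le> half k E t i \<and> half k E t i \<le> 1"
    using cubeD(1,2)[of t m i] by (auto simp: half_def of_bool_def)
qed (auto simp: half_def cubeD)

lemma cube_map_half: "k \<le> m \<Longrightarrow> cube_map m m (half k E)"
proof (rule cube_mapI)
  fix j show "continuous_on (cube m) (\<lambda>t. half k E t j)"
    by (cases "j < k") (simp_all add: half_def continuous_intros)
qed (simp_all add: half_cube)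

lemma phalf_cube: "i < m \<Longrightarrow> t \<in> cube (Suc m) \<Longrightarrow> phalf i E t \<in> cube m"
proof (rule cubeI)
  fix j assume "i < m" and t: "t \<in> cube (Suc m)" and "j < m"
  have "0 \<le> div_sq (t i) (t (Suc i)) \<and> div_sq (t i) (t (Suc i)) \<le> 1"
    by (rule div_sq_bounds) (use t in \<open>auto simp: cubeD\<close>)
  then show "0 \<le> phalf i E t j \<and> phalf i E t j \<le> 1"
    using cubeD(1,2)[OF t, of j] cubeD(1,2)[OF t, of "Suc j"] by (auto simp: phalf_def of_bool_def)
qed (auto simp: phalf_def cubeD)

lemma cube_map_phalf: "i < m \<Longrightarrow> cube_map (Suc m) m (phalf i E)"
proof (rule cube_mapI)
  fix j show "continuous_on (cube (Suc m)) (\<lambda>t. phalf i E t j)"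
    by (cases "j < i"; cases "j = i") (simp_all add: phalf_def div_sq_def continuous_intros)
qed (simp_all add: phalf_cube)

lemma degenerate_pull_of:
  assumes c: "\<And>t s. t \<in> cube (fst c) \<Longrightarrow> s \<in> {0..1} \<Longrightarrow> snd c (t(k := s)) = snd c t"
    and \<phi>: "\<And>t. t \<in> cube n \<Longrightarrow> \<phi> t \<in> cube (fst c)" and i: "i < n" and k: "k < fst c"
    and ch: "\<And>t s j. j \<noteq> k \<Longrightarrow> \<phi> (t(i := s)) j = \<phi> t j"
  shows "degenerate_cube (pull n \<phi> c)"
proof (rule degenerate_pull[OF i])
  fix t s assume t: "t \<in> cube n" "s \<in> {0..1::real}"
  have "\<phi> (t(i := s)) = (\<phi> t)(k := \<phi> (t(i := s)) k)" using ch by (auto simp: fun_eq_iff)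
  moreover have "\<phi> (t(i := s)) \<in> cube (fst c)" using t i by (intro \<phi> cube_upd)
  ultimately show "snd c (\<phi> (t(i := s))) = snd c (\<phi> t)"
    using c[OF \<phi>[OF t(1)], of "\<phi> (t(i := s)) k"] cubeD(1,2)[of "\<phi> (t(i := s))" "fst c" k] by auto
qed

lemma SD_supp [simp]: "nd_supp Y (SD Y f)" and SH_supp [simp]: "nd_supp Y (SH Y f)"
  by (auto intro!: nd_suppI simp: SD_def SH_def)

lemma SD_singular:
  assumes f: "nd_supp Y f" and c: "c \<in> singular_cubes Y"
  shows "SD Y f c = (\<Sum>E\<in>Pow {..<fst c}. f (pull (fst c) (half (fst c) E) c))"
proof (cases "c \<in> nd_cubes Y")
  case False
  then have "degenerate_cube c" using c by (auto simp: nd_cubes_def)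
  then obtain k where k: "k < fst c"
      and d: "\<And>t s. t \<in> cube (fst c) \<Longrightarrow> s \<in> {0..1} \<Longrightarrow> snd c (t(k := s)) = snd c t"
    unfolding degenerate_iff by blast
  have "f (pull (fst c) (half (fst c) E) c) = 0" for E
    by (rule nd_suppD(1)[OF f], rule degenerate_pull_of[OF d _ k k]) (auto simp: half_cube, simp add: half_def)
  then show ?thesis using False by (simp add: SD_def)
qed (simp add: SD_def)

lemma SH_singular:
  assumes f: "nd_supp Y f" and c: "c \<in> singular_cubes Y"
  shows "SH Y f c = (\<Sum>i<fst c. (-1) ^ i * (\<Sum>E\<in>Pow {..<i}. f (pull (Suc (fst c)) (phalf i E) c)))"
proof (cases "c \<in> nd_cubes Y")
  case False
  then have "degenerate_cube c" using c by (auto simp: nd_cubes_def)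
  then obtain k where k: "k < fst c"
      and d: "\<And>t s. t \<in> cube (fst c) \<Longrightarrow> s \<in> {0..1} \<Longrightarrow> snd c (t(k := s)) = snd c t"
    unfolding degenerate_iff by blast
  have "f (pull (Suc (fst c)) (phalf i E) c) = 0" if i: "i < fst c" for i E
    by (rule nd_suppD(1)[OF f], rule degenerate_pull_of[OF d, where i = "if k < i then k else Suc k"])
      (use i k in \<open>auto simp: phalf_cube\<close>, auto simp: phalf_def)
  then show ?thesis using False by (simp add: SH_def)
qed (simp add: SH_def)

lemma SD_grade: "f \<in> grade (CU Y) k \<Longrightarrow> SD Y f \<in> grade (CU Y) k"
  by (rule CU_gradeI) (auto simp: SD_def CU_gradeD)

lemma SH_grade: "f \<in> grade (CU Y) (Suc k) \<Longrightarrow> SH Y f \<in> grade (CU Y) k"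
  by (rule CU_gradeI) (auto simp: SH_def CU_gradeD)

lemma half_ins:
  assumes "j < k"
  shows "half k E (ins j e t) = ins j ((e + of_bool (j \<in> E)) / 2) (half (k - 1) {l. skip j l \<in> E} t)"
proof
  fix l show "half k E (ins j e t) l = ins j ((e + of_bool (j \<in> E)) / 2) (half (k - 1) {l. skip j l \<in> E} t) l"
    using assms by (cases l j rule: linorder_cases; cases l; cases k) (simp_all add: half_def ins_def skip_def)
qed

lemma phalf_ins_lt:
  assumes "j < i"
  shows "phalf i E (ins j e t) = ins j ((e + of_bool (j \<in> E)) / 2) (phalf (i - 1) {l. skip j l \<in> E} t)"
proof
  fix l show "phalf i E (ins j e t) l = ins j ((e + of_bool (j \<in> E)) / 2) (phalf (i - 1) {l. skip j l \<in> E} t) l"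
    using assms by (cases l j rule: linorder_cases; cases l i rule: linorder_cases; cases l; cases i)
      (simp_all add: phalf_def ins_def skip_def)
qed

lemma phalf_ins_gt:
  assumes "Suc i < j"
  shows "phalf i E (ins j e t) = ins (j - 1) e (phalf i E t)"
proof
  fix l show "phalf i E (ins j e t) l = ins (j - 1) e (phalf i E t) l"
    using assms by (cases l "j - 1" rule: linorder_cases; cases l i rule: linorder_cases; cases l; cases j)
      (simp_all add: phalf_def ins_def)
qed

lemma phalf_ins_1:
  assumes "E \<subseteq> {..<i}"
  shows "phalf i E (ins i 1 t) = half (Suc i) (insert i E) t"
proof
  fix l show "phalf i E (ins i 1 t) l = half (Suc i) (insert i E) t l"
    by (cases l i rule: linorder_cases) (simp_all add: phalf_def half_def ins_def div_sq_def field_simps)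
qed

lemma phalf_ins_0: "phalf i E (ins i 0 t) = half i E t"
proof
  fix l show "phalf i E (ins i 0 t) l = half i E t l"
    by (cases l i rule: linorder_cases) (simp_all add: phalf_def half_def ins_def div_sq_def)
qed

lemma phalf_ins_Suc_0:
  assumes "E \<subseteq> {..<i}"
  shows "phalf i E (ins (Suc i) 0 t) = half (Suc i) E t"
proof
  fix l
  have "i \<notin> E" using assms by auto
  then show "phalf i E (ins (Suc i) 0 t) l = half (Suc i) E t l"
    by (cases l i rule: linorder_cases) (simp_all add: phalf_def half_def ins_def div_sq_def)
qed

text \<open>The face where two halves meet occurs twice with opposite signs, as the upper face of
  the lower half and as the lower face of the upper half. Pairing each set without \<open>j\<close>
  with the same set enlarged by \<open>j\<close> leaves the outer faces.\<close>

lemma sum_halves: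
  fixes V :: "nat set \<Rightarrow> real \<Rightarrow> int"
  assumes j: "j < k"
  shows "(\<Sum>E\<in>Pow {..<k}. V {l. skip j l \<in> E} ((1 + of_bool (j \<in> E)) / 2) - V {l. skip j l \<in> E} ((0 + of_bool (j \<in> E)) / 2))
     = (\<Sum>L\<in>Pow {..<k - 1}. V L 1 - V L 0)"
proof -
  have im: "skip j ` {..<k - 1} = {..<k} - {j}" using skip_image[of j "k - 1"] j by simp
  have Pow: "Pow {..<k} = (\<lambda>L. skip j ` L) ` Pow {..<k - 1} \<union> (\<lambda>L. insert j (skip j ` L)) ` Pow {..<k - 1}"
  proof -
    have "{..<k} = insert j (skip j ` {..<k - 1})" using im j by auto
    moreover have "Pow (skip j ` S) = (\<lambda>L. skip j ` L) ` Pow S" for S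
      by (rule image_Pow_surj[OF refl, symmetric])
    ultimately show ?thesis by (simp only: Pow_insert image_image)
  qed
  have inj: "inj_on (\<lambda>L. skip j ` L) S" for S
    using inj_skip[of j] by (simp add: inj_on_def inj_image_eq_iff)
  have nj: "j \<notin> skip j ` L" for L by (auto simp: skip_def)
  have nj': "skip j l \<noteq> j" for l by (auto simp: skip_def)
  have ne: "skip j ` L \<noteq> insert j S" for L S using nj[of L] by (metis insertI1)
  have inj': "inj_on (\<lambda>L. insert j (skip j ` L)) S" for S
    using inj nj by (auto simp: inj_on_def) (metis insert_ident inj_image_eq_iff inj_skip nj)+
  have down: "{l. skip j l \<in> skip j ` L} = L" "{l. skip j l \<in> insert j (skip j ` L)} = L" for L
    using inj_skip[of j] by (auto simp: inj_image_mem_iff) (auto simp: skip_def split: if_splits)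
  define W where "W E = V {l. skip j l \<in> E} ((1 + of_bool (j \<in> E)) / 2) - V {l. skip j l \<in> E} ((0 + of_bool (j \<in> E)) / 2)" for E
  have "sum W (Pow {..<k}) = (\<Sum>L\<in>Pow {..<k - 1}. W (skip j ` L)) + (\<Sum>L\<in>Pow {..<k - 1}. W (insert j (skip j ` L)))"
    unfolding Pow using ne by (subst sum.union_disjoint) (auto simp: sum.reindex inj inj')
  also have "\<dots> = (\<Sum>L\<in>Pow {..<k - 1}. V L 1 - V L 0)"
    by (simp add: W_def down nj nj' sum.distrib[symmetric])
  finally show ?thesis by (simp add: W_def)
qed

lemma pull_pull_map: "cube_map k l \<psi> \<Longrightarrow> pull k \<psi> (pull l \<phi> c) = pull k (\<lambda>t. \<phi> (\<psi> t)) c"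
  by (rule pull_pull) (rule cube_mapD)

lemma SD_codiff:
  assumes f: "nd_supp Y f"
  shows "CU_codiff Y (SD Y f) = SD Y (CU_codiff Y f)"
proof (rule nd_supp_eqI[of Y])
  fix c assume "c \<in> nd_cubes Y"
  then have c: "c \<in> singular_cubes Y" by (simp add: nd_cubes_def)
  show "CU_codiff Y (SD Y f) c = SD Y (CU_codiff Y f) c"
  proof (cases "fst c")
    case 0
    then show ?thesis using c by (simp add: CU_codiff_singular[OF _ c] SD_singular[OF CU_codiff_supp c] CU_codiff_singular[OF f] pull_singular cube_map_half)
  next
    case (Suc m)
    define V where "V i L x = f (pull m (\<lambda>t. ins i x (half m L t)) c)" for i L x
    have 1: "SD Y f (pull m (ins i e) c) = (\<Sum>L\<in>Pow {..<m}. V i L e)" if "i < Suc m" "e \<in> {0..1}" for i e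
      using that Suc by (simp add: SD_singular[OF f face_singular[OF c]] pull_pull_map[OF cube_map_half] V_def)
    have 2: "CU_codiff Y f (pull (Suc m) (half (Suc m) E) c) = (\<Sum>i<Suc m. (-1) ^ (i + 1) *
        (V i {l. skip i l \<in> E} ((1 + of_bool (i \<in> E)) / 2) - V i {l. skip i l \<in> E} ((0 + of_bool (i \<in> E)) / 2)))" for E
    proof -
      have s: "pull (Suc m) (half (Suc m) E) c \<in> singular_cubes Y"
        using c Suc by (intro pull_singular) (auto intro: cube_map_half)
      have "pull m (ins i e) (pull (Suc m) (half (Suc m) E) c)
          = pull m (\<lambda>t. ins i ((e + of_bool (i \<in> E)) / 2) (half m {l. skip i l \<in> E} t)) c"
        if "i < Suc m" "e \<in> {0..1}" for i e
        using that by (simp add: pull_pull_map[OF cube_map_ins] half_ins)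
      then show ?thesis
        unfolding CU_codiff_singular[OF f s] fst_pull V_def by (intro sum.cong) auto
    qed
    have "SD Y (CU_codiff Y f) c = (\<Sum>E\<in>Pow {..<Suc m}. \<Sum>i<Suc m. (-1) ^ (i + 1) *
        (V i {l. skip i l \<in> E} ((1 + of_bool (i \<in> E)) / 2) - V i {l. skip i l \<in> E} ((0 + of_bool (i \<in> E)) / 2)))"
      unfolding SD_singular[OF CU_codiff_supp c] Suc 2 ..
    also have "\<dots> = (\<Sum>i<Suc m. (-1) ^ (i + 1) * (\<Sum>E\<in>Pow {..<Suc m}.
        (V i {l. skip i l \<in> E} ((1 + of_bool (i \<in> E)) / 2) - V i {l. skip i l \<in> E} ((0 + of_bool (i \<in> E)) / 2))))"
      by (subst sum.swap) (simp only: sum_distrib_left)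
    also have "\<dots> = (\<Sum>i<Suc m. (-1) ^ (i + 1) * (\<Sum>L\<in>Pow {..<m}. V i L 1 - V i L 0))"
      using sum_halves[where k = "Suc m"] by (intro sum.cong) auto
    also have "\<dots> = CU_codiff Y (SD Y f) c"
      unfolding CU_codiff_singular[OF SD_supp c] Suc
      by (intro sum.cong) (auto simp: 1 sum_subtractf)
    finally show ?thesis ..
  qed
qed simp_all

text \<open>The faces of the prism \<open>phalf i\<close> in the directions \<open>i\<close> and
  \<open>i + 1\<close> telescope between successive stages of the subdivision. The other faces
  reduce to prisms over the faces of \<open>c\<close> and are cancelled by the differential of
  \<open>SH Y f\<close>.\<close>

lemma SH_homotopy:
  assumes f: "nd_supp Y f"
  shows "CU_codiff Y (SH Y f) + SH Y (CU_codiff Y f) = f - SD Y f"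
proof (rule nd_supp_eqI[of Y])
  fix c assume "c \<in> nd_cubes Y"
  then have c: "c \<in> singular_cubes Y" by (simp add: nd_cubes_def)
  define M where "M = fst c"
  \<comment> \<open>The stage with the first \<open>i\<close> directions subdivided; it runs from
    \<open>f\<close> to \<open>SD Y f\<close>.\<close>
  define B where "B i = (\<Sum>E\<in>Pow {..<i}. f (pull M (half i E) c))" for i
  have B0: "B 0 = f c" using pull_id[OF c, of "half 0 {}"] by (simp add: B_def M_def half_def)
  have BM: "B M = SD Y f c" by (simp add: B_def M_def SD_singular[OF f c])
  define U where "U i E j e = f (pull M (\<lambda>t. phalf i E (ins j e t)) c)" for i E j e
  define u where "u i j = (\<Sum>E\<in>Pow {..<i}. U i E j 1 - U i E j 0)" for i j
  have 1: "SH Y (CU_codiff Y f) c = (\<Sum>i<M. \<Sum>j<Suc M. (-1) ^ (i + j + 1) * u i j)"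
  proof -
    have "CU_codiff Y f (pull (Suc M) (phalf i E) c) = (\<Sum>j<Suc M. (-1) ^ (j + 1) * (U i E j 1 - U i E j 0))"
      if i: "i < M" for i E
    proof -
      have s: "pull (Suc M) (phalf i E) c \<in> singular_cubes Y"
        using c i by (intro pull_singular) (auto intro: cube_map_phalf simp: M_def)
      show ?thesis unfolding CU_codiff_singular[OF f s]
        by (intro sum.cong) (auto simp: U_def pull_pull_map[OF cube_map_ins])
    qed
    then have "SH Y (CU_codiff Y f) c = (\<Sum>i<M. (-1) ^ i * (\<Sum>E\<in>Pow {..<i}. \<Sum>j<Suc M. (-1) ^ (j + 1) * (U i E j 1 - U i E j 0)))"
      unfolding SH_singular[OF CU_codiff_supp c] M_def[symmetric] by (intro sum.cong) auto
    also have "\<dots> = (\<Sum>i<M. \<Sum>j<Suc M. (-1) ^ (i + j + 1) * u i j)"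
      unfolding u_def by (subst sum.swap) (simp only: sum_distrib_left power_add mult.assoc)
    finally show ?thesis .
  qed
  have mid: "(-1) ^ (i + i + 1) * u i i + (-1) ^ (i + Suc i + 1) * u i (Suc i) = B i - B (Suc i)" if i: "i < M" for i
  proof -
    have e1: "U i E i 1 = f (pull M (half (Suc i) (insert i E)) c)" if "E \<subseteq> {..<i}" for E
      using that by (simp add: U_def phalf_ins_1)
    have e2: "U i E i 0 = f (pull M (half i E) c)" for E
      by (simp add: U_def phalf_ins_0)
    have e3: "U i E (Suc i) 0 = f (pull M (half (Suc i) E) c)" if "E \<subseteq> {..<i}" for E
      using that by (simp add: U_def phalf_ins_Suc_0)
    \<comment> \<open>The edge of \<open>div_sq\<close> with second coordinate 1 is constant, so
      this face does not depend on the coordinate \<open>i\<close>.\<close>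
    have e4: "U i E (Suc i) 1 = 0" for E
      unfolding U_def
      by (rule nd_suppD(1)[OF f], rule degenerate_pull[OF i])
        (rule arg_cong[of _ _ "snd c"], auto simp: phalf_def ins_def div_sq_def)
    have Pow: "Pow {..<Suc i} = Pow {..<i} \<union> insert i ` Pow {..<i}" by (simp add: lessThan_Suc Pow_insert)
    have inj: "inj_on (insert i) (Pow {..<i})"
      by (rule inj_onI) (metis PowD insert_ident lessThan_iff less_irrefl subsetD)
    have "B (Suc i) = (\<Sum>E\<in>Pow {..<i}. f (pull M (half (Suc i) E) c)) + (\<Sum>E\<in>Pow {..<i}. f (pull M (half (Suc i) (insert i E)) c))"
      unfolding B_def Pow by (subst sum.union_disjoint) (auto simp: sum.reindex[OF inj])
    then show ?thesis
      by (simp add: u_def e1 e2 e3 e4 B_def sum_subtractf sum_negf)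
  qed
  show "(CU_codiff Y (SH Y f) + SH Y (CU_codiff Y f)) c = (f - SD Y f) c"
  proof (cases M)
    case 0
    then show ?thesis using 1 B0 BM by (simp add: CU_codiff_singular[OF _ c] M_def)
  next
    case (Suc m)
    define K where "K i j e = (\<Sum>L\<in>Pow {..<i}. f (pull M (phalf i L) (pull m (ins j e) c)))" for i j e
    define k where "k i j = (-1) ^ (i + j) * (K i j 1 - K i j 0)" for i j :: nat
    have K: "K i j e = (\<Sum>L\<in>Pow {..<i}. f (pull M (\<lambda>t. ins j e (phalf i L t)) c))" if "i < m" for i j e
      using that Suc by (simp add: K_def pull_pull_map[OF cube_map_phalf])
    \<comment> \<open>The direction \<open>j\<close> is already halved here: inner faces cancel by
      \<open>sum_halves\<close>, and deleting the direction lowers the index of the prism by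
      one.\<close>
    have lt: "(-1) ^ (i + j + 1) * u i j = k (i - 1) j" if "j < i" "i < M" for i j
    proof -
      define V where "V L x = f (pull M (\<lambda>t. ins j x (phalf (i - 1) L t)) c)" for L x
      have "u i j = (\<Sum>E\<in>Pow {..<i}. V {l. skip j l \<in> E} ((1 + of_bool (j \<in> E)) / 2) - V {l. skip j l \<in> E} ((0 + of_bool (j \<in> E)) / 2))"
        using that by (simp add: u_def U_def V_def phalf_ins_lt)
      also have "\<dots> = (\<Sum>L\<in>Pow {..<i - 1}. V L 1 - V L 0)" using that by (intro sum_halves)
      also have "\<dots> = K (i - 1) j 1 - K (i - 1) j 0"
        using that Suc by (simp add: K V_def sum_subtractf)
      finally show ?thesis using that by (cases i) (simp_all add: k_def)
    qed
    have gt: "(-1) ^ (i + j + 1) * u i j = k i (j - 1)" if "Suc i < j" "j < Suc M" for i j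
      using that Suc by (cases j) (simp_all add: k_def u_def U_def K phalf_ins_gt sum_subtractf)
    have D: "CU_codiff Y (SH Y f) c = - (\<Sum>(i, j)\<in>{..<m} \<times> {..<M}. k i j)"
    proof -
      have "SH Y f (pull m (ins j e) c) = (\<Sum>i<m. (-1) ^ i * K i j e)" if "j < M" "e \<in> {0..1}" for j e
        using that Suc M_def by (simp add: SH_singular[OF f face_singular[OF c]] K_def)
      then have "CU_codiff Y (SH Y f) c = (\<Sum>j<M. (-1) ^ (j + 1) * ((\<Sum>i<m. (-1) ^ i * K i j 1) - (\<Sum>i<m. (-1) ^ i * K i j 0)))"
        unfolding CU_codiff_singular[OF SH_supp c] M_def[symmetric] using Suc by (intro sum.cong) auto
      also have "\<dots> = (\<Sum>j<M. \<Sum>i<m. - k i j)"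
        unfolding sum_subtractf[symmetric] sum_distrib_left k_def
        by (intro sum.cong refl) (simp add: power_add algebra_simps)
      also have "\<dots> = - (\<Sum>i<m. \<Sum>j<M. k i j)"
        by (subst sum.swap) (simp add: sum_negf)
      finally show ?thesis by (simp add: sum.cartesian_product)
    qed
    define w where "w = (\<lambda>(i, j). (-1) ^ (i + j + 1) * u i j)"
    have wlt: "w (i, j) = k (i - 1) j" if "j < i" "i < M" for i j
      using lt[OF that] by (simp only: w_def prod.case)
    have wgt: "w (i, j) = k i (j - 1)" if "Suc i < j" "j < Suc M" for i j
      using gt[OF that] by (simp only: w_def prod.case)
    have "SH Y (CU_codiff Y f) c = sum w ({..<M} \<times> {..<Suc M})"
      unfolding 1 w_def by (simp only: sum.cartesian_product)
    also have "{..<M} \<times> {..<Suc M} = {(i, j). j < i \<and> i < M} \<union> ({(i, j). i < M \<and> (j = i \<or> j = Suc i)} \<union> {(i, j). Suc i < j \<and> j < Suc M})"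
      by auto
    also have "sum w \<dots> = sum w {(i, j). j < i \<and> i < M} + (sum w {(i, j). i < M \<and> (j = i \<or> j = Suc i)} + sum w {(i, j). Suc i < j \<and> j < Suc M})"
    proof -
      have fin: "finite {(i, j). j < i \<and> i < M}" "finite {(i, j). i < M \<and> (j = i \<or> j = Suc i)}" "finite {(i, j). Suc i < j \<and> j < Suc M}"
        by (rule finite_subset[of _ "{..<M} \<times> {..<Suc M}"]; auto)+
      have "sum w ({(i, j). i < M \<and> (j = i \<or> j = Suc i)} \<union> {(i, j). Suc i < j \<and> j < Suc M})
          = sum w {(i, j). i < M \<and> (j = i \<or> j = Suc i)} + sum w {(i, j). Suc i < j \<and> j < Suc M}"
        by (rule sum.union_disjoint[OF fin(2,3)]) (rule equals0I, clarsimp)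
      moreover have "sum w ({(i, j). j < i \<and> i < M} \<union> ({(i, j). i < M \<and> (j = i \<or> j = Suc i)} \<union> {(i, j). Suc i < j \<and> j < Suc M}))
          = sum w {(i, j). j < i \<and> i < M} + sum w ({(i, j). i < M \<and> (j = i \<or> j = Suc i)} \<union> {(i, j). Suc i < j \<and> j < Suc M})"
        by (rule sum.union_disjoint[OF fin(1) finite_UnI[OF fin(2,3)]]) (rule equals0I, clarsimp)
      ultimately show ?thesis by simp
    qed
    also have "sum w {(i, j). j < i \<and> i < M} = (\<Sum>(i, j)\<in>{(i, j). j \<le> i \<and> i < m}. k i j)"
      by (rule sum.reindex_bij_witness[of _ "\<lambda>(i, j). (Suc i, j)" "\<lambda>(i, j). (i - 1, j)"])
        (use Suc in \<open>auto simp: wlt\<close>)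
    also have "sum w {(i, j). Suc i < j \<and> j < Suc M} = (\<Sum>(i, j)\<in>{(i, j). i < j \<and> j < M}. k i j)"
      by (rule sum.reindex_bij_witness[of _ "\<lambda>(i, j). (i, Suc j)" "\<lambda>(i, j). (i, j - 1)"])
        (auto simp: wgt)
    also have "sum w {(i, j). i < M \<and> (j = i \<or> j = Suc i)} = (\<Sum>i<M. B i - B (Suc i))"
    proof -
      have "{(i, j). i < M \<and> (j = i \<or> j = Suc i)} = (\<lambda>i. (i, i)) ` {..<M} \<union> (\<lambda>i. (i, Suc i)) ` {..<M}"
        by auto
      then have "sum w {(i, j). i < M \<and> (j = i \<or> j = Suc i)} = sum w ((\<lambda>i. (i, i)) ` {..<M} \<union> (\<lambda>i. (i, Suc i)) ` {..<M})"
        by (rule arg_cong)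
      also have "\<dots> = sum w ((\<lambda>i. (i, i)) ` {..<M}) + sum w ((\<lambda>i. (i, Suc i)) ` {..<M})"
      proof (rule sum.union_disjoint)
        show "(\<lambda>i. (i, i)) ` {..<M} \<inter> (\<lambda>i. (i, Suc i)) ` {..<M} = {}"
        proof (rule equals0I)
          fix z assume "z \<in> (\<lambda>i. (i, i)) ` {..<M} \<inter> (\<lambda>i. (i, Suc i)) ` {..<M}"
          then obtain i j where "z = (i, i)" "z = (j, Suc j)" by blast
          then have "i = j" "i = Suc j" by auto
          then show False using n_not_Suc_n[of j] by (rule_tac notE) simp
        qed
      qed simp_all
      also have "\<dots> = (\<Sum>i<M. w (i, i)) + (\<Sum>i<M. w (i, Suc i))"
        by (simp add: sum.reindex inj_on_def)
      also have "\<dots> = (\<Sum>i<M. B i - B (Suc i))"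
        unfolding sum.distrib[symmetric] using mid by (intro sum.cong) (auto simp: w_def)
      finally show ?thesis .
    qed
    also have "(\<Sum>i<M. B i - B (Suc i)) = f c - SD Y f c"
      using sum_lessThan_telescope'[of B M] B0 BM by simp
    finally have S: "SH Y (CU_codiff Y f) c = f c - SD Y f c
        + ((\<Sum>(i, j)\<in>{(i, j). j \<le> i \<and> i < m}. k i j) + (\<Sum>(i, j)\<in>{(i, j). i < j \<and> j < M}. k i j))"
      by simp
    have "(\<Sum>(i, j)\<in>{..<m} \<times> {..<M}. k i j)
        = (\<Sum>(i, j)\<in>{(i, j). j \<le> i \<and> i < m} \<union> {(i, j). i < j \<and> j < M}. k i j)"
      using Suc by (intro sum.cong) auto
    also have "\<dots> = (\<Sum>(i, j)\<in>{(i, j). j \<le> i \<and> i < m}. k i j) + (\<Sum>(i, j)\<in>{(i, j). i < j \<and> j < M}. k i j)"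
    proof (rule sum.union_disjoint)
      show "finite {(i, j). j \<le> i \<and> i < m}" "finite {(i, j). i < j \<and> j < M}"
        by (rule finite_subset[of _ "{..<M} \<times> {..<M}"]; use Suc in auto)+
    qed auto
    finally show ?thesis using S D by simp
  qed
qed (simp_all add: nd_supp_add nd_supp_diff f)

text \<open>A Lebesgue condition in the supremum distance of the coordinates. Quantifying over
  subsets rather than points makes it pass directly to reparametrized cubes; for e = 1 it says that
  the whole cube lies in \<open>U\<close> or in \<open>V\<close>.\<close>

definition fine :: "'y set \<Rightarrow> 'y set \<Rightarrow> 'y scube \<Rightarrow> real \<Rightarrow> bool" where
  "fine U V c e \<longleftrightarrow> (\<forall>S \<subseteq> cube (fst c). (\<forall>t\<in>S. \<forall>t'\<in>S. \<forall>j. \<bar>t j - t' j\<bar> \<le> e) \<longrightarrow>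
     snd c ` S \<subseteq> U \<or> snd c ` S \<subseteq> V)"

lemma fine_mono: "fine U V c e \<Longrightarrow> e' \<le> e \<Longrightarrow> fine U V c e'"
  unfolding fine_def by (meson order_trans)

lemma fine_pull:
  assumes "fine U V c e" and \<phi>: "\<And>t. t \<in> cube n \<Longrightarrow> \<phi> t \<in> cube (fst c)"
    and "\<And>S t t' j. S \<subseteq> cube n \<Longrightarrow> (\<And>t t' j. t \<in> S \<Longrightarrow> t' \<in> S \<Longrightarrow> \<bar>t j - t' j\<bar> \<le> e') \<Longrightarrow> t \<in> S \<Longrightarrow> t' \<in> S \<Longrightarrow> \<bar>\<phi> t j - \<phi> t' j\<bar> \<le> e"
  shows "fine U V (pull n \<phi> c) e'"
  unfolding fine_def fst_pull
proof (intro allI impI)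
  fix S assume S: "S \<subseteq> cube n" "\<forall>t\<in>S. \<forall>t'\<in>S. \<forall>j. \<bar>t j - t' j\<bar> \<le> e'"
  have "snd c ` \<phi> ` S \<subseteq> U \<or> snd c ` \<phi> ` S \<subseteq> V"
  proof -
    have "\<phi> ` S \<subseteq> cube (fst c)" using S \<phi> by auto
    moreover have "\<bar>\<phi> t j - \<phi> t' j\<bar> \<le> e" if "t \<in> S" "t' \<in> S" for t t' j
      by (rule assms(3)[OF S(1)]) (use that S(2) in auto)
    then have "\<forall>t\<in>\<phi> ` S. \<forall>t'\<in>\<phi> ` S. \<forall>j. \<bar>t j - t' j\<bar> \<le> e" by simp
    ultimately show ?thesis using assms(1) unfolding fine_def by simp
  qed
  moreover have "snd (pull n \<phi> c) ` S = snd c ` \<phi> ` S"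
    unfolding image_image by (rule image_cong) (use S(1) in \<open>auto simp: pull_def\<close>)
  ultimately show "snd (pull n \<phi> c) ` S \<subseteq> U \<or> snd (pull n \<phi> c) ` S \<subseteq> V" by simp
qed

lemma fine_1: "fine U V c 1 \<Longrightarrow> snd c ` cube (fst c) \<subseteq> U \<or> snd c ` cube (fst c) \<subseteq> V"
proof -
  have "\<bar>t j - t' j\<bar> \<le> 1" if "t \<in> cube m" "t' \<in> cube m" for t t' j and m
    using cubeD(1,2)[OF that(1), of j] cubeD(1,2)[OF that(2), of j] by linarith
  then show "fine U V c 1 \<Longrightarrow> ?thesis" unfolding fine_def by blast
qed

lemma compact_cube: "compact (cube m)"
proof -
  have "cube m = PiE UNIV (\<lambda>i. if i < m then {0..1} else {0})"
  proof (intro equalityI subsetI)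
    fix t :: "nat \<Rightarrow> real" assume t: "t \<in> PiE UNIV (\<lambda>i. if i < m then {0..1} else {0})"
    have "t i \<in> (if i < m then {0..1} else {0})" for i using PiE_mem[OF t UNIV_I, of i] .
    then show "t \<in> cube m" by (intro cubeI) (metis atLeastAtMost_iff, metis not_less singletonD)
  qed (auto simp: cubeD)
  moreover have "compactin (product_topology (\<lambda>i. euclidean) UNIV) (PiE UNIV (\<lambda>i. if i < m then {0..1::real} else {0}))"
    unfolding compactin_PiE by auto
  ultimately show ?thesis by (simp add: euclidean_product_topology)
qed

lemma Lebesgue_cube:
  assumes c: "c \<in> singular_cubes Y" and U: "openin Y U" and V: "openin Y V" and UV: "topspace Y \<subseteq> U \<union> V"
  shows "\<exists>e>0. fine U V c e"
proof -
  let ?Q = "cube (fst c)"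
  have T: "continuous_map (top_of_set ?Q) Y (snd c)" using c by (simp add: singular_cubes_iff)
  have "\<exists>A. open A \<and> {t \<in> ?Q. snd c t \<in> W} = ?Q \<inter> A" if "openin Y W" for W
    using T that by (auto simp: continuous_map_def openin_open)
  note ex = this
  obtain A where A: "open A" "{t \<in> ?Q. snd c t \<in> U} = ?Q \<inter> A" using ex[OF U] by blast
  obtain B where B: "open B" "{t \<in> ?Q. snd c t \<in> V} = ?Q \<inter> B" using ex[OF V] by blast
  have Q: "?Q \<subseteq> A \<union> B" using UV A B singular_cubes_topspace[OF c] by blast
  obtain \<delta> where \<delta>: "\<delta> > 0" "\<And>S. S \<subseteq> ?Q \<Longrightarrow> diameter S < \<delta> \<Longrightarrow> S \<subseteq> A \<or> S \<subseteq> B"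
  proof (rule Lebesgue_number_lemma[OF compact_cube[of "fst c"], of "{A, B}"])
    show "open W" if "W \<in> {A, B}" for W using that A(1) B(1) by auto
      show "\<And>\<delta>. 0 < \<delta> \<Longrightarrow> (\<And>S. S \<subseteq> ?Q \<Longrightarrow> diameter S < \<delta> \<Longrightarrow> \<exists>B\<in>{A, B}. S \<subseteq> B) \<Longrightarrow> thesis"
      using that by simp
  qed (use Q in auto)
  \<comment> \<open>The metric on functions weighs the coordinates: a distance is at most twice the
    maximum over the first terms plus the tail (1/2)^N. Coordinate differences up to \<delta>/8 thus
    give distances up to \<delta>/2, below the Lebesgue number.\<close>
  obtain N where N: "(1/2::real) ^ N < \<delta> / 4" using \<delta>(1) real_arch_pow_inv[of "\<delta> / 4" "1/2"] by auto
  have "fine U V c (\<delta> / 8)"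
    unfolding fine_def
  proof (intro allI impI)
    fix S assume S: "S \<subseteq> ?Q" "\<forall>t\<in>S. \<forall>t'\<in>S. \<forall>j. \<bar>t j - t' j\<bar> \<le> \<delta> / 8"
    have "dist t t' \<le> \<delta> / 2" if t: "t \<in> S" "t' \<in> S" for t t'
    proof -
      have "Max {dist (t (from_nat n)) (t' (from_nat n)) |n. n \<le> N} \<le> \<delta> / 8"
        using S(2) t by (subst Max_le_iff) (auto simp: dist_real_def)
      then show ?thesis using dist_fun_le_dist_first_terms[of t t' N] N by linarith
    qed
    note * = this
    have "diameter S \<le> \<delta> / 2"
    proof (cases "S = {}")
      case False
      have "(SUP (x, y)\<in>S \<times> S. dist x y) \<le> \<delta> / 2"
        by (rule cSUP_least) (use False * in auto)
      then show ?thesis using False by (simp add: diameter_def)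
    qed (use \<delta>(1) in simp)
    then have "S \<subseteq> A \<or> S \<subseteq> B" using \<delta> S(1) by (intro \<delta>(2)) auto
    then show "snd c ` S \<subseteq> U \<or> snd c ` S \<subseteq> V" using A B S(1) by blast
  qed
  then show ?thesis using \<delta>(1) by (intro exI[of _ "\<delta> / 8"]) auto
qed

text \<open>Halving a cube doubles the size at which it is fine, so \<open>r\<close> subdivisions
  bring (1/2)^r up to 1, where \<open>h\<close> vanishes.\<close>

lemma SD_pow_fine:
  assumes h: "nd_supp Y h"
    and small: "\<And>c. c \<in> singular_cubes Y \<Longrightarrow> snd c ` cube (fst c) \<subseteq> U \<or> snd c ` cube (fst c) \<subseteq> V \<Longrightarrow> h c = 0"
  shows "c \<in> singular_cubes Y \<Longrightarrow> fine U V c ((1/2) ^ r) \<Longrightarrow> (SD Y ^^ r) h c = 0"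
proof (induction r arbitrary: c)
  case 0
  then show ?case using fine_1[of U V c] small by simp
next
  case (Suc r)
  have s: "nd_supp Y ((SD Y ^^ r) h)" using h by (cases r) auto
  have "(SD Y ^^ r) h (pull (fst c) (half (fst c) E) c) = 0" for E
  proof (rule Suc.IH)
    show "pull (fst c) (half (fst c) E) c \<in> singular_cubes Y"
      using Suc.prems(1) by (intro pull_singular) (auto intro: cube_map_half)
    show "fine U V (pull (fst c) (half (fst c) E) c) ((1/2) ^ r)"
    proof (rule fine_pull[OF Suc.prems(2)])
      fix S t t' j assume S: "S \<subseteq> cube (fst c)" and d: "\<And>t t' j. t \<in> S \<Longrightarrow> t' \<in> S \<Longrightarrow> \<bar>t j - t' j\<bar> \<le> (1/2) ^ r"
        and t: "t \<in> S" "t' \<in> S"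
      show "\<bar>half (fst c) E t j - half (fst c) E t' j\<bar> \<le> (1/2) ^ Suc r"
      proof (cases "j < fst c")
        case True
        then have "half (fst c) E t j - half (fst c) E t' j = (t j - t' j) / 2"
          by (simp add: half_def diff_divide_distrib add_divide_distrib)
        then have "\<bar>half (fst c) E t j - half (fst c) E t' j\<bar> = \<bar>t j - t' j\<bar> / 2" by (simp only: abs_divide)
        then show ?thesis using d[OF t, of j] by simp
      next
        case False
        then have "t j = 0" "t' j = 0" using S t cubeD(3) by fastforce+
        then show ?thesis using False by (simp add: half_def)
      qed
    qed (simp add: half_cube)
  qed
  then show ?case by (simp add: SD_singular[OF s Suc.prems(1)])
qed

lemma SD_pow_supp: "nd_supp Y h \<Longrightarrow> nd_supp Y ((SD Y ^^ r) h)"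
  by (cases r) auto

lemma SD_pow_codiff: "nd_supp Y h \<Longrightarrow> CU_codiff Y ((SD Y ^^ r) h) = (SD Y ^^ r) (CU_codiff Y h)"
  by (induction r) (simp_all add: SD_codiff SD_pow_supp)

lemma SD_diff: "SD Y (f - g) = SD Y f - SD Y g"
  by (auto simp: SD_def fun_eq_iff sum_subtractf)

lemma SD_pow_diff: "(SD Y ^^ r) (f - g) = (SD Y ^^ r) f - (SD Y ^^ r) g"
  by (induction r) (simp_all only: funpow.simps comp_apply id_apply SD_diff)

lemma CU_codiff_sum: "CU_codiff Y (\<Sum>r\<in>R. f r) = (\<Sum>r\<in>R. CU_codiff Y (f r))"
  by (induction R rule: infinite_finite_induct)
    (simp_all only: sum.infinite sum.empty sum.insert CU_codiff_0 CU_codiff_add not_False_eq_True)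

lemma sum_cochain_apply: "(\<Sum>r\<in>R. f r :: 'y scube \<Rightarrow> int) c = (\<Sum>r\<in>R. f r c)"
  by (induction R rule: infinite_finite_induct) simp_all

text \<open>The primitive is the sum of \<open>SH f\<close> over all iterated subdivisions, which is finite at each cube.\<close>

lemma small_cochain_coboundary:
  assumes f: "f \<in> grade (CU Y) (Suc k)" "CU_codiff Y f = 0"
    and small: "\<And>c. c \<in> singular_cubes Y \<Longrightarrow> snd c ` cube (fst c) \<subseteq> U \<or> snd c ` cube (fst c) \<subseteq> V \<Longrightarrow> f c = 0"
    and U: "openin Y U" and V: "openin Y V" and UV: "topspace Y \<subseteq> U \<union> V"
  shows "\<exists>g \<in> grade (CU Y) k. CU_codiff Y g = f"
proof -
  have fs: "nd_supp Y f" using f by (simp add: CU_grade)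
  define h where "h r = (SD Y ^^ r) (SH Y f)" for r
  have hs: "nd_supp Y (h r)" for r by (simp add: h_def SD_pow_supp)
  \<comment> \<open>The prisms over a cube have their images inside the image of the cube, so
    \<open>SH\<close> preserves vanishing on small cubes. This is what makes the sum of the iterates
    finite at each cube.\<close>
  have smallSH: "SH Y f c = 0" if c: "c \<in> singular_cubes Y" and s: "snd c ` cube (fst c) \<subseteq> U \<or> snd c ` cube (fst c) \<subseteq> V" for c
  proof -
    have "f (pull (Suc (fst c)) (phalf i E) c) = 0" if i: "i < fst c" for i E
    proof (rule small)
      show "pull (Suc (fst c)) (phalf i E) c \<in> singular_cubes Y"
        using c i by (intro pull_singular) (auto intro: cube_map_phalf)
      show "snd (pull (Suc (fst c)) (phalf i E) c) ` cube (fst (pull (Suc (fst c)) (phalf i E) c)) \<subseteq> U \<or>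
         snd (pull (Suc (fst c)) (phalf i E) c) ` cube (fst (pull (Suc (fst c)) (phalf i E) c)) \<subseteq> V"
        using s phalf_cube[OF i] by (auto simp: pull_def image_subset_iff)
    qed
    then show ?thesis using c by (simp add: SH_singular[OF fs])
  qed
  have h0: "h r c = 0" if "c \<in> singular_cubes Y" "fine U V c ((1/2) ^ r)" for r c
    unfolding h_def by (rule SD_pow_fine[where U = U and V = V]) (use smallSH that in auto)
  have half_mono: "(1/2::real) ^ r \<le> (1/2) ^ R" if "R \<le> r" for r R :: nat
    using that by (intro power_decreasing) auto
  have ex: "\<exists>R. fine U V c ((1/2) ^ R)" if c: "c \<in> singular_cubes Y" for c
  proof -
    obtain e where e: "e > 0" "fine U V c e" using Lebesgue_cube[OF c U V UV] by blast
    then obtain R where "(1/2::real) ^ R < e" using real_arch_pow_inv[of e "1/2"] by auto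
    then show ?thesis using fine_mono[OF e(2)] by (intro exI[of _ R]) auto
  qed
  define g where "g c = (\<Sum>r | h r c \<noteq> 0. h r c)" for c
  have g: "g c = (\<Sum>r<R. h r c)" if c: "c \<in> singular_cubes Y" "fine U V c ((1/2) ^ R)" for c R
  proof -
    have "{r. h r c \<noteq> 0} \<subseteq> {..<R}"
    proof
      fix r assume "r \<in> {r. h r c \<noteq> 0}"
      then have "\<not> R \<le> r" using h0[OF c(1) fine_mono[OF c(2) half_mono]] by blast
      then show "r \<in> {..<R}" by simp
    qed
    then show ?thesis unfolding g_def by (intro sum.mono_neutral_left) auto
  qed
  have hg: "h r \<in> grade (CU Y) k" for r
    unfolding h_def by (induction r) (use f in \<open>auto intro: SH_grade SD_grade\<close>)
  have gg: "g \<in> grade (CU Y) k"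
  proof (rule CU_gradeI)
    show "nd_supp Y g"
    proof (rule nd_suppI)
      fix c assume "c \<notin> nd_cubes Y"
      then have "h r c = 0" for r using hs[of r] unfolding nd_supp_def by blast
      then show "g c = 0" by (simp add: g_def)
    qed
    show "g c = 0" if "fst c \<noteq> k" for c
      using CU_gradeD[OF hg that] by (simp add: g_def)
  qed
  have "CU_codiff Y g = f"
  proof (rule nd_supp_eqI[OF CU_codiff_supp fs])
    fix c assume "c \<in> nd_cubes Y"
    then have c: "c \<in> singular_cubes Y" by (simp add: nd_cubes_def)
    obtain R where R: "fine U V c ((1/2) ^ R)" using ex[OF c] by blast
    \<comment> \<open>Freezing a coordinate does not increase coordinate differences: the faces of
      \<open>c\<close> are as fine as \<open>c\<close>, and one truncation \<open>R\<close> serves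
      for all of them.\<close>
    have gf: "g (pull (fst c - 1) (ins i e) c) = (\<Sum>r<R. h r) (pull (fst c - 1) (ins i e) c)"
      if i: "i < fst c" and e: "e \<in> {0..1}" for i e
    proof -
      obtain m where m: "fst c = Suc m" using i by (cases "fst c") auto
      have "fine U V (pull m (ins i e) c) ((1/2) ^ R)"
      proof (rule fine_pull[OF R])
        show "ins i e t \<in> cube (fst c)" if "t \<in> cube m" for t
          using ins_cube[OF that, of i e] i e m by simp
      qed (auto simp: ins_def)
      then show ?thesis using g[of "pull m (ins i e) c" R] face_singular[OF c m, of i e] i e m by (simp add: sum_cochain_apply)
    qed
    have "CU_codiff Y g c = CU_codiff Y (\<Sum>r<R. h r) c"
      using \<open>c \<in> nd_cubes Y\<close> gf by (auto simp: CU_codiff_def subcube_face simp del: One_nat_def intro!: sum.cong)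
    also have "\<dots> = (\<Sum>r<R. CU_codiff Y (h r)) c" by (simp add: CU_codiff_sum)
    also have "(\<Sum>r<R. CU_codiff Y (h r)) = (\<Sum>r<R. (SD Y ^^ r) f - (SD Y ^^ Suc r) f)"
    proof (rule sum.cong)
      fix r
      have SH0: "SH Y (0 :: 'a scube \<Rightarrow> int) = 0" by (simp add: SH_def fun_eq_iff)
      have "CU_codiff Y (h r) = (SD Y ^^ r) (CU_codiff Y (SH Y f))" by (simp add: h_def SD_pow_codiff)
      also have "CU_codiff Y (SH Y f) = f - SD Y f"
        using SH_homotopy[OF fs] f(2) SH0 by simp
      finally show "CU_codiff Y (h r) = (SD Y ^^ r) f - (SD Y ^^ Suc r) f"
        by (simp only: SD_pow_diff funpow_Suc_right comp_apply)
    qed simp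
    also have "\<dots> = f - (SD Y ^^ R) f"
      using sum_lessThan_telescope'[of "\<lambda>r. (SD Y ^^ r) f" R] by simp
    also have "\<dots> c = f c"
      using SD_pow_fine[OF fs, of U V c R] small c R by simp
    finally show "CU_codiff Y g c = f c" .
  qed
  then show ?thesis using gg by blast
qed

section \<open>Cubical cohomology of punctured space\<close>

lemma singular_cubes_subset:
  "c \<in> singular_cubes (top_of_set A) \<longleftrightarrow>
     continuous_on (cube (fst c)) (snd c) \<and> snd c ` cube (fst c) \<subseteq> A \<and> snd c \<in> extensional (cube (fst c))"
  by (auto simp: singular_cubes_iff)

lemma singular_cubes_mono: "A \<subseteq> B \<Longrightarrow> singular_cubes (top_of_set A) \<subseteq> singular_cubes (top_of_set B)"
  unfolding singular_cubes_subset subset_iff by blast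

lemma nd_cubes_mono: "A \<subseteq> B \<Longrightarrow> nd_cubes (top_of_set A) \<subseteq> nd_cubes (top_of_set B)"
  using singular_cubes_mono[of A B] by (auto simp: nd_cubes_def)

lemma CU_codiff_local:
  assumes "c \<in> nd_cubes Y" "c \<in> nd_cubes Z"
  shows "CU_codiff Y f c = CU_codiff Z f c"
  using assms by (simp add: CU_codiff_def)

lemma CX_identity: "c \<in> nd_cubes Y \<Longrightarrow> CX Y 0 (\<lambda>s y. y) f c = f c"
proof -
  assume c: "c \<in> nd_cubes Y"
  then have "snd c \<in> extensional (cube (fst c))" by (simp add: nd_cubes_def singular_cubes_iff)
  then have "cross 0 (\<lambda>s y. y) c = c" by (cases c) (auto simp: cross_def restrict_def extensional_def)
  then show ?thesis using c by (simp add: CX_def)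
qed

text \<open>Extension by zero makes \<open>k\<close> a cochain on \<open>A\<close>, so
  \<open>a\<close> can be corrected by the differential of \<open>k\<close> until it agrees with
  \<open>b\<close> on common cubes. Subtracting the differential of the glued cochain from
  \<open>f\<close> leaves a cocycle that vanishes on small cubes, and subdivision makes it a
  coboundary.\<close>

lemma Mayer_Vietoris_coboundary:
  assumes f: "f \<in> grade (CU (top_of_set (A \<union> B))) (Suc N)" "CU_codiff (top_of_set (A \<union> B)) f = 0"
    and op: "openin (top_of_set (A \<union> B)) A" "openin (top_of_set (A \<union> B)) B"
    and a: "a \<in> grade (CU (top_of_set A)) N" "\<And>c. c \<in> nd_cubes (top_of_set A) \<Longrightarrow> CU_codiff (top_of_set A) a c = f c"
    and b: "b \<in> grade (CU (top_of_set B)) N" "\<And>c. c \<in> nd_cubes (top_of_set B) \<Longrightarrow> CU_codiff (top_of_set B) b c = f c"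
    and k: "nd_supp (top_of_set (A \<inter> B)) k" "\<And>c. fst c \<noteq> N - 1 \<Longrightarrow> k c = 0" "N = 0 \<Longrightarrow> k = 0"
      "\<And>c. c \<in> nd_cubes (top_of_set (A \<inter> B)) \<Longrightarrow> CU_codiff (top_of_set (A \<inter> B)) k c = a c - b c"
  shows "\<exists>g \<in> grade (CU (top_of_set (A \<union> B))) N. CU_codiff (top_of_set (A \<union> B)) g = f"
proof -
  let ?Y = "top_of_set (A \<union> B)" and ?A = "top_of_set A" and ?B = "top_of_set B" and ?W = "top_of_set (A \<inter> B)"
  have kA: "k \<in> grade (CU ?A) (N - 1)"
  proof (rule CU_gradeI)
    show "nd_supp ?A k" using k(1) nd_cubes_mono[of "A \<inter> B" A] unfolding nd_supp_def by blast
  qed (use k in auto)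
  define a' where "a' = a - CU_codiff ?A k"
  have a': "a' \<in> grade (CU ?A) N"
  proof (cases N)
    case 0 then show ?thesis using a(1) k(3) by (simp add: a'_def)
  next
    case (Suc m)
    then have "CU_codiff ?A k \<in> grade (CU ?A) N" using CU_codiff_grade[OF kA] by simp
    then show ?thesis unfolding a'_def by (rule CU_grade_diff[OF a(1)])
  qed
  have da': "CU_codiff ?A a' = CU_codiff ?A a"
    using kA by (simp only: a'_def CU_codiff_diff CU_codiff_codiff[OF CU_grade_supp]) simp
  \<comment> \<open>Cubes contained in neither set get the value 0, since \<open>b\<close> vanishes
    off the cubes of \<open>B\<close>.\<close>
  define e where "e c = (if c \<in> nd_cubes ?A then a' c else b c)" for c
  have eB: "e c = b c" if c: "c \<in> nd_cubes ?B" for c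
  proof (cases "c \<in> nd_cubes ?A")
    case True
    then have "c \<in> nd_cubes ?W" using c by (auto simp: nd_cubes_def singular_cubes_subset)
    then show ?thesis
      using k(4)[of c] True CU_codiff_local[of c ?A ?W k] by (simp add: e_def a'_def)
  qed (simp add: e_def)
  have e: "e \<in> grade (CU ?Y) N"
  proof (rule CU_gradeI)
    show "nd_supp ?Y e"
    proof (rule nd_suppI)
      fix c assume c: "c \<notin> nd_cubes ?Y"
      then have "c \<notin> nd_cubes ?A" "c \<notin> nd_cubes ?B" using nd_cubes_mono[of A "A \<union> B"] nd_cubes_mono[of B "A \<union> B"] by blast+
      then show "e c = 0" using CU_grade_supp[OF b(1)] unfolding nd_supp_def e_def by (metis (full_types))
    qed
    show "\<And>c. fst c \<noteq> N \<Longrightarrow> e c = 0" using a' b(1) by (simp add: e_def CU_gradeD)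
  qed
  have local: "CU_codiff ?Y e c = CU_codiff ?A a' c" if c: "c \<in> nd_cubes ?A" for c
  proof -
    have "e (subcube ({..<fst c} - {i}) u c) = a' (subcube ({..<fst c} - {i}) u c)" if "u \<in> {0..1}" for i u
      using nd_suppD(1)[OF CU_grade_supp[OF e]] nd_suppD(1)[OF CU_grade_supp[OF a']]
        subcube_singular[of c ?A "{..<fst c} - {i}" u] c that
      by (cases "degenerate_cube (subcube ({..<fst c} - {i}) u c)") (auto simp: e_def nd_cubes_def)
    then show ?thesis using c nd_cubes_mono[of A "A \<union> B"] by (auto simp: CU_codiff_def)
  qed
  have localB: "CU_codiff ?Y e c = CU_codiff ?B b c" if c: "c \<in> nd_cubes ?B" for c
  proof -
    have "e (subcube ({..<fst c} - {i}) u c) = b (subcube ({..<fst c} - {i}) u c)" if "u \<in> {0..1}" for i u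
      using nd_suppD(1)[OF CU_grade_supp[OF e]] nd_suppD(1)[OF CU_grade_supp[OF b(1)]] eB
        subcube_singular[of c ?B "{..<fst c} - {i}" u] c that
      by (cases "degenerate_cube (subcube ({..<fst c} - {i}) u c)") (auto simp: nd_cubes_def)
    then show ?thesis using c nd_cubes_mono[of B "A \<union> B"] by (auto simp: CU_codiff_def)
  qed
  define f' where "f' = f - CU_codiff ?Y e"
  have f': "f' \<in> grade (CU ?Y) (Suc N)" unfolding f'_def by (intro CU_grade_diff f CU_codiff_grade e)
  have "\<exists>g \<in> grade (CU ?Y) N. CU_codiff ?Y g = f'"
  proof (rule small_cochain_coboundary[OF f' _ _ op])
    show "CU_codiff ?Y f' = 0"
      using f(2) CU_codiff_codiff[OF CU_grade_supp[OF e]] by (simp only: f'_def CU_codiff_diff) simp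
    fix c assume c: "c \<in> singular_cubes ?Y" and s: "snd c ` cube (fst c) \<subseteq> A \<or> snd c ` cube (fst c) \<subseteq> B"
    show "f' c = 0"
    proof (cases "degenerate_cube c")
      case True then show ?thesis by (rule nd_suppD(1)[OF CU_grade_supp[OF f']])
    next
      case False
      then have "c \<in> nd_cubes ?A \<or> c \<in> nd_cubes ?B"
        using c s by (auto simp: nd_cubes_def singular_cubes_subset)
      then have "CU_codiff ?Y e c = f c"
        using local[of c] localB[of c] a(2)[of c] b(2)[of c] unfolding da' by metis
      then show ?thesis by (simp add: f'_def)
    qed
  qed auto
  then obtain g where "g \<in> grade (CU ?Y) N" "CU_codiff ?Y g = f'" by blast
  then show ?thesis using e by (intro bexI[of _ "g + e"]) (auto simp: CU_codiff_add f'_def intro: CU_grade_add)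
qed

lemma CU_one_grade: "CU_one Y \<in> grade (CU Y) 0"
  by (rule CU_gradeI) (auto intro: nd_suppI simp: CU_one_def)

lemma CU_codiff_one: "CU_codiff Y (CU_one Y) = 0"
proof (rule nd_supp_eqI[of Y])
  fix c assume "c \<in> nd_cubes Y"
  then have c: "c \<in> singular_cubes Y" by (simp add: nd_cubes_def)
  have "CU_one Y (pull (fst c - 1) (ins i 1) c) = CU_one Y (pull (fst c - 1) (ins i 0) c)" if i: "i < fst c" for i
  proof -
    obtain m where m: "fst c = Suc m" using i by (cases "fst c") auto
    have "pull m (ins i e) c \<in> singular_cubes Y" if "e \<in> {0..1}" for e
      using face_singular[OF c m _ that] i m by simp
    then have "CU_one Y (pull m (ins i e) c) = (if m = 0 then 1 else 0)" if "e \<in> {0..1}" for e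
      using that by (auto simp: CU_one_def nd_cubes_def degenerate_iff)
    then show ?thesis using m by simp
  qed
  then show "CU_codiff Y (CU_one Y) c = 0 c"
    using CU_codiff_singular[OF CU_grade_supp[OF CU_one_grade] c] by (simp del: One_nat_def)
qed simp_all

text \<open>The complement of a linear subspace of codimension N + 1, of the homotopy type of the
  N-sphere. As the later coordinates are free, \<open>punctured N\<close> is literally the
  intersection of the two open sets that cover \<open>punctured (Suc N)\<close> in the inductive
  step.\<close>

definition punctured :: "nat \<Rightarrow> (nat \<Rightarrow> real) set" where
  "punctured N = {x. \<exists>i\<le>N. x i \<noteq> 0}"

text \<open>The broken line from one pole on the axis N + 1, where the coordinate is 1, through
  \<open>p\<close>, reached at s = 1/2, to the opposite pole.\<close>

definition susp :: "nat \<Rightarrow> real \<Rightarrow> (nat \<Rightarrow> real) \<Rightarrow> nat \<Rightarrow> real" where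
  "susp N s p = (\<lambda>j. (1 - \<bar>1 - 2 * s\<bar>) * p j + (if j = Suc N then 1 - 2 * s else 0))"

text \<open>\<open>iota 1 N - iota (-1) N\<close> is a fundamental cycle of the sphere, the iterated unreduced suspension
  of the difference of two points.\<close>

primrec iota :: "real \<Rightarrow> nat \<Rightarrow> (nat \<Rightarrow> real) scube" where
  "iota e 0 = (0, restrict (\<lambda>t j. if j = 0 then e else 0) (cube 0))"
| "iota e (Suc N) = cross 1 (\<lambda>s. susp N (s 0)) (iota e N)"

lemma continuous_on_cube_coord: "continuous_on (cube p \<times> A) (\<lambda>z. fst z j)"
proof -
  have "continuous_on (cube p \<times> A) ((\<lambda>t. t j) \<circ> fst)"
    by (rule continuous_on_compose) (auto intro: continuous_intros)
  then show ?thesis by (simp add: comp_def)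
qed

lemma continuous_on_snd_coord: "continuous_on (cube p \<times> A) (\<lambda>z. snd z (j::nat) :: real)"
proof -
  have "continuous_on (cube p \<times> A) ((\<lambda>t. t j) \<circ> snd)"
    by (rule continuous_on_compose) (auto intro: continuous_intros)
  then show ?thesis by (simp add: comp_def)
qed

lemma cross_mapI:
  assumes "\<And>s y. s \<in> cube p \<Longrightarrow> y \<in> A \<Longrightarrow> a s y \<in> B"
    and "\<And>j. continuous_on (cube p \<times> A) (\<lambda>z. a (fst z) (snd z) (j::nat) :: real)"
  shows "cross_map (top_of_set A) (top_of_set B) p a"
  unfolding cross_map_def prod_topology_subtopology_eu continuous_map_subtopology_eu
  using assms by (auto simp: case_prod_beta' intro: continuous_on_coordinatewise_then_product)

lemma susp_punctured:
  assumes "s \<in> {0..1}" "p \<in> punctured N"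
  shows "susp N s p \<in> punctured (Suc N)"
proof (cases "1 - \<bar>1 - 2 * s\<bar> = 0")
  case True
  then show ?thesis by (auto simp: susp_def punctured_def intro!: exI[of _ "Suc N"])
next
  case False
  obtain i where "i \<le> N" "p i \<noteq> 0" using assms by (auto simp: punctured_def)
  then show ?thesis using False by (auto simp: susp_def punctured_def intro!: exI[of _ i])
qed

lemma cross_map_susp: "cross_map (top_of_set (punctured N)) (top_of_set (punctured (Suc N))) 1 (\<lambda>s. susp N (s 0))"
proof (rule cross_mapI)
  fix j show "continuous_on (cube 1 \<times> punctured N) (\<lambda>z. susp N (fst z 0) (snd z) j)"
    by (cases "j = Suc N") (auto simp: susp_def intro!: continuous_intros continuous_on_cube_coord continuous_on_snd_coord)
qed (auto intro: susp_punctured simp: cubeD)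

lemma fst_iota [simp]: "fst (iota e N) = N"
  by (induction N) simp_all

lemma iota_singular: "e \<noteq> 0 \<Longrightarrow> iota e N \<in> singular_cubes (top_of_set (punctured N))"
proof (induction N)
  case 0
  then show ?case by (auto simp: singular_cubes_subset cube_0 punctured_def)
next
  case (Suc N)
  then show ?case using cross_singular[OF cross_map_susp] by simp
qed

text \<open>The path components are the two half spaces of the first coordinate. A straight segment
  inside one of them joins each point to 1 or -1 on the axis, and a cocycle takes equal values at
  both ends.\<close>

lemma detect_cocycle_0:
  assumes f: "f \<in> grade (CU (top_of_set (punctured 0))) 0" "CU_codiff (top_of_set (punctured 0)) f = 0"
    and eq: "f (iota 1 0) = f (iota (-1) 0)"
  shows "f = (\<lambda>T. f (iota 1 0) * CU_one (top_of_set (punctured 0)) T)"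
proof (rule nd_supp_eqI[OF CU_grade_supp[OF f(1)] CU_grade_supp[OF CU_grade_smult[OF CU_one_grade]]])
  let ?Y = "top_of_set (punctured 0)"
  fix c assume nd: "c \<in> nd_cubes ?Y"
  then have c: "c \<in> singular_cubes ?Y" by (simp add: nd_cubes_def)
  show "f c = f (iota 1 0) * CU_one ?Y c"
  proof (cases "fst c = 0")
    case True
    define x where "x = snd c (\<lambda>_. 0)"
    have x: "x 0 \<noteq> 0" using singular_cubes_topspace[OF c, of "\<lambda>_. 0"] by (simp add: x_def punctured_def)
    define e where "e = sgn (x 0)"
    have e: "e = 1 \<or> e = -1" using x by (auto simp: e_def sgn_if)
    define a where "a = (\<lambda>s (y::nat \<Rightarrow> real) j. (1 - s (0::nat)) * (if j = (0::nat) then e else 0) + s 0 * y j)"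
    have a: "cross_map (top_of_set {y. y 0 * e > 0}) ?Y 1 a"
    proof (rule cross_mapI)
      fix s y assume s: "s \<in> cube 1" and y: "y \<in> {y. y (0::nat) * e > 0}"
      have s0: "0 \<le> s 0" "s 0 \<le> 1" using s by (auto simp: cubeD)
      have "0 < (1 - s 0) * (e * e) + s 0 * (y 0 * e)"
      proof (cases "s 0 = 0")
        case True then show ?thesis using e by auto
      next
        case False
        then have "0 < s 0 * (y 0 * e)" using s0 y by simp
        moreover have "0 \<le> (1 - s 0) * (e * e)" using s0 by simp
        ultimately show ?thesis by linarith
      qed
      then have "a s y 0 * e > 0" by (simp add: a_def algebra_simps)
      then have "a s y 0 \<noteq> 0" by auto
      then show "a s y \<in> punctured 0" by (auto simp: punctured_def)
    next
      fix j show "continuous_on (cube 1 \<times> {y. y 0 * e > 0}) (\<lambda>z. a (fst z) (snd z) j)"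
        by (cases "j = 0") (auto simp: a_def intro!: continuous_intros continuous_on_cube_coord continuous_on_snd_coord)
    qed
    have "x 0 * e > 0" using x by (simp add: e_def flip: abs_sgn)
    then have c': "c \<in> singular_cubes (top_of_set {y. y 0 * e > 0})"
      using c True by (auto simp: singular_cubes_subset cube_0 x_def)
    have D: "cross 1 a c \<in> singular_cubes ?Y" by (rule cross_singular[OF a c'])
    have f1: "pull 0 (ins 0 1) (cross 1 a c) = c"
    proof -
      have "pull (0 + fst c) (ins 0 1) (cross (Suc 0) a c) = cross 0 (\<lambda>s. a (ins 0 1 s)) c"
        by (rule cross_face_fst) auto
      also have "\<dots> = cross 0 (\<lambda>s y. y) c"
        by (rule cross_cong[OF c]) (simp add: a_def ins_def)
      also have "\<dots> = c"
        using c by (cases c) (auto simp: cross_def restrict_def extensional_def singular_cubes_iff)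
      finally show ?thesis using True by simp
    qed
    have f0: "pull 0 (ins 0 0) (cross 1 a c) = iota e 0"
    proof -
      have "pull (0 + fst c) (ins 0 0) (cross (Suc 0) a c) = cross 0 (\<lambda>s. a (ins 0 0 s)) c"
        by (rule cross_face_fst) auto
      also have "\<dots> = iota e 0" using True by (simp add: cross_def a_def ins_def)
      finally show ?thesis using True by simp
    qed
    have "0 = f c - f (iota e 0)"
      using CU_codiff_singular[OF CU_grade_supp[OF f(1)] D] f(2) True f0 f1 by simp
    then have "f c = f (iota 1 0)" using e eq by auto
    then show ?thesis using True nd by (simp add: CU_one_def)
  next
    case False
    then show ?thesis using f(1) by (simp add: CU_gradeD CU_one_def)
  qed
qed

text \<open>Stokes for a contraction to the point \<open>e\<close>: the end at \<open>e\<close>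
  contributes nothing because a constant family kills cochains of positive degree.\<close>

lemma cone_primitive:
  assumes f: "f \<in> grade (CU Y) (Suc N)" "CU_codiff Y f = 0" and a: "cross_map A Y 1 a"
    and a1: "\<And>y. y \<in> topspace A \<Longrightarrow> a (ins 0 1 (\<lambda>_. 0)) y = y" and a0: "\<And>y. y \<in> topspace A \<Longrightarrow> a (ins 0 0 (\<lambda>_. 0)) y = e"
    and c: "c \<in> nd_cubes A"
  shows "CU_codiff A (- CX A 1 a f) c = f c"
proof -
  have "CX A 0 (\<lambda>s. a (ins 0 1 s)) f = CX A 0 (\<lambda>s y. y) f"
    by (rule CX_cong) (simp add: cube_0 a1)
  moreover have "CX A 0 (\<lambda>s. a (ins 0 0 s)) f = CX A 0 (\<lambda>s y. e) f"
    by (rule CX_cong) (simp add: cube_0 a0)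
  moreover have "CX A 0 (\<lambda>s y. e) f = 0" by (rule CX_const[OF f(1)]) simp
  ultimately show ?thesis
    using fun_cong[OF CX_codiff[OF CU_grade_supp[OF f(1)] a], of c] f(2) c
    by (simp add: CX_identity CU_codiff_minus)
qed

text \<open>\<open>punctured (Suc N)\<close> is the union of two open sets that are star-shaped about the points
  \<open>\<plusminus>e\<close> on the new axis and meet in \<open>punctured N\<close>; the square below relates the difference of the
  two cones over \<open>punctured N\<close> to the suspension.\<close>

lemma detect_cocycle_step:
  assumes f: "f \<in> grade (CU (top_of_set (punctured (Suc N)))) (Suc N)" "CU_codiff (top_of_set (punctured (Suc N))) f = 0"
    and g: "nd_supp (top_of_set (punctured N)) g" "\<And>c. fst c \<noteq> N - 1 \<Longrightarrow> g c = 0" "N = 0 \<Longrightarrow> g = 0"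
    and r: "N > 0 \<Longrightarrow> r = 0"
    and F: "CX (top_of_set (punctured N)) 1 (\<lambda>s. susp N (s 0)) f
      = CU_codiff (top_of_set (punctured N)) g + (\<lambda>T. r * CU_one (top_of_set (punctured N)) T)"
  shows "\<exists>g \<in> grade (CU (top_of_set (punctured (Suc N)))) N. CU_codiff (top_of_set (punctured (Suc N))) g = f"
proof -
  define S where "S e = {y. y (Suc N) * e > 0 \<or> y \<in> punctured N}" for e :: real
  define cone where "cone e = (\<lambda>s (y::nat \<Rightarrow> real) j. (1 - s (0::nat)) * (if j = Suc N then e else 0) + s 0 * y j)" for e :: real
  let ?Y = "top_of_set (punctured (Suc N))" and ?W = "top_of_set (punctured N)"
  have un: "S 1 \<union> S (-1) = punctured (Suc N)"
    by (auto simp: S_def punctured_def le_Suc_eq)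
  have int: "S 1 \<inter> S (-1) = punctured N" by (auto simp: S_def)
  have "open {y. (y::nat \<Rightarrow> real) j \<noteq> 0}" for j
    by (intro open_Collect_neq continuous_on_coord continuous_on_const)
  then have "open (\<Union>j\<in>{..N}. {y. (y::nat \<Rightarrow> real) j \<noteq> 0})" by blast
  moreover have "(\<Union>j\<in>{..N}. {y. (y::nat \<Rightarrow> real) j \<noteq> 0}) = punctured N" by (auto simp: punctured_def)
  ultimately have "open (punctured N)" by simp
  moreover have "open {y. (y::nat \<Rightarrow> real) (Suc N) * e > 0}" for e
    by (intro open_Collect_less continuous_intros)
  ultimately have "open (S e)" for e unfolding S_def by (intro open_Collect_disj) auto
  then have op: "openin (top_of_set (S 1 \<union> S (-1))) (S e)" if "e \<in> {1, -1}" for e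
    using that by (auto simp: openin_open)
  have mem: "S e \<subseteq> punctured (Suc N)" if "e \<in> {1, -1}" for e using un that by auto
  have cm: "cross_map (top_of_set (S e)) ?Y 1 (cone e)" if e: "e \<in> {1, -1}" for e
  proof (rule cross_mapI)
    fix s y assume s: "s \<in> cube 1" and y: "y \<in> S e"
    have s0: "0 \<le> s 0" "s 0 \<le> 1" using s by (auto simp: cubeD)
    show "cone e s y \<in> punctured (Suc N)"
    proof (cases "s 0 = 0")
      case True then show ?thesis using e by (auto simp: cone_def punctured_def intro!: exI[of _ "Suc N"])
    next
      case False
      show ?thesis
      proof (cases "y \<in> punctured N")
        case True
        then obtain i where "i \<le> N" "y i \<noteq> 0" by (auto simp: punctured_def)
        then show ?thesis using False by (auto simp: cone_def punctured_def intro!: exI[of _ i])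
      next
        case f: False
        then have "0 < s 0 * (y (Suc N) * e)" using y False s0 by (simp add: S_def)
        moreover have "0 \<le> (1 - s 0) * (e * e)" using s0 by simp
        ultimately have "0 < (1 - s 0) * (e * e) + s 0 * (y (Suc N) * e)" by linarith
        then have "cone e s y (Suc N) * e > 0" by (simp add: cone_def algebra_simps)
        then have "cone e s y (Suc N) \<noteq> 0" by auto
        then show ?thesis by (auto simp: punctured_def)
      qed
    qed
  next
    fix j show "continuous_on (cube 1 \<times> S e) (\<lambda>z. cone e (fst z) (snd z) j)"
      by (cases "j = Suc N") (auto simp: cone_def intro!: continuous_intros continuous_on_cube_coord continuous_on_snd_coord)
  qed
  have prim: "CU_codiff (top_of_set (S e)) (- CX (top_of_set (S e)) 1 (cone e) f) c = f c"
    if "e \<in> {1, -1}" "c \<in> nd_cubes (top_of_set (S e))" for e c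
    by (rule cone_primitive[OF f cm[OF that(1)] _ _ that(2), where e = "\<lambda>j. if j = Suc N then e else 0"])
      (auto simp: cone_def ins_def fun_eq_iff)
  have pg: "- CX (top_of_set (S e)) 1 (cone e) f \<in> grade (CU (top_of_set (S e))) N" for e
    using CX_grade[of f ?Y 1 N "top_of_set (S e)" "cone e"] f(1) by (simp add: CU_grade_minus)
  \<comment> \<open>The straight homotopy from the suspension path of \<open>p\<close> to
    \<open>p\<close>. Its edges are the suspension, a constant edge, and the segments from the two
    poles to \<open>p\<close>, which are the two cones.\<close>
  define sq where "sq = (\<lambda>s p j. (1 - s 0) * susp N (s (Suc 0)) p j + s (0::nat) * p j)"
  have sq: "cross_map ?W ?Y 2 sq"
  proof (rule cross_mapI)
    fix s p assume s: "s \<in> cube 2" and p: "p \<in> punctured N"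
    have s0: "0 \<le> s 0" "s 0 \<le> 1" "0 \<le> s (Suc 0)" "s (Suc 0) \<le> 1" using s by (auto simp: cubeD)
    show "sq s p \<in> punctured (Suc N)"
    proof (cases "s 0 = 0")
      case True
      then show ?thesis using susp_punctured[OF _ p, of "s (Suc 0)"] s0 by (simp add: sq_def)
    next
      case False
      obtain i where i: "i \<le> N" "p i \<noteq> 0" using p by (auto simp: punctured_def)
      have "0 \<le> (1 - s 0) * (1 - \<bar>1 - 2 * s (Suc 0)\<bar>)" using s0 by (intro mult_nonneg_nonneg) auto
      then have "(1 - s 0) * (1 - \<bar>1 - 2 * s (Suc 0)\<bar>) + s 0 \<noteq> 0" using False s0 by linarith
      moreover have "sq s p i = ((1 - s 0) * (1 - \<bar>1 - 2 * s (Suc 0)\<bar>) + s 0) * p i"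
        using i by (simp add: sq_def susp_def algebra_simps)
      ultimately have "sq s p i \<noteq> 0" using i by simp
      then show ?thesis using i by (auto simp: punctured_def intro!: exI[of _ i])
    qed
  next
    fix j show "continuous_on (cube 2 \<times> punctured N) (\<lambda>z. sq (fst z) (snd z) j)"
      by (cases "j = Suc N") (auto simp: sq_def susp_def intro!: continuous_intros continuous_on_cube_coord continuous_on_snd_coord)
  qed
  define E where "E = CX ?W 2 sq f"
  have rel: "CX ?W 1 (cone 1) f c - CX ?W 1 (cone (-1)) f c = CU_codiff ?W E c + CX ?W 1 (\<lambda>s. susp N (s 0)) f c" for c
  proof -
    have "CX ?W 1 (\<lambda>s. sq (ins 0 1 s)) f = 0"
      by (rule CX_degenerate[OF CU_grade_supp[OF f(1)], of 0]) (simp_all add: sq_def ins_def)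
    moreover have "CX ?W 1 (\<lambda>s. sq (ins 0 0 s)) f = CX ?W 1 (\<lambda>s. susp N (s 0)) f"
      by (rule CX_cong) (simp add: sq_def ins_def)
    moreover have "CX ?W 1 (\<lambda>s. sq (ins (Suc 0) 1 s)) f = CX ?W 1 (cone (-1)) f"
      by (rule CX_cong) (simp add: sq_def ins_def susp_def cone_def fun_eq_iff)
    moreover have "CX ?W 1 (\<lambda>s. sq (ins (Suc 0) 0 s)) f = CX ?W 1 (cone 1) f"
      by (rule CX_cong) (simp add: sq_def ins_def susp_def cone_def fun_eq_iff)
    ultimately show ?thesis
      using fun_cong[OF CX_codiff[OF CU_grade_supp[OF f(1)] sq], of c] f(2)
      by (simp add: E_def numeral_2_eq_2)
  qed
  define k where "k = - g - E"
  \<comment> \<open>For N = 0 the pulled back cocycle is a constant \<open>r\<close> rather than a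
    coboundary. Adding this constant to one of the two primitives absorbs it, as constants are
    closed.\<close>
  define a where "a = (\<lambda>T. - CX (top_of_set (S 1)) 1 (cone 1) f T) + (\<lambda>T. r * CU_one (top_of_set (S 1)) T)"
  have a: "a = - CX (top_of_set (S 1)) 1 (cone 1) f + (\<lambda>T. r * CU_one (top_of_set (S 1)) T)"
    by (simp add: a_def fun_eq_iff)
  have E: "E c = 0" if "fst c \<noteq> N - 1 \<or> N = 0" for c
  proof -
    have "fst (cross 2 sq c) \<noteq> Suc N" using that by auto
    then show ?thesis by (simp add: E_def CX_def CU_gradeD[OF f(1)])
  qed
  have "\<exists>g \<in> grade (CU (top_of_set (S 1 \<union> S (-1)))) N. CU_codiff (top_of_set (S 1 \<union> S (-1))) g = f"
  proof (rule Mayer_Vietoris_coboundary[where a = a and b = "- CX (top_of_set (S (-1))) 1 (cone (-1)) f" and k = k])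
    show "f \<in> grade (CU (top_of_set (S 1 \<union> S (-1)))) (Suc N)" "CU_codiff (top_of_set (S 1 \<union> S (-1))) f = 0"
      using f un by simp_all
    show "openin (top_of_set (S 1 \<union> S (-1))) (S 1)" "openin (top_of_set (S 1 \<union> S (-1))) (S (-1))"
      using op by simp_all
    show "- CX (top_of_set (S (-1))) 1 (cone (-1)) f \<in> grade (CU (top_of_set (S (-1)))) N" by (rule pg)
    show "CU_codiff (top_of_set (S (-1))) (- CX (top_of_set (S (-1))) 1 (cone (-1)) f) c = f c"
      if "c \<in> nd_cubes (top_of_set (S (-1)))" for c using that by (intro prim) auto
    have one: "(\<lambda>T. r * CU_one (top_of_set (S 1)) T) \<in> grade (CU (top_of_set (S 1))) N"
      using r CU_grade_smult[OF CU_one_grade, of r "top_of_set (S 1)"] CU_grade_0[of "top_of_set (S 1)" N]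
      by (cases "N = 0") (auto simp: zero_fun_def)
    show "a \<in> grade (CU (top_of_set (S 1))) N" unfolding a by (rule CU_grade_add[OF pg one])
    show "CU_codiff (top_of_set (S 1)) a c = f c" if "c \<in> nd_cubes (top_of_set (S 1))" for c
      using prim[of 1 c] that unfolding a CU_codiff_add CU_codiff_smult CU_codiff_one by simp
    show "nd_supp (top_of_set (S 1 \<inter> S (-1))) k"
      unfolding int k_def E_def by (intro nd_supp_diff nd_supp_minus g CX_supp)
    show "k c = 0" if "fst c \<noteq> N - 1" for c using g(2) E that by (simp add: k_def)
    show "k = 0" if "N = 0" using g(3) E that by (auto simp: k_def fun_eq_iff)
    fix c assume "c \<in> nd_cubes (top_of_set (S 1 \<inter> S (-1)))"
    then have c: "c \<in> nd_cubes ?W" by (simp add: int)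
    have W: "CX (top_of_set (S e)) 1 (cone e) f c = CX ?W 1 (cone e) f c" "c \<in> nd_cubes (top_of_set (S e))" if "e \<in> {1, -1}" for e
      using c nd_cubes_mono[of "punctured N" "S e"] by (auto simp: CX_def S_def)
    have "CU_one (top_of_set (S 1)) c = CU_one ?W c" using c W(2)[of 1] by (simp add: CU_one_def)
    then have "a c - (- CX (top_of_set (S (-1))) 1 (cone (-1)) f) c
        = - (CX ?W 1 (cone 1) f c - CX ?W 1 (cone (-1)) f c) + r * CU_one ?W c"
      using W(1)[of 1] W(1)[of "-1"] by (simp add: a_def)
    also have "\<dots> = - CU_codiff ?W E c - CU_codiff ?W g c" unfolding rel using fun_cong[OF F, of c] by simp
    also have "\<dots> = CU_codiff (top_of_set (S 1 \<inter> S (-1))) k c"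
      unfolding int k_def CU_codiff_diff CU_codiff_minus by simp
    finally show "CU_codiff (top_of_set (S 1 \<inter> S (-1))) k c = a c - (- CX (top_of_set (S (-1))) 1 (cone (-1)) f) c" by simp
  qed
  then show ?thesis by (simp only: un)
qed

text \<open>Both ends of the suspension are constant families, so pulling back along it preserves
  closedness; by construction of \<open>iota\<close> the values on the hemispheres are kept.\<close>

lemma susp_cocycle:
  assumes f: "f \<in> grade (CU (top_of_set (punctured (Suc N)))) (Suc N)" "CU_codiff (top_of_set (punctured (Suc N))) f = 0"
  defines "F \<equiv> CX (top_of_set (punctured N)) 1 (\<lambda>s. susp N (s 0)) f"
  shows "F \<in> grade (CU (top_of_set (punctured N))) N" "CU_codiff (top_of_set (punctured N)) F = 0"
    "e \<noteq> 0 \<Longrightarrow> F (iota e N) = f (iota e (Suc N))"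
proof -
  let ?W = "top_of_set (punctured N)"
  show "F \<in> grade (CU ?W) N" unfolding F_def using f(1) by (intro CX_grade) simp
  have "CX ?W 0 (\<lambda>s. susp N (ins 0 1 s 0)) f = CX ?W 0 (\<lambda>s y. \<lambda>j. if j = Suc N then -1 else 0) f"
    by (rule CX_cong) (simp add: susp_def ins_def fun_eq_iff)
  moreover have "CX ?W 0 (\<lambda>s. susp N (ins 0 0 s 0)) f = CX ?W 0 (\<lambda>s y. \<lambda>j. if j = Suc N then 1 else 0) f"
    by (rule CX_cong) (simp add: susp_def ins_def fun_eq_iff)
  moreover have "CX ?W 0 (\<lambda>s y. x) f = 0" for x by (rule CX_const[OF f(1)]) simp
  ultimately show "CU_codiff ?W F = 0"
    using CX_codiff[OF CU_grade_supp[OF f(1)] cross_map_susp] f(2) by (simp add: F_def fun_eq_iff)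
  show "e \<noteq> 0 \<Longrightarrow> F (iota e N) = f (iota e (Suc N))"
    unfolding F_def by (simp add: CX_singular[OF CU_grade_supp[OF f(1)] iota_singular])
qed

text \<open>Induction by desuspension: \<open>susp\<close> lowers the dimension and keeps the
  vanishing on the fundamental cycle, until the two points of the 0-sphere are left.\<close>

lemma detect_cocycle:
  "f \<in> grade (CU (top_of_set (punctured (Suc N)))) (Suc N) \<Longrightarrow> CU_codiff (top_of_set (punctured (Suc N))) f = 0 \<Longrightarrow>
   f (iota 1 (Suc N)) = f (iota (-1) (Suc N)) \<Longrightarrow>
   \<exists>g \<in> grade (CU (top_of_set (punctured (Suc N)))) N. CU_codiff (top_of_set (punctured (Suc N))) g = f"
proof (induction N arbitrary: f)
  case 0
  note F = susp_cocycle[OF 0(1,2)]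
  let ?F = "CX (top_of_set (punctured 0)) 1 (\<lambda>s. susp 0 (s 0)) f"
  have "?F = (\<lambda>T. ?F (iota 1 0) * CU_one (top_of_set (punctured 0)) T)"
    by (rule detect_cocycle_0[OF F(1,2)]) (use 0(3) F(3)[of 1] F(3)[of "-1"] in simp)
  then have "?F = CU_codiff (top_of_set (punctured 0)) 0 + (\<lambda>T. ?F (iota 1 0) * CU_one (top_of_set (punctured 0)) T)"
    by simp
  from detect_cocycle_step[OF 0(1,2) nd_supp_0 _ _ _ this] show ?case by simp
next
  case (Suc N)
  note F = susp_cocycle[OF Suc.prems(1,2)]
  let ?F = "CX (top_of_set (punctured (Suc N))) 1 (\<lambda>s. susp (Suc N) (s 0)) f"
  obtain g where g: "g \<in> grade (CU (top_of_set (punctured (Suc N)))) N" "CU_codiff (top_of_set (punctured (Suc N))) g = ?F"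
    using Suc.IH[OF F(1,2)] Suc.prems(3) F(3)[of 1] F(3)[of "-1"] by auto
  have "?F = CU_codiff (top_of_set (punctured (Suc N))) g + (\<lambda>T. 0 * CU_one (top_of_set (punctured (Suc N))) T)"
    by (simp add: g fun_eq_iff)
  from detect_cocycle_step[OF Suc.prems(1,2) CU_grade_supp[OF g(1)] _ _ _ this] show ?case
    using CU_gradeD[OF g(1)] by simp
qed

section \<open>Powers of a transgressed class\<close>

lemma coboundaries_0 [simp]: "coboundaries C 0 = {0}"
  and coboundaries_Suc: "coboundaries C (Suc k) = codiff C ` grade C k"
  by (simp_all add: coboundaries_def)

lemma CU_coboundaries_0 [simp]: "0 \<in> coboundaries (CU Y) k"
  by (cases k) (auto simp: coboundaries_Suc intro!: image_eqI[of _ _ 0])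

lemma CU_coboundaries_add:
  assumes "a \<in> coboundaries (CU Y) k" "b \<in> coboundaries (CU Y) k"
  shows "a + b \<in> coboundaries (CU Y) k"
proof (cases k)
  case (Suc j)
  then obtain g h where "g \<in> grade (CU Y) j" "h \<in> grade (CU Y) j" "a = CU_codiff Y g" "b = CU_codiff Y h"
    using assms by (auto simp: coboundaries_Suc)
  then show ?thesis
    by (simp only: Suc coboundaries_Suc) (auto intro!: image_eqI[of _ _ "g + h"] CU_grade_add simp: CU_codiff_add)
qed (use assms in simp)

lemma CU_coboundaries_smult:
  assumes "a \<in> coboundaries (CU Y) k"
  shows "(\<lambda>T. r * a T) \<in> coboundaries (CU Y) k"
proof (cases k)
  case (Suc j)
  then obtain g where "g \<in> grade (CU Y) j" "a = CU_codiff Y g"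
    using assms by (auto simp: coboundaries_Suc)
  then show ?thesis
    by (simp only: Suc coboundaries_Suc) (auto intro!: image_eqI[of _ _ "\<lambda>T. r * g T"] CU_grade_smult simp: CU_codiff_smult)
qed (use assms in \<open>auto simp: fun_eq_iff\<close>)

lemma CU_coboundaries_minus:
  assumes "a \<in> coboundaries (CU Y) k"
  shows "- a \<in> coboundaries (CU Y) k"
proof -
  have "- a = (\<lambda>T. (-1) * a T)" by (simp add: fun_eq_iff)
  then show ?thesis using CU_coboundaries_smult[OF assms, of "-1"] by (simp only:)
qed

lemma CU_coboundaries_diff:
  "a \<in> coboundaries (CU Y) k \<Longrightarrow> b \<in> coboundaries (CU Y) k \<Longrightarrow> a - b \<in> coboundaries (CU Y) k"
  using CU_coboundaries_add[of a Y k "- b"] CU_coboundaries_minus[of b Y k] by simp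

lemma CU_map_grade: "f \<in> grade (CU Z) k \<Longrightarrow> CU_map Y h f \<in> grade (CU Y) k"
  unfolding CU_map_eq_CX by (rule CX_grade) simp

lemma CU_map_coboundaries:
  assumes "continuous_map Y Z h" "a \<in> coboundaries (CU Z) k"
  shows "CU_map Y h a \<in> coboundaries (CU Y) k"
proof (cases k)
  case 0
  then show ?thesis using assms by (simp add: CU_map_eq_CX)
next
  case (Suc j)
  then obtain g where g: "g \<in> grade (CU Z) j" "a = CU_codiff Z g"
    using assms by (auto simp: coboundaries_Suc)
  then have "CU_map Y h a = CU_codiff Y (CU_map Y h g)" using CU_map_codiff[OF CU_grade_supp assms(1)] by blast
  then show ?thesis
    unfolding Suc coboundaries_Suc using CU_map_grade[OF g(1)] by (auto intro!: image_eqI)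
qed

lemma CU_mult_coboundaries_left:
  assumes a: "a \<in> coboundaries (CU Y) k" and b: "b \<in> grade (CU Y) l" "CU_codiff Y b = 0"
  shows "CU_mult Y a b \<in> coboundaries (CU Y) (k + l)"
proof (cases k)
  case 0
  then show ?thesis using a by simp
next
  case (Suc j)
  then obtain g where g: "g \<in> grade (CU Y) j" "a = CU_codiff Y g"
    using a by (auto simp: coboundaries_Suc)
  have "CU_mult Y a b = CU_codiff Y (CU_mult Y g b)"
    unfolding g(2) using CU_mult_codiff[OF g(1) CU_grade_supp[OF b(1)]] b(2) by (simp add: fun_eq_iff)
  then show ?thesis
    using CU_mult_grade[OF g(1) b(1)] by (simp only: Suc add_Suc coboundaries_Suc) (auto intro!: image_eqI)
qed

lemma CU_mult_coboundaries_right: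
  assumes a: "a \<in> coboundaries (CU Y) k" and b: "b \<in> grade (CU Y) l" "CU_codiff Y b = 0"
  shows "CU_mult Y b a \<in> coboundaries (CU Y) (l + k)"
proof (cases k)
  case 0
  then show ?thesis using a by simp
next
  case (Suc j)
  then obtain g where g: "g \<in> grade (CU Y) j" "a = CU_codiff Y g"
    using a by (auto simp: coboundaries_Suc)
  define h where "h = (\<lambda>T. (-1) ^ l * CU_mult Y b g T)"
  have "CU_codiff Y h = (\<lambda>T. (-1) ^ l * CU_codiff Y (CU_mult Y b g) T)"
    unfolding h_def by (rule CU_codiff_smult)
  also have "CU_codiff Y (CU_mult Y b g) = (\<lambda>T. (-1) ^ l * CU_mult Y b a T)"
    unfolding g(2) using CU_mult_codiff[OF b(1) CU_grade_supp[OF g(1)]] b(2) by (simp add: fun_eq_iff)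
  also have "(\<lambda>T. (-1) ^ l * ((-1) ^ l * CU_mult Y b a T)) = CU_mult Y b a"
    by (simp add: fun_eq_iff flip: mult.assoc power_add)
  finally have "CU_mult Y b a = CU_codiff Y h" ..
  moreover have "h \<in> grade (CU Y) (l + j)" unfolding h_def by (intro CU_grade_smult CU_mult_grade b g)
  ultimately show ?thesis
    by (simp only: Suc add_Suc_right coboundaries_Suc) (auto intro!: image_eqI)
qed

lemma CU_mult_cocycle:
  assumes "a \<in> grade (CU Y) k" "CU_codiff Y a = 0" "b \<in> grade (CU Y) l" "CU_codiff Y b = 0"
  shows "CU_codiff Y (CU_mult Y a b) = 0"
  using CU_mult_codiff[OF assms(1) CU_grade_supp[OF assms(3)]] assms by (simp add: fun_eq_iff)

primrec CU_power :: "'y topology \<Rightarrow> ('y scube \<Rightarrow> int) \<Rightarrow> nat \<Rightarrow> 'y scube \<Rightarrow> int" where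
  "CU_power Y a 0 = CU_one Y"
| "CU_power Y a (Suc m) = CU_mult Y a (CU_power Y a m)"

lemma CU_power_grade: "a \<in> grade (CU Y) k \<Longrightarrow> CU_power Y a m \<in> grade (CU Y) (k * m)"
  by (induction m) (simp_all add: CU_one_grade CU_mult_grade)

lemma CU_power_cocycle: "a \<in> grade (CU Y) k \<Longrightarrow> CU_codiff Y a = 0 \<Longrightarrow> CU_codiff Y (CU_power Y a m) = 0"
proof (induction m)
  case (Suc m)
  show ?case unfolding CU_power.simps
    by (rule CU_mult_cocycle[OF Suc.prems CU_power_grade[OF Suc.prems(1)] Suc.IH[OF Suc.prems]])
qed (simp add: CU_codiff_one)

text \<open>One factor is exchanged at a time; the others are closed, so each difference stays
  exact.\<close>

lemma CU_power_cong:
  assumes "a \<in> grade (CU Y) k" "CU_codiff Y a = 0" "b \<in> grade (CU Y) k" "CU_codiff Y b = 0"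
    and "a - b \<in> coboundaries (CU Y) k"
  shows "CU_power Y a m - CU_power Y b m \<in> coboundaries (CU Y) (k * m)"
proof (induction m)
  case (Suc m)
  have "CU_power Y a (Suc m) - CU_power Y b (Suc m)
      = CU_mult Y (a - b) (CU_power Y a m) + CU_mult Y b (CU_power Y a m - CU_power Y b m)"
    by (simp add: CU_mult_diff_left CU_mult_diff_right)
  moreover have "CU_mult Y (a - b) (CU_power Y a m) \<in> coboundaries (CU Y) (k + k * m)"
    by (rule CU_mult_coboundaries_left[OF assms(5) CU_power_grade[OF assms(1)] CU_power_cocycle[OF assms(1,2)]])
  moreover have "CU_mult Y b (CU_power Y a m - CU_power Y b m) \<in> coboundaries (CU Y) (k + k * m)"
    by (rule CU_mult_coboundaries_right[OF Suc assms(3,4)])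
  ultimately show ?case by (simp only: CU_coboundaries_add mult_Suc_right)
qed (simp add: zero_fun_def)

lemma CU_map_one: "continuous_map Y Z h \<Longrightarrow> CU_map Y h (CU_one Z) = CU_one Y"
proof (rule nd_supp_eqI[of Y])
  fix c assume h: "continuous_map Y Z h" and c: "c \<in> nd_cubes Y"
  have "cross 0 (\<lambda>s. h) c \<in> singular_cubes Z"
    using cross_singular[of Y Z 0 "\<lambda>s. h" c] h c by (simp add: cross_map_0 nd_cubes_def)
  then show "CU_map Y h (CU_one Z) c = CU_one Y c"
    using c by (auto simp: CU_map_eq_CX CX_def CU_one_def nd_cubes_def degenerate_iff)
qed (simp_all add: CU_map_eq_CX CU_grade_supp[OF CU_one_grade])

lemma CU_map_power:
  assumes "continuous_map Y Z h" "a \<in> grade (CU Z) k"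
  shows "CU_map Y h (CU_power Z a m) = CU_power Y (CU_map Y h a) m"
proof (induction m)
  case (Suc m)
  then show ?case
    using CU_map_mult[OF assms(2) CU_grade_supp[OF CU_power_grade[OF assms(2)]] assms(1)] by simp
qed (simp add: CU_map_one assms)

lemma CU_map_smult: "CU_map Y h (\<lambda>T. r * f T) = (\<lambda>T. r * CU_map Y h f T)"
  unfolding CU_map_eq_CX by (rule CX_smult)

lemma CU_map_add: "CU_map Y h (f + g) = CU_map Y h f + CU_map Y h g"
  unfolding CU_map_eq_CX by (rule CX_add)

lemma CU_map_diff: "CU_map Y h (f - g) = CU_map Y h f - CU_map Y h g"
  unfolding CU_map_eq_CX by (rule CX_diff)

text \<open>The fixed end points make concatenation with a family of loops possible. Nonvanishing on
  the free loop space is tested by restriction to these loops.\<close>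

definition based_loops :: "'a topology \<Rightarrow> 'a \<Rightarrow> (real \<Rightarrow> 'a) topology" where
  "based_loops X p = subtopology (path_space X) {l. l 0 = p \<and> l 1 = p}"

lemma topspace_based_loops: "topspace (based_loops X p) = {l \<in> paths X. l 0 = p \<and> l 1 = p}"
  by (auto simp: based_loops_def)

lemma continuous_map_into_based_loops:
  "continuous_map Y (path_space X) h \<Longrightarrow> (\<And>y. y \<in> topspace Y \<Longrightarrow> h y 0 = p \<and> h y 1 = p) \<Longrightarrow>
   continuous_map Y (based_loops X p) h"
  by (auto simp: based_loops_def continuous_map_in_subtopology)

lemma continuous_map_based_incl: "continuous_map (based_loops X p) (path_space X) (\<lambda>l. l)"
  by (simp add: based_loops_def continuous_map_from_subtopology)

text \<open>Two families of loops over a cube that agree on its boundary form a spherical cycle in the based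
  loop space. The operator \<open>slant\<close>, which concatenates with it, is a derivation up to homotopy.\<close>

locale loop_cycle =
  fixes X :: "'a topology" and p :: 'a and q :: nat and \<omega> :: "'a scube \<Rightarrow> int"
    and L :: "bool \<Rightarrow> (nat \<Rightarrow> real) \<Rightarrow> real \<Rightarrow> 'a"
  assumes q: "q > 0" "even q"
    and \<omega>: "\<omega> \<in> grade (CU X) (Suc q)" "CU_codiff X \<omega> = 0"
    and L: "continuous_map (top_of_set (cube q)) (based_loops X p) (L b)"
    and L_bdry: "t \<in> cube q \<Longrightarrow> i < q \<Longrightarrow> t i \<in> {0, 1} \<Longrightarrow> L True t = L False t"
begin

abbreviation "W \<equiv> based_loops X p"

definition x where "x = CX W 1 (\<lambda>s l. l (s 0)) \<omega>"

definition slant1 where "slant1 b f = CX W q (\<lambda>t l. path_conc (L b t) l) f"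

definition slant where "slant f = slant1 True f - slant1 False f"

text \<open>Translation by the loop at the corner with all coordinates \<open>e\<close>, where the
  two families agree. It is what remains of a family on one factor of a product when the other
  factor receives all \<open>q\<close> parameters.\<close>

definition shift where "shift e f = CU_map W (\<lambda>l. path_conc (L True (\<lambda>j. if j < q then e else 0)) l) f"

text \<open>The value of \<open>\<omega>\<close> on the cycle adjoint to the two families;
  \<open>(q, restrict (\<lambda>t. t) (cube q))\<close> is the identity cube.\<close>

definition u where "u = \<omega> (cross 1 (\<lambda>s t. L True t (s 0)) (q, restrict (\<lambda>t. t) (cube q)))
   - \<omega> (cross 1 (\<lambda>s t. L False t (s 0)) (q, restrict (\<lambda>t. t) (cube q)))"

lemma L_mem: "t \<in> cube q \<Longrightarrow> L b t \<in> paths X \<and> L b t 0 = p \<and> L b t 1 = p"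
  using L[of b] by (auto simp: continuous_map_def topspace_based_loops Pi_iff)

lemma cross_map_concL: "cross_map W W q (\<lambda>t l. path_conc (L b t) l)"
proof -
  let ?D = "prod_topology (top_of_set (cube q)) W"
  have 1: "continuous_map ?D (path_space X) (\<lambda>z. L b (fst z))"
    using continuous_map_compose[OF continuous_map_fst continuous_map_compose[OF L[of b] continuous_map_based_incl], of W]
    by (simp add: comp_def)
  have 2: "continuous_map ?D (path_space X) (\<lambda>z. snd z)"
    using continuous_map_compose[OF continuous_map_snd continuous_map_based_incl, of "top_of_set (cube q)"]
    by (simp add: comp_def)
  have "continuous_map ?D W (\<lambda>z. path_conc (L b (fst z)) (snd z))"
    by (rule continuous_map_into_based_loops[OF continuous_map_conc[OF 1 2]])
      (auto simp: topspace_based_loops L_mem)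
  then show ?thesis by (simp add: cross_map_def case_prod_beta')
qed

lemma slant_grade: "f \<in> grade (CU W) (q + k) \<Longrightarrow> slant f \<in> grade (CU W) k"
  unfolding slant_def slant1_def by (intro CU_grade_diff CX_grade)

lemma slant_low:
  assumes "f \<in> grade (CU W) k" "k < q"
  shows "slant f = 0"
proof
  fix c :: "(real \<Rightarrow> 'a) scube"
  have "q + fst c \<noteq> k" using assms by simp
  then show "slant f c = 0 c"
    by (simp add: slant_def slant1_def CX_def CU_gradeD[OF assms(1)])
qed

lemma slant_smult: "slant (\<lambda>T. r * f T) = (\<lambda>T. r * slant f T)"
  by (simp add: slant_def slant1_def CX_smult fun_eq_iff algebra_simps)

text \<open>The formula for each family contains the faces of its parameter cube; there the families
  agree, so these terms cancel in the difference. As \<open>q\<close> is even, no sign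
  remains.\<close>

lemma slant_codiff:
  assumes f: "nd_supp W f"
  shows "slant (CU_codiff W f) = CU_codiff W (slant f)"
proof
  fix c
  have "CX W (q - 1) (\<lambda>s l. path_conc (L True (ins i e s)) l) f = CX W (q - 1) (\<lambda>s l. path_conc (L False (ins i e s)) l) f"
    if "i < q" "e \<in> {0, 1}" for i e
  proof (rule CX_cong)
    fix s l assume "s \<in> cube (q - 1)"
    then have "ins i e s \<in> cube q" using ins_cube[of s "q - 1" i e] that by auto
    then have "L True (ins i e s) = L False (ins i e s)"
      by (rule L_bdry[OF _ that(1)]) (use that in \<open>auto simp: ins_def\<close>)
    then show "path_conc (L True (ins i e s)) l = path_conc (L False (ins i e s)) l" by simp
  qed
  note eq = this
  have "slant1 b (CU_codiff W f) c = CU_codiff W (slant1 b f) c + (\<Sum>i<q. (-1) ^ (i + 1) *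
     (CX W (q - 1) (\<lambda>s l. path_conc (L b (ins i 1 s)) l) f c - CX W (q - 1) (\<lambda>s l. path_conc (L b (ins i 0 s)) l) f c))" for b
    using fun_cong[OF CX_codiff[OF f cross_map_concL[of b]], of c] q(2) by (simp add: slant1_def)
  moreover have "(\<Sum>i<q. (-1) ^ (i + 1) * (CX W (q - 1) (\<lambda>s l. path_conc (L True (ins i 1 s)) l) f c - CX W (q - 1) (\<lambda>s l. path_conc (L True (ins i 0 s)) l) f c))
    = (\<Sum>i<q. (-1) ^ (i + 1) * (CX W (q - 1) (\<lambda>s l. path_conc (L False (ins i 1 s)) l) f c - CX W (q - 1) (\<lambda>s l. path_conc (L False (ins i 0 s)) l) f c))"
    by (rule sum.cong) (simp_all add: eq del: One_nat_def)
  ultimately show "slant (CU_codiff W f) c = CU_codiff W (slant f) c"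
    by (simp add: slant_def CU_codiff_diff)
qed

lemma slant_coboundaries:
  assumes "a \<in> coboundaries (CU W) (q + k)"
  shows "slant a \<in> coboundaries (CU W) k"
proof -
  obtain j where j: "q + k = Suc j" using q by (cases "q + k") auto
  then obtain g where g: "g \<in> grade (CU W) j" "a = CU_codiff W g" using assms by (auto simp: coboundaries_Suc)
  have a: "slant a = CU_codiff W (slant g)" using slant_codiff[OF CU_grade_supp[OF g(1)]] g(2) by simp
  show ?thesis
  proof (cases k)
    case 0
    then show ?thesis using a slant_low[OF g(1)] j by simp
  next
    case (Suc k')
    then show ?thesis using a slant_grade[of g k'] g(1) j
      by (simp add: coboundaries_Suc)
  qed
qed

text \<open>Among the ways to distribute the \<open>q\<close> parameters over the two factors, a
  proper splitting puts both factors on the boundary of the cube, where the families agree. Only the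
  two extreme splittings survive in the difference.\<close>

lemma slant_mult:
  assumes f: "f \<in> grade (CU W) k" and g: "nd_supp W g"
  shows "slant (CU_mult W f g) = CU_mult W (slant f) (shift 1 g) + CU_mult W (shift 0 f) (slant g)"
proof (rule nd_supp_eqI[of W])
  show "nd_supp W (slant (CU_mult W f g))"
    unfolding slant_def slant1_def by (intro nd_supp_diff CX_supp)
  show "nd_supp W (CU_mult W (slant f) (shift 1 g) + CU_mult W (shift 0 f) (slant g))"
    by (intro nd_supp_add CU_mult_supp)
  fix c assume "c \<in> nd_cubes W"
  then have c: "c \<in> singular_cubes W" by (simp add: nd_cubes_def)
  define P where "P b A = (-1) ^ (inversions A ({..<q} - A) + (q - card A) * (k - card A)) *
     CU_mult W (CX W (card A) (\<lambda>s l. path_conc (L b (fins A q 0 s)) l) f)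
               (CX W (card ({..<q} - A)) (\<lambda>s l. path_conc (L b (fins ({..<q} - A) q 1 s)) l) g) c" for b A
  have P: "slant1 b (CU_mult W f g) c = sum (P b) (Pow {..<q})" for b
    unfolding slant1_def P_def by (rule CX_mult[OF f g cross_map_concL c])
  have eq: "CX W (card A) (\<lambda>s l. path_conc (L True (fins A q e s)) l) h = CX W (card A) (\<lambda>s l. path_conc (L False (fins A q e s)) l) h"
    if "A \<subset> {..<q}" "e \<in> {0, 1}" for A e h
  proof (rule CX_cong)
    fix s l assume s: "s \<in> cube (card A)"
    obtain i where i: "i < q" "i \<notin> A" using \<open>A \<subset> {..<q}\<close> by auto
    have "fins A q e s \<in> cube q"
      using cube_mapD[OF cube_map_fins[of A q e] s] that by auto
    then have "L True (fins A q e s) = L False (fins A q e s)"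
      by (rule L_bdry[OF _ i(1)]) (use i that in \<open>auto simp: fins_def\<close>)
    then show "path_conc (L True (fins A q e s)) l = path_conc (L False (fins A q e s)) l" by simp
  qed
  have "P True A = P False A" if "A \<in> Pow {..<q} - {{}, {..<q}}" for A
  proof -
    have "A \<subset> {..<q}" "{..<q} - A \<subset> {..<q}" using that by auto
    then show ?thesis using eq[of A 0] eq[of "{..<q} - A" 1] by (simp add: P_def)
  qed
  then have mid: "sum (P True) (Pow {..<q} - {{}, {..<q}}) = sum (P False) (Pow {..<q} - {{}, {..<q}})"
    by (intro sum.cong) auto
  have split: "sum (P b) (Pow {..<q}) = P b {} + P b {..<q} + sum (P b) (Pow {..<q} - {{}, {..<q}})" for b
  proof -
    have "sum (P b) (Pow {..<q}) = sum (P b) {{}, {..<q}} + sum (P b) (Pow {..<q} - {{}, {..<q}})"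
      by (rule sum.subset_diff[THEN trans[OF _ add.commute]]) auto
    moreover have "{} \<noteq> {..<q}" using q by auto
    ultimately show ?thesis by simp
  qed
  have full: "CX W (card {..<q}) (\<lambda>s l. path_conc (L b (fins {..<q} q e s)) l) h = slant1 b h" for b e h
    unfolding slant1_def card_lessThan
  proof (rule CX_cong)
    fix s l assume s: "s \<in> cube q"
    have "card {i \<in> {..<q}. i < j} = j" if "j < q" for j
    proof -
      have "{i \<in> {..<q}. i < j} = {..<j}" using that by auto
      then show ?thesis by simp
    qed
    then have "fins {..<q} q e s = s" using cubeD(3)[OF s] by (auto simp: fins_def fun_eq_iff)
    then show "path_conc (L b (fins {..<q} q e s)) l = path_conc (L b s) l" by simp
  qed
  have empty: "CX W (card {}) (\<lambda>s l. path_conc (L b (fins {} q e s)) l) h = shift e h" if "e \<in> {0, 1}" for b e h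
  proof -
    have "fins {} q e s = (\<lambda>j. if j < q then e else 0)" for s by (simp add: fins_def)
    moreover have "L b (\<lambda>j. if j < q then e else 0) = L True (\<lambda>j. if j < q then e else 0)"
      using L_bdry[of "\<lambda>j. if j < q then e else 0" 0] q that by (cases b) (auto simp: cube_def)
    ultimately show ?thesis by (simp add: shift_def CU_map_eq_CX)
  qed
  have P1: "P b {..<q} = CU_mult W (slant1 b f) (shift 1 g) c" for b
    using full[of b 0 f] empty[of 1 b g] by (simp add: P_def)
  have P0: "P b {} = CU_mult W (shift 0 f) (slant1 b g) c" for b
    using full[of b 1 g] empty[of 0 b f] q by (simp add: P_def)
  have "slant (CU_mult W f g) c = (P True {} - P False {}) + (P True {..<q} - P False {..<q})"
    using mid by (simp add: slant_def P split)
  then show "slant (CU_mult W f g) c = (CU_mult W (slant f) (shift 1 g) + CU_mult W (shift 0 f) (slant g)) c"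
    by (simp add: P0 P1 slant_def CU_mult_diff_left CU_mult_diff_right)
qed

lemma x_grade: "x \<in> grade (CU W) q"
  unfolding x_def using \<omega>(1) by (intro CX_grade) simp

lemma cross_map_loop_family: "continuous_map W (path_space X) h \<Longrightarrow> cross_map W (path_space X) 0 (\<lambda>t. h)"
  by (simp add: cross_map_0)

lemma adj_x: "CX W (Suc 0) (adj (\<lambda>t l. l)) \<omega> = x"
  by (simp add: x_def adj_def[abs_def])

lemma x_cocycle: "CU_codiff W x = 0"
proof -
  have "cross_map W X 1 (adj (\<lambda>t l. l))"
    using cross_map_adj[OF cross_map_loop_family[OF continuous_map_based_incl]] by simp
  then have cm: "cross_map W X 1 (\<lambda>s l. l (s 0))" by (simp add: adj_def[abs_def])
  have "CX W 0 (\<lambda>s l. l (ins 0 e s 0)) \<omega> = CX W 0 (\<lambda>s l. p) \<omega>" if "e \<in> {0, 1}" for e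
    by (rule CX_cong) (use that in \<open>auto simp: ins_def topspace_based_loops\<close>)
  then show ?thesis
    using CX_codiff[OF CU_grade_supp[OF \<omega>(1)] cm] \<omega>(2) by (simp add: x_def fun_eq_iff)
qed

lemma shift_continuous:
  assumes "e \<in> {0, 1}"
  shows "continuous_map W W (\<lambda>l. path_conc (L True (\<lambda>j. if j < q then e else 0)) l)"
proof -
  have "continuous_map W (path_space X) (\<lambda>l. L True (\<lambda>j. if j < q then e else 0))"
    using L_mem[of "\<lambda>j. if j < q then e else 0" True] assms by (auto simp: cube_def)
  then show ?thesis
    using L_mem[of "\<lambda>j. if j < q then e else 0" True] assms
    by (intro continuous_map_into_based_loops continuous_map_conc continuous_map_based_incl)
      (auto simp: cube_def topspace_based_loops)
qed

text \<open>Dividing the concatenated loop at its midpoint shows that translation adds a coboundary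
  and the transgression along the constant family \<open>c\<close>, and the latter vanishes because
  \<open>q > 0\<close>.\<close>

lemma shift_x:
  assumes "e \<in> {0, 1}"
  shows "shift e x - x \<in> coboundaries (CU W) q"
proof -
  define c where "c = L True (\<lambda>j. if j < q then e else 0)"
  have c: "c \<in> paths X" "c 0 = p" "c 1 = p"
    using L_mem[of "\<lambda>j. if j < q then e else 0" True] assms by (auto simp: cube_def c_def)
  have cont: "continuous_map W (path_space X) (\<lambda>l. path_conc c l)"
    using continuous_map_compose[OF shift_continuous[OF assms] continuous_map_based_incl] by (simp add: comp_def c_def)
  have "CX W (Suc 0) (adj (\<lambda>t l. path_conc c l)) \<omega> =
     CX W (Suc 0) (adj (\<lambda>t l. l)) \<omega> + CX W (Suc 0) (adj (\<lambda>t l. c)) \<omega>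
     - CU_codiff W (CX W 2 (\<lambda>s l. path_conc c l (div_sq (s 0) (s 1))) \<omega>)"
  proof -
    have "CX W (Suc 0) (adj (\<lambda>t l u. path_conc c l ((1 + u) / 2))) \<omega> = CX W (Suc 0) (adj (\<lambda>t l. l)) \<omega>"
      by (rule CX_adj_conc_upper) (auto simp: c topspace_based_loops)
    moreover have "CX W (Suc 0) (adj (\<lambda>t l u. path_conc c l (u / 2))) \<omega> = CX W (Suc 0) (adj (\<lambda>t l. c)) \<omega>"
      by (rule CX_adj_conc_lower)
    ultimately show ?thesis
      using CX_divide[OF CU_grade_supp[OF \<omega>(1)] \<omega>(2) cross_map_loop_family[OF cont]]
      by (simp add: fun_eq_iff numeral_2_eq_2)
  qed
  moreover have "CX W (Suc 0) (adj (\<lambda>t l. c)) \<omega> = 0"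
    unfolding adj_def[abs_def] by (rule CX_const[OF \<omega>(1)]) (use q in simp)
  moreover have "CX W (Suc 0) (adj (\<lambda>t l. path_conc c l)) \<omega> = shift e x"
  proof -
    have "cross_map W W 0 (\<lambda>s l. path_conc c l)" using shift_continuous[OF assms] by (simp add: cross_map_0 c_def)
    from CX_CX[OF CU_grade_supp[OF \<omega>(1)] this, of 1 "\<lambda>s l. l (s 0)"]
    show ?thesis by (simp add: shift_def x_def CU_map_eq_CX adj_def[abs_def] c_def)
  qed
  ultimately have eq: "shift e x - x = - CU_codiff W (CX W 2 (\<lambda>s l. path_conc c l (div_sq (s 0) (s 1))) \<omega>)"
    by (simp add: adj_x)
  obtain r where r: "q = Suc r" using q by (cases q) auto
  have "CX W 2 (\<lambda>s l. path_conc c l (div_sq (s 0) (s 1))) \<omega> \<in> grade (CU W) r"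
    using \<omega>(1) r by (intro CX_grade) simp
  then have "CU_codiff W (CX W 2 (\<lambda>s l. path_conc c l (div_sq (s 0) (s 1))) \<omega>) \<in> coboundaries (CU W) q"
    unfolding r coboundaries_Suc by auto
  then show ?thesis unfolding eq by (rule CU_coboundaries_minus)
qed

text \<open>When the concatenated loop is divided, the part coming from \<open>l\<close> and the
  faces of the parameter cube are the same for both families and cancel. What is left does not
  depend on \<open>l\<close> and is supported on 0-cubes, where it is the number
  \<open>u\<close>.\<close>

lemma slant_x: "slant x = (\<lambda>T. u * CU_one W T)"
proof -
  have cm: "cross_map W (path_space X) q (\<lambda>t l. path_conc (L b t) l)" for b
    using continuous_map_compose[OF cross_map_concL[unfolded cross_map_def] continuous_map_based_incl, of b]
    by (simp add: cross_map_def comp_def case_prod_beta')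
  have s1: "slant1 b x = CX W (Suc q) (adj (\<lambda>t l. path_conc (L b t) l)) \<omega>" for b
    using CX_CX[OF CU_grade_supp[OF \<omega>(1)] cross_map_concL[of b], of 1 "\<lambda>s l. l (s 0)"]
    by (simp add: slant1_def x_def adj_def[abs_def])
  define sq where "sq b s l = path_conc (L b (csnd 2 s)) l (div_sq (s 0) (s 1))" for b s l
  define R where "R b c = (\<Sum>i<q. (-1) ^ (i + 1) *
     (CX W (Suc q) (\<lambda>s l. path_conc (L b (ins i 1 (csnd 2 s))) l (div_sq (s 0) (s 1))) \<omega> c
    - CX W (Suc q) (\<lambda>s l. path_conc (L b (ins i 0 (csnd 2 s))) l (div_sq (s 0) (s 1))) \<omega> c))" for b c
  \<comment> \<open>The degree q + 1 of \<open>\<omega>\<close> is too small for an operator that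
    lowers degrees by q + 2. So the division has no coboundary correction and the result is an
    equality of cochains.\<close>
  have "CX W (q + 2) (sq b) \<omega> = 0" for b
  proof
    fix c show "CX W (q + 2) (sq b) \<omega> c = 0 c"
      by (simp add: CX_def CU_gradeD[OF \<omega>(1)])
  qed
  then have div: "slant1 b x = x' + CX W (Suc q) (adj (\<lambda>t l. L b t)) \<omega> - R b"
    if "x' = CX W (Suc q) (adj (\<lambda>t l. l)) \<omega>" for b x'
  proof -
    have "CX W (Suc q) (adj (\<lambda>t l u. path_conc (L b t) l ((1 + u) / 2))) \<omega> = CX W (Suc q) (adj (\<lambda>t l. l)) \<omega>"
      by (rule CX_adj_conc_upper) (auto simp: L_mem topspace_based_loops)
    moreover have "CX W (Suc q) (adj (\<lambda>t l u. path_conc (L b t) l (u / 2))) \<omega> = CX W (Suc q) (adj (\<lambda>t l. L b t)) \<omega>"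
      by (rule CX_adj_conc_lower)
    moreover have "CX W (Suc q) (adj (\<lambda>t l. path_conc (L b t) l)) \<omega> =
       CX W (Suc q) (adj (\<lambda>t l u. path_conc (L b t) l ((1 + u) / 2))) \<omega> + CX W (Suc q) (adj (\<lambda>t l u. path_conc (L b t) l (u / 2))) \<omega>
       - (\<lambda>c. (-1) ^ q * CU_codiff W (CX W (q + 2) (sq b) \<omega>) c) - R b"
      unfolding sq_def[abs_def] R_def[abs_def]
      by (rule CX_divide[OF CU_grade_supp[OF \<omega>(1)] \<omega>(2) cm[of b]])
    moreover have "CU_codiff W (CX W (q + 2) (sq b) \<omega>) = 0"
      by (simp only: \<open>\<And>b. CX W (q + 2) (sq b) \<omega> = 0\<close> CU_codiff_0)
    ultimately show ?thesis unfolding s1 that by (simp add: fun_eq_iff)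
  qed
  have "R True = R False"
  proof
    fix c
    have "CX W (Suc q) (\<lambda>s l. path_conc (L True (ins i e (csnd 2 s))) l (div_sq (s 0) (s 1))) \<omega>
        = CX W (Suc q) (\<lambda>s l. path_conc (L False (ins i e (csnd 2 s))) l (div_sq (s 0) (s 1))) \<omega>" if "i < q" "e \<in> {0, 1}" for i e
    proof (rule CX_cong)
      fix s l assume s: "s \<in> cube (Suc q)"
      have "csnd 2 s \<in> cube (q - 1)" using csnd_cube[of s 2 "q - 1"] s q by simp
      then have "ins i e (csnd 2 s) \<in> cube q" using ins_cube[of "csnd 2 s" "q - 1" i e] that by auto
      then have "L True (ins i e (csnd 2 s)) = L False (ins i e (csnd 2 s))"
        by (rule L_bdry[OF _ that(1)]) (use that in \<open>auto simp: ins_def\<close>)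
      then show "path_conc (L True (ins i e (csnd 2 s))) l (div_sq (s 0) (s 1)) = path_conc (L False (ins i e (csnd 2 s))) l (div_sq (s 0) (s 1))"
        by simp
    qed
    then show "R True c = R False c" unfolding R_def by (intro sum.cong) auto
  qed
  then have sl: "slant x = CX W (Suc q) (adj (\<lambda>t l. L True t)) \<omega> - CX W (Suc q) (adj (\<lambda>t l. L False t)) \<omega>"
    unfolding slant_def div[OF refl] by simp
  show ?thesis
  proof (rule nd_supp_eqI[of W])
    show "nd_supp W (slant x)" unfolding sl by (intro nd_supp_diff CX_supp)
    show "nd_supp W (\<lambda>T. u * CU_one W T)" by (intro nd_supp_smult CU_grade_supp[OF CU_one_grade])
    fix c assume c: "c \<in> nd_cubes W"
    show "slant x c = u * CU_one W c"
    proof (cases "fst c = 0")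
      case False
      then have "CX W (Suc q) (adj (\<lambda>t l. L b t)) \<omega> c = 0" for b
        by (simp add: CX_def CU_gradeD[OF \<omega>(1)])
      then show ?thesis using False by (simp add: sl CU_one_def)
    next
      case True
      have "cross (Suc q) (adj (\<lambda>t l. L b t)) c = cross 1 (\<lambda>s t. L b t (s 0)) (q, restrict (\<lambda>t. t) (cube q))" for b
      proof -
        have "L b (csnd 1 (cfst (Suc q) t)) (cfst (Suc q) t 0) = L b (restrict (\<lambda>t. t) (cube q) (csnd 1 t)) (cfst 1 t 0)"
          if t: "t \<in> cube (Suc q)" for t
        proof -
          have "cfst (Suc q) t = t" using cubeD(3)[OF t] by (auto simp: fun_eq_iff)
          moreover have *: "csnd 1 t \<in> cube q" using csnd_cube[of t 1 q] t by simp
          moreover have "cfst q (csnd 1 t) = csnd 1 t" using cubeD(3)[OF *] by (auto simp: fun_eq_iff)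
          ultimately show ?thesis by simp
        qed
        then show ?thesis using True by (auto simp: cross_def adj_def restrict_def fun_eq_iff)
      qed
      then show ?thesis using c True by (simp add: sl CX_def u_def CU_one_def)
    qed
  qed
qed

text \<open>The derivation rule applied to \<open>x\<close> times a power: modulo coboundaries the
  translations disappear, and each factor contributes \<open>u\<close>.\<close>

lemma slant_power:
  "slant (CU_power W x (Suc m)) - (\<lambda>T. (int (Suc m) * u) * CU_power W x m T) \<in> coboundaries (CU W) (q * m)"
proof (induction m)
  case 0
  have one: "CU_one W \<in> grade (CU W) 0" by (rule CU_one_grade)
  have "CU_mult W x (CU_one W) = x" by (rule CU_mult_one(2)[OF CU_grade_supp[OF x_grade]])
  then show ?case using slant_x by (simp add: zero_fun_def)
next
  case (Suc m)
  note xp = CU_power_grade[OF x_grade, of "Suc m"] CU_power_cocycle[OF x_grade x_cocycle, of "Suc m"]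
  note xm = CU_power_grade[OF x_grade, of m] CU_power_cocycle[OF x_grade x_cocycle, of m]
  have sh: "shift e x \<in> grade (CU W) q" "CU_codiff W (shift e x) = 0" if "e \<in> {0, 1}" for e
    using CU_map_grade[OF x_grade] CU_map_codiff[OF CU_grade_supp[OF x_grade] shift_continuous[OF that]] x_cocycle
    by (auto simp: shift_def CU_map_eq_CX)
  let ?P = "CU_power W x (Suc m)" and ?k = "int (Suc m) * u"
  define a where "a = slant ?P - (\<lambda>T. ?k * CU_power W x m T)"
  have a: "a \<in> coboundaries (CU W) (q * m)" using Suc by (simp only: a_def)
  define b where "b = shift 1 ?P - ?P"
  have b: "b \<in> coboundaries (CU W) (q * Suc m)"
  proof -
    have "shift 1 ?P = CU_power W (shift 1 x) (Suc m)"
      unfolding shift_def by (rule CU_map_power[OF shift_continuous x_grade]) simp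
    then show ?thesis unfolding b_def
      using CU_power_cong[OF sh[of 1] x_grade x_cocycle shift_x[of 1], of "Suc m"] by simp
  qed
  define d where "d = shift 0 x - x"
  have d: "d \<in> coboundaries (CU W) q" unfolding d_def by (rule shift_x) simp
  have sP: "slant ?P \<in> grade (CU W) (q * m)" "CU_codiff W (slant ?P) = 0"
    using slant_grade[of ?P "q * m"] xp slant_codiff[OF CU_grade_supp[OF xp(1)]]
    by (auto simp: slant_def slant1_def)
  have "slant (CU_mult W x ?P) = CU_mult W (slant x) (shift 1 ?P) + CU_mult W (shift 0 x) (slant ?P)"
    by (rule slant_mult[OF x_grade CU_grade_supp[OF xp(1)]])
  also have "CU_mult W (slant x) (shift 1 ?P) = (\<lambda>T. u * (?P + b) T)"
  proof -
    have "nd_supp W (shift 1 ?P)" by (simp add: shift_def CU_map_eq_CX)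
    then show ?thesis unfolding slant_x CU_mult_smult_left b_def by (simp add: CU_mult_one)
  qed
  also have "CU_mult W (shift 0 x) (slant ?P) = CU_mult W d (slant ?P) + CU_mult W x a + (\<lambda>T. ?k * ?P T)"
  proof -
    have "slant ?P = a + (\<lambda>T. ?k * CU_power W x m T)" by (simp add: a_def)
    then have "CU_mult W x (slant ?P) = CU_mult W x a + (\<lambda>T. ?k * ?P T)"
      by (simp only: CU_mult_add_right CU_mult_smult_right CU_power.simps)
    moreover have "shift 0 x = d + x" by (simp add: d_def)
    ultimately show ?thesis by (simp only: CU_mult_add_left add.assoc)
  qed
  \<comment> \<open>Besides the main term only exact contributions remain: the translation errors
    \<open>b\<close> and \<open>d\<close> and the inductive error \<open>a\<close>.\<close>
  finally have eq: "slant (CU_power W x (Suc (Suc m))) - (\<lambda>T. (int (Suc (Suc m)) * u) * ?P T)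
     = (\<lambda>T. u * b T) + (CU_mult W d (slant ?P) + CU_mult W x a)"
    by (simp add: fun_eq_iff algebra_simps del: CU_power.simps) (simp add: algebra_simps)
  have "CU_mult W d (slant ?P) \<in> coboundaries (CU W) (q * Suc m)"
    using CU_mult_coboundaries_left[OF d sP] by simp
  moreover have "CU_mult W x a \<in> coboundaries (CU W) (q * Suc m)"
    using CU_mult_coboundaries_right[OF a x_grade x_cocycle] by simp
  ultimately show ?case unfolding eq
    by (intro CU_coboundaries_add CU_coboundaries_smult b)
qed

text \<open>\<open>slant\<close> lowers the exponent at the price of the nonzero factor (m + 1) u,
  which the arbitrary multiple \<open>k\<close> absorbs. For m = 0 the constant is nonzero at a
  0-cube, while the only coboundary of degree 0 is 0.\<close>

lemma power_not_coboundary: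
  assumes "u \<noteq> 0"
  shows "k \<noteq> 0 \<Longrightarrow> (\<lambda>T. k * CU_power W x m T) \<notin> coboundaries (CU W) (q * m)"
proof (induction m arbitrary: k)
  case 0
  have "L True (\<lambda>_. 0) \<in> topspace W" using L_mem[of "\<lambda>_. 0" True] by (simp add: topspace_based_loops)
  then have "(0, restrict (\<lambda>t. L True (\<lambda>_. 0)) (cube 0)) \<in> nd_cubes W"
    by (auto simp: nd_cubes_def singular_cubes_iff degenerate_iff cube_0)
  then have "k * CU_one W (0, restrict (\<lambda>t. L True (\<lambda>_. 0)) (cube 0)) \<noteq> 0" using 0 by (simp add: CU_one_def)
  then show ?case by (auto simp: fun_eq_iff)
next
  case (Suc m)
  show ?case
  proof
    assume "(\<lambda>T. k * CU_power W x (Suc m) T) \<in> coboundaries (CU W) (q * Suc m)"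
    then have "slant (\<lambda>T. k * CU_power W x (Suc m) T) \<in> coboundaries (CU W) (q * m)"
      by (intro slant_coboundaries) simp
    moreover have "(\<lambda>T. k * (slant (CU_power W x (Suc m)) - (\<lambda>T. (int (Suc m) * u) * CU_power W x m T)) T) \<in> coboundaries (CU W) (q * m)"
      by (rule CU_coboundaries_smult[OF slant_power])
    ultimately have "slant (\<lambda>T. k * CU_power W x (Suc m) T) - (\<lambda>T. k * (slant (CU_power W x (Suc m)) - (\<lambda>T. (int (Suc m) * u) * CU_power W x m T)) T) \<in> coboundaries (CU W) (q * m)"
      by (rule CU_coboundaries_diff)
    moreover have "slant (\<lambda>T. k * CU_power W x (Suc m) T) - (\<lambda>T. k * (slant (CU_power W x (Suc m)) - (\<lambda>T. (int (Suc m) * u) * CU_power W x m T)) T)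
       = (\<lambda>T. (k * int (Suc m) * u) * CU_power W x m T)"
      unfolding slant_smult by (simp add: fun_eq_iff right_diff_distrib mult.assoc)
    ultimately show False using Suc.IH[of "k * int (Suc m) * u"] Suc.prems assms by simp
  qed
qed

end

section \<open>Loops on odd spheres\<close>

text \<open>Normalization as a retraction onto the sphere; the free later coordinates of
  \<open>punctured N\<close> are replaced by 0.\<close>

definition radial :: "nat \<Rightarrow> (nat \<Rightarrow> real) \<Rightarrow> nat \<Rightarrow> real" where
  "radial N x = (\<lambda>i. if i \<le> N then x i / sqrt (\<Sum>j\<le>N. (x j)\<^sup>2) else 0)"

lemma nsphere_eq: "nsphere N = top_of_set {x. (\<Sum>i\<le>N. (x i)\<^sup>2) = 1 \<and> (\<forall>i>N. x i = 0)}"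
  by (simp add: nsphere euclidean_product_topology)

lemma punctured_sum_pos: "x \<in> punctured N \<Longrightarrow> 0 < (\<Sum>j\<le>N. (x j)\<^sup>2)"
  by (auto simp: punctured_def intro!: sum_pos2)

lemma continuous_map_radial: "continuous_map (top_of_set (punctured N)) (nsphere N) (radial N)"
  unfolding nsphere_eq continuous_map_subtopology_eu
proof (intro conjI)
  show "continuous_on (punctured N) (radial N)"
  proof (rule continuous_on_coordinatewise_then_product)
    fix i
    have "(\<Sum>j\<le>N. (x j)\<^sup>2) \<noteq> 0" if "x \<in> punctured N" for x
      using punctured_sum_pos[OF that] by simp
    then show "continuous_on (punctured N) (\<lambda>x. radial N x i)"
      by (cases "i \<le> N") (auto simp: radial_def intro!: continuous_intros)
  qed
  show "radial N \<in> punctured N \<rightarrow> {x. (\<Sum>i\<le>N. (x i)\<^sup>2) = 1 \<and> (\<forall>i>N. x i = 0)}"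
  proof
    fix x assume x: "x \<in> punctured N"
    define y where "y = radial N x"
    have p: "0 < (\<Sum>j\<le>N. (x j)\<^sup>2)" using punctured_sum_pos[OF x] .
    have "(\<Sum>i\<le>N. (y i)\<^sup>2) = (\<Sum>i\<le>N. (x i)\<^sup>2 / (\<Sum>j\<le>N. (x j)\<^sup>2))"
      using p by (intro sum.cong) (auto simp: y_def radial_def power_divide)
    also have "\<dots> = 1" using p by (simp flip: sum_divide_distrib)
    finally show "radial N x \<in> {x. (\<Sum>i\<le>N. (x i)\<^sup>2) = 1 \<and> (\<forall>i>N. x i = 0)}"
      by (simp add: y_def) (simp add: radial_def)
  qed
qed

lemma sphere_subset_punctured: "topspace (nsphere N) \<subseteq> punctured N"
proof
  fix x assume "x \<in> topspace (nsphere N)"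
  then have "(\<Sum>i\<le>N. (x i)\<^sup>2) = 1" by (simp add: nsphere_eq)
  moreover have "(\<Sum>i\<le>N. (x i)\<^sup>2) = 0" if "x \<notin> punctured N"
    using that by (intro sum.neutral) (auto simp: punctured_def)
  ultimately show "x \<in> punctured N" by fastforce
qed

lemma radial_sphere: "x \<in> topspace (nsphere N) \<Longrightarrow> radial N x = x"
  by (auto simp: nsphere_eq radial_def fun_eq_iff)

text \<open>With equal values on the two hemispheres the radial pullback of \<open>\<omega>\<close>
  would be exact on punctured space, and restricting the primitive to the sphere would make
  \<open>\<omega>\<close> itself exact.\<close>

lemma sphere_cocycle_detect:
  assumes \<omega>: "\<omega> \<in> grade (CU (nsphere (Suc q))) (Suc q)" "CU_codiff (nsphere (Suc q)) \<omega> = 0"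
    and nb: "\<omega> \<notin> coboundaries (CU (nsphere (Suc q))) (Suc q)"
  shows "\<omega> (cross 0 (\<lambda>s. radial (Suc q)) (iota 1 (Suc q))) \<noteq> \<omega> (cross 0 (\<lambda>s. radial (Suc q)) (iota (-1) (Suc q)))"
proof
  let ?X = "nsphere (Suc q)" and ?Y = "top_of_set (punctured (Suc q))"
  assume eq: "\<omega> (cross 0 (\<lambda>s. radial (Suc q)) (iota 1 (Suc q))) = \<omega> (cross 0 (\<lambda>s. radial (Suc q)) (iota (-1) (Suc q)))"
  let ?f = "CU_map ?Y (radial (Suc q)) \<omega>"
  have f: "?f \<in> grade (CU ?Y) (Suc q)" by (rule CU_map_grade[OF \<omega>(1)])
  have df: "CU_codiff ?Y ?f = 0"
    using CU_map_codiff[OF CU_grade_supp[OF \<omega>(1)] continuous_map_radial] \<omega>(2) by (simp add: CU_map_eq_CX)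
  have ev: "?f (iota e (Suc q)) = \<omega> (cross 0 (\<lambda>s. radial (Suc q)) (iota e (Suc q)))" if "e \<noteq> 0" for e
    unfolding CU_map_eq_CX by (rule CX_singular[OF CU_grade_supp[OF \<omega>(1)] iota_singular[OF that]])
  obtain g where g: "g \<in> grade (CU ?Y) q" "CU_codiff ?Y g = ?f"
    using detect_cocycle[OF f df] eq ev[of 1] ev[of "-1"] by auto
  have incl: "continuous_map ?X ?Y (\<lambda>x. x)"
    using sphere_subset_punctured[of "Suc q"] by (auto simp: nsphere_eq)
  have "CU_map ?X (\<lambda>x. x) ?f = CX ?X 0 (\<lambda>s x. radial (Suc q) x) \<omega>"
    using CX_CX[OF CU_grade_supp[OF \<omega>(1)], of ?X ?Y 0 "\<lambda>s x. x" 0 "\<lambda>s. radial (Suc q)"] incl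
    by (simp add: CU_map_eq_CX cross_map_0)
  also have "\<dots> = CX ?X 0 (\<lambda>s x. x) \<omega>" by (rule CX_cong) (simp add: radial_sphere)
  also have "\<dots> = \<omega>"
    by (rule nd_supp_eqI[OF CX_supp CU_grade_supp[OF \<omega>(1)]]) (simp add: CX_identity)
  finally have "\<omega> = CU_codiff ?X (CU_map ?X (\<lambda>x. x) g)"
    using CU_map_codiff[OF CU_grade_supp[OF g(1)] incl] g(2) by simp
  moreover have "CU_map ?X (\<lambda>x. x) g \<in> grade (CU ?X) q" by (rule CU_map_grade[OF g(1)])
  ultimately show False using nb by (auto simp: coboundaries_Suc)
qed

text \<open>At the ends of the outermost suspension coordinate both points are the same pole; on the
  remaining faces induction applies. So the two hemispheres fit together to a cycle.\<close>

lemma iota_boundary: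
  "t \<in> cube q \<Longrightarrow> i < q \<Longrightarrow> t i \<in> {0, 1} \<Longrightarrow> snd (iota e q) t = snd (iota e' q) t"
proof (induction q arbitrary: t i)
  case (Suc q)
  have t: "csnd 1 t \<in> cube q" using csnd_cube[of t 1 q] Suc.prems(1) by simp
  have "snd (iota e (Suc q)) t = susp q (cfst 1 t 0) (snd (iota e q) (csnd 1 t))" for e
    using Suc.prems(1) snd_cross[of t 1 "iota e q" "\<lambda>s. susp q (s 0)"] by simp
  then have s: "snd (iota e (Suc q)) t = susp q (t 0) (snd (iota e q) (csnd 1 t))" for e by simp
  show ?case
  proof (cases i)
    case 0
    then show ?thesis using Suc.prems(3) unfolding s by (auto simp: susp_def)
  next
    case (Suc j)
    then have "snd (iota e q) (csnd 1 t) = snd (iota e' q) (csnd 1 t)"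
      using Suc.prems(2,3) by (intro Suc.IH[OF t, of j]) auto
    then show ?thesis unfolding s by simp
  qed
qed simp

section \<open>Loops on the sphere adjoint to the suspension\<close>

definition north :: "nat \<Rightarrow> nat \<Rightarrow> real" where
  "north q = (\<lambda>j. if j = Suc q then 1 else 0)"

definition meridian :: "nat \<Rightarrow> (nat \<Rightarrow> real) \<Rightarrow> real \<Rightarrow> nat \<Rightarrow> real" where
  "meridian q p = restrict (\<lambda>s. radial (Suc q) (susp q s p)) {0..1}"

lemma meridian_ends: "meridian q p 0 = north q" "meridian q p 1 = (\<lambda>j. - north q j)"
proof -
  have "radial (Suc q) (\<lambda>j. if j = Suc q then e else 0) = (\<lambda>j. if j = Suc q then e else 0)" if "\<bar>e\<bar> = 1" for e
  proof -
    have "e\<^sup>2 = 1" using that by (metis one_power2 power2_abs)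
    then have "(\<Sum>j\<le>Suc q. (if j = Suc q then e else 0)\<^sup>2) = 1" by simp
    then show ?thesis by (auto simp: radial_def fun_eq_iff)
  qed
  note r = this
  have "susp q 0 p = (\<lambda>j. if j = Suc q then 1 else 0)" "susp q 1 p = (\<lambda>j. if j = Suc q then -1 else 0)"
    by (simp_all add: susp_def fun_eq_iff)
  moreover have north: "north q = (\<lambda>j. if j = Suc q then 1 else 0)" "(\<lambda>j. - north q j) = (\<lambda>j. if j = Suc q then -1 else 0)"
    by (simp_all add: north_def fun_eq_iff)
  ultimately show "meridian q p 0 = north q" "meridian q p 1 = (\<lambda>j. - north q j)"
    using r[of 1] r[of "-1"] by (simp_all add: meridian_def north)
qed

lemma continuous_map_meridian: "continuous_map (top_of_set (punctured q)) (path_space (nsphere (Suc q))) (meridian q)"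
  unfolding meridian_def
proof (rule continuous_map_curry)
  have 1: "continuous_on (punctured q \<times> {0..1}) (\<lambda>z. susp q (snd z) (fst z))"
  proof (rule continuous_on_coordinatewise_then_product)
    fix j
    have "continuous_on (punctured q \<times> {0..1::real}) ((\<lambda>t. t j) \<circ> fst)"
      by (rule continuous_on_compose) (auto intro: continuous_intros)
    then show "continuous_on (punctured q \<times> {0..1}) (\<lambda>z. susp q (snd z) (fst z) j)"
      by (cases "j = Suc q") (auto simp: susp_def comp_def intro!: continuous_intros)
  qed
  have "continuous_map (prod_topology (top_of_set (punctured q)) (top_of_set {0..1})) (top_of_set (punctured (Suc q)))
     (\<lambda>z. susp q (snd z) (fst z))"
    unfolding prod_topology_subtopology_eu continuous_map_subtopology_eu using 1
    by (auto intro!: susp_punctured)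
  from continuous_map_compose[OF this continuous_map_radial]
  show "continuous_map (prod_topology (top_of_set (punctured q)) (top_of_set {0..1})) (nsphere (Suc q))
     (\<lambda>(p, s). radial (Suc q) (susp q s p))"
    by (simp add: comp_def case_prod_beta')
qed

text \<open>One fixed meridian run backwards; it closes all meridians to loops at the north
  pole.\<close>

definition return_path :: "nat \<Rightarrow> real \<Rightarrow> nat \<Rightarrow> real" where
  "return_path q = restrict (\<lambda>s. meridian q (\<lambda>j. if j = 0 then 1 else 0) (1 - s)) {0..1}"

lemma return_path: "return_path q \<in> paths (nsphere (Suc q))"
  "return_path q 0 = (\<lambda>j. - north q j)" "return_path q 1 = north q"
proof -
  have "(\<lambda>j. if j = 0 then 1 else 0) \<in> punctured q" by (auto simp: punctured_def)
  then have m: "meridian q (\<lambda>j. if j = 0 then 1 else 0) \<in> topspace (path_space (nsphere (Suc q)))"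
    using continuous_map_meridian[of q] by (auto simp: continuous_map_def)
  have "continuous_map (top_of_set {0..1}) (nsphere (Suc q)) (\<lambda>s. meridian q (\<lambda>j. if j = 0 then 1 else 0) (1 - s))"
    using m by (intro continuous_map_eval_comp[where f = "\<lambda>_. meridian q (\<lambda>j. if j = 0 then 1 else 0)"])
      (auto intro!: continuous_intros)
  then show "return_path q \<in> paths (nsphere (Suc q))"
    by (auto simp: return_path_def paths_def intro: continuous_map_eq)
qed (simp_all add: return_path_def meridian_ends)

text \<open>Given on the two hemispheres, the map from the q-sphere to the based loops on the next
  sphere that is adjoint to the identity of the suspension.\<close>

definition sphere_loop :: "nat \<Rightarrow> bool \<Rightarrow> (nat \<Rightarrow> real) \<Rightarrow> real \<Rightarrow> nat \<Rightarrow> real" where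
  "sphere_loop q b t = path_conc (meridian q (snd (iota (if b then 1 else -1) q) t)) (return_path q)"

lemma cross_cong_image:
  assumes "\<And>s t. s \<in> cube p \<Longrightarrow> t \<in> cube (fst c) \<Longrightarrow> a s (snd c t) = b s (snd c t)"
  shows "cross p a c = cross p b c"
  unfolding cross_def using assms by (auto simp: restrict_def fun_eq_iff cfst_cube csnd_cube)

lemma loop_cycle_sphere:
  assumes q: "q > 0" "even q"
    and \<omega>: "\<omega> \<in> grade (CU (nsphere (Suc q))) (Suc q)" "CU_codiff (nsphere (Suc q)) \<omega> = 0"
  shows "loop_cycle (nsphere (Suc q)) (north q) q \<omega> (sphere_loop q)"
proof
  fix b
  have "continuous_map (top_of_set (cube q)) (top_of_set (punctured q)) (snd (iota (if b then 1 else -1) q))"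
    using iota_singular[of "if b then 1 else -1" q] by (simp add: singular_cubes_iff)
  from continuous_map_compose[OF this continuous_map_meridian]
  have "continuous_map (top_of_set (cube q)) (path_space (nsphere (Suc q))) (\<lambda>t. meridian q (snd (iota (if b then 1 else -1) q) t))"
    by (simp add: comp_def)
  then have "continuous_map (top_of_set (cube q)) (path_space (nsphere (Suc q))) (sphere_loop q b)"
    unfolding sphere_loop_def[abs_def]
    by (rule continuous_map_conc) (auto simp: return_path meridian_ends)
  then show "continuous_map (top_of_set (cube q)) (based_loops (nsphere (Suc q)) (north q)) (sphere_loop q b)"
    by (rule continuous_map_into_based_loops) (auto simp: sphere_loop_def meridian_ends return_path)
next
  fix t i assume "t \<in> cube q" "i < q" "t i \<in> {0, 1::real}"
  then show "sphere_loop q True t = sphere_loop q False t"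
    using iota_boundary[of t q i 1 "-1"] by (simp add: sphere_loop_def)
qed (use assms in auto)

text \<open>Restriction to based loops carries the transgression to \<open>x\<close>, so a
  coboundary on free loops would give one there. It remains to identify \<open>u\<close> with the
  value of \<open>\<omega>\<close> on the fundamental cycle.\<close>

lemma sphere_power_not_coboundary:
  assumes q: "q > 0" "even q"
    and \<omega>: "\<omega> \<in> grade (CU (nsphere (Suc q))) (Suc q)" "CU_codiff (nsphere (Suc q)) \<omega> = 0"
    and nb: "\<omega> \<notin> coboundaries (CU (nsphere (Suc q))) (Suc q)" and k: "k \<noteq> 0"
  defines "Y \<equiv> free_loop_space (nsphere (Suc q))"
  shows "(\<lambda>T. k * CU_power Y (CX Y 1 (\<lambda>s l. l (s 0)) \<omega>) m T) \<notin> coboundaries (CU Y) (q * m)"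
proof
  let ?X = "nsphere (Suc q)"
  interpret loop_cycle ?X "north q" q \<omega> "sphere_loop q" by (rule loop_cycle_sphere[OF q \<omega>])
  let ?C = "top_of_set (cube q)" and ?c = "(q, restrict (\<lambda>t. t) (cube q))"
  have c: "?c \<in> singular_cubes ?C" by (auto simp: singular_cubes_subset intro: continuous_on_eq[OF continuous_on_id])
  have u: "u = \<omega> (cross 0 (\<lambda>s. radial (Suc q)) (iota 1 (Suc q))) - \<omega> (cross 0 (\<lambda>s. radial (Suc q)) (iota (-1) (Suc q)))"
  proof -
    define \<eta> where "\<eta> b = CX ?C 2 (\<lambda>s t. sphere_loop q b t (div_sq (s 0) (s 1))) \<omega>" for b
    \<comment> \<open>Each loop is divided into its meridian and the return path. The meridians
      sweep out a hemisphere; the return path is constant in the parameters and contributes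
      nothing.\<close>
    have D: "\<omega> (cross 1 (\<lambda>s t. sphere_loop q b t (s 0)) ?c)
       = \<omega> (cross 0 (\<lambda>s. radial (Suc q)) (iota (if b then 1 else -1) (Suc q))) - CU_codiff ?C (\<eta> b) ?c" for b
    proof -
      let ?e = "if b then 1 else -1 :: real"
      have cm: "cross_map ?C (path_space ?X) 0 (\<lambda>t. sphere_loop q b)"
        using continuous_map_compose[OF L[of b] continuous_map_based_incl] by (simp add: cross_map_0 comp_def)
      have "CX ?C (Suc 0) (adj (\<lambda>t y. sphere_loop q b y)) \<omega> =
         CX ?C (Suc 0) (adj (\<lambda>t y u. sphere_loop q b y ((1 + u) / 2))) \<omega>
         + CX ?C (Suc 0) (adj (\<lambda>t y u. sphere_loop q b y (u / 2))) \<omega> - CU_codiff ?C (\<eta> b)"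
        using CX_divide[OF CU_grade_supp[OF \<omega>(1)] \<omega>(2) cm] by (simp add: \<eta>_def fun_eq_iff numeral_2_eq_2)
      moreover have "CX ?C (Suc 0) (adj (\<lambda>t y u. sphere_loop q b y ((1 + u) / 2))) \<omega> = 0"
      proof -
        have "CX ?C (Suc 0) (adj (\<lambda>t y u. sphere_loop q b y ((1 + u) / 2))) \<omega> = CX ?C (Suc 0) (adj (\<lambda>t y. return_path q)) \<omega>"
          unfolding sphere_loop_def by (rule CX_adj_conc_upper) (simp add: meridian_ends return_path)
        also have "\<dots> = 0" unfolding adj_def[abs_def] by (rule CX_const[OF \<omega>(1)]) (use q in simp)
        finally show ?thesis .
      qed
      moreover have "CX ?C (Suc 0) (adj (\<lambda>t y u. sphere_loop q b y (u / 2))) \<omega> = CX ?C (Suc 0) (adj (\<lambda>t y. meridian q (snd (iota ?e q) y))) \<omega>"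
        unfolding sphere_loop_def by (rule CX_adj_conc_lower)
      ultimately have "CX ?C (Suc 0) (adj (\<lambda>t y. sphere_loop q b y)) \<omega> ?c
          = CX ?C (Suc 0) (adj (\<lambda>t y. meridian q (snd (iota ?e q) y))) \<omega> ?c - CU_codiff ?C (\<eta> b) ?c"
        by simp
      then have "\<omega> (cross 1 (\<lambda>s t. sphere_loop q b t (s 0)) ?c)
          = \<omega> (cross 1 (\<lambda>s t. meridian q (snd (iota ?e q) t) (s 0)) ?c) - CU_codiff ?C (\<eta> b) ?c"
        by (simp add: CX_singular[OF CU_grade_supp[OF \<omega>(1)] c] adj_def[abs_def])
      moreover have "cross 1 (\<lambda>s t. meridian q (snd (iota ?e q) t) (s 0)) ?c = cross 0 (\<lambda>s. radial (Suc q)) (iota ?e (Suc q))"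
      proof -
        have "meridian q (snd (iota ?e q) (restrict (\<lambda>t. t) (cube q) (csnd 1 t))) (cfst 1 t 0) = radial (Suc q) (snd (iota ?e (Suc q)) t)"
          if t: "t \<in> cube (Suc q)" for t
        proof -
          have "csnd 1 t \<in> cube q" using csnd_cube[of t 1 q] t by simp
          moreover have "snd (iota ?e (Suc q)) t = susp q (cfst 1 t 0) (snd (iota ?e q) (csnd 1 t))"
            using t snd_cross[of t 1 "iota ?e q" "\<lambda>s. susp q (s 0)"] by simp
          moreover have "t 0 \<in> {0..1}" using t by (auto simp: cubeD)
          ultimately show ?thesis by (simp add: meridian_def)
        qed
        note eq = this
        show ?thesis
        proof (rule prod_eqI, goal_cases)
          case 2
          show ?case
          proof
            fix t show "snd (cross 1 (\<lambda>s t. meridian q (snd (iota ?e q) t) (s 0)) ?c) t = snd (cross 0 (\<lambda>s. radial (Suc q)) (iota ?e (Suc q))) t"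
            proof (cases "t \<in> cube (Suc q)")
              case True
              then show ?thesis
                using eq[OF True] snd_cross[of t 1 ?c "\<lambda>s t. meridian q (snd (iota ?e q) t) (s 0)"]
                  snd_cross[of t 0 "iota ?e (Suc q)" "\<lambda>s. radial (Suc q)"]
                by (simp del: iota.simps)
            qed (simp add: cross_def)
          qed
        qed simp
      qed
      ultimately show ?thesis by simp
    qed
    \<comment> \<open>The correction depends only on the boundary of the identity cube, where the
      two families agree, so it cancels in the difference \<open>u\<close>.\<close>
    have "CU_codiff ?C (\<eta> True) ?c = CU_codiff ?C (\<eta> False) ?c"
    proof -
      have "\<eta> True (pull (q - 1) (ins i e) ?c) = \<eta> False (pull (q - 1) (ins i e) ?c)" if i: "i < q" "e \<in> {0, 1}" for i e
      proof -
        have s: "pull (q - 1) (ins i e) ?c \<in> singular_cubes ?C" using i by (intro face_singular[OF c]) auto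
        have "cross 2 (\<lambda>s t. sphere_loop q True t (div_sq (s 0) (s 1))) (pull (q - 1) (ins i e) ?c)
           = cross 2 (\<lambda>s t. sphere_loop q False t (div_sq (s 0) (s 1))) (pull (q - 1) (ins i e) ?c)"
        proof (rule cross_cong_image)
          fix s t assume "t \<in> cube (fst (pull (q - 1) (ins i e) ?c))"
          then have t: "t \<in> cube (q - 1)" by simp
          then have it: "ins i e t \<in> cube q" using ins_cube[OF t, of i e] i by auto
          then have "sphere_loop q True (ins i e t) = sphere_loop q False (ins i e t)"
            by (rule L_bdry[OF _ i(1)]) (use i in \<open>auto simp: ins_def\<close>)
          then show "sphere_loop q True (snd (pull (q - 1) (ins i e) ?c) t) (div_sq (s 0) (s 1))
             = sphere_loop q False (snd (pull (q - 1) (ins i e) ?c) t) (div_sq (s 0) (s 1))"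
            using t it by (simp add: snd_pull)
        qed
        then show ?thesis unfolding \<eta>_def CX_singular[OF CU_grade_supp[OF \<omega>(1)] s] by (rule arg_cong)
      qed
      note eq = this
      have "nd_supp ?C (\<eta> b)" for b by (simp add: \<eta>_def)
      note cod = CU_codiff_singular[OF this c]
      show ?thesis unfolding cod by (rule sum.cong) (simp_all add: eq del: One_nat_def)
    qed
    then show ?thesis using D[of True] D[of False] by (simp add: u_def)
  qed
  then have "u \<noteq> 0" using sphere_cocycle_detect[OF \<omega> nb] by simp
  note nc = power_not_coboundary[OF this k, of m]
  have incl: "continuous_map W Y (\<lambda>l. l)"
    unfolding Y_def free_loop_space_def continuous_map_in_subtopology
    by (auto simp: continuous_map_based_incl topspace_based_loops)
  define y where "y = CX Y 1 (\<lambda>s l. l (s 0)) \<omega>"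
  have y: "y \<in> grade (CU Y) q" unfolding y_def using \<omega>(1) by (intro CX_grade) simp
  have "CU_map W (\<lambda>l. l) y = x"
    using CX_CX[OF CU_grade_supp[OF \<omega>(1)], of W Y 0 "\<lambda>s l. l" 1 "\<lambda>s l. l (s 0)"] incl
    by (simp add: y_def x_def CU_map_eq_CX cross_map_0)
  then have "CU_map W (\<lambda>l. l) (\<lambda>T. k * CU_power Y y m T) = (\<lambda>T. k * CU_power W x m T)"
    by (simp add: CU_map_smult CU_map_power[OF incl y])
  moreover assume "(\<lambda>T. k * CU_power Y (CX Y 1 (\<lambda>s l. l (s 0)) \<omega>) m T) \<in> coboundaries (CU Y) (q * m)"
  ultimately show False using CU_map_coboundaries[OF incl] nc unfolding y_def by metis
qed

lemma power_map2_transgression: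
  assumes \<omega>: "\<omega> \<in> grade (CU X) (Suc q)" "CU_codiff X \<omega> = 0" and q: "q > 0"
  defines "Y \<equiv> free_loop_space X"
  defines "y \<equiv> CX Y 1 (\<lambda>s l. l (s 0)) \<omega>"
  shows "y \<in> grade (CU Y) q" "CU_codiff Y y = 0"
    "CU_map Y power_map2 y - (\<lambda>T. 2 * y T) \<in> coboundaries (CU Y) q"
proof -
  have incl: "continuous_map Y (path_space X) (\<lambda>l. l)" unfolding Y_def by (rule continuous_map_loop_incl)
  show "y \<in> grade (CU Y) q" unfolding y_def using \<omega>(1) by (intro CX_grade) simp
  have "cross_map Y X 1 (adj (\<lambda>t l. l))"
    using cross_map_adj[of Y X 0 "\<lambda>t l. l"] incl by (simp add: cross_map_0)
  then have cm: "cross_map Y X 1 (\<lambda>s l. l (s 0))" by (simp add: adj_def[abs_def])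
  have "CX Y 0 (\<lambda>s l. l (ins 0 1 s 0)) \<omega> = CX Y 0 (\<lambda>s l. l (ins 0 0 s 0)) \<omega>"
    by (rule CX_cong) (simp add: ins_def Y_def topspace_free_loop_space)
  then show "CU_codiff Y y = 0"
    using CX_codiff[OF CU_grade_supp[OF \<omega>(1)] cm] \<omega>(2) by (simp add: y_def fun_eq_iff)
  have cont: "continuous_map Y (path_space X) (\<lambda>l. path_conc l l)"
    by (rule continuous_map_conc[OF incl incl]) (simp add: Y_def topspace_free_loop_space)
  let ?\<eta> = "CX Y 2 (\<lambda>s l. path_conc l l (div_sq (s 0) (s 1))) \<omega>"
  have "CX Y (Suc 0) (adj (\<lambda>t l. path_conc l l)) \<omega> = CX Y (Suc 0) (adj (\<lambda>t l. l)) \<omega> + CX Y (Suc 0) (adj (\<lambda>t l. l)) \<omega> - CU_codiff Y ?\<eta>"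
  proof -
    have "CX Y (Suc 0) (adj (\<lambda>t l u. path_conc l l ((1 + u) / 2))) \<omega> = CX Y (Suc 0) (adj (\<lambda>t l. l)) \<omega>"
      by (rule CX_adj_conc_upper) (simp add: Y_def topspace_free_loop_space)
    moreover have "CX Y (Suc 0) (adj (\<lambda>t l u. path_conc l l (u / 2))) \<omega> = CX Y (Suc 0) (adj (\<lambda>t l. l)) \<omega>"
      by (rule CX_adj_conc_lower)
    moreover have "cross_map Y (path_space X) 0 (\<lambda>t l. path_conc l l)" using cont by (simp add: cross_map_0)
    ultimately show ?thesis
      using CX_divide[OF CU_grade_supp[OF \<omega>(1)] \<omega>(2), of Y 0 "\<lambda>t l. path_conc l l"]
      by (simp add: fun_eq_iff numeral_2_eq_2)
  qed
  moreover have "CX Y (Suc 0) (adj (\<lambda>t l. l)) \<omega> = y" by (simp add: y_def adj_def[abs_def])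
  moreover have "CX Y (Suc 0) (adj (\<lambda>t l. path_conc l l)) \<omega> = CU_map Y power_map2 y"
    using CX_CX[OF CU_grade_supp[OF \<omega>(1)], of Y Y 0 "\<lambda>s. power_map2" 1 "\<lambda>s l. l (s 0)"]
      continuous_map_power_map2[of X]
    by (simp add: y_def CU_map_eq_CX cross_map_0 adj_def[abs_def] power_map2_conc Y_def)
  ultimately have eq: "CU_map Y power_map2 y - (\<lambda>T. 2 * y T) = - CU_codiff Y ?\<eta>"
    by (simp add: fun_eq_iff)
  obtain r where r: "q = Suc r" using q by (cases q) auto
  have "?\<eta> \<in> grade (CU Y) r" using \<omega>(1) r by (intro CX_grade) simp
  then have "CU_codiff Y ?\<eta> \<in> coboundaries (CU Y) q" unfolding r coboundaries_Suc by auto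
  then show "CU_map Y power_map2 y - (\<lambda>T. 2 * y T) \<in> coboundaries (CU Y) q"
    unfolding eq by (rule CU_coboundaries_minus)
qed

section \<open>The algebra of the two-cell model\<close>

lemma frag_extend2_of [simp]: "frag_extend2 f (frag_of a) (frag_of b) = f a b"
  by (simp add: frag_extend2_def)

lemma frag_extend2_0 [simp]: "frag_extend2 f 0 q = 0" "frag_extend2 f p 0 = 0"
  by (simp_all add: frag_extend2_def frag_extend_eq_0)

lemma frag_extend_add_fun: "frag_extend (\<lambda>a. f a + g a) p = frag_extend f p + frag_extend g p"
  by (simp add: frag_extend_def frag_cmul_distrib2 sum.distrib)

lemma frag_extend_cmul_fun: "frag_extend (\<lambda>a. frag_cmul r (f a)) p = frag_cmul r (frag_extend f p)"
  by (simp add: frag_extend_def frag_cmul_sum mult.commute)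

lemma frag_extend2_add_left: "frag_extend2 f (p + p') q = frag_extend2 f p q + frag_extend2 f p' q"
  by (simp add: frag_extend2_def frag_extend_add)

lemma frag_extend2_add_right: "frag_extend2 f p (q + q') = frag_extend2 f p q + frag_extend2 f p q'"
  by (simp add: frag_extend2_def frag_extend_add frag_extend_add_fun)

lemma frag_extend2_cmul_left: "frag_extend2 f (frag_cmul r p) q = frag_cmul r (frag_extend2 f p q)"
  by (simp add: frag_extend2_def frag_extend_cmul)

lemma frag_extend2_cmul_right: "frag_extend2 f p (frag_cmul r q) = frag_cmul r (frag_extend2 f p q)"
  by (simp add: frag_extend2_def frag_extend_cmul frag_extend_cmul_fun)

lemma tensor_of [simp]: "tensor (frag_of a) (frag_of b) = frag_of (a, b)"
  and tensor_0 [simp]: "tensor 0 q = 0" "tensor p 0 = 0"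
  by (simp_all add: tensor_def)

lemma tensor_cmul_left: "tensor (frag_cmul r p) q = frag_cmul r (tensor p q)"
  and tensor_cmul_right: "tensor p (frag_cmul r q) = frag_cmul r (tensor p q)"
  by (simp_all add: tensor_def frag_extend2_cmul_left frag_extend2_cmul_right)

lemma additive_frag_extend:
  assumes "\<And>p q. F (p + q) = F p + F q"
  shows "F (frag_extend g p) = frag_extend (\<lambda>b. F (g b)) p"
  using subset_UNIV
proof (induction p rule: frag_induction)
  have F0: "F 0 = 0" using assms[of 0 0] by simp
  {
    case zero
    then show ?case by (simp add: F0)
  next
    case (diff a b)
    have "F (p - q) = F p - F q" for p q using assms[of "p - q" q] by simp
    then show ?case using diff by (simp add: frag_extend_diff)
  }
qed simp

lemma tensor_add_left: "tensor (p + p') q = tensor p q + tensor p' q"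
  by (simp add: tensor_def frag_extend2_add_left)

lemma tensor_minus: "tensor (- p) q = - tensor p q"
  using tensor_cmul_left[of "-1"] by simp

lemma tensor_diff_left: "tensor (p - p') q = tensor p q - tensor p' q"
  using tensor_add_left[of p "- p'"] by (simp add: tensor_minus)

section \<open>The simplicial sphere with two nondegenerate simplices\<close>

locale odd_sphere_model =
  fixes n :: nat and K :: "'s sset" and G :: "'s \<times> 's \<Rightarrow> ('s \<times> 's) list \<Rightarrow>\<^sub>0 int" and v z :: 's
  assumes n: "n > 0" and K: "simplicial_set K" and nd: "nondegenerate K = {v, z}"
    and dim: "sdim K v = 0" "sdim K z = 2 * n + 1" and G: "AW_algebra_map K G"
begin

lemma vz: "v \<noteq> z" "v \<in> simplices K" "z \<in> simplices K"
  using nd dim by (auto simp: nondegenerate_def)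

lemma face_simplex:
  assumes "y \<in> simplices K" "i \<le> sdim K y" "0 < sdim K y"
  shows "face K i y \<in> simplices K" "sdim K (face K i y) = sdim K y - 1"
  using K assms by (auto simp: simplicial_set_def)

lemma zero_simplex: "y \<in> simplices K \<Longrightarrow> sdim K y = 0 \<Longrightarrow> y = v"
proof -
  assume y: "y \<in> simplices K" "sdim K y = 0"
  have "\<not> (\<exists>x\<in>simplices K. \<exists>i\<le>sdim K x. y = degen K i x)"
    using K y(2) by (auto simp: simplicial_set_def)
  then have "y \<in> nondegenerate K" using y by (simp add: nondegenerate_def)
  then show "y = v" using nd dim y by auto
qed

lemma base_vertex [simp]: "base_vertex K = v"
  unfolding base_vertex_def using vz(2) dim(1) zero_simplex by (intro the_equality conjI) blast+

lemma nchain_eq: "y \<in> simplices K \<Longrightarrow> sdim K y \<noteq> 0 \<Longrightarrow> sdim K y \<noteq> 2 * n + 1 \<Longrightarrow> nchain K y = 0"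
  using nd dim by (auto simp: nchain_def)

lemma nchain_vz [simp]: "nchain K v = frag_of v" "nchain K z = frag_of z"
  by (simp_all add: nchain_def nd)

text \<open>The faces of \<open>z\<close> have dimension 2n, where every simplex is
  degenerate.\<close>

lemma cdiff_0:
  assumes "y \<in> nondegenerate K"
  shows "cdiff (chains K) y = 0"
proof (cases "y = v")
  case True
  then show ?thesis by (simp add: chains_def dim)
next
  case False
  then have y: "y = z" using assms nd by blast
  have "nchain K (face K i z) = 0" if i: "i \<le> 2 * n + 1" for i
  proof (rule nchain_eq)
    have "i \<le> sdim K z" "0 < sdim K z" using i dim by simp_all
    from face_simplex[OF vz(3) this] dim
    show "face K i z \<in> simplices K" "sdim K (face K i z) \<noteq> 0" "sdim K (face K i z) \<noteq> 2 * n + 1"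
      using n by simp_all
  qed
  then show ?thesis unfolding y by (simp add: chains_def dim)
qed

lemma simp_codiff_0 [simp]: "simp_codiff K y = 0"
proof -
  have "(if w \<in> nondegenerate K then - ((-1) ^ sdim K y) * Poly_Mapping.lookup (cdiff (chains K) w) y else 0) = 0" for w
    using cdiff_0[of w] by (cases "w \<in> nondegenerate K") simp_all
  then show ?thesis by (simp only: simp_codiff_def zero_poly_mapping_def)
qed

lemma face_funpow:
  assumes "y \<in> simplices K" "\<And>x. x \<in> simplices K \<Longrightarrow> i x \<le> sdim K x" "\<And>x. f x = face K (i x) x" "k \<le> sdim K y"
  shows "(f ^^ k) y \<in> simplices K \<and> sdim K ((f ^^ k) y) = sdim K y - k"
  using assms(4)
proof (induction k)
  case 0
  then show ?case using assms(1) by simp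
next
  case (Suc k)
  then have IH: "(f ^^ k) y \<in> simplices K" "sdim K ((f ^^ k) y) = sdim K y - k" by simp_all
  then have "0 < sdim K ((f ^^ k) y)" using Suc.prems by simp
  then have "f ((f ^^ k) y) \<in> simplices K" "sdim K (f ((f ^^ k) y)) = sdim K ((f ^^ k) y) - 1"
    using face_simplex[OF IH(1) assms(2)[OF IH(1)]] by (simp_all only: assms(3))
  then show ?case using IH(2) by simp
qed

lemma front_face_simplex:
  assumes "y \<in> simplices K" "i \<le> sdim K y"
  shows "front_face K i y \<in> simplices K" "sdim K (front_face K i y) = i"
proof -
  have "front_face K i y \<in> simplices K \<and> sdim K (front_face K i y) = sdim K y - (sdim K y - i)"
    unfolding front_face_def by (rule face_funpow[OF assms(1) order_refl refl]) simp
  then show "front_face K i y \<in> simplices K" "sdim K (front_face K i y) = i" using assms(2) by linarith+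
qed

lemma back_face_simplex:
  assumes "y \<in> simplices K" "i \<le> sdim K y"
  shows "back_face K i y \<in> simplices K" "sdim K (back_face K i y) = sdim K y - i"
  using face_funpow[OF assms(1) le0 refl assms(2)] by (simp_all add: back_face_def)

text \<open>Front faces of intermediate dimension are degenerate; only the two extreme terms remain,
  so \<open>z\<close> is primitive.\<close>

lemma AW_z: "AW K (z, z) = frag_of (z, v) + frag_of (v, z)"
proof -
  let ?N = "2 * n + 1"
  have f: "front_face K i z \<in> simplices K" "sdim K (front_face K i z) = i" if "i \<le> ?N" for i
    using front_face_simplex[OF vz(3)] that dim by simp_all
  have b: "back_face K i z \<in> simplices K" "sdim K (back_face K i z) = ?N - i" if "i \<le> ?N" for i
    using back_face_simplex[OF vz(3)] that dim by simp_all
  define t where "t i = tensor (nchain K (front_face K i z)) (nchain K (back_face K i z))" for i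
  have t0: "t i = 0" if "i \<le> ?N" "i \<noteq> 0" "i \<noteq> ?N" for i
    using nchain_eq[OF f(1)] f(2) that by (simp add: t_def)
  have z: "t 0 = frag_of (v, z)"
    using zero_simplex[OF f] by (simp add: t_def back_face_def)
  have N: "t ?N = frag_of (z, v)"
    using zero_simplex[of "back_face K ?N z"] b[of ?N] by (simp add: t_def front_face_def dim)
  have "AW K (z, z) = sum t {..?N}" by (simp add: AW_def t_def dim)
  also have "\<dots> = sum t {0, ?N}"
    by (rule sum.mono_neutral_right) (use t0 in auto)
  finally show ?thesis using z N n by (simp add: add.commute)
qed

lemma AW_v: "AW K (v, v) = frag_of (v, v)"
  by (simp add: AW_def dim front_face_def back_face_def)

lemma cup_z_v: "cup K z v = frag_of z"
proof -
  have "(\<lambda>w. if w \<in> nondegenerate K then (-1) ^ (sdim K z * sdim K v) * Poly_Mapping.lookup (ccop (chains K) w) (z, v) else 0)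
      = (\<lambda>w. if w = z then 1 else 0)"
    using vz by (auto simp: fun_eq_iff nd chains_def AW_z AW_v dim lookup_add)
  also have "\<dots> = Poly_Mapping.lookup (frag_of z)" by (auto simp: fun_eq_iff)
  finally show ?thesis by (simp only: cup_def lookup_inverse)
qed

lemma cup_z_z: "cup K z z = 0"
proof -
  have "(\<lambda>w. if w \<in> nondegenerate K then (-1) ^ (sdim K z * sdim K z) * Poly_Mapping.lookup (ccop (chains K) w) (z, z) else 0)
      = (\<lambda>w. 0)"
    using vz by (auto simp: fun_eq_iff nd chains_def AW_z AW_v dim lookup_add)
  then show ?thesis by (simp only: cup_def zero_poly_mapping_def)
qed

abbreviation "zs m \<equiv> replicate m z"

lemma bar_words_eq: "bar_words K = range (\<lambda>m. zs m)"
proof -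
  have "w \<in> lists {z} \<longleftrightarrow> w \<in> range (\<lambda>m. zs m)" for w
  proof
    assume "w \<in> lists {z}"
    then have "w = zs (length w)" by (induction w) auto
    then show "w \<in> range (\<lambda>m. zs m)" by blast
  qed auto
  moreover have "nondegenerate K - {base_vertex K} = {z}" using nd vz by auto
  ultimately show ?thesis unfolding bar_words_def by auto
qed

lemma bar_deg_zs [simp]: "bar_deg K (zs m) = 2 * n * m"
  by (simp add: bar_deg_def dim sum_list_replicate)

lemma theta_even: "even (theta K (zs m))"
  by (simp add: theta_def dim sum_list_replicate)

lemma bar_pairing_zs [simp]: "bar_pairing K (zs m) = 1"
  by (induction m) (simp_all add: dim)

lemma bar_diff_zs [simp]: "bar_diff K (zs m) = 0"
proof (induction m)
  case (Suc m)
  then show ?case by (cases m) (simp_all add: bar_cons_def cup_z_z)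
qed simp

lemma nondegenerate_diagonal: "(z, z) \<in> nondegenerate (sset_prod K K)"
proof -
  have "z \<notin> degen K i ` simplices K" if "i \<le> sdim K x" "x \<in> simplices K" "z = degen K i x" for i x
    using that nd by (auto simp: nondegenerate_def)
  moreover have "z \<in> nondegenerate K" by (simp add: nd)
  ultimately show ?thesis using vz by (auto simp: nondegenerate_def sset_prod_def)
qed

text \<open>For reasons of degree: the value lies in degree 2n and every letter has degree at least
  2n. Words of two or more letters are too large, so the value equals its linear part, which is the
  Alexander-Whitney map.\<close>

lemma G_z: "G (z, z) = frag_of [(z, v)] + frag_of [(v, z)]"
proof (rule poly_mapping_eqI)
  fix w
  let ?KK = "chains (sset_prod K K)" and ?CC = "coalg_tensor (chains K) (chains K)"
  have cunit: "cunit ?KK \<noteq> (z, z)"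
  proof -
    have "base_vertex (sset_prod K K) = (v, v)"
      unfolding base_vertex_def
    proof (rule the_equality)
      fix y assume y: "y \<in> simplices (sset_prod K K) \<and> sdim (sset_prod K K) y = 0"
      obtain a b where ab: "y = (a, b)" by (cases y)
      have "a \<in> simplices K" "sdim K a = 0" "b \<in> simplices K" "sdim K b = 0"
        using y unfolding ab by (auto simp: sset_prod_def)
      then show "y = (v, v)" using zero_simplex[of a] zero_simplex[of b] unfolding ab by simp
    qed (use vz dim in \<open>simp add: sset_prod_def\<close>)
    then show ?thesis using vz by (simp add: chains_def)
  qed
  have "(z, z) \<in> cbasis ?KK - {cunit ?KK}"
    using nondegenerate_diagonal cunit by (auto simp: chains_def)
  then have fg: "G (z, z) \<in> free_grade (cobar_words ?CC) (cobar_low_deg ?CC) (cdeg ?KK (z, z) - 1)"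
    and lin: "\<And>c. c \<in> cbasis ?CC - {cunit ?CC} \<Longrightarrow> Poly_Mapping.lookup (G (z, z)) [c] = Poly_Mapping.lookup (AW K (z, z)) c"
    using G unfolding AW_algebra_map_def Let_def by blast+
  have cb: "cbasis ?CC - {cunit ?CC} = {(v, z), (z, v), (z, z)}"
    using vz nd by (auto simp: coalg_tensor_def chains_def)
  have deg: "cdeg ?KK (z, z) - 1 = 2 * n" by (simp add: chains_def sset_prod_def dim)
  have cd: "cdeg ?CC (v, z) = 2 * n + 1" "cdeg ?CC (z, v) = 2 * n + 1" "cdeg ?CC (z, z) = 4 * n + 2"
    by (simp_all add: coalg_tensor_def chains_def dim)
  show "Poly_Mapping.lookup (G (z, z)) w = Poly_Mapping.lookup (frag_of [(z, v)] + frag_of [(v, z)]) w"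
  proof (cases "w \<in> Poly_Mapping.keys (G (z, z))")
    case True
    then have w: "w \<in> lists {(v, z), (z, v), (z, z)}" "cobar_low_deg ?CC w = 2 * n"
      using fg unfolding free_grade_def cobar_words_def cb deg by blast+
    obtain c w' where cw: "w = c # w'" "c \<in> {(v, z), (z, v), (z, z)}" "w' \<in> lists {(v, z), (z, v), (z, z)}"
    proof (cases w)
      case Nil
      then show ?thesis using w(2) n by (simp add: cobar_low_deg_def)
    qed (use w(1) in auto)
    have "w' = []"
    proof (cases w')
      case (Cons c' w'')
      then have "cdeg ?CC c - 1 + (cdeg ?CC c' - 1) \<le> 2 * n" using w(2) cw(1) by (simp add: cobar_low_deg_def)
      moreover have "cdeg ?CC c - 1 \<ge> 2 * n" "cdeg ?CC c' - 1 \<ge> 2 * n" using cw Cons cd by auto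
      ultimately show ?thesis using n by linarith
    qed simp
    then show ?thesis
      using cw lin[of c] vz by (auto simp: cb AW_z lookup_add)
  next
    case False
    then have 0: "Poly_Mapping.lookup (G (z, z)) w = 0" by (simp add: in_keys_iff)
    moreover have "w \<noteq> [(z, v)]" "w \<noteq> [(v, z)]"
      using 0 lin[of "(z, v)"] lin[of "(v, z)"] vz by (auto simp: cb AW_z lookup_add)
    ultimately show ?thesis by (simp add: lookup_add)
  qed
qed

text \<open>The diagonal is multiplicative and the generator on \<open>z\<close> is primitive of
  even degree 2n, so its two summands commute without sign and the binomial theorem applies; the
  inductive step is Pascal's rule.\<close>

lemma cobar_diagonal_zs:
  "cobar_diagonal K G (zs m) = (\<Sum>a\<le>m. frag_cmul (int (m choose a)) (frag_of (zs a, zs (m - a))))"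
proof -
  let ?C = "chains K"
  define D where "D m = alg_ext conc (frag_of []) G (map (\<lambda>x. (x, x)) (zs m))" for m
  have D0: "D 0 = frag_of []" and DS: "D (Suc m) = conc (G (z, z)) (D m)" for m
    by (simp_all add: D_def alg_ext_def)
  \<comment> \<open>Multiplicativity in the first letter suffices for an induction on the number of
    letters.\<close>
  have mil: "milgram ?C (conc (frag_of [x]) q) = conc_tensor ?C (milgram_gen ?C x) (milgram ?C q)" for x q
  proof -
    have "milgram ?C (conc (frag_of [x]) q)
        = milgram ?C (frag_extend (\<lambda>w. frag_of (x # w)) q)"
      by (simp add: conc_def frag_extend2_def)
    also have "\<dots> = frag_extend (\<lambda>w. milgram ?C (frag_of (x # w))) q"
      by (rule additive_frag_extend) (simp add: milgram_def frag_extend_add)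
    also have "\<dots> = frag_extend (\<lambda>w. conc_tensor ?C (milgram_gen ?C x) (milgram ?C (frag_of w))) q"
      by (simp add: milgram_def alg_ext_def)
    also have "\<dots> = conc_tensor ?C (milgram_gen ?C x) (frag_extend (\<lambda>w. milgram ?C (frag_of w)) q)"
      by (rule additive_frag_extend[symmetric]) (simp add: conc_tensor_def frag_extend2_add_right)
    also have "frag_extend (\<lambda>w. milgram ?C (frag_of w)) q = milgram ?C q"
      by (simp add: milgram_def)
    finally show ?thesis .
  qed
  have cu: "cunit ?C = v" by (simp add: chains_def)
  have lowdeg: "cobar_low_deg ?C (zs a) = 2 * n * a" for a
    by (simp add: cobar_low_deg_def chains_def dim sum_list_replicate)
  have lowdeg1: "cobar_low_deg ?C [z] = 2 * n" using lowdeg[of 1] by simp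
  define F where "F a b = frag_of (zs a, zs b)" for a b
  have left: "conc_tensor ?C (frag_of ([z], [])) (F a b) = F (Suc a) b" for a b
    by (simp add: conc_tensor_def F_def cobar_low_deg_def)
  have right: "conc_tensor ?C (frag_of ([], [z])) (F a b) = F a (Suc b)" for a b
    by (simp add: conc_tensor_def F_def lowdeg lowdeg1)
  have lin: "conc_tensor ?C p (\<Sum>a\<in>A. frag_cmul (r a) (f a)) = (\<Sum>a\<in>A. frag_cmul (r a) (conc_tensor ?C p (f a)))" for p r f and A :: "nat set"
    by (induction A rule: infinite_finite_induct)
      (simp_all add: conc_tensor_def frag_extend2_add_right frag_extend2_cmul_right)
  have "milgram ?C (D m) = (\<Sum>a\<le>m. frag_cmul (int (m choose a)) (F a (m - a)))"
  proof (induction m)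
    case 0
    then show ?case by (simp add: D0 milgram_def alg_ext_def F_def)
  next
    case (Suc m)
    have "milgram ?C (D (Suc m)) = milgram ?C (conc (frag_of [(z, v)]) (D m)) + milgram ?C (conc (frag_of [(v, z)]) (D m))"
      by (simp add: DS G_z conc_def frag_extend2_add_left milgram_def frag_extend_add)
    also have "\<dots> = conc_tensor ?C (frag_of ([z], [])) (milgram ?C (D m)) + conc_tensor ?C (frag_of ([], [z])) (milgram ?C (D m))"
      using vz by (simp add: mil milgram_gen_def cu)
    also have "\<dots> = (\<Sum>a\<le>m. frag_cmul (int (m choose a)) (F (Suc a) (m - a))) + (\<Sum>a\<le>m. frag_cmul (int (m choose a)) (F a (Suc (m - a))))"
      unfolding Suc by (simp add: lin left right)
    also have "\<dots> = (\<Sum>a\<le>Suc m. frag_cmul (int (Suc m choose a)) (F a (Suc m - a)))"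
    proof -
      have "(\<Sum>a\<le>m. frag_cmul (int (m choose a)) (F a (Suc (m - a)))) = (\<Sum>a\<le>m. frag_cmul (int (m choose a)) (F a (Suc m - a)))"
        by (intro sum.cong) (auto simp: Suc_diff_le)
      also have "\<dots> = (\<Sum>a\<le>Suc m. frag_cmul (int (m choose a)) (F a (Suc m - a)))"
        by simp
      also have "\<dots> = F 0 (Suc m) + (\<Sum>a\<le>m. frag_cmul (int (m choose Suc a)) (F (Suc a) (m - a)))"
        by (subst sum.atMost_Suc_shift) simp
      finally have 2: "(\<Sum>a\<le>m. frag_cmul (int (m choose a)) (F a (Suc (m - a))))
         = F 0 (Suc m) + (\<Sum>a\<le>m. frag_cmul (int (m choose Suc a)) (F (Suc a) (m - a)))" .
      have "(\<Sum>a\<le>Suc m. frag_cmul (int (Suc m choose a)) (F a (Suc m - a)))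
         = F 0 (Suc m) + (\<Sum>a\<le>m. frag_cmul (int (m choose a)) (F (Suc a) (m - a)) + frag_cmul (int (m choose Suc a)) (F (Suc a) (m - a)))"
        by (subst sum.atMost_Suc_shift) (simp add: frag_cmul_distrib)
      then show ?thesis unfolding 2 by (simp add: sum.distrib algebra_simps)
    qed
    finally show ?case .
  qed
  then show ?thesis by (simp add: cobar_diagonal_def D_def F_def)
qed

text \<open>Dual to the binomial diagonal; the pairing signs are trivial because all degrees are
  even.\<close>

lemma star_zs: "star K G (zs a) (zs b) = frag_cmul (int (a + b choose a)) (frag_of (zs (a + b)))"
proof -
  have inj: "zs i = zs j \<longleftrightarrow> i = j" for i j by (metis length_replicate)
  have lk: "Poly_Mapping.lookup (cobar_diagonal K G (zs m)) (zs a, zs b) = (if m = a + b then int (m choose a) else 0)" for m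
  proof -
    have "Poly_Mapping.lookup (cobar_diagonal K G (zs m)) (zs a, zs b)
        = (\<Sum>i\<le>m. int (m choose i) * (if i = a \<and> m - i = b then 1 else 0))"
      unfolding cobar_diagonal_zs lookup_sum by (intro sum.cong) (auto simp: inj)
    also have "\<dots> = (\<Sum>i\<le>m. if i = a then (if m = a + b then int (m choose a) else 0) else 0)"
      by (intro sum.cong) auto
    also have "\<dots> = (if m = a + b then int (m choose a) else 0)" by simp
    finally show ?thesis .
  qed
  have "(\<lambda>w. if w \<in> bar_words K
     then (-1) ^ (bar_deg K (zs a) * bar_deg K (zs b)) * bar_pairing K (zs a) * bar_pairing K (zs b) * bar_pairing K w
          * Poly_Mapping.lookup (cobar_diagonal K G w) (zs a, zs b) else 0)
     = Poly_Mapping.lookup (frag_cmul (int (a + b choose a)) (frag_of (zs (a + b))))"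
  proof
    fix w
    show "(if w \<in> bar_words K
     then (-1) ^ (bar_deg K (zs a) * bar_deg K (zs b)) * bar_pairing K (zs a) * bar_pairing K (zs b) * bar_pairing K w
          * Poly_Mapping.lookup (cobar_diagonal K G w) (zs a, zs b) else 0)
       = Poly_Mapping.lookup (frag_cmul (int (a + b choose a)) (frag_of (zs (a + b)))) w"
    proof (cases "w \<in> bar_words K")
      case True
      then obtain m where "w = zs m" by (auto simp: bar_words_eq)
      then show ?thesis using True by (auto simp: lk inj)
    next
      case False
      then have "w \<noteq> zs (a + b)" by (auto simp: bar_words_eq)
      then show ?thesis using False by simp
    qed
  qed
  then show ?thesis by (simp only: star_def lookup_inverse)
qed

text \<open>Deconcatenation followed by the divided power product sums a row of Pascal's
  triangle.\<close>

lemma Id_star_cop_of: "Id_star_cop K G (frag_of (x, zs m)) = frag_cmul (2 ^ m) (frag_of (x, zs m))"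
proof -
  have "frag_extend (\<lambda>(a, b). star K G a b) (ccop (Bar K) (zs m)) = (\<Sum>j\<le>m. star K G (zs j) (zs (m - j)))"
    by (simp add: Bar_def frag_extend_sum comp_def)
  also have "\<dots> = (\<Sum>j\<le>m. frag_cmul (int (m choose j)) (frag_of (zs m)))"
    by (intro sum.cong) (auto simp: star_zs)
  also have "\<dots> = frag_cmul (\<Sum>j\<le>m. int (m choose j)) (frag_of (zs m))"
  proof -
    have "(\<Sum>j\<in>A. frag_cmul (r j) p) = frag_cmul (\<Sum>j\<in>A. r j) p" for A :: "nat set" and r and p :: "'s list \<Rightarrow>\<^sub>0 int"
      by (induction A rule: infinite_finite_induct) (simp_all add: frag_cmul_distrib)
    then show ?thesis .
  qed
  also have "(\<Sum>j\<le>m. int (m choose j)) = 2 ^ m"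
    using choose_row_sum[of m] by (metis of_nat_numeral of_nat_power of_nat_sum)
  finally show ?thesis by (simp add: Id_star_cop_def tensor_cmul_right)
qed

text \<open>The composite of the map from the path to the loop model with the counit. The counit
  kills generators on bar words of length above one, so in the recursive formulas only generators of
  total word length one survive; this is how the thin differential is computed.\<close>

definition eps_phi :: "(('s list \<times> 's list) list \<times> 's list \<Rightarrow>\<^sub>0 int) \<Rightarrow> ('s \<times> 's list \<Rightarrow>\<^sub>0 int)" where
  "eps_phi = frag_extend (\<lambda>(w, c). tensor (eps K (phi_word K G w)) (frag_of c))"

lemma eps_Id_loop_D1: "eps_Id K (loop_D1 K G c) = eps_phi (path_D1 K G c)"
proof -
  have lin: "eps_Id K (frag_extend g p) = frag_extend (\<lambda>b. eps_Id K (g b)) p" for g :: "'z \<Rightarrow> _" and p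
    by (rule additive_frag_extend) (simp add: eps_Id_def frag_extend_add)
  have t: "eps_Id K (tensor p (frag_of c')) = tensor (eps K p) (frag_of c')" for p c'
  proof -
    have "tensor p (frag_of c') = frag_extend (\<lambda>w. frag_of (w, c')) p"
      by (simp add: tensor_def frag_extend2_def)
    then have "eps_Id K (tensor p (frag_of c')) = frag_extend (\<lambda>w. eps_Id K (frag_of (w, c'))) p"
      by (simp only: lin)
    also have "\<dots> = frag_extend (\<lambda>w. tensor (eps_word K w) (frag_of c')) p" by (simp add: eps_Id_def)
    also have "\<dots> = tensor (frag_extend (eps_word K) p) (frag_of c')"
      by (rule additive_frag_extend[symmetric]) (rule tensor_add_left)
    finally show ?thesis by (simp add: eps_def)
  qed
  have "eps_Id K (loop_D1 K G c) = frag_extend (\<lambda>b. eps_Id K (case b of (w, c') \<Rightarrow> tensor (phi_word K G w) (frag_of c'))) (path_D1 K G c)"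
    unfolding loop_D1_def by (rule additive_frag_extend) (simp add: eps_Id_def frag_extend_add)
  then show ?thesis by (simp add: eps_phi_def case_prod_beta' t)
qed

lemma eps_phi_add: "eps_phi (p + q) = eps_phi p + eps_phi q"
  and eps_phi_diff: "eps_phi (p - q) = eps_phi p - eps_phi q"
  and eps_phi_cmul: "eps_phi (frag_cmul r p) = frag_cmul r (eps_phi p)"
  and eps_phi_0: "eps_phi 0 = 0"
  by (simp_all add: eps_phi_def frag_extend_add frag_extend_diff frag_extend_cmul)

lemma eps_phi_minus: "eps_phi (- p) = - eps_phi p"
  using eps_phi_diff[of 0 p] by (simp add: eps_phi_0)

lemma eps_phi_sum: "finite I \<Longrightarrow> eps_phi (sum f I) = (\<Sum>i\<in>I. eps_phi (f i))"
  by (induction I rule: finite_induct) (simp_all add: eps_phi_0 eps_phi_add)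

abbreviation S :: "'s list \<Rightarrow> 's list \<Rightarrow> ('s list \<times> 's list) list \<Rightarrow>\<^sub>0 int" where
  "S a b \<equiv> sinv (BarBar K) (frag_of (a, b))"

lemma S_eq: "S (zs i) (zs j) = (if i + j = 0 then 0 else frag_of [(zs i, zs j)])"
proof -
  have "S (zs i) (zs j) = (if (zs i, zs j) = ([], []) then 0 else frag_of [(zs i, zs j)])"
    by (simp only: sinv_def frag_extend_of coalg_tensor_def Bar_def coalg.simps)
  then show ?thesis by (simp only: prod.inject replicate_empty add_is_0)
qed

lemma sinv_cmul: "sinv C (frag_cmul r p) = frag_cmul r (sinv C p)"
  by (simp add: sinv_def frag_extend_cmul)

lemma eps_word_1: "eps_word K [zs m] = (if m = 1 then frag_of z else 0)"
proof -
  have "eps_word K [zs m] = frag_extend2 (cup K) (case zs m of [x] \<Rightarrow> frag_of x | _ \<Rightarrow> 0) (frag_of v)"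
    by (simp add: eps_word_def alg_ext_def)
  also have "(case zs m of [x] \<Rightarrow> frag_of x | _ \<Rightarrow> 0) = (if m = 1 then frag_of z else 0)"
    by (cases m; cases "m - 1") auto
  finally show ?thesis by (auto simp: cup_z_v)
qed

lemma eps_phi_S: "0 < i + j \<Longrightarrow> eps_phi (tensor (S (zs i) (zs j)) (frag_of c)) = (if i + j = 1 then frag_of (z, c) else 0)"
proof -
  assume ij: "0 < i + j"
  have "phi_word K G [(zs i, zs j)] = conc (sinv (Bar K) (star K G (zs i) (zs j))) (frag_of [])"
    by (simp add: phi_word_def alg_ext_def)
  also have "\<dots> = frag_cmul (int (i + j choose i)) (frag_of [zs (i + j)])"
    using ij by (simp add: star_zs sinv_cmul) (simp add: sinv_def Bar_def conc_def frag_extend2_cmul_left)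
  finally have "eps K (phi_word K G [(zs i, zs j)]) = frag_cmul (int (i + j choose i)) (if i + j = 1 then frag_of z else 0)"
    by (simp add: eps_def frag_extend_cmul eps_word_1 del: replicate_Suc)
  moreover have "int (i + j choose i) = 1" if "i + j = 1"
    using that by (cases i) auto
  ultimately show ?thesis using ij by (auto simp: eps_phi_def S_eq)
qed

lemma eps_phi_star:
  assumes "2 \<le> i + j + k"
  shows "eps_phi (tensor (sinv (BarBar K) (tensor (frag_of (zs i)) (star K G (zs j) (zs k)))) (frag_of c)) = 0"
    and "eps_phi (tensor (sinv (BarBar K) (tensor (star K G (zs i) (zs j)) (frag_of (zs k)))) (frag_of c)) = 0"
proof -
  have "eps_phi (tensor (S (zs i) (zs (j + k))) (frag_of c)) = 0" "eps_phi (tensor (S (zs (i + j)) (zs k)) (frag_of c)) = 0"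
    using eps_phi_S[of i "j + k" c] eps_phi_S[of "i + j" k c] assms by (simp_all only:) auto
  then show "eps_phi (tensor (sinv (BarBar K) (tensor (frag_of (zs i)) (star K G (zs j) (zs k)))) (frag_of c)) = 0"
    and "eps_phi (tensor (sinv (BarBar K) (tensor (star K G (zs i) (zs j)) (frag_of (zs k)))) (frag_of c)) = 0"
    by (simp_all only: star_zs tensor_cmul_left tensor_cmul_right tensor_of sinv_cmul eps_phi_cmul frag_cmul_zero2)
qed

text \<open>Every correction term of the left action moves letters of the bar word into the
  generator, which then has total length at least two and is killed. Only the leading term can
  survive.\<close>

lemma eps_phi_left_gen:
  "0 < i + j \<Longrightarrow> eps_phi (left_gen K G (zs i) (zs j) (zs k)) = (if i + j = 1 then frag_of (z, zs k) else 0)"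
proof (induction k arbitrary: i j rule: less_induct)
  case (less k)
  show ?case
  proof (cases "k = 0")
    case True
    then have "left_gen K G (zs i) (zs j) (zs k) = tensor (S (zs i) (zs j)) (frag_of [])"
      by (subst left_gen.simps) (simp only: Let_def replicate.simps simp_thms if_True tensor_of)
    then show ?thesis using eps_phi_S[OF less.prems, of "[]"] True by (simp only: replicate.simps)
  next
    case False
    then have ne: "zs k \<noteq> []" by simp
    have 1: "eps_phi (tensor (sinv (BarBar K) (tensor (frag_of (zs i)) (star K G (zs k) (zs j)))) (frag_of [])) = 0"
      "eps_phi (tensor (sinv (BarBar K) (tensor (star K G (zs i) (zs k)) (frag_of (zs j)))) (frag_of [])) = 0"
      using False less.prems by (intro eps_phi_star; linarith)+
    have 2: "eps_phi (frag_extend (\<lambda>a'. left_gen K G a' (zs j) (drop l (zs k))) (star K G (zs i) (take l (zs k)))) = 0"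
      if l: "l \<in> {1..<k}" for l
    proof -
      have "eps_phi (left_gen K G (zs (i + l)) (zs j) (zs (k - l))) = 0"
        using less.IH[of "k - l" "i + l" j] l less.prems by (simp only: atLeastLessThan_iff) auto
      moreover have "take l (zs k) = zs l" "drop l (zs k) = zs (k - l)" using l by (simp_all add: min_absorb1)
      ultimately show ?thesis
        by (simp only: star_zs frag_extend_cmul frag_extend_of eps_phi_cmul frag_cmul_zero2)
    qed
    have 3: "eps_phi (tensor (sinv (BarBar K) (tensor (frag_of (zs i)) (star K G (drop l (zs k)) (zs j)))) (frag_of (take l (zs k)))) = 0"
      if l: "l \<in> {1..<k}" for l
      using eps_phi_star(1)[of i "k - l" j "take l (zs k)"] l less.prems
      by (cases "i + (k - l) + j = 1") auto
    show ?thesis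
      by (simp only: left_gen.simps[of K G "zs i" "zs j" "zs k"] Let_def if_not_P[OF ne] length_replicate
        eps_phi_add eps_phi_cmul eps_phi_minus eps_phi_diff tensor_diff_left eps_phi_sum[OF finite_atLeastLessThan]
        tensor_of[of "zs i" "zs j"] eps_phi_S[OF less.prems] 1 2 3 frag_cmul_zero2 minus_zero diff_zero add_0_right sum.neutral_const cong: sum.cong)
  qed
qed

text \<open>Splitting off one letter in front and one letter at the back leave the same term with
  opposite signs; the sign attached to the second is trivial because \<open>theta\<close> is even.
  For m = 1 the sum is empty and the two outer generators cancel instead.\<close>

lemma eps_phi_path_D1: "eps_phi (path_D1 K G (zs m)) = 0"
proof (cases "m = 0")
  case True
  then show ?thesis by (simp add: path_D1_def eps_phi_0)
next
  case False
  let ?u = "frag_of (z, zs (m - 1))"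
  have S: "eps_phi (tensor (S (zs m) []) (frag_of [])) = eps_phi (tensor (S [] (zs m)) (frag_of []))"
    using eps_phi_S[of m 0 "[]"] eps_phi_S[of 0 m "[]"] False by simp
  have "eps_phi (left_gen K G (take j (zs m)) [] (drop j (zs m))
        - frag_cmul ((-1) ^ (theta K (take j (zs m)) * theta K (drop j (zs m))))
                 (tensor (S [] (drop j (zs m))) (frag_of (take j (zs m)))))
      = (if j = 1 then ?u else 0) - (if j = m - 1 then ?u else 0)" if j: "j \<in> {1..<m}" for j
  proof -
    have td: "take j (zs m) = zs j" "drop j (zs m) = zs (m - j)" using j by (simp_all add: min_absorb1)
    have "eps_phi (left_gen K G (zs j) [] (zs (m - j))) = (if j = 1 then ?u else 0)"
      using j eps_phi_left_gen[of j 0 "m - j"] by auto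
    moreover have "eps_phi (tensor (S [] (zs (m - j))) (frag_of (zs j))) = (if j = m - 1 then ?u else 0)"
      using j eps_phi_S[of 0 "m - j" "zs j"] by auto
    moreover have "((-1)::int) ^ (theta K (zs j) * theta K (zs (m - j))) = 1" using theta_even[of j] by simp
    ultimately show ?thesis by (simp only: td eps_phi_diff eps_phi_cmul frag_cmul_one)
  qed
  then have "eps_phi (path_D1 K G (zs m)) = (\<Sum>j\<in>{1..<m}. (if j = 1 then ?u else 0) - (if j = m - 1 then ?u else 0))"
    using S by (simp only: path_D1_def Let_def eps_phi_add eps_phi_diff[of "tensor (S (zs m) []) (frag_of [])" "tensor (S [] (zs m)) (frag_of [])"] eps_phi_sum[OF finite_atLeastLessThan] bar_diff_zs tensor_0
        eps_phi_0 length_replicate add_0_left diff_self cong: sum.cong)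
  also have "\<dots> = 0"
  proof -
    have "1 \<in> {1..<m} \<longleftrightarrow> m - 1 \<in> {1..<m}" unfolding atLeastLessThan_iff by linarith
    then show ?thesis by (simp only: sum_subtractf sum.delta[OF finite_atLeastLessThan] diff_self)
  qed
  finally show ?thesis .
qed

lemma thin_codiff_0:
  assumes "p \<in> grade (thin_model K G) k"
  shows "codiff (thin_model K G) p = 0"
proof -
  have "thin_diff_basis K G (x, zs m) = 0" for x m
  proof -
    have "thin_right_act K 0 p = 0" "thin_right_act K q 0 = 0" for p q
      by (simp_all only: thin_right_act_def frag_extend2_0)
    then show ?thesis
      by (simp only: thin_diff_basis_def split_conv eps_Id_loop_D1 eps_phi_path_D1 simp_codiff_0 frag_cmul_zero2 add_0_left)
  qed
  then have "thin_diff_basis K G b = 0" if "b \<in> Poly_Mapping.keys p" for b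
    using that assms by (auto simp: thin_model_def free_grade_def bar_words_eq)
  then show ?thesis by (simp add: thin_model_def frag_extend_eq_0)
qed

end

section \<open>Cochain maps on free complexes\<close>

text \<open>Linear extension with values in functions, as cochains may have infinite support;
  \<open>delta\<close> is of this form.\<close>

definition cochain_extend :: "('b \<Rightarrow> 'c \<Rightarrow> int) \<Rightarrow> ('b \<Rightarrow>\<^sub>0 int) \<Rightarrow> 'c \<Rightarrow> int" where
  "cochain_extend f p = (\<lambda>T. \<Sum>b\<in>Poly_Mapping.keys p. Poly_Mapping.lookup p b * f b T)"

lemma cochain_extend_superset:
  assumes "finite B" "Poly_Mapping.keys p \<subseteq> B"
  shows "cochain_extend f p T = (\<Sum>b\<in>B. Poly_Mapping.lookup p b * f b T)"
  unfolding cochain_extend_def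
  by (rule sum.mono_neutral_left) (use assms in \<open>auto simp: in_keys_iff\<close>)

lemma cochain_extend_of: "cochain_extend f (frag_of b) = f b"
  by (simp add: cochain_extend_def)

lemma cochain_extend_0: "cochain_extend f 0 = 0"
  by (simp add: cochain_extend_def zero_fun_def)

lemma cochain_extend_add: "cochain_extend f (p + q) = cochain_extend f p + cochain_extend f q"
proof
  fix T
  let ?B = "Poly_Mapping.keys p \<union> Poly_Mapping.keys q"
  have "Poly_Mapping.keys (p + q) \<subseteq> ?B" by (rule keys_add)
  then show "cochain_extend f (p + q) T = (cochain_extend f p + cochain_extend f q) T"
    by (simp add: cochain_extend_superset[of ?B] lookup_add distrib_right sum.distrib)
qed

lemma cochain_extend_cmul: "cochain_extend f (frag_cmul r p) = (\<lambda>T. r * cochain_extend f p T)"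
proof
  fix T
  have "Poly_Mapping.keys (frag_cmul r p) \<subseteq> Poly_Mapping.keys p" by (rule keys_cmul)
  then show "cochain_extend f (frag_cmul r p) T = r * cochain_extend f p T"
    by (simp add: cochain_extend_superset[of "Poly_Mapping.keys p"] sum_distrib_left mult.assoc)
qed

lemma cochain_extend_diff: "cochain_extend f (p - q) = cochain_extend f p - cochain_extend f q"
  using cochain_extend_add[of f "p - q" q] by (simp only: diff_add_cancel eq_diff_eq)

lemma cochain_extend_diff_fun:
  "cochain_extend f p - cochain_extend g p = cochain_extend (\<lambda>b. f b - g b) p"
  by (rule ext) (simp add: cochain_extend_def right_diff_distrib sum_subtractf)

lemma cochain_extend_cong:
  "(\<And>b. b \<in> Poly_Mapping.keys p \<Longrightarrow> f b = g b) \<Longrightarrow> cochain_extend f p = cochain_extend g p"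
  by (simp add: cochain_extend_def)

lemma cochain_extend_grade:
  assumes "\<And>b. b \<in> Poly_Mapping.keys p \<Longrightarrow> f b \<in> grade (CU Y) k"
  shows "cochain_extend f p \<in> grade (CU Y) k"
proof -
  have "c \<in> nd_cubes Y \<and> fst c = k" if "cochain_extend f p c \<noteq> 0" for c
  proof -
    have "\<exists>b\<in>Poly_Mapping.keys p. f b c \<noteq> 0"
    proof (rule ccontr)
      assume "\<not> ?thesis"
      then have "cochain_extend f p c = 0" unfolding cochain_extend_def by (intro sum.neutral ballI) simp
      then show False using that by contradiction
    qed
    then obtain b where b: "b \<in> Poly_Mapping.keys p" "f b c \<noteq> 0" by blast
    show ?thesis using assms[OF b(1)] b(2) unfolding CU_def cochain_complex.simps mem_Collect_eq by blast
  qed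
  then show ?thesis unfolding CU_def cochain_complex.simps mem_Collect_eq by blast
qed

lemma cochain_extend_codiff: "CU_codiff Y (cochain_extend f p) = cochain_extend (\<lambda>b. CU_codiff Y (f b)) p"
proof -
  have "CU_codiff Y (\<lambda>T. \<Sum>b\<in>B. r b * f b T) = (\<lambda>T. \<Sum>b\<in>B. r b * CU_codiff Y (f b) T)" if "finite B" for B r
    using that
  proof (induction B rule: finite_induct)
    case empty
    then show ?case using CU_codiff_0[of Y] by (simp add: zero_fun_def)
  next
    case (insert b B)
    have "(\<lambda>T. \<Sum>b\<in>insert b B. r b * f b T) = (\<lambda>T. r b * f b T) + (\<lambda>T. \<Sum>b\<in>B. r b * f b T)"
      using insert.hyps by (simp add: plus_fun_def)
    then have "CU_codiff Y (\<lambda>T. \<Sum>b\<in>insert b B. r b * f b T)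
        = (\<lambda>T. r b * CU_codiff Y (f b) T) + (\<lambda>T. \<Sum>b\<in>B. r b * CU_codiff Y (f b) T)"
      by (simp only: CU_codiff_add CU_codiff_smult insert.IH)
    then show ?case unfolding plus_fun_def sum.insert[OF insert.hyps] .
  qed
  then show ?thesis unfolding cochain_extend_def by simp
qed

text \<open>Additivity is available only within one degree. That degree is itself free on part of
  the basis, so induction over combinations of basis elements never leaves it.\<close>

lemma graded_hom_cochain_extend:
  assumes F: "graded_hom C (CU Y) F" and C: "grade C = free_grade B dg" and p: "p \<in> grade C k"
  shows "F p = cochain_extend (\<lambda>b. F (frag_of b)) p"
proof -
  let ?S = "{b \<in> B. dg b = k}"
  have add: "F (a + b) = F a + F b" if "a \<in> grade C k" "b \<in> grade C k" for a b
    using F that by (simp only: graded_hom_def)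
  have S: "a \<in> grade C k \<longleftrightarrow> Poly_Mapping.keys a \<subseteq> ?S" for a
    by (simp only: C free_grade_def mem_Collect_eq)
  have S0: "0 \<in> grade C k" by (simp add: S)
  have F0: "F 0 = 0" using add[OF S0 S0] by (simp only: add_0 add_cancel_right_right)
  have "p \<in> grade C k \<and> F p = cochain_extend (\<lambda>b. F (frag_of b)) p"
    using p[unfolded S]
  proof (induction p rule: frag_induction)
    case zero
    then show ?case using S0 F0 by (simp only: cochain_extend_0)
  next
    case (one b)
    then show ?case by (simp add: S cochain_extend_of)
  next
    case (diff a b)
    have "a - b \<in> grade C k" using diff keys_diff[of a b] unfolding S by blast
    have "b \<in> grade C k" using diff by blast
    from add[OF \<open>a - b \<in> grade C k\<close> this] have "F a = F (a - b) + F b" unfolding diff_add_cancel .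
    then have eq: "F (a - b) = F a - F b" by (simp only: add_diff_cancel_right')
    have "F a = cochain_extend (\<lambda>b. F (frag_of b)) a" "F b = cochain_extend (\<lambda>b. F (frag_of b)) b"
      using diff by blast+
    then have "F (a - b) = cochain_extend (\<lambda>b. F (frag_of b)) (a - b)"
      unfolding eq cochain_extend_diff by (simp only:)
    then show ?case using \<open>a - b \<in> grade C k\<close> by blast
  qed
  then show ?thesis by blast
qed

lemma cochain_map_comp:
  assumes f: "cochain_map C D f" and g: "cochain_map D E g"
  shows "cochain_map C E (g \<circ> f)"
proof -
  have fD: "f x \<in> grade D k" "y \<in> grade C k \<Longrightarrow> f (x + y) = f x + f y" "f (codiff C x) = codiff D (f x)"
    if "x \<in> grade C k" for x y k
    using f that unfolding cochain_map_def graded_hom_def by blast+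
  have gE: "g x \<in> grade E k" "y \<in> grade D k \<Longrightarrow> g (x + y) = g x + g y" "g (codiff D x) = codiff E (g x)"
    if "x \<in> grade D k" for x y k
    using g that unfolding cochain_map_def graded_hom_def by blast+
  show ?thesis
    unfolding cochain_map_def graded_hom_def comp_apply
  proof (intro conjI allI ballI)
    fix k x assume x: "x \<in> grade C k"
    show "g (f x) \<in> grade E k" by (rule gE(1)[OF fD(1)[OF x]])
    show "g (f (codiff C x)) = codiff E (g (f x))"
      unfolding fD(3)[OF x] by (rule gE(3)[OF fD(1)[OF x]])
    fix y assume y: "y \<in> grade C k"
    show "g (f (x + y)) = g (f x) + g (f y)"
      unfolding fD(2)[OF x y] by (rule gE(2)[OF fD(1)[OF x] fD(1)[OF y]])
  qed
qed

lemma cochain_map_zero: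
  assumes f: "cochain_map C D f" and 0: "0 \<in> grade C k"
  shows "f 0 = 0"
proof -
  have "f (0 + 0) = f 0 + f 0" using f 0 unfolding cochain_map_def graded_hom_def by blast
  then show ?thesis by (simp only: add_0 add_cancel_right_right)
qed

lemma quasi_iso_comp_surj:
  assumes f: "quasi_iso C D f" and g: "quasi_iso D (CU Y) g" and y: "y \<in> cocycles (CU Y) k"
    and D: "grade D = free_grade B dg"
  shows "\<exists>x\<in>cocycles C k. y - g (f x) \<in> coboundaries (CU Y) k"
proof -
  obtain q where q: "q \<in> cocycles D k" "y - g q \<in> coboundaries (CU Y) k"
    using g y unfolding quasi_iso_def by blast
  obtain x where x: "x \<in> cocycles C k" "q - f x \<in> coboundaries D k"
    using f q(1) unfolding quasi_iso_def by blast
  have g': "cochain_map D (CU Y) g" and f': "cochain_map C D f" using f g unfolding quasi_iso_def by blast+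
  have add: "g (a + b) = g a + g b" if "a \<in> grade D k" "b \<in> grade D k" for a b
    using g' that unfolding cochain_map_def graded_hom_def by blast
  have fx: "f x \<in> grade D k" using f' x(1) unfolding cochain_map_def graded_hom_def cocycles_def by blast
  have qf: "q - f x \<in> grade D k"
    using q(1) fx keys_diff[of q "f x"] unfolding cocycles_def D free_grade_def by blast
  have "g (q - f x) \<in> coboundaries (CU Y) k"
  proof (cases k)
    case 0
    then have "q - f x = 0" using x(2) by simp
    then show ?thesis using cochain_map_zero[OF g', of k] qf by (simp only: CU_coboundaries_0)
  next
    case (Suc j)
    then obtain w where w: "w \<in> grade D j" "q - f x = codiff D w"
      using x(2) by (auto simp: coboundaries_def)
    then have "g (q - f x) = codiff (CU Y) (g w)" "g w \<in> grade (CU Y) j"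
      using g' unfolding cochain_map_def graded_hom_def by simp_all
    then show ?thesis unfolding Suc coboundaries_def by simp
  qed
  moreover have "y - g (f x) = (y - g q) + g (q - f x)"
  proof -
    have "f x + (q - f x) = q" by simp
    then have "g q = g (f x) + g (q - f x)" using add[OF fx qf] by (simp only:)
    then show ?thesis by (intro ext) simp
  qed
  ultimately have "y - g (f x) \<in> coboundaries (CU Y) k"
    using CU_coboundaries_add[OF q(2)] by (simp only:)
  then show ?thesis using x(1) by blast
qed

section \<open>The second power map on the cohomology of the free loop space\<close>

lemma CU_power_smult: "CU_power Y (\<lambda>T. r * a T) m = (\<lambda>T. r ^ m * CU_power Y a m T)"
  by (induction m) (simp_all add: CU_mult_smult_left CU_mult_smult_right mult.assoc)

lemma power_map2_eigenvalue:
  assumes q: "q > 0" "even q"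
    and \<omega>: "\<omega> \<in> grade (CU (nsphere (Suc q))) (Suc q)" "CU_codiff (nsphere (Suc q)) \<omega> = 0"
      "\<omega> \<notin> coboundaries (CU (nsphere (Suc q))) (Suc q)"
  defines "Y \<equiv> free_loop_space (nsphere (Suc q))"
  assumes x: "x \<in> grade (CU Y) (q * m)" "CU_codiff Y x = 0"
    and gen: "\<And>y. y \<in> grade (CU Y) (q * m) \<Longrightarrow> CU_codiff Y y = 0 \<Longrightarrow> \<exists>k. y - (\<lambda>T. k * x T) \<in> coboundaries (CU Y) (q * m)"
  shows "CU_map Y power_map2 x - (\<lambda>T. 2 ^ m * x T) \<in> coboundaries (CU Y) (q * m)"
proof -
  define B where "B = coboundaries (CU Y) (q * m)"
  define y where "y = CX Y 1 (\<lambda>s l. l (s 0)) \<omega>"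
  define yp where "yp = CU_power Y y m"
  let ?L = "CU_map Y power_map2"
  have L: "continuous_map Y Y power_map2" unfolding Y_def by (rule continuous_map_power_map2)
  have y: "y \<in> grade (CU Y) q" "CU_codiff Y y = 0" "?L y - (\<lambda>T. 2 * y T) \<in> coboundaries (CU Y) q"
    using power_map2_transgression[OF \<omega>(1,2) q(1)] unfolding y_def Y_def by blast+
  have yp: "yp \<in> grade (CU Y) (q * m)" "CU_codiff Y yp = 0"
    using y unfolding yp_def by (blast intro: CU_power_grade CU_power_cocycle)+
  have L_supp: "nd_supp Y x" "nd_supp Y yp" using x(1) yp(1) by (blast intro: CU_grade_supp)+
  obtain c where c: "yp - (\<lambda>T. c * x T) \<in> B" using gen[OF yp] unfolding B_def by blast
  have "?L x \<in> grade (CU Y) (q * m)" "CU_codiff Y (?L x) = 0"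
    using CU_map_grade[OF x(1)] CU_map_codiff[OF L_supp(1) L] x(2) by (simp_all add: CU_map_eq_CX)
  then obtain d where d: "?L x - (\<lambda>T. d * x T) \<in> B" using gen unfolding B_def by blast
  have Byp: "k = 0" if "(\<lambda>T. k * yp T) \<in> B" for k
    using sphere_power_not_coboundary[OF q \<omega>, of k m] that unfolding B_def yp_def y_def Y_def by blast
  have c0: "c \<noteq> 0"
  proof
    assume "c = 0"
    then have "(\<lambda>T. 1 * yp T) \<in> B" using c by (simp add: fun_diff_def)
    then show False using Byp[of 1] by simp
  qed
  have "?L yp - (\<lambda>T. 2 ^ m * yp T) \<in> B"
  proof -
    have "?L yp = CU_power Y (?L y) m" unfolding yp_def by (rule CU_map_power[OF L y(1)])
    moreover have "CU_codiff Y (?L y) = 0"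
      using CU_map_codiff[OF CU_grade_supp[OF y(1)] L] y(2) by (simp add: CU_map_eq_CX)
    moreover have "(\<lambda>T. 2 * y T) \<in> grade (CU Y) q" "CU_codiff Y (\<lambda>T. 2 * y T) = 0"
      using y CU_grade_smult[of y Y q 2] by (simp_all add: CU_codiff_smult zero_fun_def)
    ultimately show ?thesis
      using CU_power_cong[OF CU_map_grade[OF y(1)] _ _ _ y(3), of m] unfolding B_def yp_def CU_power_smult by simp
  qed
  note 1 = this
  have 2: "?L yp - (\<lambda>T. c * ?L x T) \<in> B"
    using CU_map_coboundaries[OF L c[unfolded B_def]] unfolding CU_map_diff CU_map_smult B_def .
  define r where "r = 2 ^ m - d"
  have "(\<lambda>T. r * yp T) \<in> B"
  proof -
    define b1 where "b1 = ?L yp - (\<lambda>T. 2 ^ m * yp T)"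
    define b2 where "b2 = ?L yp - (\<lambda>T. c * ?L x T)"
    define b3 where "b3 = ?L x - (\<lambda>T. d * x T)"
    define b4 where "b4 = yp - (\<lambda>T. c * x T)"
    have "(\<lambda>T. c * b3 T) \<in> B" "(\<lambda>T. d * b4 T) \<in> B" "b1 \<in> B" "b2 \<in> B"
      using 1 2 c d unfolding B_def b1_def b2_def b3_def b4_def by (blast intro: CU_coboundaries_smult)+
    \<comment> \<open>With L for the map induced by the power map, modulo coboundaries 2^m y^m ~ L
      y^m ~ c L x ~ c d x ~ d y^m; the combination of the four errors spells out this chain.\<close>
    then have "(b2 - b1) + ((\<lambda>T. c * b3 T) - (\<lambda>T. d * b4 T)) \<in> B"
      unfolding B_def by (intro CU_coboundaries_add CU_coboundaries_diff)
    moreover have "(b2 - b1) + ((\<lambda>T. c * b3 T) - (\<lambda>T. d * b4 T)) = (\<lambda>T. r * yp T)"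
      by (rule ext) (simp add: b1_def b2_def b3_def b4_def r_def algebra_simps)
    ultimately show ?thesis by simp
  qed
  then have "r = 0" by (rule Byp)
  then have "d = 2 ^ m" by (simp add: r_def)
  then show ?thesis using d unfolding B_def by simp
qed

section \<open>The thin free loop model of an odd sphere\<close>

locale odd_sphere_loop_model = odd_sphere_model n K G v z
  for n :: nat and K :: "'s sset" and G :: "'s \<times> 's \<Rightarrow> ('s \<times> 's) list \<Rightarrow>\<^sub>0 int" and v z :: 's +
  fixes \<alpha> :: "(('s list \<times> 's list) list \<Rightarrow>\<^sub>0 int) \<Rightarrow> ((nat \<Rightarrow> real) \<times> (nat \<Rightarrow> real)) scube \<Rightarrow> int"
    and \<gamma> :: "('s list list \<Rightarrow>\<^sub>0 int) \<Rightarrow> (nat \<Rightarrow> real) scube \<Rightarrow> int"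
    and \<beta> :: "((('s list \<times> 's list) list \<times> 's list) \<Rightarrow>\<^sub>0 int) \<Rightarrow> (real \<Rightarrow> nat \<Rightarrow> real) scube \<Rightarrow> int"
    and \<sigma> :: "(('s \<times> 's list) \<Rightarrow>\<^sub>0 int) \<Rightarrow> ('s list list \<times> 's list) \<Rightarrow>\<^sub>0 int"
  assumes square: "model_square K G (nsphere (Suc (2 * n))) \<alpha> \<gamma>"
    and thin_section: "thin_section K G \<sigma>"
    and delta: "quasi_iso (loop_model K G) (CU (free_loop_space (nsphere (Suc (2 * n)))))
      (delta K G (nsphere (Suc (2 * n))) \<beta> \<gamma>)"
    and sigma: "quasi_iso (thin_model K G) (loop_model K G) \<sigma>"
begin

abbreviation X where "X \<equiv> nsphere (Suc (2 * n))"
abbreviation LX where "LX \<equiv> free_loop_space X"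
abbreviation thin where "thin \<equiv> thin_model K G"
abbreviation \<Upsilon> where "\<Upsilon> \<equiv> Upsilon K G X \<beta> \<gamma> \<sigma>"

definition \<omega> where "\<omega> = \<gamma> (frag_of [[z]])"

text \<open>The unit is preserved strictly although \<open>\<gamma>\<close> is assumed
  multiplicative only in cohomology: in degree 0 the only coboundary is 0.\<close>

lemma gamma:
  shows gamma_quasi_iso: "quasi_iso (cobar_complex (Bar K)) (CU X) \<gamma>"
    and gamma_unit: "\<gamma> (frag_of []) = CU_one X"
    and gamma_kernel: "p \<in> grade (cobar_complex (Bar K)) k \<Longrightarrow> eps K p = 0 \<Longrightarrow> \<gamma> p = 0"
proof -
  show "quasi_iso (cobar_complex (Bar K)) (CU X) \<gamma>"
    using square unfolding model_square_def Let_def by blast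
  show "p \<in> grade (cobar_complex (Bar K)) k \<Longrightarrow> eps K p = 0 \<Longrightarrow> \<gamma> p = 0"
    using square unfolding model_square_def Let_def by blast
  have "cohomology_algebra_map (cobar_complex (Bar K)) conc (frag_of []) (CU X) (CU_mult X) (CU_one X) \<gamma>"
    using square unfolding model_square_def Let_def by blast
  then have "\<gamma> (frag_of []) - CU_one X \<in> coboundaries (CU X) 0" unfolding cohomology_algebra_map_def by blast
  then have "\<gamma> (frag_of []) - CU_one X = 0" unfolding coboundaries_0 by blast
  then show "\<gamma> (frag_of []) = CU_one X" by (simp only: right_minus_eq)
qed

lemma bar_wordE:
  assumes "c \<in> bar_words K"
  obtains m where "c = zs m"
  using assms unfolding bar_words_eq by blast

lemma nonempty_bar_wordE:
  assumes "c \<in> bar_words K - {[]}"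
  obtains m where "c = zs (Suc m)"
proof -
  obtain m where m: "c = zs m" using assms bar_wordE by blast
  have "m \<noteq> 0" using assms unfolding m by auto
  then show thesis using that m by (cases m) blast+
qed

lemma z_bar_word: "[z] \<in> bar_words K - {[]}"
  using bar_words_eq by (auto intro!: image_eqI[where x = 1])

lemma cobar_grade:
  "p \<in> grade (cobar_complex (Bar K)) k \<longleftrightarrow> (\<forall>w\<in>Poly_Mapping.keys p. w \<in> lists (bar_words K - {[]}) \<and> (\<Sum>c\<leftarrow>w. bar_deg K c + 1) = k)"
  by (auto simp: cobar_complex_def free_grade_def cobar_words_def cobar_deg_def Bar_def)

lemma cobar_diff_z: "codiff (cobar_complex (Bar K)) (frag_of [[z]]) = 0"
proof -
  have ccop: "ccop (Bar K) [z] = frag_of ([], [z]) + frag_of ([z], [])" by (simp add: Bar_def)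
  have 1: "cdiff (Bar K) [z] = 0" using bar_diff_zs[of 1] by (simp add: Bar_def)
  have "sinv (Bar K) (frag_of []) = 0" by (simp add: sinv_def Bar_def)
  then have "cobar_diff_gen (Bar K) [z] = 0"
    unfolding cobar_diff_gen_def ccop 1 frag_extend_add
    by (simp add: conc_def) (simp add: sinv_def frag_extend_eq_0)
  then show ?thesis
    by (simp add: cobar_complex_def cobar_diff_def conc_def)
qed

text \<open>The class is nonzero because nothing in the cobar complex can bound the generator: the
  empty word has degree 0 and all other words have degree at least 2n + 1, so degree 2n is
  empty.\<close>

lemma \<omega>: "\<omega> \<in> grade (CU X) (Suc (2 * n))" "CU_codiff X \<omega> = 0" "\<omega> \<notin> coboundaries (CU X) (Suc (2 * n))"
proof -
  let ?C = "cobar_complex (Bar K)"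
  have g: "cochain_map ?C (CU X) \<gamma>" using gamma_quasi_iso unfolding quasi_iso_def by blast
  have z: "frag_of [[z]] \<in> grade ?C (Suc (2 * n))"
    using z_bar_word bar_deg_zs[of 1] unfolding cobar_grade by simp
  have zc: "frag_of [[z]] \<in> cocycles ?C (Suc (2 * n))" using z cobar_diff_z unfolding cocycles_def by blast
  show "\<omega> \<in> grade (CU X) (Suc (2 * n))" using g z unfolding cochain_map_def graded_hom_def \<omega>_def by blast
  have 0: "0 \<in> grade ?C k" for k unfolding cobar_grade by simp
  have "codiff (CU X) \<omega> = \<gamma> (codiff ?C (frag_of [[z]]))"
    using g z unfolding cochain_map_def \<omega>_def by (simp only:)
  then show "CU_codiff X \<omega> = 0" unfolding cobar_diff_z CU_codiff cochain_map_zero[OF g 0] .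
  show "\<omega> \<notin> coboundaries (CU X) (Suc (2 * n))"
  proof
    assume "\<omega> \<in> coboundaries (CU X) (Suc (2 * n))"
    then have "frag_of [[z]] \<in> coboundaries ?C (Suc (2 * n))"
      using gamma_quasi_iso zc unfolding quasi_iso_def \<omega>_def by blast
    then obtain p where p: "p \<in> grade ?C (2 * n)" "frag_of [[z]] = codiff ?C p" by (auto simp: coboundaries_def)
    have "w \<notin> Poly_Mapping.keys p" for w
    proof
      assume "w \<in> Poly_Mapping.keys p"
      then have w: "w \<in> lists (bar_words K - {[]})" "(\<Sum>c\<leftarrow>w. bar_deg K c + 1) = 2 * n"
        using p(1) unfolding cobar_grade by blast+
      then obtain c w' where cw: "w = c # w'" "c \<in> bar_words K - {[]}" using n by (cases w) auto
      obtain m where "c = zs (Suc m)" using nonempty_bar_wordE[OF cw(2)] by blast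
      then have "2 * n \<le> bar_deg K c" by (simp only: bar_deg_zs mult_Suc_right le_add1)
      then show False using w(2) cw(1) by simp
    qed
    then have "p = 0" by (metis all_not_in_conv keys_eq_empty)
    then have "frag_of [[z]] = 0" using p(2) by (simp add: cobar_complex_def cobar_diff_def)
    then show False by simp
  qed
qed

section \<open>The values of \<open>\<Upsilon>\<close> on the basis\<close>

definition lift :: "'s \<Rightarrow> 's list list" where
  "lift x = (if x = v then [] else [[x]])"

text \<open>A letter of length above one is killed by the counit, and two letters \<open>[z]\<close>
  give the square of \<open>z\<close>, which is 0.\<close>

lemma eps_word_cases:
  "w \<in> lists (bar_words K - {[]}) \<Longrightarrow>
    eps_word K w = (if w = [] then frag_of v else if w = [[z]] then frag_of z else 0)"
proof (induction w)
  case Nil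
  then show ?case by (simp add: eps_word_def alg_ext_def)
next
  case (Cons c w)
  then have "c \<in> bar_words K - {[]}" by simp
  then obtain m where m: "c = zs (Suc m)" by (rule nonempty_bar_wordE)
  have "eps_word K (c # w) = frag_extend2 (cup K) (case c of [x] \<Rightarrow> frag_of x | _ \<Rightarrow> 0) (eps_word K w)"
    by (simp add: eps_word_def alg_ext_def)
  also have "(case c of [x] \<Rightarrow> frag_of x | _ \<Rightarrow> 0) = (if c = [z] then frag_of z else 0)"
    using m by (cases m) auto
  finally show ?case using Cons by (auto simp: cup_z_v cup_z_z)
qed

lemma loop_grade:
  "p \<in> grade (loop_model K G) k \<longleftrightarrow> (\<forall>(w, c)\<in>Poly_Mapping.keys p.
     w \<in> lists (bar_words K - {[]}) \<and> c \<in> bar_words K \<and> (\<Sum>c\<leftarrow>w. bar_deg K c + 1) + bar_deg K c = k)"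
  by (auto simp: loop_model_def twisted_complex_def free_grade_def cobar_words_def cobar_deg_def Bar_def)

lemma thin_grade:
  "p \<in> grade thin k \<longleftrightarrow> (\<forall>(x, c)\<in>Poly_Mapping.keys p.
     x \<in> {v, z} \<and> c \<in> bar_words K \<and> sdim K x + bar_deg K c = k)"
  by (auto simp: thin_model_def free_grade_def nd)

lemma thin_free_grade: "grade thin = free_grade (nondegenerate K \<times> bar_words K) (\<lambda>(x, c). sdim K x + bar_deg K c)"
  by (simp add: thin_model_def)

lemma loop_free_grade:
  "grade (loop_model K G) = free_grade (cobar_words (Bar K) \<times> bar_words K) (\<lambda>(w, c). cobar_deg (Bar K) w + bar_deg K c)"
  by (simp add: loop_model_def twisted_complex_def)

text \<open>The counit reaches \<open>v\<close> only from the empty word and \<open>z\<close> only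
  from the word \<open>[[z]]\<close>, so each coefficient of the image comes from a single basis
  element.\<close>

lemma lookup_eps_Id:
  assumes q: "q \<in> grade (loop_model K G) k" and x: "x \<in> {v, z}"
  shows "Poly_Mapping.lookup (eps_Id K q) (x, c) = Poly_Mapping.lookup q (lift x, c)"
proof -
  have lk: "Poly_Mapping.lookup (tensor (eps_word K w) (frag_of c')) (x, c) = (if (w, c') = (lift x, c) then 1 else 0)"
    if "w \<in> lists (bar_words K - {[]})" for w c'
    using x vz(1) unfolding eps_word_cases[OF that] by (auto simp: lift_def)
  have "Poly_Mapping.lookup (case b of (w, c') \<Rightarrow> tensor (eps_word K w) (frag_of c')) (x, c) = (if b = (lift x, c) then 1 else 0)"
    if "b \<in> Poly_Mapping.keys q" for b
  proof -
    obtain w c' where wc: "b = (w, c')" by (cases b)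
    have "w \<in> lists (bar_words K - {[]})" using q that unfolding loop_grade wc by blast
    from lk[OF this, of c'] show ?thesis unfolding wc split_conv .
  qed
  then have "Poly_Mapping.lookup (eps_Id K q) (x, c)
      = (\<Sum>b\<in>Poly_Mapping.keys q. Poly_Mapping.lookup q b * (if b = (lift x, c) then 1 else 0))"
    unfolding eps_Id_def frag_extend_def lookup_sum lookup_frag_cmul by (intro sum.cong refl) (simp only:)
  also have "\<dots> = (\<Sum>b\<in>Poly_Mapping.keys q. if b = (lift x, c) then Poly_Mapping.lookup q b else 0)"
    by (intro sum.cong) auto
  also have "\<dots> = Poly_Mapping.lookup q (lift x, c)"
    by (simp only: sum.delta[OF finite_keys]) (simp add: in_keys_iff)
  finally show ?thesis .
qed

lemma delta_basis_0:
  assumes "w \<in> lists (bar_words K - {[]})" "w \<noteq> []" "w \<noteq> [[z]]"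
  shows "delta_basis K G X \<beta> \<gamma> (w, c) = 0"
proof -
  have "frag_of w \<in> grade (cobar_complex (Bar K)) (\<Sum>c\<leftarrow>w. bar_deg K c + 1)"
    using assms(1) unfolding cobar_grade by simp
  moreover have "eps K (frag_of w) = 0" using eps_word_cases[OF assms(1)] assms(2,3) by (simp add: eps_def)
  ultimately have "\<gamma> (frag_of w) = 0" by (rule gamma_kernel)
  then have "CU_map LX (\<lambda>l. l 0) (\<gamma> (frag_of w)) = 0" by (simp only: CU_map_eq_CX CX_0)
  then show ?thesis unfolding delta_basis_def split_conv by (intro ext) (simp only: CU_mult_0, simp)
qed

definition U where "U = (\<lambda>(x, c). delta_basis K G X \<beta> \<gamma> (lift x, c))"

text \<open>\<open>\<sigma>\<close> is explicit only on short bar words. Being a section, it has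
  prescribed coefficients on the basis elements whose cobar word is empty or \<open>[[z]]\<close>,
  and \<open>delta\<close> vanishes on all others by the kernel condition; the unknown part of
  \<open>\<sigma>\<close> thus does not show in the composite.\<close>

lemma Upsilon_eq:
  assumes p: "p \<in> grade thin k"
  shows "\<Upsilon> p = cochain_extend U p"
proof
  fix T
  let ?D = "delta_basis K G X \<beta> \<gamma>" and ?l = "\<lambda>(x, c). (lift x, c :: 's list)"
  define q where "q = \<sigma> p"
  have q: "q \<in> grade (loop_model K G) k" and eps: "eps_Id K q = p"
    using p thin_section unfolding q_def thin_section_def cochain_map_def graded_hom_def by blast+
  have inj: "inj_on ?l (Poly_Mapping.keys p)"
    using p by (auto simp: inj_on_def thin_grade lift_def split: if_splits)
  have lk: "Poly_Mapping.lookup q (?l b) = Poly_Mapping.lookup p b" if "b \<in> Poly_Mapping.keys p" for b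
    using that p lookup_eps_Id[OF q] unfolding eps thin_grade by auto
  have sub: "?l ` Poly_Mapping.keys p \<subseteq> Poly_Mapping.keys q"
    using lk by (auto simp: in_keys_iff)
  have "\<Upsilon> p T = (\<Sum>b\<in>Poly_Mapping.keys q. Poly_Mapping.lookup q b * ?D b T)"
    by (simp add: Upsilon_def delta_def q_def)
  also have "\<dots> = (\<Sum>b\<in>?l ` Poly_Mapping.keys p. Poly_Mapping.lookup q b * ?D b T)"
  proof (rule sum.mono_neutral_right[OF _ sub], simp, rule ballI)
    fix b assume b: "b \<in> Poly_Mapping.keys q - ?l ` Poly_Mapping.keys p"
    obtain w c where wc: "b = (w, c)" by (cases b)
    have w: "w \<in> lists (bar_words K - {[]})" using q b unfolding loop_grade wc by blast
    have "w \<noteq> lift x" if "x \<in> {v, z}" for x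
    proof
      assume "w = lift x"
      then have "Poly_Mapping.lookup p (x, c) = Poly_Mapping.lookup q b"
        using lookup_eps_Id[OF q that, of c] unfolding eps wc by simp
      then have "(x, c) \<in> Poly_Mapping.keys p" using b by (simp add: in_keys_iff)
      then show False using b wc \<open>w = lift x\<close> by force
    qed
    then have "w \<noteq> []" "w \<noteq> [[z]]" using vz(1) unfolding lift_def by force+
    then show "Poly_Mapping.lookup q b * ?D b T = 0" using delta_basis_0[OF w] wc by simp
  qed
  also have "\<dots> = (\<Sum>b\<in>Poly_Mapping.keys p. Poly_Mapping.lookup q (?l b) * ?D (?l b) T)"
    by (rule sum.reindex[OF inj, unfolded comp_def])
  also have "\<dots> = cochain_extend U p T"
    unfolding cochain_extend_def using lk by (intro sum.cong) (auto simp: U_def)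
  finally show "\<Upsilon> p T = cochain_extend U p T" .
qed

lemma Upsilon_cochain_map: "cochain_map thin (CU LX) \<Upsilon>"
  unfolding Upsilon_def using sigma delta by (intro cochain_map_comp) (auto simp: quasi_iso_def)

lemma frag_of_thin: "x \<in> {v, z} \<Longrightarrow> frag_of (x, zs m) \<in> grade thin (sdim K x + 2 * n * m)"
  unfolding thin_grade by (auto simp: bar_words_eq)

lemma U_cocycle:
  assumes "x \<in> {v, z}"
  shows "U (x, zs m) \<in> grade (CU LX) (sdim K x + 2 * n * m)" "CU_codiff LX (U (x, zs m)) = 0"
proof -
  note g = frag_of_thin[OF assms, of m]
  have U: "\<Upsilon> (frag_of (x, zs m)) = U (x, zs m)" unfolding Upsilon_eq[OF g] cochain_extend_of ..
  have c: "\<Upsilon> (frag_of (x, zs m)) \<in> grade (CU LX) (sdim K x + 2 * n * m)"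
    "codiff (CU LX) (\<Upsilon> (frag_of (x, zs m))) = \<Upsilon> (codiff thin (frag_of (x, zs m)))"
    using Upsilon_cochain_map g unfolding cochain_map_def graded_hom_def by simp_all
  have "0 \<in> grade thin 0" unfolding thin_grade by simp
  then show "U (x, zs m) \<in> grade (CU LX) (sdim K x + 2 * n * m)" "CU_codiff LX (U (x, zs m)) = 0"
    using c cochain_map_zero[OF Upsilon_cochain_map] unfolding thin_codiff_0[OF g] U CU_codiff by auto
qed

lemma U_v: "U (v, zs m) = delta1 K G X \<beta> (zs m)"
proof -
  have "continuous_map LX X (\<lambda>l. l 0)"
    using continuous_map_compose[OF continuous_map_loop_incl continuous_map_path_eval[of 0]] by (simp add: comp_def)
  then have "CU_map LX (\<lambda>l. l 0) (CU_one X) = CU_one LX" by (rule CU_map_one)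
  moreover have "nd_supp LX (delta1 K G X \<beta> (zs m))"
    using CU_grade_supp[OF CU_one_grade[of LX]] by (simp add: delta1_def CU_map_eq_CX)
  ultimately show ?thesis
    by (simp add: U_def lift_def delta_basis_def gamma_unit CU_mult_one(2) cobar_deg_def)
qed

lemma U_z: "U (z, zs m) = CU_mult LX (U (v, zs m)) (CU_map LX (\<lambda>l. l 0) \<omega>)"
  unfolding U_v using vz(1) by (simp add: U_def lift_def delta_basis_def \<omega>_def)

text \<open>The degree 2nm is even, bar words have even degree and \<open>z\<close> has odd degree,
  so the thin model has rank one there; a cocycle on loops comes from it up to a coboundary.\<close>

lemma U_generates:
  assumes "y \<in> grade (CU LX) (2 * n * m)" "CU_codiff LX y = 0"
  shows "\<exists>k. y - (\<lambda>T. k * U (v, zs m) T) \<in> coboundaries (CU LX) (2 * n * m)"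
proof -
  have "y \<in> cocycles (CU LX) (2 * n * m)" using assms unfolding cocycles_def by simp
  then obtain p where p: "p \<in> cocycles thin (2 * n * m)" "y - delta K G X \<beta> \<gamma> (\<sigma> p) \<in> coboundaries (CU LX) (2 * n * m)"
    using quasi_iso_comp_surj[OF sigma delta _ loop_free_grade] by blast
  have g: "p \<in> grade thin (2 * n * m)" using p(1) unfolding cocycles_def by blast
  have "b = (v, zs m)" if b: "b \<in> Poly_Mapping.keys p" for b
  proof -
    obtain x c where xc: "b = (x, c)" by (cases b)
    have c: "x \<in> {v, z}" "c \<in> bar_words K" "sdim K x + bar_deg K c = 2 * n * m"
      using g b unfolding thin_grade xc by blast+
    obtain a where a: "c = zs a" using c(2) by (rule bar_wordE)
    have xa: "b = (x, zs a)" "x \<in> {v, z}" "sdim K x + 2 * n * a = 2 * n * m"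
      using xc c by (simp_all only: a bar_deg_zs)
    have "even (sdim K x)" using xa(3) by (metis even_add even_mult_iff even_numeral)
    then have "x = v" using xa(2) dim by auto
    then show ?thesis using xa n dim by simp
  qed
  then have keys: "Poly_Mapping.keys p \<subseteq> {(v, zs m)}" by blast
  then have "\<Upsilon> p = (\<lambda>T. Poly_Mapping.lookup p (v, zs m) * U (v, zs m) T)"
    unfolding Upsilon_eq[OF g] by (simp add: fun_eq_iff cochain_extend_superset[OF _ keys])
  then show ?thesis using p(2) unfolding Upsilon_def comp_apply by auto
qed

lemma U_v_power_map2: "CU_map LX power_map2 (U (v, zs m)) - (\<lambda>T. 2 ^ m * U (v, zs m) T) \<in> coboundaries (CU LX) (2 * n * m)"
proof (rule power_map2_eigenvalue)
  show "U (v, zs m) \<in> grade (CU LX) (2 * n * m)" "CU_codiff LX (U (v, zs m)) = 0"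
    using U_cocycle[of v m] dim by simp_all
qed (use n \<omega> U_generates in auto)

lemma U_power_map2:
  assumes "x \<in> {v, z}"
  shows "(\<lambda>T. 2 ^ m * U (x, zs m) T) - CU_map LX power_map2 (U (x, zs m)) \<in> coboundaries (CU LX) (sdim K x + 2 * n * m)"
proof -
  define e where "e = CU_map LX (\<lambda>l. l 0) \<omega>"
  have L: "continuous_map LX LX power_map2" by (rule continuous_map_power_map2)
  have ev: "continuous_map LX X (\<lambda>l. l 0)"
    using continuous_map_compose[OF continuous_map_loop_incl continuous_map_path_eval[of 0]] by (simp add: comp_def)
  have e: "e \<in> grade (CU LX) (Suc (2 * n))" "CU_codiff LX e = 0"
    using CU_map_grade[OF \<omega>(1)] CU_map_codiff[OF CU_grade_supp[OF \<omega>(1)] ev] unfolding e_def \<omega>(2)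
    by (simp_all add: CU_map_eq_CX)
  have Le: "CU_map LX power_map2 e = e"
  proof -
    have "CU_map LX power_map2 e = CX LX 0 (\<lambda>s l. power_map2 l 0) \<omega>"
      unfolding e_def CU_map_eq_CX
      by (subst CX_CX[OF CU_grade_supp[OF \<omega>(1)]]) (simp_all add: cross_map_0 L)
    then show ?thesis by (simp add: e_def CU_map_eq_CX power_map2_conc)
  qed
  let ?u = "U (v, zs m)"
  have v: "(\<lambda>T. 2 ^ m * ?u T) - CU_map LX power_map2 ?u \<in> coboundaries (CU LX) (2 * n * m)"
    using CU_coboundaries_minus[OF U_v_power_map2[of m]] by (simp only: minus_diff_eq)
  show ?thesis
  proof (cases "x = v")
    case True
    then show ?thesis using v dim by simp
  next
    case False
    then have x: "x = z" using assms by simp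
    have "CU_map LX power_map2 (U (z, zs m)) = CU_mult LX (CU_map LX power_map2 ?u) e"
      unfolding U_z e_def[symmetric]
      by (subst CU_map_mult[OF U_cocycle(1)[of v] CU_grade_supp[OF e(1)] L]) (simp_all only: Le insertI1)
    moreover have "(\<lambda>T. 2 ^ m * U (z, zs m) T) = CU_mult LX (\<lambda>T. 2 ^ m * ?u T) e"
      unfolding U_z e_def[symmetric] CU_mult_smult_left ..
    ultimately have "(\<lambda>T. 2 ^ m * U (z, zs m) T) - CU_map LX power_map2 (U (z, zs m))
        = CU_mult LX ((\<lambda>T. 2 ^ m * ?u T) - CU_map LX power_map2 ?u) e"
      by (simp only: CU_mult_diff_left)
    then show ?thesis using CU_mult_coboundaries_left[OF v e] unfolding x dim by (simp add: add.commute)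
  qed
qed

text \<open>As the thin differential vanishes, compatibility with it reduces to preserving degrees,
  and this holds because each basis element is an eigenvector.\<close>

lemma Id_star_cop_cochain_map: "cochain_map thin thin (Id_star_cop K G)"
proof -
  have Id: "Id_star_cop K G p \<in> grade thin k" if p: "p \<in> grade thin k" for p k
  proof -
    have sub: "Poly_Mapping.keys (Id_star_cop K G p) \<subseteq> Poly_Mapping.keys p"
    proof -
      have "Id_star_cop K G p = frag_extend (\<lambda>b. Id_star_cop K G (frag_of b)) p"
        by (simp add: Id_star_cop_def)
      moreover have "Poly_Mapping.keys (Id_star_cop K G (frag_of b)) \<subseteq> {b}" if "b \<in> Poly_Mapping.keys p" for b
      proof -
        obtain x c where xc: "b = (x, c)" by (cases b)
        have "c \<in> bar_words K" using that p unfolding thin_grade xc by blast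
        then obtain m where m: "c = zs m" by (rule bar_wordE)
        show ?thesis unfolding xc m Id_star_cop_of using keys_cmul[of "2 ^ m" "frag_of (x, zs m)"] by simp
      qed
      ultimately show ?thesis using keys_frag_extend[of "\<lambda>b. Id_star_cop K G (frag_of b)" p] by (simp only:) blast
    qed
    show ?thesis using subset_trans[OF sub] p unfolding thin_free_grade free_grade_def mem_Collect_eq .
  qed
  have add: "Id_star_cop K G (p + q) = Id_star_cop K G p + Id_star_cop K G q" for p q
    by (simp only: Id_star_cop_def frag_extend_add)
  have 0: "Id_star_cop K G 0 = 0" by (simp add: Id_star_cop_def)
  show ?thesis
    unfolding cochain_map_def graded_hom_def
  proof (intro conjI allI ballI Id add)
    fix k p assume p: "p \<in> grade thin k"
    show "Id_star_cop K G (codiff thin p) = codiff thin (Id_star_cop K G p)"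
      unfolding thin_codiff_0[OF p] thin_codiff_0[OF Id[OF p]] by (rule 0)
  qed
qed

lemma Upsilon_power_map2_homotopic:
  "cochain_homotopic thin (CU LX) (\<Upsilon> \<circ> Id_star_cop K G) (CU_map LX power_map2 \<circ> \<Upsilon>)"
proof -
  let ?f = "\<Upsilon> \<circ> Id_star_cop K G" and ?g = "CU_map LX power_map2 \<circ> \<Upsilon>"
  have L: "cochain_map (CU LX) (CU LX) (CU_map LX power_map2)"
    unfolding cochain_map_def graded_hom_def CU_codiff
    using CU_map_grade CU_map_add CU_map_codiff[OF CU_grade_supp continuous_map_power_map2] by blast
  have f: "cochain_map thin (CU LX) ?f" by (rule cochain_map_comp[OF Id_star_cop_cochain_map Upsilon_cochain_map])
  have g: "cochain_map thin (CU LX) ?g" by (rule cochain_map_comp[OF Upsilon_cochain_map L])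
  define D where "D b = ?f (frag_of b) - ?g (frag_of b)" for b
  define dg where "dg = (\<lambda>(x, c). sdim K x + bar_deg K c)"
  have D: "D b \<in> coboundaries (CU LX) (dg b)" if "b \<in> {v, z} \<times> bar_words K" for b
  proof -
    obtain x c where bc: "b = (x, c)" by (cases b)
    have xc: "b = (x, c)" "x \<in> {v, z}" "c \<in> bar_words K" using that unfolding bc by blast+
    obtain m where m: "c = zs m" using xc(3) by (rule bar_wordE)
    note b = xc(1)[unfolded m] xc(2)
    note gr = frag_of_thin[OF b(2), of m]
    have "Id_star_cop K G (frag_of b) \<in> grade thin (sdim K x + 2 * n * m)"
      using Id_star_cop_cochain_map gr unfolding b(1) cochain_map_def graded_hom_def by blast
    then have "\<Upsilon> (Id_star_cop K G (frag_of b)) = (\<lambda>T. 2 ^ m * U b T)"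
      unfolding Upsilon_eq unfolding b(1) Id_star_cop_of cochain_extend_cmul cochain_extend_of by (simp only: Upsilon_eq cochain_extend_cmul cochain_extend_of)
    moreover have "\<Upsilon> (frag_of b) = U b" using Upsilon_eq[OF gr] unfolding b(1) cochain_extend_of .
    ultimately show ?thesis using U_power_map2[OF b(2), of m] unfolding D_def comp_apply by (simp add: b(1) dg_def)
  qed
  \<comment> \<open>A primitive is chosen for each basis element, to be extended linearly. In degree
    0 a homotopy has to be 0, which is consistent since 0 is the only coboundary there.\<close>
  have "\<exists>\<eta>. (dg b = 0 \<longrightarrow> \<eta> = 0) \<and> (\<forall>k. dg b = Suc k \<longrightarrow> \<eta> \<in> grade (CU LX) k) \<and> D b = CU_codiff LX \<eta>"
    if b: "b \<in> {v, z} \<times> bar_words K" for b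
  proof (cases "dg b")
    case 0
    then show ?thesis using D[OF b] by (intro exI[of _ 0]) simp
  next
    case (Suc k)
    then obtain \<eta> where "\<eta> \<in> grade (CU LX) k" "D b = CU_codiff LX \<eta>"
      using D[OF b] unfolding coboundaries_def by auto
    then show ?thesis using Suc by auto
  qed
  then obtain \<eta> where \<eta>: "\<And>b. b \<in> {v, z} \<times> bar_words K \<Longrightarrow>
      (dg b = 0 \<longrightarrow> \<eta> b = 0) \<and> (\<forall>k. dg b = Suc k \<longrightarrow> \<eta> b \<in> grade (CU LX) k) \<and> D b = CU_codiff LX (\<eta> b)"
    by metis
  have keys: "b \<in> {v, z} \<times> bar_words K" "dg b = k" if "p \<in> grade thin k" "b \<in> Poly_Mapping.keys p" for p k b
    using that unfolding thin_grade dg_def by auto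
  show ?thesis
    unfolding cochain_homotopic_def
  proof (intro conjI f g exI[of _ "cochain_extend \<eta>"] allI ballI)
    fix p assume p: "p \<in> grade thin 0"
    have "cochain_extend \<eta> p = cochain_extend (\<lambda>b. 0) p"
      by (rule cochain_extend_cong) (use \<eta> keys[OF p] in blast)
    then show "cochain_extend \<eta> p = 0" by (simp add: cochain_extend_def zero_fun_def)
  next
    fix k p assume p: "p \<in> grade thin (Suc k)"
    show "cochain_extend \<eta> p \<in> grade (CU LX) k"
      by (rule cochain_extend_grade) (use \<eta> keys[OF p] in blast)
  next
    fix p q show "cochain_extend \<eta> (p + q) = cochain_extend \<eta> p + cochain_extend \<eta> q"
      by (rule cochain_extend_add)
  next
    fix k p assume p: "p \<in> grade thin k"
    have "?f p = cochain_extend (\<lambda>b. ?f (frag_of b)) p" "?g p = cochain_extend (\<lambda>b. ?g (frag_of b)) p"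
      using f g unfolding cochain_map_def by (blast intro: graded_hom_cochain_extend[OF _ thin_free_grade p])+
    then have "?f p - ?g p = cochain_extend D p" unfolding D_def by (simp only: cochain_extend_diff_fun)
    also have "\<dots> = cochain_extend (\<lambda>b. CU_codiff LX (\<eta> b)) p"
      by (rule cochain_extend_cong) (use \<eta> keys[OF p] in blast)
    \<comment> \<open>The term with the thin differential is 0, so the linear extension of the
      primitives is already the homotopy.\<close>
    also have "\<dots> = codiff (CU LX) (cochain_extend \<eta> p) + cochain_extend \<eta> (codiff thin p)"
      unfolding cochain_extend_codiff[symmetric] thin_codiff_0[OF p] cochain_extend_0 CU_codiff by (simp only: add_0_right)
    finally show "?f p - ?g p = codiff (CU LX) (cochain_extend \<eta> p) + cochain_extend \<eta> (codiff thin p)" .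
  qed
qed

end

theorem theorem3p1p2:
  fixes n :: nat
    and K :: "'s sset"
    and G :: "'s \<times> 's \<Rightarrow> ('s \<times> 's) list \<Rightarrow>\<^sub>0 int"
    and X :: "(nat \<Rightarrow> real) topology"
    and \<alpha> :: "(('s list \<times> 's list) list \<Rightarrow>\<^sub>0 int) \<Rightarrow> ((nat \<Rightarrow> real) \<times> (nat \<Rightarrow> real)) scube \<Rightarrow> int"
    and \<gamma> :: "('s list list \<Rightarrow>\<^sub>0 int) \<Rightarrow> (nat \<Rightarrow> real) scube \<Rightarrow> int"
    and \<beta> :: "((('s list \<times> 's list) list \<times> 's list) \<Rightarrow>\<^sub>0 int) \<Rightarrow> (real \<Rightarrow> nat \<Rightarrow> real) scube \<Rightarrow> int"
    and \<sigma> :: "(('s \<times> 's list) \<Rightarrow>\<^sub>0 int) \<Rightarrow> ('s list list \<times> 's list) \<Rightarrow>\<^sub>0 int"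
  assumes "n > 0"
    and "X = nsphere (2 * n + 1)"
    and "simplicial_set K"
    and "\<exists>v z. nondegenerate K = {v, z} \<and> sdim K v = 0 \<and> sdim K z = 2 * n + 1"
    and "AW_algebra_map K G"
    and "model_square K G X \<alpha> \<gamma>"
    and "path_map_equations K G X \<alpha> \<beta>"
    and "thin_section K G \<sigma>"
    and "quasi_iso (path_model K G) (CU (path_space X)) \<beta>"
    and "quasi_iso (loop_model K G) (CU (free_loop_space X)) (delta K G X \<beta> \<gamma>)"
    and "quasi_iso (thin_model K G) (loop_model K G) \<sigma>"
  shows "cochain_homotopic (thin_model K G) (CU (free_loop_space X))
           (Upsilon K G X \<beta> \<gamma> \<sigma> \<circ> Id_star_cop K G)
           (CU_map (free_loop_space X) power_map2 \<circ> Upsilon K G X \<beta> \<gamma> \<sigma>)"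
proof -
  obtain v z where vz: "nondegenerate K = {v, z}" "sdim K v = 0" "sdim K z = 2 * n + 1" using assms(4) by blast
  have X: "X = nsphere (Suc (2 * n))" using assms(2) by simp
  interpret odd_sphere_loop_model n K G v z \<alpha> \<gamma> \<beta> \<sigma>
    by unfold_locales (use assms(1,3,5) vz assms(6,8,10,11)[unfolded X] in blast)+
  show ?thesis unfolding X by (rule Upsilon_power_map2_homotopic)
qed

end
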